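(* Let $\psi$ be an arbitrary probability measure on $]0,+\infty[$, let $(\tau_i)_{i\ge1}$ be i.i.d. with law $\psi$, and let $\mathbf P_t$ denote the law of the empirical measure $\mu_t$ of the backward and forward recurrence time processes, regarded as a random element of $\mathcal P(]0,+\infty]^2)$. Then $(\mathbf P_t)_{t>0}$ satisfies, as $t\uparrow+\infty$, a large deviations principle with speed $t$ and good rate functional $\mathrm I$; that is, $\mathrm I$ has compact sublevel sets, for each closed set $\mathcal C\subset\mathcal P(]0,+\infty]^2)$ $$\limsup_{t\to+\infty}\frac1t\log\mathbf P_t(\mathcal C)\le-\inf_{\mu\in\mathcal C}\mathrm I(\mu),$$ and for each open set $\mathcal O\subset\mathcal P(]0,+\infty]^2)$ $$\liminf_{t\to+\infty}\frac1t\log\mathbf P_t(\mathcal O)\ge-\inf_{\mu\in\mathcal O}\mathrm I(\mu).$$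
   Context: Renewal process: $S_0:=0$, $S_n:=\tau_1+\dots+\tau_n$, $N_t:=\inf\{n\ge0:S_n>t\}$, $A_t:=t-S_{N_t-1}$, $B_t:=S_{N_t}-t$, and $\mu_t:=\frac1t\int_{[0,t[}\delta_{(A_s,B_s)}\,ds$. The space $]0,+\infty]$ carries the metric $d(p,p')=|1/p-1/p'|$ (with $1/\infty=0$), so it is Polish; $\mathcal P(X)$ is the set of Borel probability measures on a Polish space $X$ with the narrow (weak) topology. For a measure $\mu$ and a function $f$, $\mu(f):=\int f\,d\mu$; $\tau$ denotes the identity map on $]0,+\infty]$, so $\pi(1/\tau)=\int\frac1\tau\,\pi(d\tau)$. Convention: $0\cdot\infty=0$. $\mathrm H(\nu|\mu)$ is the relative entropy of $\nu$ with respect to $\mu$. $\Delta_0$ is the set of $\mu_0\in\mathcal P(]0,+\infty]^2)$ of the form $$\mu_0(da,db)=\int_{[0,1]\times]0,+\infty[}\delta_{(u\tau,(1-u)\tau)}(da,db)\,du\otimes\pi(d\tau)$$ for some $\pi\in\mathcal P(]0,+\infty[)$ with $\pi(1/\tau)<+\infty$ (i.e. $\mu_0$ is the law of $(UP,(1-U)P)$ with $U$ uniform on $[0,1]$ independent of $P\sim\pi$). $\Delta$ is the set of measures $\mu=\alpha\mu_0+(1-\alpha)\delta_{(+\infty,+\infty)}$ with $\mu_0\in\Delta_0$, $\alpha\in[0,1]$. For $\pi\in\mathcal P(]0,+\infty[)$ with $\pi(1/\tau)<+\infty$, set $\tilde\pi(d\tau):=\frac1{\pi(1/\tau)}\frac1\tau\,\pi(d\tau)$.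 Let $\xi:=\sup\{c\in\mathbb R:\psi(e^{c\tau})<+\infty\}\in[0,+\infty]$. Then $$\mathrm I(\mu):=\alpha\,\pi(1/\tau)\,\mathrm H(\tilde\pi|\psi)+(1-\alpha)\,\xi$$ if $\mu\in\Delta$ is written as $\mu=\alpha\mu_0+(1-\alpha)\delta_{(+\infty,+\infty)}$ with $\alpha\in[0,1]$ and $\mu_0=\int_{[0,1]\times]0,+\infty[}\delta_{(u\tau,(1-u)\tau)}\,du\otimes\pi(d\tau)$, where $\pi\in\mathcal P(]0,+\infty[)$ and $\pi(1/\tau)<+\infty$ (if $\alpha=0$ the choice of $\pi$ is irrelevant and $\mathrm I(\mu)=\xi$), and $\mathrm I(\mu):=+\infty$ if $\mu\notin\Delta$. *)

theory Defs
  imports "HOL-Probability.Probability"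
begin

section \<open>The Polish space \<open>]0,+\<infinity>]\<close>\<close>

typedef ext_pos = "{x :: ereal. 0 < x}"
  by (rule exI[of _ 1]) simp

instantiation ext_pos :: infinity
begin
definition infinity_ext_pos :: ext_pos where
  "\<infinity> = Abs_ext_pos \<infinity>"
instance ..
end

text \<open>Total embedding of the reals. Nonpositive arguments receive the junk value \<open>\<infinity>\<close>;
  below this only concerns null sets of arguments (e.g. the renewal times, where the backward
  recurrence time is \<open>0\<close>).\<close>

definition to_ext_pos :: "real \<Rightarrow> ext_pos" where
  "to_ext_pos x = (if 0 < x then Abs_ext_pos (ereal x) else \<infinity>)"

text \<open>In \<open>ereal\<close>, \<open>1 / \<infinity> = 0\<close>.\<close>

definition recip :: "ext_pos \<Rightarrow> real" where
  "recip p = real_of_ereal (1 / Rep_ext_pos p)"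

lemma recip_inj: "recip p = recip q \<Longrightarrow> p = q"
proof -
  assume "recip p = recip q"
  moreover have "0 < Rep_ext_pos p" "0 < Rep_ext_pos q"
    using Rep_ext_pos by auto
  ultimately have "Rep_ext_pos p = Rep_ext_pos q"
    unfolding recip_def
    by (cases "Rep_ext_pos p"; cases "Rep_ext_pos q") (auto simp: one_ereal_def)
  then show "p = q" by (simp add: Rep_ext_pos_inject)
qed

lemma range_recip: "range recip = {0..}"
proof (intro equalityI subsetI)
  fix x assume "x \<in> range recip"
  then obtain p where p: "x = recip p" by auto
  have "0 < Rep_ext_pos p" using Rep_ext_pos by auto
  then show "x \<in> {0..}" unfolding p recip_def
    by (cases "Rep_ext_pos p") (auto simp: one_ereal_def)
next
  fix x :: real assume x: "x \<in> {0..}"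
  show "x \<in> range recip"
  proof (cases "x = 0")
    case True
    have "recip (Abs_ext_pos \<infinity>) = 0"
      by (simp add: recip_def Abs_ext_pos_inverse)
    then show ?thesis using True by (metis rangeI)
  next
    case False
    then have "recip (Abs_ext_pos (ereal (1/x))) = x"
      using x by (simp add: recip_def Abs_ext_pos_inverse one_ereal_def)
    then show ?thesis by (metis rangeI)
  qed
qed

instantiation ext_pos :: metric_space
begin

definition dist_ext_pos :: "ext_pos \<Rightarrow> ext_pos \<Rightarrow> real" where
  "dist p q = \<bar>recip p - recip q\<bar>"

definition uniformity_ext_pos_def:
  "(uniformity :: (ext_pos \<times> ext_pos) filter) = (INF e\<in>{0<..}. principal {(x, y). dist x y < e})"

definition open_ext_pos_def:
  "open (U :: ext_pos set) \<longleftrightarrow> (\<forall>x\<in>U. \<forall>\<^sub>F (x', y) in uniformity. x' = x \<longrightarrow> y \<in> U)"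

instance
proof
  fix p q r :: ext_pos
  show "dist p q = 0 \<longleftrightarrow> p = q"
    by (auto simp: dist_ext_pos_def dest: recip_inj)
  show "dist p q \<le> dist p r + dist q r"
    by (simp add: dist_ext_pos_def)
qed (rule uniformity_ext_pos_def open_ext_pos_def)+

end

instance ext_pos :: polish_space
proof
  fix X :: "nat \<Rightarrow> ext_pos"
  assume X: "Cauchy X"
  then have "Cauchy (\<lambda>n. recip (X n))"
    by (simp add: Cauchy_def dist_ext_pos_def dist_real_def)
  then obtain L where L: "(\<lambda>n. recip (X n)) \<longlonglongrightarrow> L"
    using Cauchy_convergent convergent_def by blast
  have "recip (X n) \<ge> 0" for n using range_recip by auto
  then have "L \<ge> 0" using L by (simp add: LIMSEQ_le_const)
  then obtain p where "L = recip p" using range_recip by (metis atLeast_iff imageE)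
  then have "X \<longlonglongrightarrow> p" using L
    by (simp add: lim_sequentially dist_ext_pos_def dist_real_def)
  then show "convergent X" by (auto simp: convergent_def)
next
  obtain B :: "real set set" where B: "countable B" "topological_basis B"
    using ex_countable_basis by blast
  have cont: "continuous_on UNIV recip"
    by (auto simp: continuous_on_iff dist_ext_pos_def dist_real_def)
  have "topological_basis ((\<lambda>V. recip -` V) ` B)"
  proof (rule topological_basisI)
    fix W assume "W \<in> (\<lambda>V. recip -` V) ` B"
    then show "open W"
      using B(2) cont topological_basis_open by (auto intro!: open_vimage)
  next
    fix W and p :: ext_pos assume W: "open W" "p \<in> W"
    then obtain e where e: "e > 0" "\<And>q. dist q p < e \<Longrightarrow> q \<in> W"
      by (meson open_dist)
    obtain V where V: "V \<in> B" "recip p \<in> V" "V \<subseteq> ball (recip p) e"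
      using topological_basisE[OF B(2), of "ball (recip p) e" "recip p"] e(1) by auto
    have "recip -` V \<subseteq> W"
    proof
      fix q assume "q \<in> recip -` V"
      then have "dist (recip p) (recip q) < e" using V(3) by auto
      then show "q \<in> W" using e(2)
        by (simp add: dist_ext_pos_def dist_real_def abs_minus_commute)
    qed
    then show "\<exists>W'\<in>(\<lambda>V. recip -` V) ` B. p \<in> W' \<and> W' \<subseteq> W" using V by auto
  qed
  then show "\<exists>B::ext_pos set set. countable B \<and> open = generate_topology B"
    using B(1) topological_basis_imp_subbasis by blast
qed


section \<open>Probability measures, narrow topology, large deviations\<close>

definition borel_probs :: "'a::topological_space measure set" where
  "borel_probs = {M. prob_space M \<and> sets M = sets borel}"

definition narrow_topology :: "'a::topological_space measure topology" where
  "narrow_topology = topology_generated_by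
     {{M \<in> borel_probs. (\<integral>x. f x \<partial>M) \<in> V} | (f :: 'a \<Rightarrow> real) V.
        continuous_on UNIV f \<and> bounded (range f) \<and> open V}"

lemma topspace_narrow_topology: "topspace narrow_topology = borel_probs"
proof -
  have "borel_probs \<in> {{M \<in> borel_probs. (\<integral>x. f x \<partial>M) \<in> V} | (f :: 'a \<Rightarrow> real) V.
        continuous_on UNIV f \<and> bounded (range f) \<and> open V}"
    by (rule CollectI, rule exI[of _ "\<lambda>_. 0"], rule exI[of _ UNIV]) auto
  then show ?thesis
    unfolding narrow_topology_def topology_generated_by_topspace by auto
qed

definition borel_of :: "'a topology \<Rightarrow> 'a measure" where
  "borel_of X = sigma (topspace X) {U. openin X U}"

text \<open>Logarithm of a probability, with \<open>log 0 = -\<infinity>\<close> (in contrast to \<open>ln 0 = 0\<close>).\<close>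

definition elog :: "real \<Rightarrow> ereal" where
  "elog p = (if p \<le> 0 then -\<infinity> else ereal (ln p))"

text \<open>Large deviations principle with speed \<open>t\<close> and good rate functional \<open>J\<close>, for probability
  measures \<open>P t\<close> on the Borel sets of the space \<open>X\<close>, as \<open>t \<rightarrow> \<infinity>\<close> along the reals.\<close>

definition LDP_good :: "'a topology \<Rightarrow> (real \<Rightarrow> 'a measure) \<Rightarrow> ('a \<Rightarrow> ereal) \<Rightarrow> bool" where
  "LDP_good X P J \<longleftrightarrow>
     (\<forall>c::real. compactin X {x \<in> topspace X. J x \<le> ereal c}) \<and>
     (\<forall>C. closedin X C \<longrightarrow>
        Limsup at_top (\<lambda>t. ereal (1 / t) * elog (measure (P t) C)) \<le> - (INF x\<in>C. J x)) \<and>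
     (\<forall>U. openin X U \<longrightarrow>
        - (INF x\<in>U. J x) \<le> Liminf at_top (\<lambda>t. ereal (1 / t) * elog (measure (P t) U)))"


section \<open>Renewal process\<close>

text \<open>The waiting times are \<open>\<tau> 1, \<tau> 2, \<dots>\<close>; the value \<open>\<tau> 0\<close> is not used.\<close>

definition renewal_time :: "(nat \<Rightarrow> 'w \<Rightarrow> real) \<Rightarrow> nat \<Rightarrow> 'w \<Rightarrow> real" where
  "renewal_time \<tau> n \<omega> = (\<Sum>i=1..n. \<tau> i \<omega>)"

text \<open>If \<open>S\<^sub>n > t\<close> for no \<open>n\<close> (a null event), \<open>N\<^sub>t\<close> is the junk value \<open>0\<close>.\<close>

definition renewal_count :: "(nat \<Rightarrow> 'w \<Rightarrow> real) \<Rightarrow> real \<Rightarrow> 'w \<Rightarrow> nat" where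
  "renewal_count \<tau> t \<omega> = Inf {n. renewal_time \<tau> n \<omega> > t}"

definition backward_time :: "(nat \<Rightarrow> 'w \<Rightarrow> real) \<Rightarrow> real \<Rightarrow> 'w \<Rightarrow> real" where
  "backward_time \<tau> t \<omega> = t - renewal_time \<tau> (renewal_count \<tau> t \<omega> - 1) \<omega>"

definition forward_time :: "(nat \<Rightarrow> 'w \<Rightarrow> real) \<Rightarrow> real \<Rightarrow> 'w \<Rightarrow> real" where
  "forward_time \<tau> t \<omega> = renewal_time \<tau> (renewal_count \<tau> t \<omega>) \<omega> - t"

definition empirical_measure ::
    "(nat \<Rightarrow> 'w \<Rightarrow> real) \<Rightarrow> real \<Rightarrow> 'w \<Rightarrow> (ext_pos \<times> ext_pos) measure" where
  "empirical_measure \<tau> t \<omega> =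
     distr (uniform_measure lborel {0..<t}) borel
       (\<lambda>s. (to_ext_pos (backward_time \<tau> s \<omega>), to_ext_pos (forward_time \<tau> s \<omega>)))"

definition empirical_law ::
    "'w measure \<Rightarrow> (nat \<Rightarrow> 'w \<Rightarrow> real) \<Rightarrow> real \<Rightarrow> (ext_pos \<times> ext_pos) measure measure" where
  "empirical_law M \<tau> t = distr M (borel_of narrow_topology) (empirical_measure \<tau> t)"


section \<open>The rate functional\<close>

text \<open>Probability measures on \<open>]0,+\<infinity>[\<close> are represented as Borel probability measures on the real
  line that give full mass to the positive half-line.\<close>

definition pos_probs :: "real measure set" where
  "pos_probs = {\<pi> \<in> borel_probs. AE \<tau> in \<pi>. 0 < \<tau>}"

definition mean_recip :: "real measure \<Rightarrow> ennreal" where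
  "mean_recip \<pi> = (\<integral>\<^sup>+\<tau>. ennreal (1 / \<tau>) \<partial>\<pi>)"

definition tilted :: "real measure \<Rightarrow> real measure" where
  "tilted \<pi> = density \<pi> (\<lambda>\<tau>. ennreal (1 / \<tau>) / mean_recip \<pi>)"

definition cycle_measure :: "real measure \<Rightarrow> (ext_pos \<times> ext_pos) measure" where
  "cycle_measure \<pi> =
     distr (uniform_measure lborel {0..1} \<Otimes>\<^sub>M \<pi>) borel
       (\<lambda>(u, \<tau>). (to_ext_pos (u * \<tau>), to_ext_pos ((1 - u) * \<tau>)))"

definition convex_comb :: "real \<Rightarrow> 'a measure \<Rightarrow> 'a measure \<Rightarrow> 'a measure" where
  "convex_comb \<alpha> \<mu> \<nu> = measure_of (space \<mu>) (sets \<mu>)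
     (\<lambda>A. ennreal \<alpha> * emeasure \<mu> A + ennreal (1 - \<alpha>) * emeasure \<nu> A)"

lemma emeasure_convex_comb:
  assumes "sets \<nu> = sets \<mu>" and "A \<in> sets \<mu>"
  shows "emeasure (convex_comb \<alpha> \<mu> \<nu>) A =
    ennreal \<alpha> * emeasure \<mu> A + ennreal (1 - \<alpha>) * emeasure \<nu> A"
proof (rule emeasure_measure_of[OF convex_comb_def])
  show "sets \<mu> \<subseteq> Pow (space \<mu>)" by (rule sets.space_closed)
  show "A \<in> sets (convex_comb \<alpha> \<mu> \<nu>)" using assms(2) by (simp add: convex_comb_def)
  show "positive (sets (convex_comb \<alpha> \<mu> \<nu>))
     (\<lambda>A. ennreal \<alpha> * emeasure \<mu> A + ennreal (1 - \<alpha>) * emeasure \<nu> A)"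
    by (simp add: positive_def)
  show "countably_additive (sets (convex_comb \<alpha> \<mu> \<nu>))
     (\<lambda>A. ennreal \<alpha> * emeasure \<mu> A + ennreal (1 - \<alpha>) * emeasure \<nu> A)"
    unfolding countably_additive_def
  proof (intro allI impI)
    fix F :: "nat \<Rightarrow> _"
    assume F: "range F \<subseteq> sets (convex_comb \<alpha> \<mu> \<nu>)" "disjoint_family F"
    then have "range F \<subseteq> sets \<mu>" "range F \<subseteq> sets \<nu>"
      using assms(1) by (auto simp: convex_comb_def)
    then have "(\<Sum>i. emeasure \<mu> (F i)) = emeasure \<mu> (\<Union>i. F i)"
      "(\<Sum>i. emeasure \<nu> (F i)) = emeasure \<nu> (\<Union>i. F i)"
      using F(2) by (simp_all add: suminf_emeasure)
    then show "(\<Sum>i. ennreal \<alpha> * emeasure \<mu> (F i) + ennreal (1 - \<alpha>) * emeasure \<nu> (F i)) =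
       ennreal \<alpha> * emeasure \<mu> (\<Union>i. F i) + ennreal (1 - \<alpha>) * emeasure \<nu> (\<Union>i. F i)"
      by (simp add: suminf_add[symmetric] ennreal_suminf_cmult)
  qed
qed

definition Delta0 :: "(ext_pos \<times> ext_pos) measure set" where
  "Delta0 = {cycle_measure \<pi> | \<pi>. \<pi> \<in> pos_probs \<and> mean_recip \<pi> < \<infinity>}"

definition Delta :: "(ext_pos \<times> ext_pos) measure set" where
  "Delta = {convex_comb \<alpha> \<mu>\<^sub>0 (return borel (\<infinity>, \<infinity>)) | \<alpha> \<mu>\<^sub>0. \<mu>\<^sub>0 \<in> Delta0 \<and> \<alpha> \<in> {0..1}}"

text \<open>For probability measures \<open>\<nu> \<lless> \<mu>\<close>, the negative part of \<open>log (d\<nu>/d\<mu>)\<close> is always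
  \<open>\<nu>\<close>-integrable, so failure of integrability means that the integral is \<open>+\<infinity>\<close>.
  The argument order of the library's \<open>KL_divergence\<close> is reversed.\<close>

definition rel_entropy :: "'a measure \<Rightarrow> 'a measure \<Rightarrow> ereal" where
  "rel_entropy \<nu> \<mu> =
     (if absolutely_continuous \<mu> \<nu> \<and> integrable \<nu> (entropy_density (exp 1) \<mu> \<nu>)
      then ereal (KL_divergence (exp 1) \<mu> \<nu>) else \<infinity>)"

definition exp_abscissa :: "real measure \<Rightarrow> ereal" where
  "exp_abscissa \<psi> = Sup (ereal ` {c. (\<integral>\<^sup>+\<tau>. ennreal (exp (c * \<tau>)) \<partial>\<psi>) < \<infinity>})"

text \<open>The representation of \<open>\<mu> \<in> \<Delta>\<close> is unique, except that \<open>\<pi>\<close> is arbitrary if \<open>\<alpha> = 0\<close>, where the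
  value is \<open>\<xi>\<close> because \<open>0 * \<infinity> = 0\<close> in \<open>ereal\<close>; hence the value is uniquely determined.\<close>

definition rate :: "real measure \<Rightarrow> (ext_pos \<times> ext_pos) measure \<Rightarrow> ereal" where
  "rate \<psi> \<mu> =
     (if \<mu> \<in> Delta then
        (THE v. \<exists>\<alpha> \<pi>. \<alpha> \<in> {0..1} \<and> \<pi> \<in> pos_probs \<and> mean_recip \<pi> < \<infinity> \<and>
            \<mu> = convex_comb \<alpha> (cycle_measure \<pi>) (return borel (\<infinity>, \<infinity>)) \<and>
            v = ereal \<alpha> * enn2ereal (mean_recip \<pi>) * rel_entropy (tilted \<pi>) \<psi>
                + ereal (1 - \<alpha>) * exp_abscissa \<psi>)
      else \<infinity>)"

end

theory Submission
  imports Defs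
begin

text \<open>
  The map \<open>(a, b) \<mapsto> 1/(a + b)\<close> is continuous on \<open>]0,+\<infinity>]\<^sup>2\<close>. It sends \<open>\<mu>\<^sub>t\<close> to the law \<open>q\<^sub>t\<close> of the inverse
  length of the cycle around a uniform time in \<open>[0,t]\<close>, and up to an error vanishing uniformly as
  \<open>t \<rightarrow> \<infinity>\<close>, \<open>\<mu>\<^sub>t\<close> is the image \<open>cycle_law q\<^sub>t\<close> under the inverse passage, which places a point
  uniformly in a cycle. Thus \<open>\<Delta>\<close> is the set of all \<open>cycle_law q\<close> with \<open>q\<close> of finite mean, and the
  mean of \<open>q\<^sub>t\<close> is essentially the number of renewals per unit of time, whose exponential tails
  give exponential tightness.

  Upper bound. If \<open>g\<close> is bounded continuous on \<open>[0,\<infinity>[\<close> with \<open>g(0) = c\<close>, \<open>\<psi>(e\<^bsup>c\<tau>\<^esup>) < \<infinity>\<close> and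
  \<open>\<psi>(e\<^bsup>\<tau> g(1/\<tau>)\<^esup>) < 1\<close>, then, up to a factor \<open>exp (o(t))\<close>, \<open>E exp (t \<mu>\<^sub>t(g(1/(a + b))))\<close> is bounded by a geometric
  series over the number of renewals. By the variational formula for the relative entropy, the supremum of
  \<open>q(g)\<close> over such \<open>g\<close> is \<open>I(cycle_law q)\<close>; compactness does the rest.

  Lower bound. Up to time about \<open>\<alpha> t\<close> the waiting times are forced to follow \<open>\<pi>\<close> tilted by \<open>1/\<tau>\<close>,
  at the relative entropy cost given by the law of large numbers, and the remaining time
  \<open>(1 - \<alpha>) t\<close> is filled by a bounded number of very long waiting times, at cost \<open>\<xi>\<close> per unit of time.
\<close>

section \<open>The narrow topology\<close>

text \<open>Using inverse lengths turns the infinite cycle into the ordinary point 0: mass escaping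
  to ever longer cycles becomes an atom at 0, while escape to ever shorter ones is excluded by
  bounded means. The variational formula yields \<open>h\<close> bounded and continuous in the
  waiting time, and \<open>\<tau> * g (1 / \<tau>) = h \<tau>\<close> forces
  \<open>g x = x * h (1 / x)\<close>. This is unbounded for large \<open>x\<close> and vanishes at
  0, hence a truncation and an added spike of height \<open>c\<close> at 0. The sign
  \<open>c \<ge> 0\<close> allows an interrupted cycle to be bounded by the complete one. In the
  lower bound the long waiting times lie in \<open>[L,L+1[\<close> for a large \<open>L\<close> that
  does not depend on \<open>t\<close>, about \<open>(1 - \<alpha>) * t / L\<close> of them: for
  arbitrary \<open>\<psi>\<close> the exponential rate of the tail may be attained only along
  exceptional lengths, so lengths comparable to \<open>t\<close> need not be available for every
  \<open>t\<close>. The narrow topology is handled through second countability alone, which gives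
  both Borel measurability of the empirical measure and a sequential criterion for
  compactness.\<close>

definition bcont :: "('a::topological_space \<Rightarrow> real) set" where
  "bcont = {f. continuous_on UNIV f \<and> bounded (range f)}"

lemma bcontI: "continuous_on UNIV f \<Longrightarrow> (\<And>x. \<bar>f x\<bar> \<le> B) \<Longrightarrow> f \<in> bcont"
  by (auto simp: bcont_def bounded_iff)

lemma bcont_boundE:
  assumes "f \<in> bcont" obtains B where "B > 0" "\<And>x. \<bar>f x\<bar> \<le> B"
proof -
  obtain B where B: "\<And>x. \<bar>f x\<bar> \<le> B" using assms by (auto simp: bcont_def bounded_iff)
  show thesis
  proof (rule that[of "\<bar>B\<bar> + 1"])
    show "\<bar>f x\<bar> \<le> \<bar>B\<bar> + 1" for x using B[of x] by linarith
  qed simp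
qed

lemma bcont_measurable: "f \<in> bcont \<Longrightarrow> f \<in> borel_measurable borel"
  by (auto simp: bcont_def intro: borel_measurable_continuous_onI)

lemma bcont_isCont: "f \<in> bcont \<Longrightarrow> isCont f x"
  by (simp add: bcont_def continuous_on_eq_continuous_at)

lemma borel_probsD:
  assumes "\<mu> \<in> borel_probs"
  shows "prob_space \<mu>" "sets \<mu> = sets borel" "space \<mu> = UNIV"
    "measurable \<mu> N = measurable borel N"
  using assms sets_eq_imp_space_eq[of \<mu> borel]
  by (auto simp: borel_probs_def cong: measurable_cong_sets)

lemma integrable_bcont:
  assumes "\<mu> \<in> borel_probs" "f \<in> bcont"
  shows "integrable \<mu> f"
proof -
  interpret prob_space \<mu> using assms borel_probsD by blast
  obtain B where B: "\<And>x. \<bar>f x\<bar> \<le> B" using bcont_boundE[OF assms(2)] by blast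
  show ?thesis
    by (rule integrable_const_bound[of _ B])
      (use B bcont_measurable[OF assms(2)] borel_probsD[OF assms(1)] in auto)
qed

definition nbhd :: "('a::topological_space \<Rightarrow> real) set \<Rightarrow> real \<Rightarrow> 'a measure \<Rightarrow> 'a measure set" where
  "nbhd F e \<mu> = {\<nu> \<in> borel_probs. \<forall>f\<in>F. \<bar>(\<integral>x. f x \<partial>\<nu>) - (\<integral>x. f x \<partial>\<mu>)\<bar> < e}"

lemma openin_narrow_vimage:
  fixes f :: "'a::topological_space \<Rightarrow> real"
  assumes "f \<in> bcont" "open V"
  shows "openin narrow_topology {\<nu> \<in> borel_probs. (\<integral>x. f x \<partial>\<nu>) \<in> V}"
proof -
  have "{\<nu> \<in> borel_probs. (\<integral>x. f x \<partial>\<nu>) \<in> V} \<in> {{M \<in> borel_probs. (\<integral>x. f x \<partial>M) \<in> V} | (f :: 'a \<Rightarrow> real) V.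
        continuous_on UNIV f \<and> bounded (range f) \<and> open V}"
    using assms unfolding bcont_def by blast
  then show ?thesis
    unfolding narrow_topology_def openin_topology_generated_by_iff
    by (rule generate_topology_on.Basis)
qed

lemma openin_narrow_finite:
  fixes T :: "(('a::topological_space \<Rightarrow> real) \<times> real set) set"
  assumes "finite T" "\<And>f V. (f, V) \<in> T \<Longrightarrow> f \<in> bcont \<and> open V"
  shows "openin narrow_topology {\<nu> \<in> borel_probs. \<forall>(f, V)\<in>T. (\<integral>x. f x \<partial>\<nu>) \<in> V}"
  using assms
proof (induction T)
  case empty
  show ?case using openin_topspace[of narrow_topology] by (simp add: topspace_narrow_topology)
next
  case (insert p T)
  obtain f V where p: "p = (f, V)" by force
  have "{\<nu> \<in> borel_probs. \<forall>(f, V)\<in>insert p T. (\<integral>x. f x \<partial>\<nu>) \<in> V} =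
     {\<nu> \<in> borel_probs. (\<integral>x. f x \<partial>\<nu>) \<in> V} \<inter> {\<nu> \<in> borel_probs. \<forall>(f, V)\<in>T. (\<integral>x. f x \<partial>\<nu>) \<in> V}"
    by (auto simp: p)
  moreover have "f \<in> bcont" "open V" using insert.prems[of f V] p by auto
  moreover have "openin narrow_topology {\<nu> \<in> borel_probs. \<forall>(f, V)\<in>T. (\<integral>x. f x \<partial>\<nu>) \<in> V}"
    by (rule insert.IH) (use insert.prems in blast)
  ultimately show ?case
    by (simp only:) (intro openin_Int openin_narrow_vimage)
qed

lemma openin_nbhd:
  assumes "finite F" "F \<subseteq> bcont"
  shows "openin narrow_topology (nbhd F e \<mu>)"
proof -
  have "nbhd F e \<mu> = {\<nu> \<in> borel_probs. \<forall>(f, V)\<in>(\<lambda>f. (f, ball (\<integral>x. f x \<partial>\<mu>) e)) ` F. (\<integral>x. f x \<partial>\<nu>) \<in> V}"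
    by (auto simp: nbhd_def dist_real_def abs_minus_commute)
  also have "openin narrow_topology \<dots>"
    using assms by (intro openin_narrow_finite) auto
  finally show ?thesis .
qed

lemma nbhd_self: "\<mu> \<in> borel_probs \<Longrightarrow> 0 < e \<Longrightarrow> \<mu> \<in> nbhd F e \<mu>"
  by (simp add: nbhd_def)

lemma nbhd_mono: "F \<subseteq> F' \<Longrightarrow> e' \<le> e \<Longrightarrow> nbhd F' e' \<mu> \<subseteq> nbhd F e \<mu>"
  by (force simp: nbhd_def)

text \<open>Induction along the generation of the topology. Only intersections need an argument: the
  union of the two sets of test functions and the smaller radius give a neighbourhood inside
  both.\<close>

lemma narrow_nbhd_base:
  fixes \<mu> :: "'a::topological_space measure"
  assumes "openin narrow_topology U" "\<mu> \<in> U"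
  shows "\<exists>F e. finite F \<and> F \<subseteq> bcont \<and> 0 < e \<and> nbhd F e \<mu> \<subseteq> U"
proof -
  have "generate_topology_on {{M \<in> borel_probs. (\<integral>x. f x \<partial>M) \<in> V} | (f :: 'a \<Rightarrow> real) V.
        continuous_on UNIV f \<and> bounded (range f) \<and> open V} U"
    using assms(1) unfolding narrow_topology_def openin_topology_generated_by_iff .
  then show ?thesis using assms(2)
  proof (induction rule: generate_topology_on.induct)
    case Empty
    then show ?case by simp
  next
    case (Int a b)
    then obtain F e F' e' where "finite F" "F \<subseteq> bcont" "0 < e" "nbhd F e \<mu> \<subseteq> a"
       "finite F'" "F' \<subseteq> bcont" "0 < e'" "nbhd F' e' \<mu> \<subseteq> b" by auto
    moreover have "nbhd (F \<union> F') (min e e') \<mu> \<subseteq> nbhd F e \<mu> \<inter> nbhd F' e' \<mu>"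
      by (intro Int_greatest nbhd_mono) auto
    ultimately show ?case by (intro exI[of _ "F \<union> F'"] exI[of _ "min e e'"]) auto
  next
    case (UN K)
    then obtain k where k: "k \<in> K" "\<mu> \<in> k" by auto
    from UN(2)[OF k] obtain F e where "finite F" "F \<subseteq> bcont" "0 < e" "nbhd F e \<mu> \<subseteq> k" by blast
    then show ?case using k by blast
  next
    case (Basis s)
    then obtain f V where f: "s = {M \<in> borel_probs. (\<integral>x. f x \<partial>M) \<in> V}" "f \<in> bcont" "open V"
      by (auto simp: bcont_def)
    then obtain e where "e > 0" "ball (\<integral>x. f x \<partial>\<mu>) e \<subseteq> V"
      using Basis openE by blast
    then show ?case using f
      by (intro exI[of _ "{f}"] exI[of _ e])
        (auto simp: nbhd_def subset_iff dist_real_def abs_minus_commute)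
  qed
qed

text \<open>Bounded continuous functions need not be separable in the uniform norm, but
  approximation from below by countably many cones is enough: centres in a countable dense set,
  rational heights, integer slopes. Positivity of \<open>f\<close> keeps a cone below
  \<open>f\<close> where the cone has already dropped to 0.\<close>

lemma countable_tents:
  "\<exists>G :: ('a::{metric_space,second_countable_topology} \<Rightarrow> real) set. countable G \<and> (\<lambda>_. 0) \<in> G \<and>
     (\<forall>g\<in>G. continuous_on UNIV g \<and> (\<forall>x. 0 \<le> g x)) \<and>
     (\<forall>f x a. continuous_on UNIV f \<longrightarrow> (\<forall>x. 0 < f x) \<longrightarrow> 0 \<le> a \<longrightarrow> a < f x \<longrightarrow> (\<exists>g\<in>G. (\<forall>x. g x \<le> f x) \<and> a < g x))"
proof -
  obtain D :: "'a set" where D: "countable D" "\<And>X. open X \<Longrightarrow> X \<noteq> {} \<Longrightarrow> \<exists>d\<in>D. d \<in> X"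
    using countable_dense_setE by blast
  define G where "G = (\<lambda>(y, r, k). (\<lambda>x. max 0 (of_rat r - real k * dist x y))) ` (D \<times> (UNIV :: rat set) \<times> (UNIV :: nat set))"
  have "(\<lambda>_. 0) \<in> G"
  proof -
    obtain y where "y \<in> D" using D(2)[of UNIV] by auto
    then show ?thesis unfolding G_def by (intro image_eqI[of _ _ "(y, 0, 0)"]) auto
  qed
  show ?thesis
  proof (intro exI[of _ G] conjI allI impI)
    show "countable G" unfolding G_def using D(1) by (intro countable_image countable_SIGMA) auto
    show "(\<lambda>_. 0) \<in> G" by fact
    show "\<forall>g\<in>G. continuous_on UNIV g \<and> (\<forall>x. 0 \<le> g x)"
      by (auto simp: G_def intro!: continuous_intros)
    fix f :: "'a \<Rightarrow> real" and x a
    assume f: "continuous_on UNIV f" "\<forall>x. 0 < f x" "0 \<le> a" "a < f x"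
    obtain r where r: "a < of_rat r" "of_rat r < f x"
      using f(4) of_rat_dense by blast
    have "open {z. of_rat r < f z}" using f(1) by (intro open_Collect_less) auto
    \<comment> \<open>The radius is doubled because the cone is centred at a point \<open>y\<close>
      near \<open>x\<close>, and its support, of radius \<open>\<rho>\<close> around
      \<open>y\<close>, has to stay where \<open>f\<close> exceeds \<open>r\<close>.\<close>
    then obtain \<rho> where \<rho>: "\<rho> > 0" "ball x (2 * \<rho>) \<subseteq> {z. of_rat r < f z}"
      using r(2) openE[of "{z. of_rat r < f z}" x] 
      by (metis mem_Collect_eq field_sum_of_halves mult_2 half_gt_zero)
    \<comment> \<open>Steep enough for a cone of height \<open>r\<close> to have dropped to 0 at
      distance \<open>\<rho>\<close> from its centre.\<close>
    obtain k :: nat where k: "of_rat r / \<rho> < real k" using reals_Archimedean2 by blast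
    have kp: "0 < real k" using k r(1) f(3) \<rho>(1)
      by (meson divide_nonneg_pos le_less_trans less_imp_le order_le_less_trans)
    \<comment> \<open>The bound \<open>\<rho>\<close> confines the support; the bound
      \<open>(of_rat r - a) / k\<close> ensures that at \<open>x\<close> the cone has lost less than
      \<open>of_rat r - a\<close> of its height.\<close>
    obtain y where y: "y \<in> D" "dist x y < min \<rho> ((of_rat r - a) / k)"
      using D(2)[of "ball x (min \<rho> ((of_rat r - a) / k))"] \<rho> r kp
      by (auto simp: not_le)
    show "\<exists>g\<in>G. (\<forall>x. g x \<le> f x) \<and> a < g x"
    proof (intro bexI[of _ "\<lambda>x. max 0 (of_rat r - real k * dist x y)"] conjI allI)
      show "(\<lambda>x. max 0 (of_rat r - real k * dist x y)) \<in> G"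
        unfolding G_def using y by (intro image_eqI[of _ _ "(y, r, k)"]) auto
      show "a < max 0 (of_rat r - real k * dist x y)"
        using y kp by (auto simp: field_simps)
      fix z
      show "max 0 (of_rat r - real k * dist z y) \<le> f z"
      proof (cases "dist z y < \<rho>")
        case True
        then have "dist x z < 2 * \<rho>"
          using y dist_triangle[of x z y] by (simp add: dist_commute)
        then have "of_rat r < f z" using \<rho>(2) by auto
        moreover have "0 \<le> real k * dist z y" by simp
        ultimately show ?thesis using f(2)[rule_format, of z] by linarith
      next
        case False
        have "of_rat r < real k * \<rho>" using k \<rho>(1) by (simp add: field_simps)
        also have "\<dots> \<le> real k * dist z y" using False by (intro mult_left_mono) auto
        finally show ?thesis using f(2)[rule_format, of z] by linarith
      qed
    qed
  qed
qed

text \<open>A positive \<open>f\<close> is the pointwise supremum of the cones below it, so maxima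
  over growing finite sets of such cones increase to \<open>f\<close>, and dominated convergence
  carries this over to integrals. Closing the cones under finite maxima keeps the family countable
  and independent of the measure.\<close>

lemma countable_approximating_family:
  "\<exists>H :: ('a::{metric_space,second_countable_topology} \<Rightarrow> real) set. countable H \<and>
     (\<forall>f\<in>bcont. (\<forall>x. 0 < f x) \<longrightarrow> (\<forall>\<mu>\<in>borel_probs. \<forall>a < (\<integral>x. f x \<partial>\<mu>).
        \<exists>g\<in>H. g \<in> bcont \<and> (\<forall>x. g x \<le> f x) \<and> a < (\<integral>x. g x \<partial>\<mu>)))"
proof -
  obtain G :: "('a \<Rightarrow> real) set" where G: "countable G" "(\<lambda>_. 0) \<in> G" 
     "\<And>g. g \<in> G \<Longrightarrow> continuous_on UNIV g" "\<And>g x. g \<in> G \<Longrightarrow> 0 \<le> g x"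
     "\<And>f x a. continuous_on UNIV f \<Longrightarrow> (\<forall>x. 0 < f x) \<Longrightarrow> 0 \<le> a \<Longrightarrow> a < f x \<Longrightarrow> (\<exists>g\<in>G. (\<forall>x. g x \<le> f x) \<and> a < g x)"
    using countable_tents by metis
  define H where "H = (\<lambda>S x. Max ((\<lambda>g. g x) ` S)) ` {S. S \<subseteq> G \<and> finite S}"
  show ?thesis
  proof (intro exI[of _ H] conjI ballI impI allI)
    show "countable H" unfolding H_def using G(1)
      using countable_Collect_finite_subset[OF G(1)] by (auto simp: conj_commute)
    fix f :: "'a \<Rightarrow> real" and \<mu> :: "'a measure" and a
    assume f: "f \<in> bcont" "\<forall>x. 0 < f x" "\<mu> \<in> borel_probs" "a < (\<integral>x. f x \<partial>\<mu>)"
    define A where "A = {g \<in> G. \<forall>x. g x \<le> f x}"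
    have A: "countable A" "(\<lambda>_. 0) \<in> A" using G(1,2) f(2) unfolding A_def by (auto intro: less_imp_le)
    define s where "s n = from_nat_into A ` {..n::nat}" for n
    have s: "s n \<subseteq> A" "finite (s n)" "s n \<noteq> {}" for n
      using from_nat_into[of A] A(2) by (auto simp: s_def)
    define h where "h n x = Max ((\<lambda>g. g x) ` s n)" for n x
    have hH: "h n \<in> H" for n unfolding H_def h_def using s A_def by (intro image_eqI[of _ _ "s n"]) auto
    have h_le: "h n x \<le> f x" for n x unfolding h_def using s[of n] by (auto simp: A_def)
    have h_ge: "h n x \<ge> 0" for n x
    proof -
      obtain g where "g \<in> s n" using s(3) by blast
      moreover from this have "g \<in> G" using s(1) by (auto simp: A_def)
      ultimately show ?thesis unfolding h_def using s(2)[of n] G(4)[of g x]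
        by (intro order_trans[OF _ Max_ge[of _ "g x"]]) auto
    qed
    have cont_Max: "continuous_on UNIV (\<lambda>x. Max ((\<lambda>g. g x) ` S))"
      if "finite S" "S \<noteq> {}" "S \<subseteq> G" for S using that
    proof (induction S rule: finite_ne_induct)
      case (insert g S)
      have "(\<lambda>x. Max ((\<lambda>g. g x) ` insert g S)) = (\<lambda>x. max (g x) (Max ((\<lambda>g. g x) ` S)))"
        using insert by (auto simp: fun_eq_iff)
      then show ?case using insert G(3) by (auto intro!: continuous_intros)
    qed (use G(3) in auto)
    obtain B where B: "\<And>x. \<bar>f x\<bar> \<le> B" using bcont_boundE[OF f(1)] by blast
    have hb: "h n \<in> bcont" for n
    proof (rule bcontI)
      show "continuous_on UNIV (h n)" unfolding h_def using s[of n] A_def by (intro cont_Max) auto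
      show "\<bar>h n x\<bar> \<le> B" for x using h_le[of n x] h_ge[of n x] B[of x] by linarith
    qed
    have "(\<lambda>n. \<integral>x. h n x \<partial>\<mu>) \<longlonglongrightarrow> (\<integral>x. f x \<partial>\<mu>)"
    proof (rule integral_dominated_convergence[where w=f])
      show "integrable \<mu> f" using f integrable_bcont by blast
      show "f \<in> borel_measurable \<mu>" "h n \<in> borel_measurable \<mu>" for n
        using bcont_measurable f hb borel_probsD by blast+
      show "AE x in \<mu>. norm (h n x) \<le> f x" for n
        using h_le h_ge by auto
      show "AE x in \<mu>. (\<lambda>n. h n x) \<longlonglongrightarrow> f x"
      proof (intro AE_I2 order_tendstoI)
        fix x a assume "a < f x"
        then have "max a 0 < f x" using f(2) by auto
        moreover have "continuous_on UNIV f" using f(1) by (auto simp: bcont_def)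
        ultimately obtain g where g: "g \<in> A" "max a 0 < g x"
          unfolding A_def using G(5)[OF _ f(2), of "max a 0" x] by auto
        obtain m where m: "g = from_nat_into A m" using A g(1) from_nat_into_surj by metis
        show "\<forall>\<^sub>F n in sequentially. a < h n x"
          unfolding eventually_sequentially
        proof (intro exI[of _ m] allI impI)
          fix n assume "m \<le> n"
          then have "g \<in> s n" unfolding s_def m by auto
          then have "g x \<le> h n x" unfolding h_def using s by (intro Max_ge) auto
          then show "a < h n x" using g by auto
        qed
      next
        fix x a assume "f x < a"
        then show "\<forall>\<^sub>F n in sequentially. h n x < a" 
          by (intro always_eventually allI order.strict_trans1[OF h_le])
      qed
    qed
    then have "\<forall>\<^sub>F n in sequentially. a < (\<integral>x. h n x \<partial>\<mu>)" using f(4) order_tendstoD(1) by blast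
    then obtain n where "a < (\<integral>x. h n x \<partial>\<mu>)" by (auto simp: eventually_sequentially)
    then show "\<exists>g\<in>H. g \<in> bcont \<and> (\<forall>x. g x \<le> f x) \<and> a < (\<integral>x. g x \<partial>\<mu>)"
      using hH hb h_le by (intro bexI[of _ "h n"]) auto
  qed
qed

text \<open>Lower bounds suffice, since an upper bound on the integral of \<open>f\<close> is a
  lower bound on that of \<open>- f\<close>. This fits a countable family that approximates only
  from below.\<close>

definition lower_nbhd :: "(('a::topological_space \<Rightarrow> real) \<times> real) set \<Rightarrow> 'a measure set" where
  "lower_nbhd T = {\<nu> \<in> borel_probs. \<forall>(f, a)\<in>T. a < (\<integral>x. f x \<partial>\<nu>)}"

lemma narrow_countable_base:
  "\<exists>\<B> :: (('a::{metric_space,second_countable_topology} \<Rightarrow> real) \<times> real) set set. countable \<B> \<and>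
     (\<forall>T\<in>\<B>. finite T \<and> fst ` T \<subseteq> bcont) \<and>
     (\<forall>U \<mu>. openin narrow_topology U \<longrightarrow> \<mu> \<in> U \<longrightarrow> (\<exists>T\<in>\<B>. 
        \<mu> \<in> lower_nbhd T \<and>
        lower_nbhd T \<subseteq> U))"
proof -
  obtain H :: "('a \<Rightarrow> real) set" where H: "countable H"
     "\<And>f \<mu> a. f \<in> bcont \<Longrightarrow> (\<And>x. 0 < f x) \<Longrightarrow> \<mu> \<in> borel_probs \<Longrightarrow> a < (\<integral>x. f x \<partial>\<mu>) \<Longrightarrow>
        \<exists>g\<in>H. g \<in> bcont \<and> (\<forall>x. g x \<le> f x) \<and> a < (\<integral>x. g x \<partial>\<mu>)"
    using countable_approximating_family by metis
  define \<B> where "\<B> = {T. T \<subseteq> (H \<inter> bcont) \<times> (\<rat> :: real set) \<and> finite T}"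
  have lower: "\<exists>T\<in>\<B>. (\<forall>(g, a)\<in>T. a < (\<integral>x. g x \<partial>\<mu>)) \<and>
      (\<forall>\<nu>\<in>borel_probs. (\<forall>(g, a)\<in>T. a < (\<integral>x. g x \<partial>\<nu>)) \<longrightarrow> (\<integral>x. f x \<partial>\<nu>) > (\<integral>x. f x \<partial>\<mu>) - e)"
    if f: "f \<in> bcont" "0 < e" "\<mu> \<in> borel_probs" for f \<mu> e
  proof -
    obtain B where B: "\<And>x. \<bar>f x\<bar> \<le> B" "0 < B" using bcont_boundE[OF f(1)] by blast
    \<comment> \<open>The family \<open>H\<close> approximates positive functions only. Adding
      \<open>2 * B\<close> makes \<open>f\<close> positive and shifts its integral under every
      probability measure by the same constant.\<close>
    have fB: "(\<lambda>x. f x + 2 * B) \<in> bcont"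
    proof (rule bcontI)
      show "continuous_on UNIV (\<lambda>x. f x + 2 * B)" using f by (auto simp: bcont_def intro!: continuous_intros)
      show "\<bar>f x + 2 * B\<bar> \<le> 3 * B" for x using B(1)[of x] by linarith
    qed
    have pos: "0 < f x + 2 * B" for x using B(1)[of x] B(2) by linarith
    have int: "(\<integral>x. f x + 2 * B \<partial>\<nu>) = (\<integral>x. f x \<partial>\<nu>) + 2 * B" if "\<nu> \<in> borel_probs" for \<nu>
    proof -
      interpret prob_space \<nu> using that borel_probsD by blast
      show ?thesis using integrable_bcont[OF that f(1)] by (simp add: prob_space)
    qed
    obtain a where a: "a \<in> \<rat>" "(\<integral>x. f x \<partial>\<mu>) + 2 * B - e < a" "a < (\<integral>x. f x \<partial>\<mu>) + 2 * B"
      using Rats_dense_in_real[of "(\<integral>x. f x \<partial>\<mu>) + 2 * B - e" "(\<integral>x. f x \<partial>\<mu>) + 2 * B"] f(2) by auto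
    obtain g where g: "g \<in> H" "g \<in> bcont" "\<And>x. g x \<le> f x + 2 * B" "a < (\<integral>x. g x \<partial>\<mu>)"
      using H(2)[OF fB pos f(3), of a] a(3) int[OF f(3)] by auto
    show ?thesis
    proof (intro bexI[of _ "{(g, a)}"] conjI ballI impI)
      show "{(g, a)} \<in> \<B>" using g a by (auto simp: \<B>_def)
      fix \<nu> :: "'a measure" assume \<nu>: "\<nu> \<in> borel_probs" "\<forall>(g, a)\<in>{(g, a)}. a < (\<integral>x. g x \<partial>\<nu>)"
      have "(\<integral>x. g x \<partial>\<nu>) \<le> (\<integral>x. f x + 2 * B \<partial>\<nu>)"
        using g fB \<nu> by (intro integral_mono integrable_bcont) auto
      then show "(\<integral>x. f x \<partial>\<nu>) > (\<integral>x. f x \<partial>\<mu>) - e" using int[OF \<nu>(1)] \<nu>(2) a(2) by auto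
    qed (use g in auto)
  qed
  have both: "\<exists>T\<in>\<B>. (\<forall>(g, a)\<in>T. a < (\<integral>x. g x \<partial>\<mu>)) \<and>
      (\<forall>\<nu>\<in>borel_probs. (\<forall>(g, a)\<in>T. a < (\<integral>x. g x \<partial>\<nu>)) \<longrightarrow> \<bar>(\<integral>x. f x \<partial>\<nu>) - (\<integral>x. f x \<partial>\<mu>)\<bar> < e)"
    if f: "f \<in> bcont" "0 < e" "\<mu> \<in> borel_probs" for f \<mu> e
  proof -
    have f': "(\<lambda>x. - f x) \<in> bcont" using f(1) by (auto simp: bcont_def bounded_iff intro!: continuous_intros)
    from lower[OF f] obtain T where T: "T \<in> \<B>" "\<forall>(g, a)\<in>T. a < (\<integral>x. g x \<partial>\<mu>)"
      "\<And>\<nu>. \<nu>\<in>borel_probs \<Longrightarrow> (\<forall>(g, a)\<in>T. a < (\<integral>x. g x \<partial>\<nu>)) \<Longrightarrow> (\<integral>x. f x \<partial>\<nu>) > (\<integral>x. f x \<partial>\<mu>) - e"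
      by blast
    from lower[OF f' f(2,3)] obtain T' where T': "T' \<in> \<B>" "\<forall>(g, a)\<in>T'. a < (\<integral>x. g x \<partial>\<mu>)"
      "\<And>\<nu>. \<nu>\<in>borel_probs \<Longrightarrow> (\<forall>(g, a)\<in>T'. a < (\<integral>x. g x \<partial>\<nu>)) \<Longrightarrow> (\<integral>x. - f x \<partial>\<nu>) > (\<integral>x. - f x \<partial>\<mu>) - e"
      by blast
    show ?thesis
    proof (intro bexI[of _ "T \<union> T'"] conjI ballI impI)
      show "T \<union> T' \<in> \<B>" using T T' by (auto simp: \<B>_def)
      fix \<nu> :: "'a measure" assume \<nu>: "\<nu> \<in> borel_probs" "\<forall>(g, a)\<in>T \<union> T'. a < (\<integral>x. g x \<partial>\<nu>)"
      show "\<bar>(\<integral>x. f x \<partial>\<nu>) - (\<integral>x. f x \<partial>\<mu>)\<bar> < e"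
        using T(3)[OF \<nu>(1)] T'(3)[OF \<nu>(1)] \<nu>(2) by (auto simp: abs_less_iff)
    qed (use T T' in auto)
  qed
  show ?thesis
  proof (intro exI[of _ \<B>] conjI ballI allI impI)
    show "countable \<B>" unfolding \<B>_def using H(1)
      using countable_Collect_finite_subset[of "(H \<inter> bcont) \<times> \<rat>"] countable_rat
      by (auto simp: conj_commute)
    show "finite T" "fst ` T \<subseteq> bcont" if "T \<in> \<B>" for T using that by (auto simp: \<B>_def)
    fix U :: "'a measure set" and \<mu> assume U: "openin narrow_topology U" "\<mu> \<in> U"
    have \<mu>: "\<mu> \<in> borel_probs" using U openin_subset topspace_narrow_topology by blast
    obtain F e where F: "finite F" "F \<subseteq> bcont" "0 < e" "nbhd F e \<mu> \<subseteq> U"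
      using narrow_nbhd_base[OF U] by blast
    have "\<forall>f\<in>F. \<exists>T\<in>\<B>. (\<forall>(g, a)\<in>T. a < (\<integral>x. g x \<partial>\<mu>)) \<and>
      (\<forall>\<nu>\<in>borel_probs. (\<forall>(g, a)\<in>T. a < (\<integral>x. g x \<partial>\<nu>)) \<longrightarrow> \<bar>(\<integral>x. f x \<partial>\<nu>) - (\<integral>x. f x \<partial>\<mu>)\<bar> < e)"
      using both F(2,3) \<mu> by blast
    then obtain T where T: "\<And>f. f \<in> F \<Longrightarrow> T f \<in> \<B>" "\<And>f. f \<in> F \<Longrightarrow> (\<forall>(g, a)\<in>T f. a < (\<integral>x. g x \<partial>\<mu>))"
       "\<And>f \<nu>. f \<in> F \<Longrightarrow> \<nu>\<in>borel_probs \<Longrightarrow> (\<forall>(g, a)\<in>T f. a < (\<integral>x. g x \<partial>\<nu>)) \<Longrightarrow> \<bar>(\<integral>x. f x \<partial>\<nu>) - (\<integral>x. f x \<partial>\<mu>)\<bar> < e"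
      by metis
    show "\<exists>T\<in>\<B>. \<mu> \<in> lower_nbhd T \<and>
        lower_nbhd T \<subseteq> U"
    proof (intro bexI[of _ "\<Union>f\<in>F. T f"] conjI)
      show "(\<Union>f\<in>F. T f) \<in> \<B>" using T(1) F(1) by (fastforce simp: \<B>_def)
      show "\<mu> \<in> lower_nbhd (\<Union>f\<in>F. T f)"
        using \<mu> T(2) unfolding lower_nbhd_def by fastforce
      have "lower_nbhd (\<Union>f\<in>F. T f) \<subseteq> nbhd F e \<mu>"
        unfolding nbhd_def lower_nbhd_def using T(3) by fastforce
      then show "lower_nbhd (\<Union>f\<in>F. T f) \<subseteq> U"
        using F(4) by blast
    qed
  qed
qed

lemma openin_narrow_lower:
  assumes "finite T" "fst ` T \<subseteq> bcont"
  shows "openin narrow_topology (lower_nbhd T)"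
proof -
  have "lower_nbhd T =
     {\<nu> \<in> borel_probs. \<forall>(f, V)\<in>map_prod id greaterThan ` T. (\<integral>x. f x \<partial>\<nu>) \<in> V}"
    unfolding lower_nbhd_def by fastforce
  also have "openin narrow_topology \<dots>"
    using assms by (intro openin_narrow_finite) auto
  finally show ?thesis .
qed

lemma second_countable_narrow:
  "second_countable (narrow_topology :: 'a::{metric_space,second_countable_topology} measure topology)"
proof -
  obtain \<B> :: "(('a \<Rightarrow> real) \<times> real) set set" where \<B>: "countable \<B>"
    "\<And>T. T \<in> \<B> \<Longrightarrow> finite T \<and> fst ` T \<subseteq> bcont"
    "\<And>U \<mu>. openin narrow_topology U \<Longrightarrow> \<mu> \<in> U \<Longrightarrow> (\<exists>T\<in>\<B>. 
        \<mu> \<in> lower_nbhd T \<and>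
        lower_nbhd T \<subseteq> U)"
    using narrow_countable_base by metis
  show ?thesis
    unfolding second_countable_def
    using \<B> by (intro exI[of _ "(\<lambda>T. lower_nbhd T) ` \<B>"])
      (auto intro!: openin_narrow_lower)
qed

text \<open>\<open>borel_of\<close> is generated by all open sets, not by a subbasis, so
  measurability of the integrals has to be lifted through the countable base: every open set is a
  countable union of sets cut out by finitely many integrals.\<close>

lemma measurable_narrow:
  fixes m :: "'w \<Rightarrow> 'a::{metric_space,second_countable_topology} measure"
  assumes m: "\<And>w. w \<in> space M \<Longrightarrow> m w \<in> borel_probs"
    and int: "\<And>f. f \<in> bcont \<Longrightarrow> (\<lambda>w. \<integral>x. f x \<partial>m w) \<in> borel_measurable M"
  shows "m \<in> measurable M (borel_of narrow_topology)"
  unfolding borel_of_def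
proof (rule measurable_measure_of)
  show "{U. openin narrow_topology U} \<subseteq> Pow (topspace narrow_topology)"
    using openin_subset by blast
  show "m \<in> space M \<rightarrow> topspace narrow_topology" using m by (simp add: topspace_narrow_topology)
  fix U :: "'a measure set" assume "U \<in> {U. openin narrow_topology U}"
  then have U: "openin narrow_topology U" by simp
  obtain \<B> :: "(('a \<Rightarrow> real) \<times> real) set set" where \<B>: "countable \<B>"
    "\<And>T. T \<in> \<B> \<Longrightarrow> finite T \<and> fst ` T \<subseteq> bcont"
    "\<And>U \<mu>. openin narrow_topology U \<Longrightarrow> \<mu> \<in> U \<Longrightarrow> (\<exists>T\<in>\<B>. 
        \<mu> \<in> lower_nbhd T \<and>
        lower_nbhd T \<subseteq> U)"
    using narrow_countable_base by metis
  define \<C> where "\<C> = {T \<in> \<B>. lower_nbhd T \<subseteq> U}"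
  have "m -` U \<inter> space M = (\<Union>T\<in>\<C>. {w \<in> space M. \<forall>p\<in>T. snd p < (\<integral>x. fst p x \<partial>m w)})"
  proof (intro equalityI subsetI)
    fix w assume w: "w \<in> m -` U \<inter> space M"
    then show "w \<in> (\<Union>T\<in>\<C>. {w \<in> space M. \<forall>p\<in>T. snd p < (\<integral>x. fst p x \<partial>m w)})"
      using \<B>(3)[OF U, of "m w"] by (fastforce simp: \<C>_def lower_nbhd_def)
  next
    fix w assume "w \<in> (\<Union>T\<in>\<C>. {w \<in> space M. \<forall>p\<in>T. snd p < (\<integral>x. fst p x \<partial>m w)})"
    then show "w \<in> m -` U \<inter> space M" using m by (fastforce simp: \<C>_def lower_nbhd_def)
  qed
  also have "\<dots> \<in> sets M"
  proof (intro sets.countable_UN' image_subsetI)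
    show "countable \<C>" using \<B>(1) unfolding \<C>_def by (rule countable_subset[rotated]) auto
    fix T assume "T \<in> \<C>"
    then have T: "finite T" "fst ` T \<subseteq> bcont" using \<B>(2) by (auto simp: \<C>_def)
    show "{w \<in> space M. \<forall>p\<in>T. snd p < (\<integral>x. fst p x \<partial>m w)} \<in> sets M"
    proof (cases "T = {}")
      case False
      show ?thesis
      proof (rule sets.sets_Collect_finite_All'[OF _ T(1) False])
      fix p assume "p \<in> T"
      then have [measurable]: "(\<lambda>w. \<integral>x. fst p x \<partial>m w) \<in> borel_measurable M"
        using T(2) by (intro int) auto
      show "{w \<in> space M. snd p < (\<integral>x. fst p x \<partial>m w)} \<in> sets M" by measurable
      qed
    qed simp
  qed
  finally show "m -` U \<inter> space M \<in> sets M" .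
qed

lemma sets_borel_of_openin: "openin X U \<Longrightarrow> U \<in> sets (borel_of X)"
  unfolding borel_of_def by (subst sets_measure_of) (auto dest: openin_subset)

lemma sets_borel_of_closedin:
  assumes "closedin X C" shows "C \<in> sets (borel_of X)"
proof -
  have "topspace X - C \<in> sets (borel_of X)" using assms by (intro sets_borel_of_openin) auto
  moreover have "topspace X \<in> sets (borel_of X)" by (intro sets_borel_of_openin) auto
  moreover have "C = topspace X - (topspace X - C)" using closedin_subset[OF assms] by auto
  ultimately show ?thesis by (metis sets.Diff)
qed

text \<open>Second countability makes \<open>S\<close> a Lindelof space, so a cover may be assumed
  countable. If no finite part sufficed, choosing points outside the first members would give a
  sequence whose subsequential limit lies in one member and forces later points into it. No
  metrization of the topology is involved.\<close>

lemma compactin_sequentially: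
  assumes X: "second_countable X" and S: "S \<subseteq> topspace X"
    and seq: "\<And>x :: nat \<Rightarrow> 'a. range x \<subseteq> S \<Longrightarrow>
      \<exists>r l. strict_mono r \<and> l \<in> S \<and> (\<forall>U. openin X U \<longrightarrow> l \<in> U \<longrightarrow> (\<forall>\<^sub>F n in sequentially. x (r n) \<in> U))"
  shows "compactin X S"
proof -
  have L: "Lindelof_space (subtopology X S)"
    using X second_countable_subtopology second_countable_imp_Lindelof_space by blast
  show ?thesis
    unfolding compactin_def
  proof (intro conjI S allI impI, elim conjE)
    fix \<U> assume \<U>: "\<forall>U\<in>\<U>. openin X U" "S \<subseteq> \<Union>\<U>"
    obtain \<V> where \<V>: "countable \<V>" "\<V> \<subseteq> \<U>" "S \<subseteq> \<Union>\<V>"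
      using L[unfolded Lindelof_space_subtopology_subset[OF S], THEN spec, of \<U>] \<U> by blast
    show "\<exists>\<F>. finite \<F> \<and> \<F> \<subseteq> \<U> \<and> S \<subseteq> \<Union>\<F>"
    proof (cases "\<V> = {}")
      case True
      then show ?thesis using \<V>(3) by (intro exI[of _ "{}"]) auto
    next
      case ne: False
      show ?thesis
      proof (rule ccontr)
        assume neg: "\<not> ?thesis"
        have "\<exists>x. x \<in> S \<and> x \<notin> \<Union>(from_nat_into \<V> ` {..n})" for n
        proof -
          have "from_nat_into \<V> ` {..n} \<subseteq> \<U>" using from_nat_into[OF ne] \<V>(2) by blast
          then show ?thesis using neg by (metis finite_atMost finite_imageI subsetI)
        qed
        then obtain x where x: "\<And>n. x n \<in> S" "\<And>n. x n \<notin> \<Union>(from_nat_into \<V> ` {..n})" by metis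
        have "range x \<subseteq> S" using x(1) by auto
        from seq[OF this] obtain r l where r: "strict_mono r" "l \<in> S"
           "\<And>U. openin X U \<Longrightarrow> l \<in> U \<Longrightarrow> (\<forall>\<^sub>F n in sequentially. x (r n) \<in> U)"
          by blast
        obtain V where V: "V \<in> \<V>" "l \<in> V" using r(2) \<V>(3) by auto
        obtain m where m: "V = from_nat_into \<V> m" using V(1) \<V>(1) from_nat_into_surj by metis
        have "openin X V" using V \<U> \<V> by blast
        then have "\<forall>\<^sub>F n in sequentially. x (r n) \<in> V \<and> m \<le> n"
          using r(3)[OF _ V(2)] eventually_ge_at_top[of m] by (auto intro: eventually_conj)
        then obtain n where n: "x (r n) \<in> V" "m \<le> n" by (auto simp: eventually_sequentially)
        have "m \<le> r n" using n(2) seq_suble[OF r(1), of n] by linarith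
        then show False using x(2)[of "r n"] n(1) m by auto
      qed
    qed
  qed
qed

section \<open>Cycle lengths and the rate functional\<close>

lemma (in prob_space) abs_expectation_le:
  fixes f :: "'a \<Rightarrow> real"
  assumes f: "f \<in> borel_measurable M" "\<And>x. \<bar>f x\<bar> \<le> B"
  shows "\<bar>expectation f\<bar> \<le> B"
proof -
  have "integrable M f" by (rule integrable_const_bound[of _ B]) (use f in auto)
  moreover have "f x \<le> B" "- B \<le> f x" for x using f(2)[of x] by linarith+
  ultimately have "expectation f \<le> B" "- B \<le> expectation f"
    by (auto intro!: integral_le_const integral_ge_const)
  then show ?thesis by linarith
qed

section \<open>Inverse lengths and points placed in a cycle\<close>

lemma recip_to_ext_pos: "recip (to_ext_pos x) = (if 0 < x then 1 / x else 0)"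
  by (auto simp: recip_def to_ext_pos_def Abs_ext_pos_inverse one_ereal_def infinity_ext_pos_def)

lemma recip_infinity [simp]: "recip \<infinity> = 0"
  by (simp add: recip_def Abs_ext_pos_inverse infinity_ext_pos_def)

lemma recip_nonneg [simp]: "0 \<le> recip p"
  using range_recip by auto

lemma tendsto_ext_pos_iff: "(f \<longlongrightarrow> p) F \<longleftrightarrow> ((\<lambda>x. recip (f x)) \<longlongrightarrow> recip p) F"
  by (simp add: tendsto_iff dist_ext_pos_def dist_real_def)

lemma tendsto_recip: "(f \<longlongrightarrow> p) F \<Longrightarrow> ((\<lambda>x. recip (f x)) \<longlongrightarrow> recip p) F"
  by (simp add: tendsto_ext_pos_iff)

lemma to_ext_pos_nonpos: "x \<le> 0 \<Longrightarrow> to_ext_pos x = \<infinity>"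
  by (simp add: to_ext_pos_def)

lemma measurable_to_ext_pos [measurable]: "to_ext_pos \<in> borel_measurable borel"
proof -
  have "continuous_on {0<..} to_ext_pos"
    unfolding continuous_on_def
  proof
    fix x :: real assume x: "x \<in> {0<..}"
    have "\<forall>\<^sub>F y in at x within {0<..}. recip (to_ext_pos y) = 1 / y"
      by (auto simp: eventually_at_filter recip_to_ext_pos)
    moreover have "((\<lambda>y. 1 / y) \<longlongrightarrow> 1 / x) (at x within {0<..})"
      using x by (auto intro!: tendsto_intros)
    ultimately show "(to_ext_pos \<longlongrightarrow> to_ext_pos x) (at x within {0<..})"
      using x by (auto simp: tendsto_ext_pos_iff recip_to_ext_pos tendsto_cong)
  qed
  then have "(\<lambda>x::real. if x \<in> {0<..} then to_ext_pos x else \<infinity>) \<in> borel_measurable borel"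
    by (intro borel_measurable_continuous_on_if) auto
  moreover have "(\<lambda>x::real. if x \<in> {0<..} then to_ext_pos x else \<infinity>) = to_ext_pos"
    by (auto simp: fun_eq_iff to_ext_pos_nonpos)
  ultimately show ?thesis by simp
qed

text \<open>The reciprocal \<open>1/(a + b)\<close> of the length of a cycle with coordinates \<open>(a, b)\<close>,
  which is \<open>0\<close> as soon as one of them is infinite.\<close>

definition inv_length :: "ext_pos \<times> ext_pos \<Rightarrow> real" where
  "inv_length z = recip (fst z) * recip (snd z) / (recip (fst z) + recip (snd z))"

text \<open>The cycle is given by its inverse length \<open>x\<close>, so that the infinite cycle is
  the parameter 0: there \<open>u / 0 = 0\<close> and \<open>to_ext_pos\<close> returns its default
  value \<open>\<infinity>\<close>. In this parametrization the point depends continuously on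
  \<open>x\<close>, for \<open>0 < u < 1\<close>.\<close>

definition cycle_point :: "real \<Rightarrow> real \<Rightarrow> ext_pos \<times> ext_pos" where
  "cycle_point u x = (to_ext_pos (u / x), to_ext_pos ((1 - u) / x))"

text \<open>The kernel from inverse lengths to points of the cycle, acting on test functions;
  \<open>cycle_law\<close> is the same kernel acting on measures.\<close>

definition cycle_avg :: "(ext_pos \<times> ext_pos \<Rightarrow> real) \<Rightarrow> real \<Rightarrow> real" where
  "cycle_avg f x = (\<integral>u. f (cycle_point u x) \<partial>uniform_measure lborel {0..1})"

lemma inv_length_nonneg [simp]: "0 \<le> inv_length z"
  by (simp add: inv_length_def)

lemma inv_length_le: "inv_length z \<le> recip (fst z)"
proof -
  have "recip (fst z) * recip (snd z) \<le> recip (fst z) * (recip (fst z) + recip (snd z))"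
    by (intro mult_left_mono) auto
  then show ?thesis unfolding inv_length_def
    by (cases "recip (fst z) + recip (snd z) = 0")
      (auto simp: divide_le_eq add_nonneg_eq_0_iff order_less_le)
qed

lemma tendsto_fst_ext: "(\<lambda>z. recip (fst z)) \<midarrow>w\<rightarrow> recip (fst w)" for w :: "ext_pos \<times> ext_pos"
  by (intro tendsto_recip tendsto_fst tendsto_ident_at)

lemma tendsto_snd_ext: "(\<lambda>z. recip (snd z)) \<midarrow>w\<rightarrow> recip (snd w)" for w :: "ext_pos \<times> ext_pos"
  by (intro tendsto_recip tendsto_snd tendsto_ident_at)

text \<open>The quotient degenerates only at \<open>(\<infinity>, \<infinity>)\<close>, where
  \<open>inv_length_le\<close> squeezes it to 0.\<close>

lemma isCont_inv_length: "isCont inv_length w"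
proof (cases "recip (fst w) + recip (snd w) = 0")
  case True
  then have w: "recip (fst w) = 0" "recip (snd w) = 0"
    by (auto simp: add_nonneg_eq_0_iff)
  have "(inv_length \<longlongrightarrow> 0) (at w)"
  proof (rule tendsto_sandwich[of "\<lambda>_. 0" _ _ "\<lambda>z. recip (fst z)"])
    show "((\<lambda>z. recip (fst z)) \<longlongrightarrow> 0) (at w)" using tendsto_fst_ext[of w] w by simp
  qed (auto simp: inv_length_le)
  then show ?thesis using w by (simp add: isCont_def inv_length_def)
next
  case False
  then show ?thesis
    unfolding isCont_def inv_length_def
    by (intro tendsto_intros tendsto_fst_ext tendsto_snd_ext)
qed

lemma continuous_inv_length: "continuous_on UNIV inv_length"
  by (simp add: continuous_on_eq_continuous_at isCont_inv_length)

lemma measurable_inv_length [measurable]: "inv_length \<in> borel_measurable borel"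
  by (intro borel_measurable_continuous_onI continuous_inv_length)

lemma recip_cycle_point:
  assumes "0 < u" "u < 1"
  shows "recip (fst (cycle_point u x)) = max 0 x / u" "recip (snd (cycle_point u x)) = max 0 x / (1 - u)"
  using assms by (auto simp: cycle_point_def recip_to_ext_pos zero_less_divide_iff)

lemma cycle_point_0 [simp]: "cycle_point u 0 = (\<infinity>, \<infinity>)"
  by (simp add: cycle_point_def to_ext_pos_nonpos)

lemma inv_length_cycle_point:
  assumes "0 < u" "u < 1" "0 \<le> x"
  shows "inv_length (cycle_point u x) = x"
proof (cases "x = 0")
  case False
  then have "x / u * (x / (1 - u)) / (x / u + x / (1 - u)) = x"
    using assms by (simp add: field_simps)
  then show ?thesis using assms by (simp add: inv_length_def recip_cycle_point)
qed (simp add: inv_length_def)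

lemma isCont_cycle_point:
  assumes "0 < u" "u < 1"
  shows "isCont (cycle_point u) x"
proof -
  have "((\<lambda>y. to_ext_pos (u / y)) \<longlongrightarrow> to_ext_pos (u / x)) (at x)"
    unfolding tendsto_ext_pos_iff
    using recip_cycle_point(1)[OF assms] assms
    by (simp add: cycle_point_def) (intro tendsto_intros, auto)
  moreover have "((\<lambda>y. to_ext_pos ((1 - u) / y)) \<longlongrightarrow> to_ext_pos ((1 - u) / x)) (at x)"
    unfolding tendsto_ext_pos_iff
    using recip_cycle_point(2)[OF assms] assms
    by (simp add: cycle_point_def) (intro tendsto_intros, auto)
  ultimately show ?thesis
    unfolding isCont_def cycle_point_def by (rule tendsto_Pair)
qed

lemma measurable_cycle_point [measurable]:
  "(\<lambda>(u, x). cycle_point u x) \<in> borel_measurable (borel \<Otimes>\<^sub>M borel)"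
  unfolding cycle_point_def borel_prod[symmetric] by measurable

lemma prob_space_unif01: "prob_space (uniform_measure lborel {0..1::real})"
  by (rule prob_space_uniform_measure) auto

lemma sets_unif01 [simp, measurable_cong]: "sets (uniform_measure lborel {0..1::real}) = sets borel"
  by simp

lemma AE_unif01: "AE u in uniform_measure lborel {0..1::real}. 0 < u \<and> u < 1"
proof (rule AE_uniform_measureI)
  show "{0..1::real} \<in> sets lborel" by simp
  have "AE u in lborel. u \<noteq> (0::real)" "AE u in lborel. u \<noteq> (1::real)"
    by (rule AE_lborel_singleton)+
  then show "AE u in lborel. u \<in> {0..1::real} \<longrightarrow> 0 < u \<and> u < 1" by eventually_elim auto
qed

text \<open>The Feller property of the kernel: it makes \<open>cycle_law\<close> continuous for the
  narrow topologies. For almost every \<open>u\<close> the point moves continuously with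
  \<open>x\<close>, and dominated convergence does the rest.\<close>

lemma cycle_avg_bcont:
  assumes f: "f \<in> bcont"
  shows "cycle_avg f \<in> bcont"
proof -
  interpret U: prob_space "uniform_measure lborel {0..1::real}" by (rule prob_space_unif01)
  obtain B where B: "B > 0" "\<And>x. \<bar>f x\<bar> \<le> B" using bcont_boundE[OF f] by blast
  have [measurable]: "f \<in> borel_measurable borel" using bcont_measurable f by blast
  show ?thesis
  proof (rule bcontI)
    show "continuous_on UNIV (cycle_avg f)"
      unfolding continuous_on_eq_continuous_at[OF open_UNIV]
    proof
      fix x :: real
      show "isCont (cycle_avg f) x"
        unfolding cycle_avg_def continuous_at_sequentially o_def
      proof (intro allI impI)
        fix X :: "nat \<Rightarrow> real" assume X: "X \<longlonglongrightarrow> x"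
        show "(\<lambda>n. \<integral>u. f (cycle_point u (X n)) \<partial>uniform_measure lborel {0..1})
          \<longlonglongrightarrow> (\<integral>u. f (cycle_point u x) \<partial>uniform_measure lborel {0..1})"
        proof (rule integral_dominated_convergence[where w="\<lambda>_. B"])
          show "AE u in uniform_measure lborel {0..1}. (\<lambda>n. f (cycle_point u (X n))) \<longlonglongrightarrow> f (cycle_point u x)"
            using AE_unif01
          proof eventually_elim
            case (elim u)
            then have "(\<lambda>n. cycle_point u (X n)) \<longlonglongrightarrow> cycle_point u x"
              using X isCont_cycle_point[of u x] by (intro isCont_tendsto_compose[where g="cycle_point u"]) auto
            then show ?case using bcont_isCont[OF f] by (intro isCont_tendsto_compose[where g=f]) auto
          qed
        qed (use B in auto)
      qed
    qed
    fix x
    show "\<bar>cycle_avg f x\<bar> \<le> B"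
      unfolding cycle_avg_def by (rule U.abs_expectation_le) (use B in auto)
  qed
qed

text \<open>A function of the length alone is constant along a cycle, up to the two end
  points.\<close>

lemma cycle_avg_inv_length:
  assumes "0 \<le> x" "g \<in> borel_measurable borel"
  shows "cycle_avg (\<lambda>z. g (inv_length z)) x = g x"
proof -
  interpret U: prob_space "uniform_measure lborel {0..1::real}" by (rule prob_space_unif01)
  have "cycle_avg (\<lambda>z. g (inv_length z)) x = (\<integral>u. g x \<partial>uniform_measure lborel {0..1::real})"
    unfolding cycle_avg_def
  proof (rule integral_cong_AE)
    show "AE u in uniform_measure lborel {0..1::real}. g (inv_length (cycle_point u x)) = g x"
      using AE_unif01 by eventually_elim (use assms in \<open>auto simp: inv_length_cycle_point\<close>)
  qed (use assms(2) in auto)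
  then show ?thesis by (simp add: U.prob_space)
qed

lemma cycle_avg_diff:
  assumes "f \<in> bcont" "g \<in> bcont"
  shows "cycle_avg (\<lambda>z. f z - g z) x = cycle_avg f x - cycle_avg g x"
proof -
  interpret U: prob_space "uniform_measure lborel {0..1::real}" by (rule prob_space_unif01)
  have [simp]: "integrable (uniform_measure lborel {0..1::real}) (\<lambda>u. f (cycle_point u x))"
    if f: "f \<in> bcont" for f
  proof -
    obtain B where B: "B > 0" "\<And>x. \<bar>f x\<bar> \<le> B" using bcont_boundE[OF f] by blast
    have [measurable]: "f \<in> borel_measurable borel" using bcont_measurable f by blast
    show ?thesis by (rule U.integrable_const_bound[of _ B]) (use B in auto)
  qed
  show ?thesis using assms by (simp add: cycle_avg_def)
qed

lemma cycle_avg_0 [simp]: "cycle_avg f 0 = f (\<infinity>, \<infinity>)"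
  using prob_space.prob_space[OF prob_space_unif01] by (simp add: cycle_avg_def)

text \<open>A single law \<open>q\<close> replaces the pair of \<open>\<alpha>\<close> and
  \<open>\<pi>\<close> in the description of \<open>Delta\<close>. The pair is discontinuous as
  \<open>\<alpha>\<close> tends to 0, whereas \<open>q\<close> converges together with its cycle
  law.\<close>

definition cycle_law :: "real measure \<Rightarrow> (ext_pos \<times> ext_pos) measure" where
  "cycle_law q = distr (uniform_measure lborel {0..1} \<Otimes>\<^sub>M q) borel (\<lambda>(u, x). cycle_point u x)"

lemma cycle_law_borel_probs:
  assumes q: "q \<in> borel_probs"
  shows "cycle_law q \<in> borel_probs"
proof -
  interpret q: prob_space q using q borel_probsD by blast
  interpret U: prob_space "uniform_measure lborel {0..1::real}" by (rule prob_space_unif01)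
  interpret P: pair_prob_space "uniform_measure lborel {0..1::real}" q ..
  have [measurable_cong]: "sets q = sets borel" using q borel_probsD by blast
  show ?thesis unfolding cycle_law_def borel_probs_def by (auto intro!: P.prob_space_distr)
qed

lemma nn_integral_cycle_law:
  assumes q: "q \<in> borel_probs" and f[measurable]: "f \<in> borel_measurable borel"
  shows "(\<integral>\<^sup>+z. f z \<partial>cycle_law q) = (\<integral>\<^sup>+x. \<integral>\<^sup>+u. f (cycle_point u x) \<partial>uniform_measure lborel {0..1} \<partial>q)"
proof -
  interpret q: prob_space q using q borel_probsD by blast
  interpret U: prob_space "uniform_measure lborel {0..1::real}" by (rule prob_space_unif01)
  interpret P: pair_prob_space "uniform_measure lborel {0..1::real}" q ..
  have [measurable_cong]: "sets q = sets borel" using q borel_probsD by blast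
  have "(\<integral>\<^sup>+z. f z \<partial>cycle_law q) = (\<integral>\<^sup>+(u, x). f (cycle_point u x) \<partial>(uniform_measure lborel {0..1} \<Otimes>\<^sub>M q))"
    unfolding cycle_law_def by (subst nn_integral_distr) (auto simp: case_prod_beta' intro!: nn_integral_cong)
  also have "\<dots> = (\<integral>\<^sup>+x. \<integral>\<^sup>+u. f (cycle_point u x) \<partial>uniform_measure lborel {0..1} \<partial>q)"
    by (subst P.nn_integral_snd[symmetric]) auto
  finally show ?thesis .
qed

lemma integral_cycle_law:
  assumes q: "q \<in> borel_probs" and f: "f \<in> bcont"
  shows "(\<integral>z. f z \<partial>cycle_law q) = (\<integral>x. cycle_avg f x \<partial>q)"
proof -
  interpret q: prob_space q using q borel_probsD by blast
  interpret U: prob_space "uniform_measure lborel {0..1::real}" by (rule prob_space_unif01)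
  interpret P: pair_prob_space "uniform_measure lborel {0..1::real}" q ..
  have [measurable_cong]: "sets q = sets borel" using q borel_probsD by blast
  have [measurable]: "f \<in> borel_measurable borel" using bcont_measurable f by blast
  obtain B where B: "B > 0" "\<And>x. \<bar>f x\<bar> \<le> B" using bcont_boundE[OF f] by blast
  have "(\<integral>z. f z \<partial>cycle_law q) = (\<integral>(u, x). f (cycle_point u x) \<partial>(uniform_measure lborel {0..1} \<Otimes>\<^sub>M q))"
    unfolding cycle_law_def by (subst integral_distr) (auto simp: case_prod_beta' intro!: Bochner_Integration.integral_cong)
  also have "\<dots> = (\<integral>x. cycle_avg f x \<partial>q)"
    unfolding cycle_avg_def
    by (subst P.integral_snd) (auto intro!: P.integrable_const_bound[of _ B] simp: B(2))
  finally show ?thesis .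
qed


section \<open>Splitting a law of inverse lengths into its atom at 0 and a law of cycle
  lengths\<close>

lemma space_convex_comb: "space (convex_comb \<alpha> \<mu> \<nu>) = space \<mu>"
  by (simp add: convex_comb_def space_measure_of sets.space_closed)

lemma sets_convex_comb [simp]: "sets (convex_comb \<alpha> \<mu> \<nu>) = sets \<mu>"
  by (simp add: convex_comb_def)

lemma nn_integral_convex_comb:
  assumes sets: "sets \<nu> = sets \<mu>" and f: "f \<in> borel_measurable \<mu>"
  shows "(\<integral>\<^sup>+x. f x \<partial>convex_comb \<alpha> \<mu> \<nu>) = ennreal \<alpha> * (\<integral>\<^sup>+x. f x \<partial>\<mu>) + ennreal (1 - \<alpha>) * (\<integral>\<^sup>+x. f x \<partial>\<nu>)"
  using f
proof (induction f rule: borel_measurable_induct)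
  case (cong f g)
  moreover have sp: "space \<nu> = space \<mu>" using sets by (rule sets_eq_imp_space_eq)
  moreover have "integral\<^sup>N (convex_comb \<alpha> \<mu> \<nu>) f = integral\<^sup>N (convex_comb \<alpha> \<mu> \<nu>) g"
    "integral\<^sup>N \<mu> f = integral\<^sup>N \<mu> g" "integral\<^sup>N \<nu> f = integral\<^sup>N \<nu> g"
    using cong(3) sp by (auto intro!: nn_integral_cong simp: space_convex_comb)
  ultimately show ?case by simp
next
  case (set A)
  then show ?case using sets by (simp add: emeasure_convex_comb)
next
  case (mult u c)
  note [measurable_cong] = sets
  note [measurable] = mult(2)
  from mult show ?case
    by (simp add: nn_integral_cmult distrib_left mult_ac measurable_cong_sets[OF sets_convex_comb refl] measurable_cong_sets[OF sets refl])
next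
  case (add u v)
  then show ?case
    by (simp add: nn_integral_add distrib_left add_ac measurable_cong_sets[OF sets_convex_comb refl] measurable_cong_sets[OF sets refl])
next
  case (seq U)
  have m: "U i \<in> borel_measurable \<nu>" "U i \<in> borel_measurable (convex_comb \<alpha> \<mu> \<nu>)" for i
    using seq(1)[of i] by (simp_all add: measurable_cong_sets[OF sets_convex_comb refl] measurable_cong_sets[OF sets refl])
  have inc: "incseq (\<lambda>i. integral\<^sup>N N (U i))" for N
    using seq(3) by (auto simp: incseq_def le_fun_def intro!: nn_integral_mono)
  have "(\<integral>\<^sup>+x. (SUP i. U i) x \<partial>convex_comb \<alpha> \<mu> \<nu>) = (SUP i. ennreal \<alpha> * (\<integral>\<^sup>+x. U i x \<partial>\<mu>) + ennreal (1 - \<alpha>) * (\<integral>\<^sup>+x. U i x \<partial>\<nu>))"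
    using m seq by (simp add: nn_integral_monotone_convergence_SUP image_comp)
  also have "\<dots> = (SUP i. ennreal \<alpha> * (\<integral>\<^sup>+x. U i x \<partial>\<mu>)) + (SUP i. ennreal (1 - \<alpha>) * (\<integral>\<^sup>+x. U i x \<partial>\<nu>))"
    using inc by (intro ennreal_SUP_add) (auto simp: incseq_def intro!: mult_left_mono)
  also have "\<dots> = ennreal \<alpha> * (\<integral>\<^sup>+x. (SUP i. U i) x \<partial>\<mu>) + ennreal (1 - \<alpha>) * (\<integral>\<^sup>+x. (SUP i. U i) x \<partial>\<nu>)"
    using m seq by (simp add: nn_integral_monotone_convergence_SUP SUP_mult_left_ennreal image_comp)
  finally show ?case .
qed

lemma convex_comb_borel_probs:
  assumes "\<mu> \<in> borel_probs" "\<nu> \<in> borel_probs" "\<alpha> \<in> {0..1}"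
  shows "convex_comb \<alpha> \<mu> \<nu> \<in> borel_probs"
proof -
  interpret \<mu>: prob_space \<mu> using assms borel_probsD by blast
  interpret \<nu>: prob_space \<nu> using assms borel_probsD by blast
  have s: "sets \<mu> = sets borel" "sets \<nu> = sets borel" "space \<mu> = UNIV" "space \<nu> = UNIV"
    using borel_probsD assms by blast+
  have "emeasure (convex_comb \<alpha> \<mu> \<nu>) (space (convex_comb \<alpha> \<mu> \<nu>)) = ennreal \<alpha> + ennreal (1 - \<alpha>)"
    using s \<mu>.emeasure_space_1 \<nu>.emeasure_space_1 sets.top[of \<mu>]
    by (subst emeasure_convex_comb) (auto simp: space_convex_comb)
  also have "\<dots> = 1" using assms(3) by (simp flip: ennreal_plus)
  finally show ?thesis using s by (auto simp: borel_probs_def intro: prob_spaceI)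
qed

lemma return_borel_probs [simp]: "return borel x \<in> borel_probs"
  by (simp add: borel_probs_def prob_space_return)

text \<open>A law on \<open>[0,\<infinity>[\<close> with finite mean describes the inverse cycle lengths seen by a uniformly
  chosen point; the atom at \<open>0\<close> is the weight of the infinite cycle.\<close>

definition length_decomp :: "real measure \<Rightarrow> real \<Rightarrow> real measure \<Rightarrow> bool" where
  "length_decomp q \<alpha> \<pi> \<longleftrightarrow> (\<forall>g :: real \<Rightarrow> ennreal. g \<in> borel_measurable borel \<longrightarrow>
     (\<integral>\<^sup>+x. g x \<partial>q) = ennreal \<alpha> * (\<integral>\<^sup>+\<tau>. g (1 / \<tau>) \<partial>\<pi>) + ennreal (1 - \<alpha>) * g 0)"

lemma pos_probsD:
  assumes "\<pi> \<in> pos_probs"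
  shows "\<pi> \<in> borel_probs" "AE x in \<pi>. 0 < x"
  using assms by (auto simp: pos_probs_def)

lemma length_decompD:
  assumes "length_decomp q \<alpha> \<pi>" "g \<in> borel_measurable borel"
  shows "(\<integral>\<^sup>+x. g x \<partial>q) = ennreal \<alpha> * (\<integral>\<^sup>+\<tau>. g (1 / \<tau>) \<partial>\<pi>) + ennreal (1 - \<alpha>) * g 0"
  using assms unfolding length_decomp_def by blast

lemma emeasure_cycle_measure:
  assumes \<pi>: "\<pi> \<in> pos_probs" and A[measurable]: "A \<in> sets borel"
  shows "emeasure (cycle_measure \<pi>) A =
    (\<integral>\<^sup>+\<tau>. \<integral>\<^sup>+u. indicator A (cycle_point u (1 / \<tau>)) \<partial>uniform_measure lborel {0..1} \<partial>\<pi>)"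
proof -
  have \<pi>': "\<pi> \<in> borel_probs" using \<pi> by (rule pos_probsD)
  interpret \<pi>: prob_space \<pi> using \<pi>' borel_probsD by blast
  interpret U: prob_space "uniform_measure lborel {0..1::real}" by (rule prob_space_unif01)
  interpret P: pair_prob_space "uniform_measure lborel {0..1::real}" \<pi> ..
  have s[measurable_cong]: "sets \<pi> = sets borel" using \<pi>' borel_probsD by blast
  have eq: "(\<lambda>(u, \<tau>). (to_ext_pos (u * \<tau>), to_ext_pos ((1 - u) * \<tau>))) = (\<lambda>(u, \<tau>). cycle_point u (1 / \<tau>))"
    by (simp add: cycle_point_def fun_eq_iff)
  have m[measurable]: "(\<lambda>(u, \<tau>). cycle_point u (1 / \<tau>)) \<in> borel_measurable (borel \<Otimes>\<^sub>M borel)"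
    using measurable_compose[of "\<lambda>(u, \<tau>). (u, 1 / \<tau>)" "borel \<Otimes>\<^sub>M borel" "borel \<Otimes>\<^sub>M borel", OF _ measurable_cycle_point]
    by (simp add: case_prod_beta')
  have "emeasure (cycle_measure \<pi>) A = (\<integral>\<^sup>+z. indicator A z \<partial>cycle_measure \<pi>)"
    by (simp add: cycle_measure_def)
  also have "\<dots> = (\<integral>\<^sup>+(u, x). indicator A (cycle_point u (1 / x)) \<partial>(uniform_measure lborel {0..1} \<Otimes>\<^sub>M \<pi>))"
    unfolding cycle_measure_def eq by (subst nn_integral_distr) (auto simp: case_prod_beta' intro!: nn_integral_cong)
  also have "\<dots> = (\<integral>\<^sup>+x. \<integral>\<^sup>+u. indicator A (cycle_point u (1 / x)) \<partial>uniform_measure lborel {0..1} \<partial>\<pi>)"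
    by (subst P.nn_integral_snd[symmetric]) auto
  finally show ?thesis .
qed

text \<open>\<open>length_decomp\<close> is applied to the function that sends an inverse length to
  the chance that a uniform point of that cycle falls into \<open>A\<close>; its value at 0 is the
  Dirac mass at \<open>(\<infinity>, \<infinity>)\<close>.\<close>

lemma cycle_law_eq_convex_comb:
  assumes q: "q \<in> borel_probs" and \<pi>: "\<pi> \<in> pos_probs" and d: "length_decomp q \<alpha> \<pi>"
  shows "cycle_law q = convex_comb \<alpha> (cycle_measure \<pi>) (return borel (\<infinity>, \<infinity>))"
proof (rule measure_eqI)
  show "sets (cycle_law q) = sets (convex_comb \<alpha> (cycle_measure \<pi>) (return borel (\<infinity>, \<infinity>)))"
    by (simp add: cycle_law_def cycle_measure_def)
  interpret U: prob_space "uniform_measure lborel {0..1::real}" by (rule prob_space_unif01)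
  fix A assume "A \<in> sets (cycle_law q)"
  then have A[measurable]: "A \<in> sets borel" by (simp add: cycle_law_def)
  have "emeasure (cycle_law q) A = (\<integral>\<^sup>+z. indicator A z \<partial>cycle_law q)"
    by (simp add: cycle_law_def)
  also have "\<dots> = (\<integral>\<^sup>+x. \<integral>\<^sup>+u. indicator A (cycle_point u x) \<partial>uniform_measure lborel {0..1} \<partial>q)"
    using q by (intro nn_integral_cycle_law) auto
  also have "\<dots> = ennreal \<alpha> * emeasure (cycle_measure \<pi>) A
     + ennreal (1 - \<alpha>) * (\<integral>\<^sup>+u. indicator A (cycle_point u 0) \<partial>uniform_measure lborel {0..1})"
    unfolding emeasure_cycle_measure[OF \<pi> A] by (rule length_decompD[OF d]) measurable
  also have "(\<integral>\<^sup>+u. indicator A (cycle_point u 0) \<partial>uniform_measure lborel {0..1::real}) = emeasure (return borel (\<infinity>, \<infinity>)) A"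
    using U.emeasure_space_1 by (simp split: split_indicator)
  also have "ennreal \<alpha> * emeasure (cycle_measure \<pi>) A + ennreal (1 - \<alpha>) * emeasure (return borel (\<infinity>, \<infinity>)) A =
      emeasure (convex_comb \<alpha> (cycle_measure \<pi>) (return borel (\<infinity>, \<infinity>))) A"
    using A by (subst emeasure_convex_comb) (auto simp: cycle_measure_def)
  finally show "emeasure (cycle_law q) A = emeasure (convex_comb \<alpha> (cycle_measure \<pi>) (return borel (\<infinity>, \<infinity>))) A" .
qed

text \<open>The law is explicit: the law of \<open>1 / \<tau>\<close> under \<open>\<pi>\<close>
  with weight \<open>\<alpha>\<close>, mixed with the Dirac mass at 0.\<close>

lemma length_decomp_exists_law:
  assumes \<pi>: "\<pi> \<in> pos_probs" and \<alpha>: "\<alpha> \<in> {0..1}"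
  shows "\<exists>q\<in>borel_probs. (AE x in q. 0 \<le> x) \<and> length_decomp q \<alpha> \<pi>"
proof -
  have \<pi>': "\<pi> \<in> borel_probs" using \<pi> by (rule pos_probsD)
  interpret \<pi>: prob_space \<pi> using \<pi>' borel_probsD by blast
  have s[measurable_cong]: "sets \<pi> = sets borel" using \<pi>' borel_probsD by blast
  define p where "p = distr \<pi> borel (\<lambda>\<tau>. 1 / \<tau>)"
  have p: "p \<in> borel_probs" unfolding p_def borel_probs_def by (auto intro!: \<pi>.prob_space_distr)
  define q where "q = convex_comb \<alpha> p (return borel 0)"
  have q: "q \<in> borel_probs" unfolding q_def using p \<alpha> by (intro convex_comb_borel_probs) auto
  have d: "length_decomp q \<alpha> \<pi>"
    unfolding length_decomp_def
  proof (intro allI impI)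
    fix g :: "real \<Rightarrow> ennreal" assume g[measurable]: "g \<in> borel_measurable borel"
    have "(\<integral>\<^sup>+x. g x \<partial>q) = ennreal \<alpha> * (\<integral>\<^sup>+x. g x \<partial>p) + ennreal (1 - \<alpha>) * g 0"
      unfolding q_def by (subst nn_integral_convex_comb) (auto simp: p_def nn_integral_return)
    then show "(\<integral>\<^sup>+x. g x \<partial>q) = ennreal \<alpha> * (\<integral>\<^sup>+\<tau>. g (1 / \<tau>) \<partial>\<pi>) + ennreal (1 - \<alpha>) * g 0"
      by (simp add: p_def nn_integral_distr)
  qed
  have "(\<integral>\<^sup>+x. indicator {..<0} x \<partial>q) = ennreal \<alpha> * (\<integral>\<^sup>+\<tau>. indicator {..<0} (1 / \<tau>) \<partial>\<pi>) + ennreal (1 - \<alpha>) * indicator {..<0} (0::real)"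
    by (rule length_decompD[OF d]) auto
  also have "(\<integral>\<^sup>+\<tau>. indicator {..<0} (1 / \<tau>) \<partial>\<pi>) = (\<integral>\<^sup>+\<tau>. 0 \<partial>\<pi>)"
    using pos_probsD(2)[OF \<pi>] by (intro nn_integral_cong_AE) (auto elim!: eventually_mono)
  finally have "emeasure q {..<0} = 0" using q borel_probsD(2)[OF q] by simp
  then have "AE x in q. 0 \<le> x"
    using borel_probsD[OF q] by (subst AE_iff_measurable[of "{..<0}"]) auto
  then show ?thesis using q d by blast
qed

text \<open>Conversely \<open>\<alpha>\<close> is the mass of \<open>{0<..}\<close> and
  \<open>\<pi>\<close> is the image under inversion of \<open>q\<close> conditioned on that set.
  Finiteness of the mean of \<open>q\<close> becomes finiteness of
  \<open>mean_recip \<pi>\<close>.\<close>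

lemma length_decomp_exists:
  assumes q: "q \<in> borel_probs" and nn: "AE x in q. 0 \<le> x" and fin: "(\<integral>\<^sup>+x. ennreal x \<partial>q) < \<infinity>"
  shows "\<exists>\<alpha> \<pi>. \<alpha> \<in> {0..1} \<and> \<pi> \<in> pos_probs \<and> mean_recip \<pi> < \<infinity> \<and> length_decomp q \<alpha> \<pi>"
proof -
  interpret q: prob_space q using q borel_probsD by blast
  have s[measurable_cong]: "sets q = sets borel" using q borel_probsD by blast
  have sp: "space q = UNIV" using q borel_probsD by blast
  define \<alpha> where "\<alpha> = measure q {0<..}"
  have \<alpha>: "\<alpha> \<in> {0..1}" by (auto simp: \<alpha>_def)
  have e\<alpha>: "emeasure q {0<..} = ennreal \<alpha>" by (simp add: \<alpha>_def q.emeasure_eq_measure)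
  have split: "(\<integral>\<^sup>+x. g x \<partial>q) = (\<integral>\<^sup>+x. g x * indicator {0<..} x \<partial>q) + ennreal (1 - \<alpha>) * g 0"
    if g[measurable]: "g \<in> borel_measurable borel" for g :: "real \<Rightarrow> ennreal"
  proof -
    have "(\<integral>\<^sup>+x. g x \<partial>q) = (\<integral>\<^sup>+x. g x * indicator {0<..} x + g 0 * indicator (UNIV - {0<..}) x \<partial>q)"
      using nn by (intro nn_integral_cong_AE) (auto elim!: eventually_mono split: split_indicator)
    also have "\<dots> = (\<integral>\<^sup>+x. g x * indicator {0<..} x \<partial>q) + g 0 * emeasure q (UNIV - {0<..})"
      by (subst nn_integral_add) (auto simp: nn_integral_cmult)
    also have "emeasure q (UNIV - {0<..}) = ennreal (1 - \<alpha>)"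
      using q.prob_compl[of "{0<..}"] by (simp add: q.emeasure_eq_measure \<alpha>_def sp)
    finally show ?thesis by (simp add: mult.commute)
  qed
  show ?thesis
  proof (cases "\<alpha> = 0")
    case True
    have zero: "(\<integral>\<^sup>+x. g x * indicator {0<..} x \<partial>q) = 0" if g[measurable]: "g \<in> borel_measurable borel" for g :: "real \<Rightarrow> ennreal"
    proof -
      have "AE x in q. x \<notin> {0<..}" using e\<alpha> True by (intro AE_not_in) (auto simp: null_sets_def)
      then have "(\<integral>\<^sup>+x. g x * indicator {0<..} x \<partial>q) = (\<integral>\<^sup>+x. 0 \<partial>q)"
        by (intro nn_integral_cong_AE) (auto elim!: eventually_mono)
      then show ?thesis by simp
    qed
    \<comment> \<open>With \<open>\<alpha> = 0\<close> the law \<open>\<pi>\<close> has no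
      influence; the Dirac mass at 1 is a choice with finite \<open>mean_recip\<close>.\<close>
    have "length_decomp q 0 (return borel 1)"
      unfolding length_decomp_def
    proof (intro allI impI)
      fix g :: "real \<Rightarrow> ennreal" assume g: "g \<in> borel_measurable borel"
      show "(\<integral>\<^sup>+x. g x \<partial>q) = ennreal 0 * (\<integral>\<^sup>+\<tau>. g (1 / \<tau>) \<partial>return borel 1) + ennreal (1 - 0) * g 0"
        unfolding split[OF g] zero[OF g] True by simp
    qed
    moreover have "return borel (1::real) \<in> pos_probs" by (simp add: pos_probs_def AE_return)
    moreover have "mean_recip (return borel 1) < \<infinity>" by (simp add: mean_recip_def nn_integral_return)
    ultimately show ?thesis by (intro exI[of _ 0] exI[of _ "return borel 1"]) auto
  next
    case False
    then have pos: "0 < \<alpha>" using \<alpha> by auto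
    interpret c: prob_space "uniform_measure q {0<..}"
      using pos e\<alpha> by (intro prob_space_uniform_measure) auto
    define \<pi> where "\<pi> = distr (uniform_measure q {0<..}) borel (\<lambda>x. 1 / x)"
    have int\<pi>: "ennreal \<alpha> * (\<integral>\<^sup>+\<tau>. g (1 / \<tau>) \<partial>\<pi>) = (\<integral>\<^sup>+x. g x * indicator {0<..} x \<partial>q)"
      if g[measurable]: "g \<in> borel_measurable borel" for g :: "real \<Rightarrow> ennreal"
    proof -
      have "(\<integral>\<^sup>+\<tau>. g (1 / \<tau>) \<partial>\<pi>) = (\<integral>\<^sup>+x. g x \<partial>uniform_measure q {0<..})"
        by (simp add: \<pi>_def nn_integral_distr)
      also have "\<dots> = (\<integral>\<^sup>+x. g x * indicator {0<..} x \<partial>q) / ennreal \<alpha>"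
        by (subst nn_integral_uniform_measure) (auto simp: e\<alpha>)
      finally show ?thesis using pos
        by (simp add: ennreal_times_divide) (subst mult.commute, subst ennreal_mult_divide_eq, auto)
    qed
    have d: "length_decomp q \<alpha> \<pi>" unfolding length_decomp_def by (intro allI impI) (simp only: split int\<pi>)
    have "AE x in uniform_measure q {0<..}. 0 < 1 / x"
      by (rule AE_uniform_measureI) auto
    then have "AE x in distr (uniform_measure q {0<..}) borel (\<lambda>x. 1 / x). 0 < x"
      by (subst AE_distr_iff) auto
    then have \<pi>: "\<pi> \<in> pos_probs"
      by (auto simp: pos_probs_def borel_probs_def \<pi>_def intro!: c.prob_space_distr)
    have "ennreal \<alpha> * mean_recip \<pi> \<le> (\<integral>\<^sup>+x. ennreal x \<partial>q)"
      unfolding mean_recip_def using length_decompD[OF d, of ennreal] by simp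
    then have "ennreal \<alpha> * mean_recip \<pi> < \<infinity>" using fin by (rule le_less_trans)
    then have "mean_recip \<pi> < \<infinity>" using pos by (auto simp: ennreal_mult_less_top)
    then show ?thesis using \<alpha> \<pi> d by blast
  qed
qed

lemma length_decomp_mean:
  "length_decomp q \<alpha> \<pi> \<Longrightarrow> (\<integral>\<^sup>+x. ennreal x \<partial>q) = ennreal \<alpha> * mean_recip \<pi>"
  unfolding mean_recip_def using length_decompD[of q \<alpha> \<pi> ennreal] by simp

text \<open>Adding the bound \<open>B\<close> makes \<open>g\<close> nonnegative, so that the
  identity between nonnegative integrals applies.\<close>

lemma length_decomp_integral:
  fixes g :: "real \<Rightarrow> real"
  assumes d: "length_decomp q \<alpha> \<pi>" and q: "q \<in> borel_probs" and \<pi>: "\<pi> \<in> borel_probs" and \<alpha>: "\<alpha> \<in> {0..1}"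
    and g[measurable]: "g \<in> borel_measurable borel" and B: "\<And>x. \<bar>g x\<bar> \<le> B"
  shows "(\<integral>x. g x \<partial>q) = \<alpha> * (\<integral>\<tau>. g (1 / \<tau>) \<partial>\<pi>) + (1 - \<alpha>) * g 0"
proof -
  interpret q: prob_space q using q borel_probsD by blast
  interpret \<pi>: prob_space \<pi> using \<pi> borel_probsD by blast
  have [measurable_cong]: "sets q = sets borel" "sets \<pi> = sets borel" using q \<pi> borel_probsD by blast+
  have nn: "0 \<le> g x + B" for x using B[of x] by linarith
  have iq: "integrable q g" by (rule q.integrable_const_bound[of _ B]) (use B in auto)
  have ip: "integrable \<pi> (\<lambda>\<tau>. g (1 / \<tau>))" by (rule \<pi>.integrable_const_bound[of _ B]) (use B in auto)
  have "ennreal (\<integral>x. g x + B \<partial>q) = (\<integral>\<^sup>+x. ennreal (g x + B) \<partial>q)"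
    using iq nn by (intro nn_integral_eq_integral[symmetric]) auto
  also have "\<dots> = ennreal \<alpha> * (\<integral>\<^sup>+\<tau>. ennreal (g (1 / \<tau>) + B) \<partial>\<pi>) + ennreal (1 - \<alpha>) * ennreal (g 0 + B)"
    by (rule length_decompD[OF d]) auto
  also have "(\<integral>\<^sup>+\<tau>. ennreal (g (1 / \<tau>) + B) \<partial>\<pi>) = ennreal (\<integral>\<tau>. g (1 / \<tau>) + B \<partial>\<pi>)"
    using ip nn by (intro nn_integral_eq_integral) auto
  also have "ennreal \<alpha> * ennreal (\<integral>\<tau>. g (1 / \<tau>) + B \<partial>\<pi>) + ennreal (1 - \<alpha>) * ennreal (g 0 + B)
     = ennreal (\<alpha> * (\<integral>\<tau>. g (1 / \<tau>) + B \<partial>\<pi>) + (1 - \<alpha>) * (g 0 + B))"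
    using \<alpha> nn by (simp add: ennreal_mult ennreal_plus integral_nonneg)
  finally have "(\<integral>x. g x + B \<partial>q) = \<alpha> * (\<integral>\<tau>. g (1 / \<tau>) + B \<partial>\<pi>) + (1 - \<alpha>) * (g 0 + B)"
    using \<alpha> nn by (subst (asm) ennreal_inj) (auto intro!: integral_nonneg add_nonneg_nonneg mult_nonneg_nonneg)
  then show ?thesis using iq ip by (simp add: q.prob_space \<pi>.prob_space algebra_simps)
qed


text \<open>\<open>inv_length\<close> undoes the uniform placement almost surely, so
  \<open>\<pi>\<close> can be read off from \<open>cycle_measure \<pi>\<close>. The condition
  \<open>0 < inv_length z\<close> discards the infinite cycle, for which \<open>1 / 0 = 0\<close>
  could otherwise belong to \<open>B\<close>.\<close>

lemma emeasure_cycle_measure_length: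
  assumes \<pi>: "\<pi> \<in> pos_probs" and B: "B \<in> sets borel"
  shows "emeasure (cycle_measure \<pi>) {z. 0 < inv_length z \<and> 1 / inv_length z \<in> B} = emeasure \<pi> B"
proof -
  have \<pi>': "\<pi> \<in> borel_probs" using \<pi> by (rule pos_probsD)
  interpret U: prob_space "uniform_measure lborel {0..1::real}" by (rule prob_space_unif01)
  have s[measurable_cong]: "sets \<pi> = sets borel" using \<pi>' borel_probsD by blast
  note [measurable] = B
  let ?A = "{z. 0 < inv_length z \<and> 1 / inv_length z \<in> B}"
  have A: "?A \<in> sets borel" by measurable
  have "emeasure (cycle_measure \<pi>) ?A =
    (\<integral>\<^sup>+\<tau>. \<integral>\<^sup>+u. indicator ?A (cycle_point u (1 / \<tau>)) \<partial>uniform_measure lborel {0..1} \<partial>\<pi>)"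
    by (rule emeasure_cycle_measure[OF \<pi> A])
  also have "\<dots> = (\<integral>\<^sup>+\<tau>. \<integral>\<^sup>+u. indicator B \<tau> \<partial>uniform_measure lborel {0..1::real} \<partial>\<pi>)"
  proof (rule nn_integral_cong_AE)
    show "AE \<tau> in \<pi>. (\<integral>\<^sup>+u. indicator ?A (cycle_point u (1 / \<tau>)) \<partial>uniform_measure lborel {0..1}) =
       (\<integral>\<^sup>+u. indicator B \<tau> \<partial>uniform_measure lborel {0..1::real})"
      using pos_probsD(2)[OF \<pi>]
    proof eventually_elim
      case (elim \<tau>)
      show ?case
      proof (rule nn_integral_cong_AE)
        show "AE u in uniform_measure lborel {0..1}. indicator ?A (cycle_point u (1 / \<tau>)) = (indicator B \<tau> :: ennreal)"
          using AE_unif01 by eventually_elim (use elim in \<open>auto simp: inv_length_cycle_point split: split_indicator\<close>)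
      qed
    qed
  qed
  also have "\<dots> = (\<integral>\<^sup>+\<tau>. indicator B \<tau> \<partial>\<pi>)" using U.emeasure_space_1 by simp
  also have "\<dots> = emeasure \<pi> B" using B s by simp
  finally show ?thesis .
qed

lemma emeasure_convex_comb_length:
  assumes \<pi>: "\<pi> \<in> pos_probs" and B: "B \<in> sets borel"
  shows "emeasure (convex_comb \<alpha> (cycle_measure \<pi>) (return borel (\<infinity>, \<infinity>)))
     {z. 0 < inv_length z \<and> 1 / inv_length z \<in> B} = ennreal \<alpha> * emeasure \<pi> B"
proof -
  note [measurable] = B
  have A: "{z. 0 < inv_length z \<and> 1 / inv_length z \<in> B} \<in> sets borel" by measurable
  have "inv_length (\<infinity>, \<infinity>) = 0" by (simp add: inv_length_def)
  then show ?thesis using A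
    by (subst emeasure_convex_comb)
      (auto simp: cycle_measure_def emeasure_cycle_measure_length[OF \<pi> B, unfolded cycle_measure_def])
qed

text \<open>The length law seen by the measure determines \<open>\<alpha>\<close> as its total mass
  and, unless \<open>\<alpha> = 0\<close>, also \<open>\<pi>\<close>; so the definite description is
  legitimate. For \<open>\<alpha> = 0\<close> two choices of \<open>\<pi>\<close> give the same
  value because the entropy, even if infinite, is multiplied by 0.\<close>

lemma rate_convex_comb:
  assumes \<pi>: "\<pi> \<in> pos_probs" "mean_recip \<pi> < \<infinity>" and \<alpha>: "\<alpha> \<in> {0..1}"
  shows "rate \<psi> (convex_comb \<alpha> (cycle_measure \<pi>) (return borel (\<infinity>, \<infinity>))) =
    ereal \<alpha> * enn2ereal (mean_recip \<pi>) * rel_entropy (tilted \<pi>) \<psi> + ereal (1 - \<alpha>) * exp_abscissa \<psi>"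
proof -
  let ?\<mu> = "\<lambda>\<alpha> \<pi>. convex_comb \<alpha> (cycle_measure \<pi>) (return borel (\<infinity>, \<infinity>))"
  have D: "?\<mu> \<alpha> \<pi> \<in> Delta" using \<pi> \<alpha> unfolding Delta_def Delta0_def by blast
  have uniq: "\<alpha>' = \<alpha> \<and> (\<alpha> = 0 \<or> \<pi>' = \<pi>)"
    if \<pi>': "\<pi>' \<in> pos_probs" "\<alpha>' \<in> {0..1}" "?\<mu> \<alpha> \<pi> = ?\<mu> \<alpha>' \<pi>'" for \<alpha>' \<pi>'
  proof -
    interpret \<pi>: prob_space \<pi> using \<pi> pos_probsD borel_probsD by blast
    interpret \<pi>': prob_space \<pi>' using \<pi>' pos_probsD borel_probsD by blast
    have sp: "space \<pi> = UNIV" "space \<pi>' = UNIV" "sets \<pi> = sets borel" "sets \<pi>' = sets borel"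
      using \<pi> \<pi>' pos_probsD borel_probsD by blast+
    have eq: "ennreal \<alpha> * emeasure \<pi> B = ennreal \<alpha>' * emeasure \<pi>' B" if B: "B \<in> sets borel" for B
      using emeasure_convex_comb_length[OF \<pi>(1) B, of \<alpha>] emeasure_convex_comb_length[OF \<pi>'(1) B, of \<alpha>'] \<pi>'(3) by simp
    have \<alpha>': "\<alpha>' = \<alpha>"
      using eq[of UNIV] \<pi>.emeasure_space_1 \<pi>'.emeasure_space_1 \<alpha> \<pi>'(2) by (simp add: sp)
    show ?thesis
    proof (cases "\<alpha> = 0")
      case False
      have "\<pi>' = \<pi>"
      proof (rule measure_eqI)
        fix B assume "B \<in> sets \<pi>'"
        then show "emeasure \<pi>' B = emeasure \<pi> B"
          using eq[of B] False \<alpha> sp unfolding \<alpha>' by (auto simp: ennreal_mult_cancel_left)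
      qed (simp add: sp)
      then show ?thesis using \<alpha>' by simp
    qed (use \<alpha>' in simp)
  qed
  have "(THE v. \<exists>\<alpha>' \<pi>'. \<alpha>' \<in> {0..1} \<and> \<pi>' \<in> pos_probs \<and> mean_recip \<pi>' < \<infinity> \<and>
            ?\<mu> \<alpha> \<pi> = ?\<mu> \<alpha>' \<pi>' \<and>
            v = ereal \<alpha>' * enn2ereal (mean_recip \<pi>') * rel_entropy (tilted \<pi>') \<psi>
                + ereal (1 - \<alpha>') * exp_abscissa \<psi>) =
     ereal \<alpha> * enn2ereal (mean_recip \<pi>) * rel_entropy (tilted \<pi>) \<psi> + ereal (1 - \<alpha>) * exp_abscissa \<psi>"
  proof (rule the_equality)
    fix v assume "\<exists>\<alpha>' \<pi>'. \<alpha>' \<in> {0..1} \<and> \<pi>' \<in> pos_probs \<and> mean_recip \<pi>' < \<infinity> \<and>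
            ?\<mu> \<alpha> \<pi> = ?\<mu> \<alpha>' \<pi>' \<and>
            v = ereal \<alpha>' * enn2ereal (mean_recip \<pi>') * rel_entropy (tilted \<pi>') \<psi>
                + ereal (1 - \<alpha>') * exp_abscissa \<psi>"
    then obtain \<alpha>' \<pi>' where v: "\<alpha>' \<in> {0..1}" "\<pi>' \<in> pos_probs" "?\<mu> \<alpha> \<pi> = ?\<mu> \<alpha>' \<pi>'"
      "v = ereal \<alpha>' * enn2ereal (mean_recip \<pi>') * rel_entropy (tilted \<pi>') \<psi> + ereal (1 - \<alpha>') * exp_abscissa \<psi>"
      by blast
    have "\<alpha>' = \<alpha>" "\<alpha> = 0 \<or> \<pi>' = \<pi>" using uniq[OF v(2,1,3)] by auto
    then show "v = ereal \<alpha> * enn2ereal (mean_recip \<pi>) * rel_entropy (tilted \<pi>) \<psi> + ereal (1 - \<alpha>) * exp_abscissa \<psi>"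
      using v(4) by (auto simp flip: zero_ereal_def)
  qed (use \<pi> \<alpha> in blast)
  then show ?thesis using D unfolding rate_def by simp
qed

section \<open>Compactness of the cycle laws with bounded mean inverse length\<close>

definition short_recip_set :: "real \<Rightarrow> (ext_pos \<times> ext_pos) measure set" where
  "short_recip_set K = {cycle_law q | q. q \<in> borel_probs \<and> (AE x in q. 0 \<le> x) \<and> (\<integral>\<^sup>+x. ennreal x \<partial>q) \<le> ennreal K}"

lemma short_recip_set_subset: "short_recip_set K \<subseteq> borel_probs"
  unfolding short_recip_set_def using cycle_law_borel_probs by blast

lemma real_distribution_borel_probs: "q \<in> borel_probs \<longleftrightarrow> real_distribution q"
  using borel_probsD(3)[of q]
  by (auto simp: borel_probs_def real_distribution_def real_distribution_axioms_def)

lemma tight_bounded_mean: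
  assumes q: "\<And>n. q n \<in> borel_probs" "\<And>n. AE x in q n. 0 \<le> x" "\<And>n. (\<integral>\<^sup>+x. ennreal x \<partial>q n) \<le> ennreal K"
  shows "tight q"
  unfolding tight_def
proof (intro conjI allI impI)
  show "real_distribution (q n)" for n using q(1) real_distribution_borel_probs by blast
  fix e :: real assume e: "0 < e"
  \<comment> \<open>By Markov's inequality the mass beyond \<open>b\<close> is at most
    \<open>\<bar>K\<bar> / b\<close>, which this choice makes smaller than \<open>e\<close>.\<close>
  define b where "b = (\<bar>K\<bar> + 1) / e"
  have b: "0 < b" using e by (simp add: b_def add_pos_nonneg)
  show "\<exists>a b. a < b \<and> (\<forall>n. 1 - e < measure (q n) {a<..b})"
  \<comment> \<open>Tightness is stated with intervals open on the left, so the left end is taken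
    negative in order to keep an atom at 0 inside.\<close>
  proof (rule exI[of _ "-1"], rule exI[of _ b], intro conjI allI)
    fix n
    interpret prob_space "q n" using q borel_probsD by blast
    have [measurable_cong]: "sets (q n) = sets borel" using q borel_probsD by blast
    have sp: "space (q n) = UNIV" using q borel_probsD by blast
    have "emeasure (q n) {x \<in> space (q n). 1 \<le> ennreal (1 / b) * ennreal x} \<le>
       ennreal (1 / b) * (\<integral>\<^sup>+x. ennreal x \<partial>q n)"
      using nn_integral_Markov_inequality[of ennreal UNIV "q n" "ennreal (1 / b)"] by (simp add: sp)
    also have "\<dots> \<le> ennreal (1 / b) * ennreal K" using q(3)[of n] by (intro mult_left_mono) auto
    also have "\<dots> \<le> ennreal (1 / b) * ennreal \<bar>K\<bar>" by (intro mult_left_mono ennreal_leI) auto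
    also have "\<dots> = ennreal (\<bar>K\<bar> / b)" using b by (simp flip: ennreal_mult')
    finally have "emeasure (q n) {x \<in> space (q n). 1 \<le> ennreal (1 / b) * ennreal x} \<le> ennreal (\<bar>K\<bar> / b)" .
    moreover have "{b<..} \<subseteq> {x \<in> space (q n). 1 \<le> ennreal (1 / b) * ennreal x}"
      using b by (auto simp: sp simp flip: ennreal_mult' ennreal_1)
    moreover have "{x \<in> space (q n). 1 \<le> ennreal (1 / b) * ennreal x} \<in> events" by measurable
    ultimately have "emeasure (q n) {b<..} \<le> ennreal (\<bar>K\<bar> / b)"
      by (meson emeasure_mono order_trans)
    then have "prob {b<..} \<le> \<bar>K\<bar> / b" using b by (simp add: emeasure_eq_measure ennreal_le_iff)
    also have "\<bar>K\<bar> / b < e" using e by (simp add: b_def field_simps add_pos_nonneg)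
    finally have 1: "prob {b<..} < e" .
    have "AE x in q n. x \<in> {-1<..b} \<union> {b<..}" using q(2)[of n] by eventually_elim auto
    then have "prob ({-1<..b} \<union> {b<..}) = 1" by (subst prob_eq_1) auto
    moreover have "prob ({-1<..b} \<union> {b<..}) \<le> prob {-1<..b} + prob {b<..}" by (rule measure_Un_le) auto
    ultimately show "1 - e < prob {-1<..b}" using 1 by linarith
  qed (use b in simp)
qed


text \<open>Convergent subsequences are found for the laws on the real line, where bounded means
  give tightness, and are transported by duality: \<open>cycle_avg f\<close> is again bounded and
  continuous. It remains to see that nonnegativity and the bound on the mean survive in the
  limit.\<close>

lemma short_recip_set_sequentially_compact:
  assumes \<mu>: "\<And>n. \<mu> n \<in> short_recip_set K" and K: "0 \<le> K"
  shows "\<exists>r l. strict_mono (r :: nat \<Rightarrow> nat) \<and> l \<in> short_recip_set K \<and>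
    (\<forall>f\<in>bcont. (\<lambda>n. \<integral>z. f z \<partial>\<mu> (r n)) \<longlonglongrightarrow> (\<integral>z. f z \<partial>l))"
proof -
  have "\<exists>q. \<mu> n = cycle_law q \<and> q \<in> borel_probs \<and> (AE x in q. 0 \<le> x) \<and> (\<integral>\<^sup>+x. ennreal x \<partial>q) \<le> ennreal K" for n
    using \<mu>[of n] unfolding short_recip_set_def by blast
  then obtain q where q: "\<And>n. \<mu> n = cycle_law (q n)" "\<And>n. q n \<in> borel_probs" "\<And>n. AE x in q n. 0 \<le> x"
     "\<And>n. (\<integral>\<^sup>+x. ennreal x \<partial>q n) \<le> ennreal K"
    by metis
  have "tight q" by (rule tight_bounded_mean[OF q(2-4)])
  moreover have "strict_mono (id :: nat \<Rightarrow> nat)" by (simp add: strict_mono_def)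
  ultimately obtain r p where r: "strict_mono r" "real_distribution p" "weak_conv_m (q \<circ> id \<circ> r) p"
    using tight_imp_convergent_subsubsequence by blast
  then have p: "p \<in> borel_probs" by (simp add: real_distribution_borel_probs)
  interpret p: prob_space p using p borel_probsD by blast
  have conv: "(\<lambda>n. \<integral>x. g x \<partial>q (r n)) \<longlonglongrightarrow> (\<integral>x. g x \<partial>p)" if g: "g \<in> bcont" for g
  proof -
    obtain B where B: "\<And>x. \<bar>g x\<bar> \<le> B" using bcont_boundE[OF g] by blast
    have "\<And>n. real_distribution ((q \<circ> id \<circ> r) n)" using q(2) by (simp add: real_distribution_borel_probs)
    from weak_conv_imp_integral_bdd_continuous_conv[OF this r(2,3) bcont_isCont[OF g], of B]
    show ?thesis using B by simp
  qed
  have [measurable_cong]: "sets p = sets borel" using p borel_probsD by blast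
  have nn: "AE x in p. 0 \<le> x"
  proof -
    \<comment> \<open>A bounded continuous function that vanishes exactly on the nonnegative
      numbers; its integral is 0 along the sequence and hence for the limit.\<close>
    define g :: "real \<Rightarrow> real" where "g x = min 1 (max 0 (- x))" for x
    have g: "g \<in> bcont" unfolding g_def by (rule bcontI[of _ 1]) (auto intro!: continuous_intros)
    have [measurable]: "g \<in> borel_measurable borel" using g by (rule bcont_measurable)
    have "(\<integral>x. g x \<partial>q n) = (\<integral>x. 0 \<partial>q n)" for n
    proof (rule integral_cong_AE)
      show "g \<in> borel_measurable (q n)" using g bcont_measurable borel_probsD(4)[OF q(2)] by blast
      show "AE x in q n. g x = 0" using q(3)[of n] by eventually_elim (auto simp: g_def)
    qed simp
    then have "(\<lambda>n::nat. 0) \<longlonglongrightarrow> (\<integral>x. g x \<partial>p)" using conv[OF g] by simp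
    then have "(\<integral>x. g x \<partial>p) = 0" by (simp add: LIMSEQ_const_iff)
    moreover have "AE x in p. 0 \<le> g x" by (simp add: g_def)
    ultimately have "AE x in p. g x = 0"
      using integrable_bcont[OF p g] by (simp add: integral_nonneg_eq_0_iff_AE)
    then show ?thesis by eventually_elim (auto simp: g_def min_def max_def split: if_splits)
  qed
  have mean: "(\<integral>\<^sup>+x. ennreal x \<partial>p) \<le> ennreal K"
  proof -
    \<comment> \<open>The mean is not continuous under narrow limits, but its bounded truncations
      are, and it is their increasing limit.\<close>
    define g :: "nat \<Rightarrow> real \<Rightarrow> real" where "g m x = min (real m) (max 0 x)" for m x
    have g: "g m \<in> bcont" for m unfolding g_def by (rule bcontI[of _ m]) (auto intro!: continuous_intros)
    have [measurable]: "g m \<in> borel_measurable borel" for m using g by (rule bcont_measurable)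
    have le: "(\<integral>x. g m x \<partial>q n) \<le> K" for m n
    proof -
      have "ennreal (\<integral>x. g m x \<partial>q n) = (\<integral>\<^sup>+x. ennreal (g m x) \<partial>q n)"
        by (rule nn_integral_eq_integral[OF integrable_bcont[OF q(2) g], symmetric]) (auto simp: g_def)
      also have "\<dots> \<le> (\<integral>\<^sup>+x. ennreal x \<partial>q n)"
        by (intro nn_integral_mono) (auto simp: g_def min_def max_def ennreal_neg intro!: ennreal_leI)
      also have "\<dots> \<le> ennreal K" by fact
      finally show ?thesis using K by (simp add: ennreal_le_iff)
    qed
    have gK: "(\<integral>\<^sup>+x. ennreal (g m x) \<partial>p) \<le> ennreal K" for m
    proof -
      have "(\<integral>x. g m x \<partial>p) \<le> K"
        using conv[OF g] le by (intro LIMSEQ_le_const2[OF conv[OF g]]) auto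
      moreover have "(\<integral>\<^sup>+x. ennreal (g m x) \<partial>p) = ennreal (\<integral>x. g m x \<partial>p)"
        by (rule nn_integral_eq_integral[OF integrable_bcont[OF p g]]) (auto simp: g_def)
      ultimately show ?thesis by (simp add: ennreal_leI)
    qed
    have "(\<integral>\<^sup>+x. ennreal x \<partial>p) = (\<integral>\<^sup>+x. (SUP m. ennreal (g m x)) \<partial>p)"
    proof (intro nn_integral_cong antisym)
      fix x :: real
      obtain m :: nat where "x \<le> m" using real_arch_simple by blast
      then have "ennreal x \<le> ennreal (g m x)" by (intro ennreal_leI) (auto simp: g_def)
      then show "ennreal x \<le> (SUP m. ennreal (g m x))" by (rule SUP_upper2[OF UNIV_I])
      show "(SUP m. ennreal (g m x)) \<le> ennreal x"
        by (intro SUP_least) (auto simp: g_def min_def max_def ennreal_neg intro!: ennreal_leI)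
    qed
    also have "\<dots> = (SUP m. \<integral>\<^sup>+x. ennreal (g m x) \<partial>p)"
      by (intro nn_integral_monotone_convergence_SUP)
        (auto simp: incseq_def le_fun_def g_def intro!: ennreal_leI)
    also have "\<dots> \<le> ennreal K" using gK by (intro SUP_least)
    finally show ?thesis .
  qed
  show ?thesis
  proof (intro exI conjI ballI)
    show "strict_mono r" by fact
    show "cycle_law p \<in> short_recip_set K" unfolding short_recip_set_def using p nn mean by blast
    fix f :: "ext_pos \<times> ext_pos \<Rightarrow> real" assume f: "f \<in> bcont"
    show "(\<lambda>n. \<integral>z. f z \<partial>\<mu> (r n)) \<longlonglongrightarrow> (\<integral>z. f z \<partial>cycle_law p)"
      using conv[OF cycle_avg_bcont[OF f]] by (simp add: q(1) integral_cycle_law q(2) p f)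
  qed
qed

lemma eventually_in_openin_narrow:
  assumes lim: "\<And>f. f \<in> bcont \<Longrightarrow> (\<lambda>n. \<integral>z. f z \<partial>\<mu> n) \<longlonglongrightarrow> (\<integral>z. f z \<partial>l)"
    and \<mu>: "\<And>n. \<mu> n \<in> borel_probs" and U: "openin narrow_topology U" "l \<in> U"
  shows "\<forall>\<^sub>F n in sequentially. \<mu> n \<in> U"
proof -
  obtain F e where F: "finite F" "F \<subseteq> bcont" "0 < e" "nbhd F e l \<subseteq> U"
    using narrow_nbhd_base[OF U] by blast
  have "\<forall>\<^sub>F n in sequentially. \<forall>f\<in>F. dist (\<integral>z. f z \<partial>\<mu> n) (\<integral>z. f z \<partial>l) < e"
    using F(2,3) by (intro eventually_ball_finite[OF F(1)] ballI tendstoD[OF lim]) auto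
  then show ?thesis
    by eventually_elim (use F(4) \<mu> in \<open>auto simp: nbhd_def dist_real_def\<close>)
qed

text \<open>The ambient set provides convergent subsequences, so only stability under limits is left
  to check: nothing for the whole set, the large deviations bounds for sublevel sets of the
  rate.\<close>

lemma compactin_short_recip_subset:
  assumes S: "S \<subseteq> short_recip_set K" and K: "0 \<le> K"
    and closed: "\<And>\<mu> l. range \<mu> \<subseteq> S \<Longrightarrow> l \<in> short_recip_set K \<Longrightarrow>
       (\<And>U. openin narrow_topology U \<Longrightarrow> l \<in> U \<Longrightarrow> \<forall>\<^sub>F n::nat in sequentially. \<mu> n \<in> U) \<Longrightarrow> l \<in> S"
  shows "compactin narrow_topology S"
proof (rule compactin_sequentially[OF second_countable_narrow])
  show "S \<subseteq> topspace narrow_topology"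
    using S short_recip_set_subset unfolding topspace_narrow_topology by blast
  fix \<mu> :: "nat \<Rightarrow> (ext_pos \<times> ext_pos) measure" assume \<mu>: "range \<mu> \<subseteq> S"
  have "\<mu> n \<in> short_recip_set K" for n using \<mu> S by blast
  from short_recip_set_sequentially_compact[of \<mu>, OF this K]
  obtain r l where r: "strict_mono r" "l \<in> short_recip_set K"
    "\<And>f. f \<in> bcont \<Longrightarrow> (\<lambda>n. \<integral>z. f z \<partial>\<mu> (r n)) \<longlonglongrightarrow> (\<integral>z. f z \<partial>l)" by blast
  have ev: "\<forall>\<^sub>F n in sequentially. \<mu> (r n) \<in> U" if "openin narrow_topology U" "l \<in> U" for U
    by (rule eventually_in_openin_narrow[OF r(3) _ that]) (use \<mu> S short_recip_set_subset in blast)+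
  have "l \<in> S" by (rule closed[of "\<mu> \<circ> r"]) (use \<mu> r(2) ev in auto)
  then show "\<exists>r l. strict_mono r \<and> l \<in> S \<and> (\<forall>U. openin narrow_topology U \<longrightarrow> l \<in> U \<longrightarrow> (\<forall>\<^sub>F n in sequentially. \<mu> (r n) \<in> U))"
    using r(1) ev by blast
qed

section \<open>Renewal paths\<close>

definition seg_integral :: "real \<Rightarrow> real \<Rightarrow> (real \<Rightarrow> real) \<Rightarrow> real" where
  "seg_integral a b g = (\<integral>s. indicator {a..<b} s * g s \<partial>lborel)"

lemma integrable_seg:
  fixes g :: "real \<Rightarrow> real"
  assumes [measurable]: "g \<in> borel_measurable borel" and B: "\<And>x. \<bar>g x\<bar> \<le> B"
  shows "integrable lborel (\<lambda>s. indicator {a..<b} s * g s)"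
proof (rule Bochner_Integration.integrable_bound)
  show "integrable lborel (\<lambda>s. B * indicator {a..<b} s :: real)"
    by (cases "a \<le> b") (auto intro!: integrable_mult_right integrable_real_indicator)
  show "AE x in lborel. norm (indicator {a..<b} x * g x) \<le> norm (B * indicator {a..<b} x)"
    using B by (auto split: split_indicator intro: order_trans[OF _ abs_ge_self])
qed simp

lemma seg_integral_cong:
  assumes [measurable]: "g \<in> borel_measurable borel" "h \<in> borel_measurable borel"
    and "\<And>s. a < s \<Longrightarrow> s < b \<Longrightarrow> g s = h s"
  shows "seg_integral a b g = seg_integral a b h"
  unfolding seg_integral_def
proof (rule integral_cong_AE)
  show "AE s in lborel. indicator {a..<b} s * g s = indicator {a..<b} s * h s"
    using AE_lborel_singleton[of a] by eventually_elim (use assms(3) in \<open>auto split: split_indicator\<close>)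
qed auto

lemma seg_integral_split:
  assumes g: "g \<in> borel_measurable borel" "\<And>x. \<bar>g x\<bar> \<le> B" and le: "a \<le> b" "b \<le> c"
  shows "seg_integral a c g = seg_integral a b g + seg_integral b c g"
proof -
  have "indicator {a..<c} s * g s = indicator {a..<b} s * g s + indicator {b..<c} s * g s" for s
    using le by (auto split: split_indicator)
  then show ?thesis
    unfolding seg_integral_def using integrable_seg[OF g] by simp
qed

lemma seg_integral_const:
  "a \<le> b \<Longrightarrow> seg_integral a b (\<lambda>_. c) = c * (b - a)"
  by (simp add: seg_integral_def mult.commute)

lemma seg_integral_mono:
  assumes g: "g \<in> borel_measurable borel" "\<And>x. \<bar>g x\<bar> \<le> B" and h: "h \<in> borel_measurable borel" "\<And>x. \<bar>h x\<bar> \<le> C"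
    and le: "\<And>s. a < s \<Longrightarrow> s < b \<Longrightarrow> g s \<le> h s"
  shows "seg_integral a b g \<le> seg_integral a b h"
  unfolding seg_integral_def
proof (rule integral_mono_AE)
  show "AE s in lborel. indicator {a..<b} s * g s \<le> indicator {a..<b} s * h s"
    using AE_lborel_singleton[of a] by eventually_elim (use le in \<open>auto split: split_indicator\<close>)
qed (use integrable_seg[OF g] integrable_seg[OF h] in auto)

lemma abs_seg_integral_le:
  assumes g: "g \<in> borel_measurable borel" "\<And>x. \<bar>g x\<bar> \<le> B" and le: "a \<le> b"
  shows "\<bar>seg_integral a b g\<bar> \<le> B * (b - a)"
proof -
  have "seg_integral a b g \<le> seg_integral a b (\<lambda>_. B)" "seg_integral a b (\<lambda>_. - B) \<le> seg_integral a b g"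
    using g(2) by (intro seg_integral_mono[where B=B and C="\<bar>B\<bar>"] seg_integral_mono[where B="\<bar>B\<bar>" and C=B] g;
      auto simp: abs_le_iff intro: order_trans; smt (verit))+
  then show ?thesis using le by (simp add: seg_integral_const abs_le_iff)
qed

lemma seg_integral_shift:
  "seg_integral a b g = seg_integral 0 (b - a) (\<lambda>s. g (a + s))"
  unfolding seg_integral_def
  by (subst lborel_integral_real_affine[of 1 _ a]) (auto intro!: Bochner_Integration.integral_cong split: split_indicator)

lemma seg_integral_scale:
  assumes "0 < c"
  shows "seg_integral 0 c g = c * seg_integral 0 1 (\<lambda>u. g (u * c))"
  unfolding seg_integral_def using assms
  by (subst lborel_integral_real_affine[of c _ 0])
    (auto intro!: Bochner_Integration.integral_cong split: split_indicator simp: mult.commute zero_le_mult_iff)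

lemma integral_uniform_seg:
  assumes g: "g \<in> borel_measurable borel" and t: "0 < t"
  shows "(\<integral>s. g s \<partial>uniform_measure lborel {0..<t}) = seg_integral 0 t g / t"
proof -
  have "uniform_measure lborel {0..<t} = density lborel (\<lambda>s. ennreal (indicator {0..<t} s / t))"
    unfolding uniform_measure_def using t
    by (intro density_cong) (auto split: split_indicator simp: divide_ennreal ennreal_1[symmetric] simp del: ennreal_1)
  then have "(\<integral>s. g s \<partial>uniform_measure lborel {0..<t}) = (\<integral>s. (indicator {0..<t} s / t) *\<^sub>R g s \<partial>lborel)"
    using g t by (simp only:) (subst integral_density, auto)
  also have "\<dots> = (\<integral>s. (indicator {0..<t} s * g s) / t \<partial>lborel)"
    by (intro Bochner_Integration.integral_cong) auto
  finally show ?thesis by (simp add: seg_integral_def)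
qed

lemma cycle_avg_eq_seg_integral:
  assumes f: "f \<in> borel_measurable borel"
  shows "cycle_avg f x = seg_integral 0 1 (\<lambda>u. f (cycle_point u x))"
proof -
  note [measurable] = f
  have "uniform_measure lborel {0..1::real} = density lborel (\<lambda>s. ennreal (indicator {0..1} s))"
    unfolding uniform_measure_def
    by (rule arg_cong[where f="density lborel"]) (auto simp: fun_eq_iff split: split_indicator)
  then have "cycle_avg f x = (\<integral>u. indicator {0..1} u *\<^sub>R f (cycle_point u x) \<partial>lborel)"
    unfolding cycle_avg_def by (simp only:) (subst integral_density, auto)
  also have "\<dots> = seg_integral 0 1 (\<lambda>u. f (cycle_point u x))"
    unfolding seg_integral_def
  proof (rule integral_cong_AE)
    show "AE u in lborel. indicator {0..1} u *\<^sub>R f (cycle_point u x) = indicator {0..<1} u * f (cycle_point u x)"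
      using AE_lborel_singleton[of 1] by eventually_elim (auto split: split_indicator)
  qed auto
  finally show ?thesis .
qed

text \<open>Substituting \<open>s = u * l\<close> turns one passage through a cycle of length
  \<open>l\<close> into \<open>l\<close> times the uniform average at inverse length
  \<open>1 / l\<close>.\<close>

lemma seg_integral_cycle:
  assumes f: "f \<in> borel_measurable borel" and l: "0 < l"
  shows "seg_integral 0 l (\<lambda>s. f (to_ext_pos s, to_ext_pos (l - s))) = l * cycle_avg f (1 / l)"
  unfolding cycle_avg_eq_seg_integral[OF f] seg_integral_scale[OF l, of "\<lambda>s. f (to_ext_pos s, to_ext_pos (l - s))"]
  by (simp add: cycle_point_def left_diff_distrib)


section \<open>Recurrence times along a path\<close>

definition recurrence_point :: "(nat \<Rightarrow> 'w \<Rightarrow> real) \<Rightarrow> 'w \<Rightarrow> real \<Rightarrow> ext_pos \<times> ext_pos" where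
  "recurrence_point \<tau> \<omega> s = (to_ext_pos (backward_time \<tau> s \<omega>), to_ext_pos (forward_time \<tau> s \<omega>))"

lemma renewal_time_0 [simp]: "renewal_time \<tau> 0 \<omega> = 0"
  by (simp add: renewal_time_def)

lemma renewal_time_Suc: "renewal_time \<tau> (Suc n) \<omega> = renewal_time \<tau> n \<omega> + \<tau> (Suc n) \<omega>"
  by (simp add: renewal_time_def)

lemma renewal_time_strict_mono:
  assumes "\<And>i. 1 \<le> i \<Longrightarrow> 0 < \<tau> i \<omega>"
  shows "strict_mono (\<lambda>n. renewal_time \<tau> n \<omega>)"
  unfolding strict_mono_Suc_iff using assms by (simp add: renewal_time_Suc)

lemma renewal_count_eq:
  assumes pos: "\<And>i. 1 \<le> i \<Longrightarrow> 0 < \<tau> i \<omega>"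
    and s: "renewal_time \<tau> n \<omega> \<le> s" "s < renewal_time \<tau> (Suc n) \<omega>"
  shows "renewal_count \<tau> s \<omega> = Suc n"
proof -
  have mono: "mono (\<lambda>n. renewal_time \<tau> n \<omega>)"
    by (rule strict_mono_mono[OF renewal_time_strict_mono]) (rule pos)
  show ?thesis unfolding renewal_count_def
  proof (rule cInf_eq_minimum)
    fix k assume "k \<in> {n. s < renewal_time \<tau> n \<omega>}"
    then have "\<not> k \<le> n" using monoD[OF mono, of k n] s(1) by auto
    then show "Suc n \<le> k" by simp
  qed (use s in simp)
qed

lemma recurrence_point_eq:
  assumes "\<And>i. 1 \<le> i \<Longrightarrow> 0 < \<tau> i \<omega>"
    and "renewal_time \<tau> n \<omega> \<le> s" "s < renewal_time \<tau> (Suc n) \<omega>"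
  shows "recurrence_point \<tau> \<omega> s =
    (to_ext_pos (s - renewal_time \<tau> n \<omega>), to_ext_pos (\<tau> (Suc n) \<omega> - (s - renewal_time \<tau> n \<omega>)))"
  using renewal_count_eq[OF assms]
  by (simp add: recurrence_point_def backward_time_def forward_time_def renewal_time_Suc algebra_simps)

text \<open>Joint measurability in path and time serves twice: for the image measure in time, and
  for the time integrals as random variables. The random index \<open>renewal_count\<close> takes
  countably many values, which reduces the compositions to fixed indices.\<close>

lemma measurable_recurrence_point:
  assumes [measurable]: "\<And>i. 1 \<le> i \<Longrightarrow> \<tau> i \<in> borel_measurable M"
  shows "(\<lambda>(\<omega>, s). recurrence_point \<tau> \<omega> s) \<in> borel_measurable (M \<Otimes>\<^sub>M borel)"
proof -
  have S[measurable]: "renewal_time \<tau> n \<in> borel_measurable M" for n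
    unfolding renewal_time_def[abs_def] by (intro borel_measurable_sum assms) auto
  have N[measurable]: "(\<lambda>(\<omega>, s). renewal_count \<tau> s \<omega>) \<in> measurable (M \<Otimes>\<^sub>M borel) (count_space UNIV)"
    unfolding renewal_count_def Inf_nat_def by simp measurable
  have b[measurable]: "(\<lambda>p. backward_time \<tau> (snd p) (fst p)) \<in> borel_measurable (M \<Otimes>\<^sub>M borel)"
    unfolding backward_time_def
    using N by (intro borel_measurable_diff measurable_compose_countable[where f="\<lambda>n p. renewal_time \<tau> (n - 1) (fst p)" and g="\<lambda>p. renewal_count \<tau> (snd p) (fst p)"])
      (auto simp: case_prod_beta')
  have f[measurable]: "(\<lambda>p. forward_time \<tau> (snd p) (fst p)) \<in> borel_measurable (M \<Otimes>\<^sub>M borel)"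
    unfolding forward_time_def
    using N by (intro borel_measurable_diff measurable_compose_countable[where f="\<lambda>n p. renewal_time \<tau> n (fst p)" and g="\<lambda>p. renewal_count \<tau> (snd p) (fst p)"])
      (auto simp: case_prod_beta')
  show ?thesis unfolding recurrence_point_def borel_prod[symmetric] case_prod_beta' by measurable
qed

lemma near_infinity:
  assumes f: "f \<in> bcont" and e: "0 < e"
  obtains R where "0 < R" "\<And>a b. R \<le> a \<Longrightarrow> R \<le> b \<Longrightarrow> \<bar>f (to_ext_pos a, to_ext_pos b) - f (\<infinity>, \<infinity>)\<bar> \<le> e"
proof -
  obtain d where d: "0 < d" "\<And>z. dist z (\<infinity>, \<infinity>) < d \<Longrightarrow> dist (f z) (f (\<infinity>, \<infinity>)) < e"
    using bcont_isCont[OF f, of "(\<infinity>, \<infinity>)"] e unfolding continuous_at_eps_delta by blast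
  show thesis
  \<comment> \<open>With both coordinates beyond \<open>3 / d\<close> the distance to
    \<open>(\<infinity>, \<infinity>)\<close> is at most \<open>2 * d / 3\<close>.\<close>
  proof (rule that[of "3 / d"])
    fix a b assume ab: "3 / d \<le> a" "3 / d \<le> b"
    have pos: "0 < a" "0 < b" using ab d(1) by (auto intro: less_le_trans[rotated])
    have "1 / a \<le> d / 3" "1 / b \<le> d / 3" using ab pos d(1) by (auto simp: field_simps)
    moreover have "dist (to_ext_pos a, to_ext_pos b) (\<infinity>, \<infinity>) \<le> 1 / a + 1 / b"
      using pos by (auto simp: dist_Pair_Pair dist_ext_pos_def recip_to_ext_pos intro!: sqrt_sum_squares_le_sum)
    ultimately have "dist (to_ext_pos a, to_ext_pos b) (\<infinity>, \<infinity>) < d" using d(1) by linarith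
    then show "\<bar>f (to_ext_pos a, to_ext_pos b) - f (\<infinity>, \<infinity>)\<bar> \<le> e"
      using d(2) by (force simp: dist_real_def)
  qed (use d in simp)
qed

lemma length_function_bcont:
  assumes g: "g \<in> bcont"
  shows "(\<lambda>z. g (inv_length z)) \<in> bcont"
proof -
  obtain B where B: "\<And>x. \<bar>g x\<bar> \<le> B" using bcont_boundE[OF g] by blast
  show ?thesis
    by (rule bcontI[of _ B])
      (use B g continuous_inv_length in \<open>auto simp: bcont_def intro: continuous_on_compose2\<close>)
qed

lemma diff_bcont: "f \<in> bcont \<Longrightarrow> g \<in> bcont \<Longrightarrow> (\<lambda>z. f z - g z) \<in> bcont"
  by (auto simp: bcont_def intro!: continuous_on_diff bounded_minus_comp)

section \<open>The empirical measure as a sum over cycles\<close>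

context
  fixes \<tau> :: "nat \<Rightarrow> 'w \<Rightarrow> real" and M :: "'w measure"
  assumes meas_\<tau>: "\<And>i. 1 \<le> i \<Longrightarrow> \<tau> i \<in> borel_measurable M"
begin

lemma measurable_recurrence_point_time:
  assumes "\<omega> \<in> space M"
  shows "recurrence_point \<tau> \<omega> \<in> borel_measurable borel"
  using measurable_compose[OF measurable_Pair1'[OF assms] measurable_recurrence_point[OF meas_\<tau>]] by simp

lemma empirical_measure_borel_probs:
  assumes "\<omega> \<in> space M" "0 < t"
  shows "empirical_measure \<tau> t \<omega> \<in> borel_probs"
proof -
  interpret prob_space "uniform_measure lborel {0..<t}"
    using assms(2) by (intro prob_space_uniform_measure) auto
  show ?thesis
    unfolding empirical_measure_def borel_probs_def
    using measurable_recurrence_point_time[OF assms(1)]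
    by (auto intro!: prob_space_distr simp: recurrence_point_def[abs_def])
qed

lemma integral_empirical_measure:
  assumes "\<omega> \<in> space M" "0 < t" and f[measurable]: "(f :: _ \<Rightarrow> real) \<in> borel_measurable borel"
  shows "(\<integral>z. f z \<partial>empirical_measure \<tau> t \<omega>) = seg_integral 0 t (\<lambda>s. f (recurrence_point \<tau> \<omega> s)) / t"
proof -
  note [measurable] = measurable_recurrence_point_time[OF assms(1)]
  have "empirical_measure \<tau> t \<omega> = distr (uniform_measure lborel {0..<t}) borel (recurrence_point \<tau> \<omega>)"
    by (simp add: empirical_measure_def recurrence_point_def[abs_def])
  then have "(\<integral>z. f z \<partial>empirical_measure \<tau> t \<omega>) = (\<integral>s. f (recurrence_point \<tau> \<omega> s) \<partial>uniform_measure lborel {0..<t})"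
    by (simp only:) (subst integral_distr, auto)
  also have "\<dots> = seg_integral 0 t (\<lambda>s. f (recurrence_point \<tau> \<omega> s)) / t"
    using assms(2) by (intro integral_uniform_seg) auto
  finally show ?thesis .
qed

lemma measurable_integral_empirical_measure:
  assumes "0 < t" and f[measurable]: "(f :: _ \<Rightarrow> real) \<in> borel_measurable borel"
  shows "(\<lambda>\<omega>. \<integral>z. f z \<partial>empirical_measure \<tau> t \<omega>) \<in> borel_measurable M"
proof -
  note [measurable] = measurable_recurrence_point[OF meas_\<tau>]
  have "(\<lambda>\<omega>. seg_integral 0 t (\<lambda>s. f (recurrence_point \<tau> \<omega> s)) / t) \<in> borel_measurable M"
    unfolding seg_integral_def by measurable
  then show ?thesis
    using integral_empirical_measure[OF _ assms] by (simp cong: measurable_cong)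
qed

lemma measurable_empirical_measure:
  assumes "0 < t"
  shows "empirical_measure \<tau> t \<in> measurable M (borel_of narrow_topology)"
  using assms
  by (intro measurable_narrow empirical_measure_borel_probs measurable_integral_empirical_measure bcont_measurable)

text \<open>Inside one cycle the path depends only on the length of that cycle, also when the cycle
  is cut at \<open>t\<close>; a complete cycle is the case where \<open>t\<close> is the next
  renewal time.\<close>

lemma seg_integral_last_cycle:
  assumes \<omega>: "\<omega> \<in> space M" and pos: "\<And>i. 1 \<le> i \<Longrightarrow> 0 < \<tau> i \<omega>" and f: "(f :: _ \<Rightarrow> real) \<in> borel_measurable borel"
    and t: "t \<le> renewal_time \<tau> (Suc n) \<omega>"
  shows "seg_integral (renewal_time \<tau> n \<omega>) t (\<lambda>s. f (recurrence_point \<tau> \<omega> s)) =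
    seg_integral 0 (t - renewal_time \<tau> n \<omega>) (\<lambda>s. f (to_ext_pos s, to_ext_pos (\<tau> (Suc n) \<omega> - s)))"
proof -
  note [measurable] = measurable_recurrence_point_time[OF \<omega>] f
  have [measurable]: "(\<lambda>s. (to_ext_pos s, to_ext_pos (l - s))) \<in> borel_measurable borel" for l
    unfolding borel_prod[symmetric] by measurable
  show ?thesis
    unfolding seg_integral_shift[of "renewal_time \<tau> n \<omega>"]
  proof (rule seg_integral_cong)
    fix s assume s: "0 < s" "s < t - renewal_time \<tau> n \<omega>"
    then show "f (recurrence_point \<tau> \<omega> (renewal_time \<tau> n \<omega> + s)) = f (to_ext_pos s, to_ext_pos (\<tau> (Suc n) \<omega> - s))"
      using t pos by (subst recurrence_point_eq[of \<tau> \<omega> n]) auto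
  qed auto
qed

lemma seg_integral_full_cycles:
  assumes \<omega>: "\<omega> \<in> space M" and pos: "\<And>i. 1 \<le> i \<Longrightarrow> 0 < \<tau> i \<omega>" and f: "f \<in> borel_measurable borel"
    and B: "\<And>z. \<bar>f z\<bar> \<le> B"
  shows "seg_integral 0 (renewal_time \<tau> n \<omega>) (\<lambda>s. f (recurrence_point \<tau> \<omega> s)) =
    (\<Sum>i=1..n. \<tau> i \<omega> * cycle_avg f (1 / \<tau> i \<omega>))"
proof (induction n)
  case 0
  show ?case by (simp add: seg_integral_def)
next
  case (Suc n)
  note [measurable] = measurable_recurrence_point_time[OF \<omega>] f
  have mono: "mono (\<lambda>n. renewal_time \<tau> n \<omega>)"
    by (rule strict_mono_mono[OF renewal_time_strict_mono]) (rule pos)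
  have le: "0 \<le> renewal_time \<tau> n \<omega>" "renewal_time \<tau> n \<omega> \<le> renewal_time \<tau> (Suc n) \<omega>"
    using monoD[OF mono, of 0 n] monoD[OF mono, of n "Suc n"] by auto
  have "seg_integral 0 (renewal_time \<tau> (Suc n) \<omega>) (\<lambda>s. f (recurrence_point \<tau> \<omega> s)) =
     seg_integral 0 (renewal_time \<tau> n \<omega>) (\<lambda>s. f (recurrence_point \<tau> \<omega> s)) +
     seg_integral (renewal_time \<tau> n \<omega>) (renewal_time \<tau> (Suc n) \<omega>) (\<lambda>s. f (recurrence_point \<tau> \<omega> s))"
    using le by (intro seg_integral_split[where B=B]) (use B in auto)
  also have "seg_integral (renewal_time \<tau> n \<omega>) (renewal_time \<tau> (Suc n) \<omega>) (\<lambda>s. f (recurrence_point \<tau> \<omega> s)) =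
     \<tau> (Suc n) \<omega> * cycle_avg f (1 / \<tau> (Suc n) \<omega>)"
    by (subst seg_integral_last_cycle[OF \<omega> pos f])
      (auto simp: renewal_time_Suc intro!: seg_integral_cycle f pos)
  finally show ?case using Suc by simp
qed

lemma empirical_measure_cycles:
  assumes \<omega>: "\<omega> \<in> space M" and pos: "\<And>i. 1 \<le> i \<Longrightarrow> 0 < \<tau> i \<omega>" and f: "f \<in> borel_measurable borel"
    and B: "\<And>z. \<bar>f z\<bar> \<le> B"
    and t: "0 < t" "renewal_time \<tau> n \<omega> \<le> t" "t \<le> renewal_time \<tau> (Suc n) \<omega>"
  shows "t * (\<integral>z. f z \<partial>empirical_measure \<tau> t \<omega>) =
    (\<Sum>i=1..n. \<tau> i \<omega> * cycle_avg f (1 / \<tau> i \<omega>)) +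
    seg_integral 0 (t - renewal_time \<tau> n \<omega>) (\<lambda>s. f (to_ext_pos s, to_ext_pos (\<tau> (Suc n) \<omega> - s)))"
proof -
  note [measurable] = measurable_recurrence_point_time[OF \<omega>] f
  have mono: "mono (\<lambda>n. renewal_time \<tau> n \<omega>)"
    by (rule strict_mono_mono[OF renewal_time_strict_mono]) (rule pos)
  have le: "0 \<le> renewal_time \<tau> n \<omega>" using monoD[OF mono, of 0 n] by auto
  have "t * (\<integral>z. f z \<partial>empirical_measure \<tau> t \<omega>) = seg_integral 0 t (\<lambda>s. f (recurrence_point \<tau> \<omega> s))"
    using t by (subst integral_empirical_measure[OF \<omega> t(1) f]) auto
  also have "\<dots> = seg_integral 0 (renewal_time \<tau> n \<omega>) (\<lambda>s. f (recurrence_point \<tau> \<omega> s)) +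
     seg_integral (renewal_time \<tau> n \<omega>) t (\<lambda>s. f (recurrence_point \<tau> \<omega> s))"
    using le t by (intro seg_integral_split[where B=B]) (use B in auto)
  finally show ?thesis
    by (simp only: seg_integral_full_cycles[OF \<omega> _ f B] seg_integral_last_cycle[OF \<omega> _ f t(3)] pos)
qed

text \<open>For the lower bound the number \<open>n\<close> of cycles is prescribed, and their total
  length may overshoot \<open>t\<close> by several cycles. The overshoot costs at most
  \<open>B\<close> per unit of time.\<close>

lemma empirical_measure_cycles_Lipschitz:
  assumes \<omega>: "\<omega> \<in> space M" and pos: "\<And>i. 1 \<le> i \<Longrightarrow> 0 < \<tau> i \<omega>" and f: "f \<in> borel_measurable borel"
    and B: "\<And>z. \<bar>f z\<bar> \<le> B" and t: "0 < t" "t \<le> renewal_time \<tau> n \<omega>"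
  shows "\<bar>t * (\<integral>z. f z \<partial>empirical_measure \<tau> t \<omega>) - (\<Sum>i=1..n. \<tau> i \<omega> * cycle_avg f (1 / \<tau> i \<omega>))\<bar>
    \<le> B * (renewal_time \<tau> n \<omega> - t)"
proof -
  note [measurable] = measurable_recurrence_point_time[OF \<omega>] f
  have "t * (\<integral>z. f z \<partial>empirical_measure \<tau> t \<omega>) = seg_integral 0 t (\<lambda>s. f (recurrence_point \<tau> \<omega> s))"
    using t by (subst integral_empirical_measure[OF \<omega> t(1) f]) auto
  moreover have "seg_integral 0 (renewal_time \<tau> n \<omega>) (\<lambda>s. f (recurrence_point \<tau> \<omega> s)) =
     seg_integral 0 t (\<lambda>s. f (recurrence_point \<tau> \<omega> s)) +
     seg_integral t (renewal_time \<tau> n \<omega>) (\<lambda>s. f (recurrence_point \<tau> \<omega> s))"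
    using t by (intro seg_integral_split[where B=B]) (use B in auto)
  moreover have "\<bar>seg_integral t (renewal_time \<tau> n \<omega>) (\<lambda>s. f (recurrence_point \<tau> \<omega> s))\<bar> \<le> B * (renewal_time \<tau> n \<omega> - t)"
    using t by (intro abs_seg_integral_le) (use B in auto)
  moreover note seg_integral_full_cycles[OF \<omega> _ f B, of n]
  ultimately show ?thesis using pos by simp
qed

text \<open>A truncated last cycle is either short compared to \<open>t\<close>, or both recurrence times are
  large along most of it.\<close>

lemma empirical_measure_approx:
  assumes f: "f \<in> bcont" and e: "0 < e"
  shows "\<exists>T>0. \<forall>t\<ge>T. \<forall>\<omega>\<in>space M. \<forall>n. (\<forall>i\<ge>1. 0 < \<tau> i \<omega>) \<longrightarrow> renewal_time \<tau> n \<omega> \<le> t \<longrightarrow> t \<le> renewal_time \<tau> (Suc n) \<omega> \<longrightarrow>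
    \<bar>t * (\<integral>z. f z \<partial>empirical_measure \<tau> t \<omega>) -
      ((\<Sum>i=1..n. \<tau> i \<omega> * cycle_avg f (1 / \<tau> i \<omega>)) + (t - renewal_time \<tau> n \<omega>) * f (\<infinity>, \<infinity>))\<bar> \<le> e * t"
proof -
  obtain B where B: "B > 0" "\<And>x. \<bar>f x\<bar> \<le> B" using bcont_boundE[OF f] by blast
  note [measurable] = bcont_measurable[OF f]
  obtain R where R: "0 < R" "\<And>a b. R \<le> a \<Longrightarrow> R \<le> b \<Longrightarrow> \<bar>f (to_ext_pos a, to_ext_pos b) - f (\<infinity>, \<infinity>)\<bar> \<le> e / 2"
    using near_infinity[OF f, of "e / 2"] e by auto
  \<comment> \<open>From time \<open>T\<close> on, the two end pieces of length \<open>R\<close>,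
    where the integrand is only known to be at most \<open>2 * B\<close>, contribute at most
    \<open>e / 2 * t\<close>.\<close>
  define T where "T = 8 * B * R / e"
  have T: "0 < T" using B R e by (simp add: T_def)
  have diff: "\<bar>f z - f (\<infinity>, \<infinity>)\<bar> \<le> 2 * B" for z
    using B(2)[of z] B(2)[of "(\<infinity>, \<infinity>)"] by linarith
  have [measurable]: "(\<lambda>s. (to_ext_pos s, to_ext_pos (l - s))) \<in> borel_measurable borel" for l
    unfolding borel_prod[symmetric] by measurable
  show ?thesis
  proof (intro exI[of _ T] conjI T allI impI ballI)
    fix t \<omega> n assume t: "T \<le> t" and \<omega>: "\<omega> \<in> space M" and pos: "\<forall>i\<ge>1. 0 < \<tau> i \<omega>"
      and n: "renewal_time \<tau> n \<omega> \<le> t" "t \<le> renewal_time \<tau> (Suc n) \<omega>"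
    define l where "l = t - renewal_time \<tau> n \<omega>"
    define L where "L = \<tau> (Suc n) \<omega>"
    have l: "0 \<le> l" "l \<le> L" "l \<le> t"
      using n monoD[OF strict_mono_mono[OF renewal_time_strict_mono[of \<tau> \<omega>]], of 0 n] pos
      by (auto simp: l_def L_def renewal_time_Suc)
    define g where "g s = f (to_ext_pos s, to_ext_pos (L - s)) - f (\<infinity>, \<infinity>)" for s
    have g[measurable]: "g \<in> borel_measurable borel" unfolding g_def by measurable
    have gB: "\<bar>g s\<bar> \<le> 2 * B" for s unfolding g_def by (rule diff)
    have "\<bar>seg_integral 0 l g\<bar> \<le> e / 2 * l + 4 * B * R"
    proof (cases "2 * R \<le> l")
      case True
      \<comment> \<open>\<open>abs_seg_integral_le\<close> asks for a bound on the whole line, so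
        \<open>g\<close> is replaced by 0 where the two times are not both at least
        \<open>R\<close>; on the segment this changes nothing.\<close>
      have "\<bar>seg_integral R (l - R) g\<bar> = \<bar>seg_integral R (l - R) (\<lambda>s. if R \<le> s \<and> R \<le> L - s then g s else 0)\<bar>"
        using l by (subst seg_integral_cong[where h="\<lambda>s. if R \<le> s \<and> R \<le> L - s then g s else 0"]) auto
      also have "\<dots> \<le> e / 2 * (l - R - R)"
        using True e R(2) by (intro abs_seg_integral_le) (auto simp: g_def)
      finally have "\<bar>seg_integral R (l - R) g\<bar> \<le> e / 2 * (l - R - R)" .
      moreover have "e / 2 * (l - R - R) \<le> e / 2 * l" using e R by (intro mult_left_mono) auto
      moreover have "\<bar>seg_integral 0 R g\<bar> \<le> 2 * B * (R - 0)" "\<bar>seg_integral (l - R) l g\<bar> \<le> 2 * B * (l - (l - R))"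
        using R abs_seg_integral_le[OF g gB, of 0 R] abs_seg_integral_le[OF g gB, of "l - R" l] by auto
      moreover have "seg_integral 0 l g = seg_integral 0 R g + seg_integral R (l - R) g + seg_integral (l - R) l g"
        using True R seg_integral_split[OF g gB, of 0 R l] seg_integral_split[OF g gB, of R "l - R" l] by simp
      ultimately show ?thesis by (simp add: abs_le_iff) linarith
    next
      case False
      have "\<bar>seg_integral 0 l g\<bar> \<le> 2 * B * (l - 0)" using l by (intro abs_seg_integral_le gB) auto
      also have "\<dots> \<le> 2 * B * (2 * R)" using False B by (intro mult_left_mono) auto
      finally show ?thesis using e l by (simp add: add_increasing)
    qed
    also have "\<dots> \<le> e / 2 * t + e / 2 * t"
    proof (intro add_mono)
      show "e / 2 * l \<le> e / 2 * t" using l e by simp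
      have "4 * B * R = e / 2 * T" using e by (simp add: T_def)
      also have "\<dots> \<le> e / 2 * t" using t e by simp
      finally show "4 * B * R \<le> e / 2 * t" .
    qed
    finally have "\<bar>seg_integral 0 l g\<bar> \<le> e * t" by simp
    moreover have "seg_integral 0 l (\<lambda>s. f (to_ext_pos s, to_ext_pos (L - s))) = seg_integral 0 l g + l * f (\<infinity>, \<infinity>)"
    proof -
      have "seg_integral 0 l (\<lambda>s. f (to_ext_pos s, to_ext_pos (L - s))) =
         (\<integral>s. indicator {0..<l} s * g s + indicator {0..<l} s * f (\<infinity>, \<infinity>) \<partial>lborel)"
        unfolding seg_integral_def g_def by (simp add: algebra_simps)
      also have "\<dots> = seg_integral 0 l g + seg_integral 0 l (\<lambda>_. f (\<infinity>, \<infinity>))"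
        unfolding seg_integral_def by (intro Bochner_Integration.integral_add integrable_seg[where B="2*B"] integrable_seg[where B=B])
          (auto simp: B gB)
      finally show ?thesis using l by (simp add: seg_integral_const)
    qed
    moreover have "t * (\<integral>z. f z \<partial>empirical_measure \<tau> t \<omega>) =
      (\<Sum>i=1..n. \<tau> i \<omega> * cycle_avg f (1 / \<tau> i \<omega>)) + seg_integral 0 l (\<lambda>s. f (to_ext_pos s, to_ext_pos (L - s)))"
      unfolding l_def L_def using T t pos
      by (intro empirical_measure_cycles[OF \<omega> _ _ B(2) _ n]) auto
    ultimately show "\<bar>t * (\<integral>z. f z \<partial>empirical_measure \<tau> t \<omega>) -
      ((\<Sum>i=1..n. \<tau> i \<omega> * cycle_avg f (1 / \<tau> i \<omega>)) + (t - renewal_time \<tau> n \<omega>) * f (\<infinity>, \<infinity>))\<bar> \<le> e * t"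
      by (simp add: l_def)
  qed
qed

text \<open>The difference \<open>k\<close> of \<open>f\<close> and its average over the current
  cycle has average 0 over every complete cycle and value 0 at
  \<open>(\<infinity>, \<infinity>)\<close>. So \<open>empirical_measure_approx\<close> leaves only
  the error term, uniformly over paths.\<close>

lemma empirical_measure_near_cycle_law:
  assumes f: "f \<in> bcont" and e: "0 < e"
  shows "\<exists>T>0. \<forall>t\<ge>T. \<forall>\<omega>\<in>space M. \<forall>n. (\<forall>i\<ge>1. 0 < \<tau> i \<omega>) \<longrightarrow> renewal_time \<tau> n \<omega> \<le> t \<longrightarrow> t \<le> renewal_time \<tau> (Suc n) \<omega> \<longrightarrow>
    \<bar>(\<integral>z. f z \<partial>empirical_measure \<tau> t \<omega>) - (\<integral>z. cycle_avg f (inv_length z) \<partial>empirical_measure \<tau> t \<omega>)\<bar> \<le> e"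
proof -
  define k where "k z = f z - cycle_avg f (inv_length z)" for z
  have f': "(\<lambda>z. cycle_avg f (inv_length z)) \<in> bcont" using cycle_avg_bcont[OF f] by (rule length_function_bcont)
  have k: "k \<in> bcont" unfolding k_def using f f' by (rule diff_bcont)
  have avg: "cycle_avg k x = 0" if "0 \<le> x" for x
    unfolding k_def using cycle_avg_diff[OF f f'] cycle_avg_inv_length[OF that bcont_measurable[OF cycle_avg_bcont[OF f]]]
    by simp
  have k0: "k (\<infinity>, \<infinity>) = 0" using avg[of 0] by simp
  from empirical_measure_approx[OF k e] obtain T where T: "T > 0"
    "\<And>t \<omega> n. T \<le> t \<Longrightarrow> \<omega> \<in> space M \<Longrightarrow> (\<forall>i\<ge>1. 0 < \<tau> i \<omega>) \<Longrightarrow> renewal_time \<tau> n \<omega> \<le> t \<Longrightarrow> t \<le> renewal_time \<tau> (Suc n) \<omega> \<Longrightarrow>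
    \<bar>t * (\<integral>z. k z \<partial>empirical_measure \<tau> t \<omega>) -
      ((\<Sum>i=1..n. \<tau> i \<omega> * cycle_avg k (1 / \<tau> i \<omega>)) + (t - renewal_time \<tau> n \<omega>) * k (\<infinity>, \<infinity>))\<bar> \<le> e * t"
    by blast
  show ?thesis
  proof (intro exI[of _ T] conjI T(1) allI impI ballI)
    fix t \<omega> n assume t: "T \<le> t" and \<omega>: "\<omega> \<in> space M" and pos: "\<forall>i\<ge>1. 0 < \<tau> i \<omega>"
      and n: "renewal_time \<tau> n \<omega> \<le> t" "t \<le> renewal_time \<tau> (Suc n) \<omega>"
    have tp: "0 < t" using T(1) t by simp
    have em: "empirical_measure \<tau> t \<omega> \<in> borel_probs" using \<omega> tp by (rule empirical_measure_borel_probs)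
    have "(\<Sum>i=1..n. \<tau> i \<omega> * cycle_avg k (1 / \<tau> i \<omega>)) = 0"
      using pos by (intro sum.neutral) (auto intro!: avg simp: less_imp_le)
    then have "t * \<bar>\<integral>z. k z \<partial>empirical_measure \<tau> t \<omega>\<bar> \<le> e * t"
      using T(2)[OF t \<omega> pos n] tp by (simp add: k0 abs_mult)
    then have "\<bar>\<integral>z. k z \<partial>empirical_measure \<tau> t \<omega>\<bar> \<le> e" using tp by (simp add: mult.commute)
    then show "\<bar>(\<integral>z. f z \<partial>empirical_measure \<tau> t \<omega>) - (\<integral>z. cycle_avg f (inv_length z) \<partial>empirical_measure \<tau> t \<omega>)\<bar> \<le> e"
      unfolding k_def using integrable_bcont[OF em f] integrable_bcont[OF em f'] by simp
  qed
qed

text \<open>A cycle of length \<open>l\<close> contributes \<open>l * (1 / l) = 1\<close> to the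
  time integral and a cut cycle at most 1, so \<open>n\<close> complete cycles and the last one give
  at most \<open>n + 1\<close>. The truncations \<open>h m\<close> are there because
  \<open>inv_length\<close> is unbounded, while the decomposition into cycles is available for
  bounded functions.\<close>

lemma empirical_measure_inv_length:
  assumes \<omega>: "\<omega> \<in> space M" and pos: "\<And>i. 1 \<le> i \<Longrightarrow> 0 < \<tau> i \<omega>"
    and t: "0 < t" "renewal_time \<tau> n \<omega> \<le> t" "t \<le> renewal_time \<tau> (Suc n) \<omega>"
  shows "(\<integral>\<^sup>+z. ennreal (inv_length z) \<partial>empirical_measure \<tau> t \<omega>) \<le> ennreal (real (Suc n) / t)"
proof -
  have em: "empirical_measure \<tau> t \<omega> \<in> borel_probs" using \<omega> t(1) by (rule empirical_measure_borel_probs)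
  note [measurable_cong] = borel_probsD(2)[OF em]
  define h where "h m x = min (real m) (max 0 x)" for m x
  have hb: "h m \<in> bcont" for m unfolding h_def by (rule bcontI[of _ m]) (auto intro!: continuous_intros)
  note [measurable] = bcont_measurable[OF hb]
  have [measurable]: "(\<lambda>s. (to_ext_pos s, to_ext_pos (l - s))) \<in> borel_measurable borel" for l
    unfolding borel_prod[symmetric] by measurable
  have int: "(\<integral>\<^sup>+z. ennreal (h m (inv_length z)) \<partial>empirical_measure \<tau> t \<omega>) \<le> ennreal (real (Suc n) / t)" for m
  proof -
    have hm: "\<bar>h m (inv_length z)\<bar> \<le> m" for z by (auto simp: h_def)
    have "t * (\<integral>z. h m (inv_length z) \<partial>empirical_measure \<tau> t \<omega>) =
      (\<Sum>i=1..n. \<tau> i \<omega> * cycle_avg (\<lambda>z. h m (inv_length z)) (1 / \<tau> i \<omega>)) +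
      seg_integral 0 (t - renewal_time \<tau> n \<omega>) (\<lambda>s. h m (inv_length (to_ext_pos s, to_ext_pos (\<tau> (Suc n) \<omega> - s))))"
      by (rule empirical_measure_cycles[OF \<omega> pos _ hm t]) auto
    also have "\<dots> \<le> (\<Sum>i=1..n. 1) + 1"
    proof (intro add_mono sum_mono)
      fix i assume "i \<in> {1..n}"
      then have p: "0 < \<tau> i \<omega>" using pos by simp
      then have "\<tau> i \<omega> * cycle_avg (\<lambda>z. h m (inv_length z)) (1 / \<tau> i \<omega>) = \<tau> i \<omega> * h m (1 / \<tau> i \<omega>)"
        by (subst cycle_avg_inv_length) auto
      also have "\<dots> \<le> \<tau> i \<omega> * (1 / \<tau> i \<omega>)" using p by (intro mult_left_mono) (auto simp: h_def)
      finally show "\<tau> i \<omega> * cycle_avg (\<lambda>z. h m (inv_length z)) (1 / \<tau> i \<omega>) \<le> 1" using p by simp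
    next
      let ?l = "t - renewal_time \<tau> n \<omega>" and ?L = "\<tau> (Suc n) \<omega>"
      have L: "0 < ?L" "0 \<le> ?l" "?l \<le> ?L" using pos[of "Suc n"] t by (auto simp: renewal_time_Suc)
      have "seg_integral 0 ?l (\<lambda>s. h m (inv_length (to_ext_pos s, to_ext_pos (?L - s)))) \<le> seg_integral 0 ?l (\<lambda>_. 1 / ?L)"
      proof (rule seg_integral_mono[where B=m and C="1 / ?L"])
        fix s assume s: "0 < s" "s < ?l"
        have "inv_length (to_ext_pos s, to_ext_pos (?L - s)) = 1 / ?L"
          using s L by (simp add: inv_length_def recip_to_ext_pos field_simps)
        then show "h m (inv_length (to_ext_pos s, to_ext_pos (?L - s))) \<le> 1 / ?L" using L by (simp add: h_def)
      qed (use hm L in auto)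
      also have "\<dots> \<le> 1" using L by (simp add: seg_integral_const)
      finally show "seg_integral 0 ?l (\<lambda>s. h m (inv_length (to_ext_pos s, to_ext_pos (?L - s)))) \<le> 1" .
    qed
    finally have "(\<integral>z. h m (inv_length z) \<partial>empirical_measure \<tau> t \<omega>) \<le> real (Suc n) / t"
      using t(1) by (simp add: field_simps)
    moreover have "(\<integral>\<^sup>+z. ennreal (h m (inv_length z)) \<partial>empirical_measure \<tau> t \<omega>) = ennreal (\<integral>z. h m (inv_length z) \<partial>empirical_measure \<tau> t \<omega>)"
      by (rule nn_integral_eq_integral[OF integrable_bcont[OF em length_function_bcont[OF hb]]]) (auto simp: h_def)
    ultimately show ?thesis by (simp add: ennreal_leI)
  qed
  have "(\<integral>\<^sup>+z. ennreal (inv_length z) \<partial>empirical_measure \<tau> t \<omega>) =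
    (\<integral>\<^sup>+z. (SUP m. ennreal (h m (inv_length z))) \<partial>empirical_measure \<tau> t \<omega>)"
  proof (intro nn_integral_cong antisym)
    fix z :: "ext_pos \<times> ext_pos"
    obtain m :: nat where "inv_length z \<le> m" using real_arch_simple by blast
    then have "ennreal (inv_length z) \<le> ennreal (h m (inv_length z))" by (intro ennreal_leI) (auto simp: h_def)
    then show "ennreal (inv_length z) \<le> (SUP m. ennreal (h m (inv_length z)))" by (rule SUP_upper2[OF UNIV_I])
    show "(SUP m. ennreal (h m (inv_length z))) \<le> ennreal (inv_length z)"
      by (intro SUP_least ennreal_leI) (auto simp: h_def)
  qed
  also have "\<dots> = (SUP m. \<integral>\<^sup>+z. ennreal (h m (inv_length z)) \<partial>empirical_measure \<tau> t \<omega>)"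
    by (intro nn_integral_monotone_convergence_SUP)
      (auto simp: incseq_def le_fun_def h_def intro!: ennreal_leI)
  also have "\<dots> \<le> ennreal (real (Suc n) / t)" using int by (intro SUP_least)
  finally show ?thesis .
qed

end

section \<open>Relative entropy\<close>

lemma bcont_dense_L1_indicator:
  fixes \<mu> :: "real measure"
  assumes \<mu>: "\<mu> \<in> borel_probs" and A: "A \<in> sets borel" and e: "0 < e"
  shows "\<exists>h\<in>bcont. (\<integral>x. \<bar>indicator A x - h x\<bar> \<partial>\<mu>) < e"
proof -
  interpret prob_space \<mu> using \<mu> borel_probsD by blast
  have s[measurable_cong]: "sets \<mu> = sets borel" using \<mu> borel_probsD by blast
  note [measurable] = A
  have sup: "emeasure \<mu> A = (SUP K\<in>{K. K \<subseteq> A \<and> compact K}. emeasure \<mu> K)"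
    using A s by (intro inner_regular) auto
  have "\<exists>K\<in>{K. K \<subseteq> A \<and> compact K}. emeasure \<mu> A < emeasure \<mu> K + ennreal (e / 2)"
  proof (rule ccontr)
    assume "\<not> ?thesis"
    then have "emeasure \<mu> K + ennreal (e / 2) \<le> emeasure \<mu> A" if "K \<subseteq> A" "compact K" for K
      using that by (auto simp: not_less)
    then have "prob K \<le> prob A - e / 2" if "K \<subseteq> A" "compact K" for K
      using that e by (auto simp: emeasure_eq_measure simp flip: ennreal_plus) (smt (verit) ennreal_le_iff measure_nonneg)
    then have "emeasure \<mu> K \<le> ennreal (prob A - e / 2)" if "K \<subseteq> A" "compact K" for K
      using that by (auto simp: emeasure_eq_measure intro!: ennreal_leI)
    then have "(SUP K\<in>{K. K \<subseteq> A \<and> compact K}. emeasure \<mu> K) \<le> ennreal (prob A - e / 2)"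
      by (intro SUP_least) auto
    then have le: "ennreal (prob A) \<le> ennreal (prob A - e / 2)"
      using sup by (simp add: emeasure_eq_measure)
    have "prob {} \<le> prob A - e / 2"
      using \<open>\<And>K. K \<subseteq> A \<Longrightarrow> compact K \<Longrightarrow> prob K \<le> prob A - e / 2\<close>[of "{}"] by simp
    then show False using le e by (simp add: ennreal_le_iff)
  qed
  then obtain K where K: "K \<subseteq> A" "compact K" "emeasure \<mu> A < emeasure \<mu> K + ennreal (e / 2)" by blast
  have Kb[measurable]: "K \<in> sets borel" using K(2) by (simp add: borel_compact)
  have AK: "prob A < prob K + e / 2"
  proof -
    have "ennreal (prob K) + ennreal (e / 2) = ennreal (prob K + e / 2)"
      using e by (intro ennreal_plus[symmetric]) auto
    then show ?thesis using K(3) by (simp add: emeasure_eq_measure ennreal_less_iff)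
  qed
  have "(\<integral>x. \<bar>indicator A x - indicator K x\<bar> \<partial>\<mu>) = (\<integral>x. (indicator (A - K) x :: real) \<partial>\<mu>)"
    using K(1) by (intro Bochner_Integration.integral_cong) (auto split: split_indicator)
  also have "\<dots> = prob A - prob K"
    using K(1) s finite_measure_Diff[of A K] by (simp add: Int_absorb1)
  finally have 1: "(\<integral>x. \<bar>indicator A x - indicator K x\<bar> \<partial>\<mu>) < e / 2" using AK by simp
  show ?thesis
  \<comment> \<open>\<open>infdist\<close> to the empty set is 0 by convention, which would turn the
    functions \<open>h n\<close> below into the constant 1.\<close>
  proof (cases "K = {}")
    case True
    have "(\<lambda>_. 0) \<in> bcont" by (rule bcontI[of _ 0]) auto
    then show ?thesis using 1 True e by (intro bexI[of _ "\<lambda>_. 0"]) auto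
  next
    case False
    \<comment> \<open>Equal to 1 on \<open>K\<close> and decreasing to its indicator, because the
      distance to a closed set vanishes only on that set.\<close>
    define h where "h n x = max 0 (1 - real n * infdist x K)" for n x
    have hb: "h n \<in> bcont" for n
      unfolding h_def by (rule bcontI[of _ 1]) (auto intro!: continuous_intros simp: infdist_nonneg)
    note [measurable] = bcont_measurable[OF hb]
    have "(\<lambda>n. \<integral>x. \<bar>indicator K x - h n x\<bar> \<partial>\<mu>) \<longlonglongrightarrow> (\<integral>x. 0 \<partial>\<mu>)"
    proof (rule integral_dominated_convergence[where w="\<lambda>_. 1"])
      show "AE x in \<mu>. (\<lambda>n. \<bar>indicator K x - h n x\<bar>) \<longlonglongrightarrow> 0"
      proof (rule AE_I2)
        fix x
        show "(\<lambda>n. \<bar>indicator K x - h n x\<bar>) \<longlonglongrightarrow> 0"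
        proof (cases "x \<in> K")
          case False
          then have d: "0 < infdist x K"
            using K(2) \<open>K \<noteq> {}\<close> by (metis compact_imp_closed in_closed_iff_infdist_zero infdist_nonneg order_less_le)
          obtain m :: nat where m: "1 / infdist x K < m" using reals_Archimedean2 by blast
          have "\<bar>indicator K x - h n x\<bar> = 0" if "m \<le> n" for n
          proof -
            have "1 / infdist x K \<le> real n" using m that by (smt (verit) of_nat_mono)
            then have "1 \<le> real n * infdist x K" using d by (simp add: divide_le_eq)
            then show ?thesis using False by (simp add: h_def)
          qed
          then show ?thesis by (intro tendsto_eventually eventually_sequentiallyI[of m]) auto
        qed (simp add: h_def)
      qed
      show "AE x in \<mu>. norm \<bar>indicator K x - h n x\<bar> \<le> 1" for n
        by (auto simp: h_def infdist_nonneg max_def split: split_indicator)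
    qed auto
    then have "\<forall>\<^sub>F n in sequentially. (\<integral>x. \<bar>indicator K x - h n x\<bar> \<partial>\<mu>) < e / 2"
      using e by (intro order_tendstoD(2)) auto
    then obtain n where n: "(\<integral>x. \<bar>indicator K x - h n x\<bar> \<partial>\<mu>) < e / 2" by (auto simp: eventually_sequentially)
    have hn: "\<bar>h n x\<bar> \<le> 1" for x by (auto simp: h_def infdist_nonneg)
    have i: "integrable \<mu> (\<lambda>x. \<bar>indicator A x - indicator K x\<bar> :: real)" "integrable \<mu> (\<lambda>x. \<bar>indicator K x - h n x\<bar>)"
       "integrable \<mu> (\<lambda>x. \<bar>indicator A x - h n x\<bar>)"
      using hn by (auto intro!: integrable_const_bound[of _ 2] AE_I2 split: split_indicator simp: abs_le_iff) (smt (verit) hn)+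
    have "(\<integral>x. \<bar>indicator A x - h n x\<bar> \<partial>\<mu>) \<le> (\<integral>x. \<bar>indicator A x - indicator K x\<bar> + \<bar>indicator K x - h n x\<bar> \<partial>\<mu>)"
      using i by (intro integral_mono) auto
    also have "\<dots> < e" using i 1 n by simp
    finally show ?thesis using hb by blast
  qed
qed

lemma bcont_dense_L1:
  fixes \<mu> :: "real measure" and f :: "real \<Rightarrow> real"
  assumes \<mu>: "\<mu> \<in> borel_probs" and f: "integrable \<mu> f"
  shows "\<forall>e>0. \<exists>h\<in>bcont. (\<integral>x. \<bar>f x - h x\<bar> \<partial>\<mu>) < e"
  using f
proof (induction rule: integrable_induct)
  case (base A c)
  interpret prob_space \<mu> using \<mu> borel_probsD by blast
  show ?case
  proof (intro allI impI)
    fix e :: real assume e: "0 < e"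
    obtain h where h: "h \<in> bcont" "(\<integral>x. \<bar>indicator A x - h x\<bar> \<partial>\<mu>) < e / (\<bar>c\<bar> + 1)"
      using bcont_dense_L1_indicator[OF \<mu>, of A "e / (\<bar>c\<bar> + 1)"] base(1) borel_probsD(2)[OF \<mu>] e by auto
    have "(\<lambda>x. h x * c) \<in> bcont"
      using h(1) by (auto simp: bcont_def bounded_iff abs_mult intro!: continuous_intros) (metis abs_ge_zero mult_right_mono)
    moreover have "(\<integral>x. \<bar>indicator A x *\<^sub>R c - h x * c\<bar> \<partial>\<mu>) < e"
    proof -
      have "(\<integral>x. \<bar>indicator A x *\<^sub>R c - h x * c\<bar> \<partial>\<mu>) = (\<integral>x. \<bar>c\<bar> * \<bar>indicator A x - h x\<bar> \<partial>\<mu>)"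
        by (intro Bochner_Integration.integral_cong) (auto simp: abs_mult[symmetric] algebra_simps)
      also have "\<dots> = \<bar>c\<bar> * (\<integral>x. \<bar>indicator A x - h x\<bar> \<partial>\<mu>)" by simp
      also have "\<dots> \<le> (\<bar>c\<bar> + 1) * (\<integral>x. \<bar>indicator A x - h x\<bar> \<partial>\<mu>)"
        by (intro mult_right_mono integral_nonneg) auto
      also have "\<dots> < e" using h(2) by (simp add: field_simps add_pos_nonneg)
      finally show ?thesis .
    qed
    ultimately show "\<exists>h\<in>bcont. (\<integral>x. \<bar>indicator A x *\<^sub>R c - h x\<bar> \<partial>\<mu>) < e"
      by (intro bexI[of _ "\<lambda>x. h x * c"])
  qed
next
  case (add f g)
  show ?case
  proof (intro allI impI)
    fix e :: real assume e: "0 < e"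
    obtain h where h: "h \<in> bcont" "(\<integral>x. \<bar>f x - h x\<bar> \<partial>\<mu>) < e / 2" using add(3) e by (meson half_gt_zero)
    obtain k where k: "k \<in> bcont" "(\<integral>x. \<bar>g x - k x\<bar> \<partial>\<mu>) < e / 2" using add(4) e by (meson half_gt_zero)
    have hk: "(\<lambda>x. h x + k x) \<in> bcont"
      using h k by (auto simp: bcont_def intro!: continuous_intros bounded_plus_comp)
    note [simp] = integrable_bcont[OF \<mu> h(1)] integrable_bcont[OF \<mu> k(1)] add(1,2)
    have "(\<integral>x. \<bar>(f x + g x) - (h x + k x)\<bar> \<partial>\<mu>) \<le> (\<integral>x. \<bar>f x - h x\<bar> + \<bar>g x - k x\<bar> \<partial>\<mu>)"
      by (intro integral_mono) auto
    also have "\<dots> < e" using h k by simp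
    finally show "\<exists>h\<in>bcont. (\<integral>x. \<bar>f x + g x - h x\<bar> \<partial>\<mu>) < e"
      using hk by (intro bexI[of _ "\<lambda>x. h x + k x"])
  qed
next
  case (lim f s)
  show ?case
  proof (intro allI impI)
    fix e :: real assume e: "0 < e"
    note m = borel_measurable_integrable
    have "(\<lambda>n. \<integral>x. \<bar>f x - s n x\<bar> \<partial>\<mu>) \<longlonglongrightarrow> (\<integral>x. 0 \<partial>\<mu>)"
    proof (rule integral_dominated_convergence[where w="\<lambda>x. 3 * \<bar>f x\<bar>"])
      show "AE x in \<mu>. (\<lambda>n. \<bar>f x - s n x\<bar>) \<longlonglongrightarrow> 0"
      proof (rule AE_I2)
        fix x assume "x \<in> space \<mu>"
        then have "(\<lambda>n. s n x) \<longlonglongrightarrow> f x" using lim by blast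
        then have "(\<lambda>n. \<bar>f x - s n x\<bar>) \<longlonglongrightarrow> \<bar>f x - f x\<bar>" by (intro tendsto_intros)
        then show "(\<lambda>n. \<bar>f x - s n x\<bar>) \<longlonglongrightarrow> 0" by simp
      qed
      show "AE x in \<mu>. norm \<bar>f x - s n x\<bar> \<le> 3 * \<bar>f x\<bar>" for n
      proof (rule AE_I2)
        fix x assume "x \<in> space \<mu>"
        then have "norm (s n x) \<le> 2 * norm (f x)" using lim by blast
        then show "norm \<bar>f x - s n x\<bar> \<le> 3 * \<bar>f x\<bar>" by simp
      qed
    qed (use lim m in auto)
    then have "\<forall>\<^sub>F n in sequentially. (\<integral>x. \<bar>f x - s n x\<bar> \<partial>\<mu>) < e / 2"
      using e by (intro order_tendstoD(2)) auto
    then obtain n where n: "(\<integral>x. \<bar>f x - s n x\<bar> \<partial>\<mu>) < e / 2" by (auto simp: eventually_sequentially)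
    obtain h where h: "h \<in> bcont" "(\<integral>x. \<bar>s n x - h x\<bar> \<partial>\<mu>) < e / 2" using lim.IH[of n] e by (meson half_gt_zero)
    have [simp]: "integrable \<mu> h" "integrable \<mu> (s n)" "integrable \<mu> f"
      using integrable_bcont[OF \<mu> h(1)] lim by blast+
    have "(\<integral>x. \<bar>f x - h x\<bar> \<partial>\<mu>) \<le> (\<integral>x. \<bar>f x - s n x\<bar> + \<bar>s n x - h x\<bar> \<partial>\<mu>)"
      by (intro integral_mono) auto
    also have "\<dots> < e" using n h by simp
    finally show "\<exists>h\<in>bcont. (\<integral>x. \<bar>f x - h x\<bar> \<partial>\<mu>) < e" using h by blast
  qed
qed


section \<open>Bounding the relative entropy from below by test functions\<close>

lemma rel_entropy_density:
  fixes \<psi> \<nu> :: "real measure"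
  assumes \<psi>: "\<psi> \<in> borel_probs" and \<nu>: "\<nu> \<in> borel_probs" and ac: "absolutely_continuous \<psi> \<nu>"
  obtains D :: "real \<Rightarrow> real" where "D \<in> borel_measurable borel" "\<And>x. 0 \<le> D x"
    "\<nu> = density \<psi> (\<lambda>x. ennreal (D x))" "AE x in \<nu>. 0 < D x"
    "rel_entropy \<nu> \<psi> = (if integrable \<nu> (\<lambda>x. ln (D x)) then ereal (\<integral>x. ln (D x) \<partial>\<nu>) else \<infinity>)"
proof -
  interpret \<psi>: prob_space \<psi> using \<psi> borel_probsD by blast
  interpret \<nu>: prob_space \<nu> using \<nu> borel_probsD by blast
  have s[measurable_cong]: "sets \<psi> = sets borel" "sets \<nu> = sets borel" using \<psi> \<nu> borel_probsD by blast+
  obtain D where D: "D \<in> borel_measurable \<psi>" "AE x in \<psi>. RN_deriv \<psi> \<nu> x = ennreal (D x)"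
    "AE x in \<nu>. 0 < D x" "\<And>x. 0 \<le> D x"
    using \<psi>.real_RN_deriv[OF \<nu>.finite_measure_axioms ac] s by auto
  have D1[measurable]: "D \<in> borel_measurable borel" using D(1) \<psi> borel_probsD(4) by blast
  have dens: "\<nu> = density \<psi> (\<lambda>x. ennreal (D x))"
  proof -
    have "density \<psi> (RN_deriv \<psi> \<nu>) = density \<psi> (\<lambda>x. ennreal (D x))"
      using D(2) by (intro density_cong) auto
    then show ?thesis using \<psi>.density_RN_deriv[OF ac] s by simp
  qed
  have "AE x in \<nu>. RN_deriv \<psi> \<nu> x = ennreal (D x)"
    using absolutely_continuous_AE[OF _ ac D(2)] s by simp
  then have ae: "AE x in \<nu>. entropy_density (exp 1) \<psi> \<nu> x = ln (D x)"
    by eventually_elim (simp add: entropy_density_def D(4) log_ln[symmetric])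
  have "integrable \<nu> (entropy_density (exp 1) \<psi> \<nu>) \<longleftrightarrow> integrable \<nu> (\<lambda>x. ln (D x))"
    using ae measurable_entropy_density[of "exp 1" \<psi> \<nu>] borel_probsD(4)[OF \<psi>] borel_probsD(4)[OF \<nu>]
    by (intro integrable_cong_AE) auto
  moreover have "KL_divergence (exp 1) \<psi> \<nu> = (\<integral>x. ln (D x) \<partial>\<nu>)"
    unfolding KL_divergence_def
    using ae measurable_entropy_density[of "exp 1" \<psi> \<nu>] borel_probsD(4)[OF \<psi>] borel_probsD(4)[OF \<nu>]
    by (intro integral_cong_AE) auto
  ultimately have "rel_entropy \<nu> \<psi> = (if integrable \<nu> (\<lambda>x. ln (D x)) then ereal (\<integral>x. ln (D x) \<partial>\<nu>) else \<infinity>)"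
    using ac by (simp add: rel_entropy_def)
  then show thesis using that D1 D(3,4) dens by blast
qed

text \<open>The tangent at \<open>a\<close> lies below the exponential function. With both functions
  bounded by \<open>K\<close>, closeness in mean thus controls exponential moments.\<close>

lemma exp_abs_diff_le:
  fixes a b K :: real
  assumes "a \<le> K"
  shows "exp a \<le> exp b + exp K * \<bar>a - b\<bar>"
proof -
  have "exp a * (1 + (b - a)) \<le> exp a * exp (b - a)"
    by (intro mult_left_mono exp_ge_add_one_self) auto
  then have "exp a - exp b \<le> exp a * (a - b)" by (simp add: algebra_simps flip: exp_add)
  also have "\<dots> \<le> exp a * \<bar>a - b\<bar>" by (intro mult_left_mono) auto
  also have "\<dots> \<le> exp K * \<bar>a - b\<bar>" using assms by (intro mult_right_mono) auto
  finally show ?thesis by simp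
qed

text \<open>For a density \<open>D\<close> of \<open>\<nu>\<close> with respect to
  \<open>\<psi>\<close> this bounds the \<open>\<nu>\<close>-integral of the negative part of
  \<open>ln D\<close> by 1, so a failure of integrability can only come from the positive
  part.\<close>

lemma negative_part_ln_le: "0 \<le> x \<Longrightarrow> x * max 0 (- ln x) \<le> (1::real)"
proof (cases "x = 0")
  case False
  assume "0 \<le> x"
  with False have x: "0 < x" by simp
  have "- ln x = ln (1 / x)" using x by (simp add: ln_div)
  also have "\<dots> \<le> 1 / x" using x ln_le_minus_one[of "1 / x"] by simp
  finally show ?thesis using x by (auto simp: max_def field_simps)
qed simp

text \<open>The harder half of the Donsker-Varadhan formula, normalized so that the exponential
  moment is strictly below 1, as the later geometric series requires. The natural candidate is
  \<open>ln D\<close>, with exponential moment at most 1; it is truncated and then lowered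
  slightly.\<close>

lemma rel_entropy_variational_measurable:
  fixes \<psi> \<nu> :: "real measure"
  assumes \<psi>: "\<psi> \<in> borel_probs" and \<nu>: "\<nu> \<in> borel_probs" and a: "ereal a < rel_entropy \<nu> \<psi>"
  shows "\<exists>h K. h \<in> borel_measurable borel \<and> (\<forall>x. \<bar>h x\<bar> \<le> K) \<and> (\<integral>x. exp (h x) \<partial>\<psi>) < 1 \<and> a < (\<integral>x. h x \<partial>\<nu>)"
proof -
  interpret \<psi>: prob_space \<psi> using \<psi> borel_probsD by blast
  interpret \<nu>: prob_space \<nu> using \<nu> borel_probsD by blast
  have s[measurable_cong]: "sets \<psi> = sets borel" "sets \<nu> = sets borel" using \<psi> \<nu> borel_probsD by blast+
  show ?thesis
  proof (cases "absolutely_continuous \<psi> \<nu>")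
    case False
    then obtain A where A: "A \<in> null_sets \<psi>" "A \<notin> null_sets \<nu>" by (auto simp: absolutely_continuous_def)
    then have Ab[measurable]: "A \<in> sets borel" using s by auto
    have p: "0 < \<nu>.prob A" using A s by (auto simp: \<nu>.emeasure_eq_measure zero_less_measure_iff null_sets_def)
    \<comment> \<open>Off \<open>A\<close> the test function is \<open>-1\<close>, so its
      exponential moment under \<open>\<psi>\<close> is \<open>exp (- 1)\<close>; on
      \<open>A\<close>, invisible to \<open>\<psi>\<close>, it is large enough for the
      \<open>\<nu>\<close>-integral to be \<open>\<bar>a\<bar> + 1\<close>.\<close>
    define K where "K = (\<bar>a\<bar> + 2) / \<nu>.prob A"
    have K: "0 \<le> K" using p by (simp add: K_def)
    define h :: "real \<Rightarrow> real" where "h x = K * indicator A x - 1" for x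
    have h[measurable]: "h \<in> borel_measurable borel" unfolding h_def by measurable
    have hb: "\<bar>h x\<bar> \<le> K + 1" for x using K by (auto simp: h_def split: split_indicator)
    have "(\<integral>x. exp (h x) \<partial>\<psi>) = (\<integral>x. exp (- 1) \<partial>\<psi>)"
    proof (rule integral_cong_AE)
      show "AE x in \<psi>. exp (h x) = exp (- 1)"
        using AE_not_in[OF A(1)] by eventually_elim (simp add: h_def)
    qed auto
    then have "(\<integral>x. exp (h x) \<partial>\<psi>) < 1" by (simp add: \<psi>.prob_space)
    moreover have "(\<integral>x. h x \<partial>\<nu>) = K * \<nu>.prob A - 1"
    proof -
      have "integrable \<nu> (\<lambda>x. K * indicator A x)" by (rule \<nu>.integrable_const_bound[of _ K]) (use K in \<open>auto split: split_indicator\<close>)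
      then show ?thesis unfolding h_def using Ab s(2) borel_probsD(3)[OF \<nu>] \<nu>.prob_space by simp
    qed
    then have "a < (\<integral>x. h x \<partial>\<nu>)" using p by (simp add: K_def)
    ultimately show ?thesis using h hb by blast
  next
    case True
    from rel_entropy_density[OF \<psi> \<nu> True] obtain D where D[measurable]: "D \<in> borel_measurable borel"
      and D0: "\<And>x. 0 \<le> D x"
      and dens: "\<nu> = density \<psi> (\<lambda>x. ennreal (D x))" and Dpos: "AE x in \<nu>. 0 < D x"
      and ent: "rel_entropy \<nu> \<psi> = (if integrable \<nu> (\<lambda>x. ln (D x)) then ereal (\<integral>x. ln (D x) \<partial>\<nu>) else \<infinity>)"
      by blast
    \<comment> \<open>Cutting off at \<open>- m\<close> from below can raise the exponential only up
      to \<open>exp (- m)\<close>, so the exponential moment exceeds 1 by at most this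
      amount.\<close>
    define h :: "nat \<Rightarrow> real \<Rightarrow> real" where
      "h m x = (if 0 < D x then max (- real m) (min (real m) (ln (D x))) else - real m)" for m x
    have h[measurable]: "h m \<in> borel_measurable borel" for m unfolding h_def by measurable
    have hb: "\<bar>h m x\<bar> \<le> m" for m x by (auto simp: h_def)
    have hi: "integrable \<nu> (h m)" for m by (rule \<nu>.integrable_const_bound[of _ m]) (use hb in auto)
    have exph: "exp (h m x) \<le> D x + exp (- real m)" for m x
    proof (cases "0 < D x")
      case True
      have "exp (h m x) \<le> exp (max (- real m) (ln (D x)))" using True by (simp add: h_def)
      also have "\<dots> \<le> D x + exp (- real m)" using True by (simp add: max_def)
      finally show ?thesis .
    qed (use D0[of x] in \<open>simp add: h_def\<close>)
    have D1: "(\<integral>\<^sup>+x. ennreal (D x) \<partial>\<psi>) = 1"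
      using \<nu>.emeasure_space_1 unfolding dens by (subst (asm) emeasure_density) (auto cong: nn_integral_cong)
    have Dint: "integrable \<psi> D" "(\<integral>x. D x \<partial>\<psi>) = 1"
      using D1 D0 by (auto intro!: integrableI_nonneg simp: integral_eq_nn_integral)
    have psih: "(\<integral>x. exp (h m x) \<partial>\<psi>) \<le> 1 + exp (- real m)" for m
    proof -
      have "(\<integral>x. exp (h m x) \<partial>\<psi>) \<le> (\<integral>x. D x + exp (- real m) \<partial>\<psi>)"
      proof (rule integral_mono)
        show "integrable \<psi> (\<lambda>x. exp (h m x))"
          using hb[of m] by (intro \<psi>.integrable_const_bound[of _ "exp m"]) (auto simp: abs_le_iff)
      qed (use exph Dint in auto)
      then show ?thesis using Dint by (simp add: \<psi>.prob_space)
    qed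
    \<comment> \<open>The margin pays for lowering \<open>h m\<close> by twice
      \<open>exp (- m)\<close>, after which the exponential moment is at most
      \<open>(1 + x) * exp (- 2 * x) \<le> exp (- x) < 1\<close> with
      \<open>x = exp (- m)\<close>.\<close>
    have main: "\<exists>m. a + 2 * exp (- real m) < (\<integral>x. h m x \<partial>\<nu>)"
    proof (cases "integrable \<nu> (\<lambda>x. ln (D x))")
      case True
      then have "a < (\<integral>x. ln (D x) \<partial>\<nu>)" using a ent by simp
      moreover have "(\<lambda>m. (\<integral>x. h m x \<partial>\<nu>) - 2 * exp (- real m)) \<longlonglongrightarrow> (\<integral>x. ln (D x) \<partial>\<nu>) - 2 * 0"
      proof (intro tendsto_intros)
        show "(\<lambda>m. exp (- real m)) \<longlonglongrightarrow> 0" 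
          by (rule filterlim_compose[OF exp_at_bot]) (simp add: filterlim_uminus_at_bot filterlim_real_sequentially)
        show "(\<lambda>m. \<integral>x. h m x \<partial>\<nu>) \<longlonglongrightarrow> (\<integral>x. ln (D x) \<partial>\<nu>)"
        proof (rule integral_dominated_convergence[where w="\<lambda>x. \<bar>ln (D x)\<bar>"])
          show "AE x in \<nu>. (\<lambda>m. h m x) \<longlonglongrightarrow> ln (D x)"
            using Dpos
          proof eventually_elim
            case (elim x)
            obtain k :: nat where k: "\<bar>ln (D x)\<bar> \<le> k" using real_arch_simple by blast
            have "h n x = ln (D x)" if "k \<le> n" for n
            proof -
              have "\<bar>ln (D x)\<bar> \<le> n" using k that by (smt (verit) of_nat_mono)
              then show ?thesis using elim by (auto simp: h_def abs_le_iff)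
            qed
            then show ?case by (intro tendsto_eventually eventually_sequentiallyI[of k]) auto
          qed
          show "AE x in \<nu>. norm (h m x) \<le> \<bar>ln (D x)\<bar>" for m
            using Dpos by eventually_elim (auto simp: h_def)
        qed (use True in auto)
      qed
      ultimately have "\<forall>\<^sub>F m in sequentially. a < (\<integral>x. h m x \<partial>\<nu>) - 2 * exp (- real m)"
        by (intro order_tendstoD(1)) auto
      then show ?thesis by (auto simp: eventually_sequentially less_diff_eq)
    next
      case False
      show ?thesis
      proof (rule ccontr)
        \<comment> \<open>Then the truncated positive parts of \<open>ln D\<close> have bounded
          integrals, since the negative part is integrable in any case. Monotone convergence would
          make \<open>ln D\<close> integrable.\<close>
        assume "\<nexists>m. a + 2 * exp (- real m) < (\<integral>x. h m x \<partial>\<nu>)"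
        then have "(\<integral>x. h m x \<partial>\<nu>) \<le> a + 2 * exp (- real m)" for m by (simp add: not_less)
        moreover have "exp (- real m) \<le> 1" for m by simp
        ultimately have hm: "(\<integral>x. h m x \<partial>\<nu>) \<le> a + 2" for m by (smt (verit))
        have "(\<integral>\<^sup>+x. ennreal (max 0 (- ln (D x))) \<partial>\<nu>) = (\<integral>\<^sup>+x. ennreal (D x) * ennreal (max 0 (- ln (D x))) \<partial>\<psi>)"
          unfolding dens by (intro nn_integral_density) auto
        also have "\<dots> \<le> (\<integral>\<^sup>+x. 1 \<partial>\<psi>)"
        proof (intro nn_integral_mono)
          fix x
          have "ennreal (D x * max 0 (- ln (D x))) \<le> ennreal 1" by (intro ennreal_leI negative_part_ln_le D0)
          then show "ennreal (D x) * ennreal (max 0 (- ln (D x))) \<le> 1" using D0 by (simp add: ennreal_mult)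
        qed
        also have "\<dots> = 1" using \<psi>.emeasure_space_1 by simp
        finally have neg: "(\<integral>\<^sup>+x. ennreal (max 0 (- ln (D x))) \<partial>\<nu>) \<le> 1" .
        then have negi: "integrable \<nu> (\<lambda>x. max 0 (- ln (D x)))"
          by (intro integrableI_nonneg) (auto intro: le_less_trans)
        have neg1: "(\<integral>x. max 0 (- ln (D x)) \<partial>\<nu>) \<le> 1"
          using neg negi by (subst (asm) nn_integral_eq_integral) auto
        have pm: "(\<integral>x. min (real m) (max 0 (ln (D x))) \<partial>\<nu>) \<le> a + 3" for m
        proof -
          have pi: "integrable \<nu> (\<lambda>x. min (real m) (max 0 (ln (D x))))"
            by (rule \<nu>.integrable_const_bound[of _ m]) auto
          have "(\<integral>x. min (real m) (max 0 (ln (D x))) \<partial>\<nu>) \<le> (\<integral>x. h m x + max 0 (- ln (D x)) \<partial>\<nu>)"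
            using Dpos by (intro integral_mono_AE Bochner_Integration.integrable_add pi hi negi) (auto elim!: eventually_mono simp: h_def)
          also have "\<dots> \<le> a + 3" using hm[of m] neg1 hi negi by simp
          finally show ?thesis .
        qed
        have pmn: "(\<integral>\<^sup>+x. ennreal (min (real m) (max 0 (ln (D x)))) \<partial>\<nu>) \<le> ennreal (a + 3)" for m
        proof -
          have pi: "integrable \<nu> (\<lambda>x. min (real m) (max 0 (ln (D x))))"
            by (rule \<nu>.integrable_const_bound[of _ m]) auto
          show ?thesis using pm[of m] by (subst nn_integral_eq_integral[OF pi]) (auto intro!: ennreal_leI)
        qed
        have "(\<integral>\<^sup>+x. ennreal (max 0 (ln (D x))) \<partial>\<nu>) = (\<integral>\<^sup>+x. (SUP m. ennreal (min (real m) (max 0 (ln (D x))))) \<partial>\<nu>)"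
        proof (intro nn_integral_cong antisym)
          fix x :: real
          obtain m :: nat where "ln (D x) \<le> m" using real_arch_simple by blast
          then have "ennreal (max 0 (ln (D x))) \<le> ennreal (min (real m) (max 0 (ln (D x))))" by (intro ennreal_leI) auto
          then show "ennreal (max 0 (ln (D x))) \<le> (SUP m. ennreal (min (real m) (max 0 (ln (D x)))))" by (rule SUP_upper2[OF UNIV_I])
          show "(SUP m. ennreal (min (real m) (max 0 (ln (D x))))) \<le> ennreal (max 0 (ln (D x)))"
            by (intro SUP_least ennreal_leI) auto
        qed
        also have "\<dots> = (SUP m. \<integral>\<^sup>+x. ennreal (min (real m) (max 0 (ln (D x)))) \<partial>\<nu>)"
          by (intro nn_integral_monotone_convergence_SUP) (auto simp: incseq_def le_fun_def intro!: ennreal_leI)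
        also have "\<dots> \<le> ennreal (a + 3)" using pmn by (intro SUP_least)
        finally have "integrable \<nu> (\<lambda>x. max 0 (ln (D x)))"
          by (intro integrableI_nonneg) (auto intro: le_less_trans)
        from Bochner_Integration.integrable_diff[OF this negi]
        have "integrable \<nu> (\<lambda>x. ln (D x))" by (rule Bochner_Integration.integrable_cong[THEN iffD1, rotated -1]) auto
        then show False using False by simp
      qed
    qed
    then obtain m where m: "a + 2 * exp (- real m) < (\<integral>x. h m x \<partial>\<nu>)" by blast
    let ?x = "exp (- real m)"
    show ?thesis
    proof (intro exI[of _ "\<lambda>x. h m x - 2 * ?x"] exI[of _ "real m + 2 * ?x"] conjI allI)
      show "\<bar>h m x - 2 * ?x\<bar> \<le> real m + 2 * ?x" for x
        using hb[of m x] exp_gt_zero[of "- real m"] by linarith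
      have "(\<integral>x. exp (h m x - 2 * ?x) \<partial>\<psi>) = (\<integral>x. exp (h m x) * exp (- 2 * ?x) \<partial>\<psi>)"
        by (intro Bochner_Integration.integral_cong) (auto simp flip: exp_add)
      also have "\<dots> = (\<integral>x. exp (h m x) \<partial>\<psi>) * exp (- 2 * ?x)" by simp
      also have "\<dots> \<le> (1 + ?x) * exp (- 2 * ?x)" using psih by (intro mult_right_mono) auto
      also have "\<dots> \<le> exp ?x * exp (- 2 * ?x)" by (intro mult_right_mono exp_ge_add_one_self) auto
      also have "\<dots> = exp (- ?x)" by (simp flip: exp_add)
      also have "\<dots> < 1" by simp
      finally show "(\<integral>x. exp (h m x - 2 * ?x) \<partial>\<psi>) < 1" .
      show "a < (\<integral>x. h m x - 2 * ?x \<partial>\<nu>)" using m hi by (simp add: \<nu>.prob_space)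
    qed auto
  qed
qed

text \<open>The measurable test function is replaced by a continuous one that is close to it in mean
  under \<open>\<psi>\<close> and \<open>\<nu>\<close> simultaneously; both strict inequalities
  leave room for the error.\<close>

lemma rel_entropy_variational:
  fixes \<psi> \<nu> :: "real measure"
  assumes \<psi>: "\<psi> \<in> borel_probs" and \<nu>: "\<nu> \<in> borel_probs" and a: "ereal a < rel_entropy \<nu> \<psi>"
  shows "\<exists>h\<in>bcont. (\<integral>x. exp (h x) \<partial>\<psi>) < 1 \<and> a < (\<integral>x. h x \<partial>\<nu>)"
proof -
  interpret \<psi>: prob_space \<psi> using \<psi> borel_probsD by blast
  interpret \<nu>: prob_space \<nu> using \<nu> borel_probsD by blast
  have s[measurable_cong]: "sets \<psi> = sets borel" "sets \<nu> = sets borel" using \<psi> \<nu> borel_probsD by blast+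
  obtain h K where h[measurable]: "h \<in> borel_measurable borel" and hK: "\<And>x. \<bar>h x\<bar> \<le> K"
    and h1: "(\<integral>x. exp (h x) \<partial>\<psi>) < 1" and h2: "a < (\<integral>x. h x \<partial>\<nu>)"
    using rel_entropy_variational_measurable[OF assms] by blast
  \<comment> \<open>One approximation under the mixture serves both laws: the mean error under
    either of them is at most twice that under \<open>\<mu>\<close>.\<close>
  define \<mu> where "\<mu> = convex_comb (1/2) \<psi> \<nu>"
  have \<mu>: "\<mu> \<in> borel_probs" unfolding \<mu>_def using \<psi> \<nu> by (intro convex_comb_borel_probs) auto
  interpret \<mu>: prob_space \<mu> using \<mu> borel_probsD by blast
  have [measurable_cong]: "sets \<mu> = sets borel" using \<mu> borel_probsD by blast
  \<comment> \<open>Half of the available room, because of the factor 2 lost to the mixture;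
    \<open>exp K\<close> is the Lipschitz constant from \<open>exp_abs_diff_le\<close>.\<close>
  define e where "e = min ((1 - (\<integral>x. exp (h x) \<partial>\<psi>)) / exp K) ((\<integral>x. h x \<partial>\<nu>) - a) / 2"
  have e: "0 < e" using h1 h2 by (simp add: e_def)
  have "integrable \<mu> h" by (rule \<mu>.integrable_const_bound[of _ K]) (use hK in auto)
  from bcont_dense_L1[OF \<mu> this] e obtain k where k: "k \<in> bcont" "(\<integral>x. \<bar>h x - k x\<bar> \<partial>\<mu>) < e" by blast
  \<comment> \<open>The approximant \<open>k\<close> may have a larger bound than \<open>h\<close>.
    Clipping it at \<open>K\<close> restores the bound used for the exponential and does not
    increase the distance to \<open>h\<close>.\<close>
  define g where "g x = max (- K) (min K (k x))" for x
  have K0: "0 \<le> K" using hK[of 0] by simp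
  have g: "g \<in> bcont" unfolding g_def
    by (rule bcontI[of _ K]) (use k K0 in \<open>auto simp: bcont_def intro!: continuous_intros\<close>)
  note [measurable] = bcont_measurable[OF g] bcont_measurable[OF k(1)]
  have gK: "\<bar>g x\<bar> \<le> K" for x using K0 by (auto simp: g_def)
  have close: "\<bar>h x - g x\<bar> \<le> \<bar>h x - k x\<bar>" for x using hK[of x] by (auto simp: g_def max_def min_def)
  have int: "integrable N (\<lambda>x. \<bar>h x - g x\<bar>)" "integrable N (\<lambda>x. exp (h x))" "integrable N (\<lambda>x. exp (g x))"
       "integrable N h" "integrable N g"
    if N: "N \<in> borel_probs" for N
  proof -
    interpret N: prob_space N using N borel_probsD by blast
    have [measurable_cong]: "sets N = sets borel" using N borel_probsD by blast
    have "\<bar>h x - g x\<bar> \<le> 2 * K" for x using hK[of x] gK[of x] by linarith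
    then show "integrable N (\<lambda>x. \<bar>h x - g x\<bar>)" by (intro N.integrable_const_bound[of _ "2 * K"]) auto
    show "integrable N (\<lambda>x. exp (h x))" using hK by (intro N.integrable_const_bound[of _ "exp K"]) (auto simp: abs_le_iff)
    show "integrable N (\<lambda>x. exp (g x))" using gK by (intro N.integrable_const_bound[of _ "exp K"]) (auto simp: abs_le_iff)
    show "integrable N h" "integrable N g" using hK gK by (auto intro!: N.integrable_const_bound[of _ K])
  qed
  have "ennreal (\<integral>x. \<bar>h x - g x\<bar> \<partial>\<mu>) = (\<integral>\<^sup>+x. ennreal \<bar>h x - g x\<bar> \<partial>\<mu>)"
    by (rule nn_integral_eq_integral[OF int(1)[OF \<mu>], symmetric]) auto
  also have "\<dots> = ennreal (1/2) * (\<integral>\<^sup>+x. ennreal \<bar>h x - g x\<bar> \<partial>\<psi>) + ennreal (1 - 1/2) * (\<integral>\<^sup>+x. ennreal \<bar>h x - g x\<bar> \<partial>\<nu>)"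
    unfolding \<mu>_def by (rule nn_integral_convex_comb) (auto simp: s)
  also have "\<dots> = ennreal (1/2) * ennreal (\<integral>x. \<bar>h x - g x\<bar> \<partial>\<psi>) + ennreal (1/2) * ennreal (\<integral>x. \<bar>h x - g x\<bar> \<partial>\<nu>)"
    by (subst (1 2) nn_integral_eq_integral) (auto simp: int[OF \<psi>] int[OF \<nu>])
  also have "\<dots> = ennreal ((\<integral>x. \<bar>h x - g x\<bar> \<partial>\<psi>) / 2 + (\<integral>x. \<bar>h x - g x\<bar> \<partial>\<nu>) / 2)"
    by (simp add: ennreal_plus ennreal_mult'[symmetric] del: ennreal_half)
  finally have "(\<integral>x. \<bar>h x - g x\<bar> \<partial>\<mu>) = (\<integral>x. \<bar>h x - g x\<bar> \<partial>\<psi>) / 2 + (\<integral>x. \<bar>h x - g x\<bar> \<partial>\<nu>) / 2"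
    by (subst (asm) ennreal_inj) auto
  moreover have "(\<integral>x. \<bar>h x - g x\<bar> \<partial>\<mu>) < e"
  proof -
    have "(\<integral>x. \<bar>h x - g x\<bar> \<partial>\<mu>) \<le> (\<integral>x. \<bar>h x - k x\<bar> \<partial>\<mu>)"
      using close int[OF \<mu>] integrable_bcont[OF \<mu> k(1)] by (intro integral_mono) auto
    then show ?thesis using k(2) by simp
  qed
  moreover have "0 \<le> (\<integral>x. \<bar>h x - g x\<bar> \<partial>\<psi>)" "0 \<le> (\<integral>x. \<bar>h x - g x\<bar> \<partial>\<nu>)" by auto
  ultimately have cl: "(\<integral>x. \<bar>h x - g x\<bar> \<partial>\<psi>) < 2 * e" "(\<integral>x. \<bar>h x - g x\<bar> \<partial>\<nu>) < 2 * e" by linarith+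
  show ?thesis
  proof (intro bexI[of _ g] conjI g)
    have "(\<integral>x. exp (g x) \<partial>\<psi>) \<le> (\<integral>x. exp (h x) + exp K * \<bar>h x - g x\<bar> \<partial>\<psi>)"
    proof (intro integral_mono Bochner_Integration.integrable_add integrable_mult_right int[OF \<psi>])
      fix x show "exp (g x) \<le> exp (h x) + exp K * \<bar>h x - g x\<bar>"
        using exp_abs_diff_le[of "g x" K "h x"] gK[of x] by (simp add: abs_minus_commute)
    qed
    also have "\<dots> = (\<integral>x. exp (h x) \<partial>\<psi>) + exp K * (\<integral>x. \<bar>h x - g x\<bar> \<partial>\<psi>)"
      using int[OF \<psi>] by simp
    also have "\<dots> < (\<integral>x. exp (h x) \<partial>\<psi>) + exp K * (2 * e)" using cl by simp
    also have "exp K * (2 * e) \<le> exp K * ((1 - (\<integral>x. exp (h x) \<partial>\<psi>)) / exp K)"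
      by (intro mult_left_mono) (auto simp: e_def)
    finally show "(\<integral>x. exp (g x) \<partial>\<psi>) < 1" by simp
    have "(\<integral>x. h x \<partial>\<nu>) - (\<integral>x. g x \<partial>\<nu>) = (\<integral>x. h x - g x \<partial>\<nu>)" using int[OF \<nu>] by simp
    also have "\<dots> \<le> (\<integral>x. \<bar>h x - g x\<bar> \<partial>\<nu>)" using int[OF \<nu>] by (intro integral_mono) auto
    also have "\<dots> < 2 * e" by (rule cl)
    also have "\<dots> \<le> (\<integral>x. h x \<partial>\<nu>) - a" by (simp add: e_def)
    finally show "a < (\<integral>x. g x \<partial>\<nu>)" by simp
  qed
qed

section \<open>Test functions below the rate functional\<close>

lemma exp_decay_integral:
  assumes \<psi>: "\<psi> \<in> pos_probs"
  shows "(\<integral>x. exp (- x) \<partial>\<psi>) < 1" "0 < (\<integral>x. exp (- x) \<partial>\<psi>)" "integrable \<psi> (\<lambda>x. exp (- x))"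
proof -
  have \<psi>': "\<psi> \<in> borel_probs" "AE x in \<psi>. 0 < x" using pos_probsD[OF \<psi>] by auto
  interpret prob_space \<psi> using \<psi>' borel_probsD by blast
  have [measurable_cong]: "sets \<psi> = sets borel" using \<psi>' borel_probsD by blast
  show i: "integrable \<psi> (\<lambda>x. exp (- x))"
    by (rule integrable_const_bound[of _ 1]) (use \<psi>'(2) in \<open>auto elim!: eventually_mono\<close>)
  have "(\<integral>x. exp (- x) \<partial>\<psi>) < (\<integral>x. 1 \<partial>\<psi>)"
  proof (rule integral_less_AE_space)
    show "AE x in \<psi>. exp (- x) < 1" using \<psi>'(2) by eventually_elim simp
  qed (use i emeasure_space_1 in auto)
  then show "(\<integral>x. exp (- x) \<partial>\<psi>) < 1" by (simp add: prob_space)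
  have "(\<integral>x. 0 \<partial>\<psi>) < (\<integral>x. exp (- x) \<partial>\<psi>)"
    by (rule integral_less_AE_space) (use i emeasure_space_1 in auto)
  then show "0 < (\<integral>x. exp (- x) \<partial>\<psi>)" by simp
qed

lemma mean_recip_pos:
  assumes \<pi>: "\<pi> \<in> pos_probs" and fin: "mean_recip \<pi> < \<infinity>"
  shows "mean_recip \<pi> = ennreal (enn2real (mean_recip \<pi>))" "0 < enn2real (mean_recip \<pi>)"
proof -
  have \<pi>': "\<pi> \<in> borel_probs" "AE x in \<pi>. 0 < x" using pos_probsD[OF \<pi>] by auto
  interpret prob_space \<pi> using \<pi>' borel_probsD by blast
  have [measurable_cong]: "sets \<pi> = sets borel" using \<pi>' borel_probsD by blast
  show "mean_recip \<pi> = ennreal (enn2real (mean_recip \<pi>))" using fin by simp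
  have "mean_recip \<pi> \<noteq> 0"
  proof
    assume "mean_recip \<pi> = 0"
    then have "AE \<tau> in \<pi>. ennreal (1 / \<tau>) = 0"
      unfolding mean_recip_def by (subst (asm) nn_integral_0_iff_AE) auto
    with \<pi>'(2) have "AE \<tau> in \<pi>. False" by eventually_elim (simp add: ennreal_eq_0_iff divide_le_0_iff)
    then show False by (simp add: AE_False)
  qed
  then show "0 < enn2real (mean_recip \<pi>)" using fin by (simp add: enn2real_positive_iff zero_less_iff_neq_zero)
qed

lemma tilted_density:
  assumes \<pi>: "\<pi> \<in> pos_probs" and fin: "mean_recip \<pi> < \<infinity>"
  shows "tilted \<pi> = density \<pi> (\<lambda>\<tau>. ennreal (max 0 (1 / \<tau>) / enn2real (mean_recip \<pi>)))"
  unfolding tilted_def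
proof (rule arg_cong[where f="density \<pi>"], rule ext)
  fix \<tau> :: real
  have "ennreal (1 / \<tau>) / mean_recip \<pi> = ennreal (max 0 (1 / \<tau>)) / ennreal (enn2real (mean_recip \<pi>))"
    using mean_recip_pos(1)[OF assms] by (simp add: max_def ennreal_neg)
  also have "\<dots> = ennreal (max 0 (1 / \<tau>) / enn2real (mean_recip \<pi>))"
    using mean_recip_pos(2)[OF assms] by (intro divide_ennreal) auto
  finally show "ennreal (1 / \<tau>) / mean_recip \<pi> = ennreal (max 0 (1 / \<tau>) / enn2real (mean_recip \<pi>))" .
qed

lemma tilted_pos_probs:
  assumes \<pi>: "\<pi> \<in> pos_probs" and fin: "mean_recip \<pi> < \<infinity>"
  shows "tilted \<pi> \<in> pos_probs"
proof -
  have \<pi>': "\<pi> \<in> borel_probs" "AE x in \<pi>. 0 < x" using pos_probsD[OF \<pi>] by auto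
  have s[measurable_cong]: "sets \<pi> = sets borel" using \<pi>' borel_probsD by blast
  have "emeasure (tilted \<pi>) (space (tilted \<pi>)) = (\<integral>\<^sup>+\<tau>. ennreal (1 / \<tau>) / mean_recip \<pi> \<partial>\<pi>)"
    unfolding tilted_def by (subst emeasure_density) (auto intro!: nn_integral_cong)
  also have "\<dots> = mean_recip \<pi> / mean_recip \<pi>"
    unfolding mean_recip_def by (rule nn_integral_divide) auto
  also have "\<dots> = 1"
    using mean_recip_pos[OF assms] fin by (intro ennreal_divide_self) (auto simp: enn2real_positive_iff)
  finally have "prob_space (tilted \<pi>)" by (rule prob_spaceI)
  moreover have "AE x in tilted \<pi>. 0 < x"
    unfolding tilted_def using \<pi>'(2) by (subst AE_density) auto
  moreover have "sets (tilted \<pi>) = sets borel" by (simp add: tilted_def s)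
  ultimately show ?thesis by (simp add: pos_probs_def borel_probs_def)
qed

lemma integral_tilted:
  fixes h :: "real \<Rightarrow> real"
  assumes \<pi>: "\<pi> \<in> pos_probs" and fin: "mean_recip \<pi> < \<infinity>" and h[measurable]: "h \<in> borel_measurable borel"
  shows "(\<integral>\<tau>. h \<tau> \<partial>tilted \<pi>) = (\<integral>\<tau>. h \<tau> / \<tau> \<partial>\<pi>) / enn2real (mean_recip \<pi>)" (is ?eq)
    and "integrable (tilted \<pi>) h \<longleftrightarrow> integrable \<pi> (\<lambda>\<tau>. h \<tau> / \<tau>)" (is ?int)
proof -
  let ?r = "enn2real (mean_recip \<pi>)"
  have \<pi>': "\<pi> \<in> borel_probs" "AE x in \<pi>. 0 < x" using pos_probsD[OF \<pi>] by auto
  have s[measurable_cong]: "sets \<pi> = sets borel" using \<pi>' borel_probsD by blast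
  have r: "0 < ?r" by (rule mean_recip_pos[OF \<pi> fin])
  have ae: "AE \<tau> in \<pi>. (max 0 (1 / \<tau>) / ?r) *\<^sub>R h \<tau> = (h \<tau> / \<tau>) / ?r"
    using \<pi>'(2) by eventually_elim simp
  have "(\<integral>\<tau>. h \<tau> \<partial>tilted \<pi>) = (\<integral>\<tau>. (max 0 (1 / \<tau>) / ?r) *\<^sub>R h \<tau> \<partial>\<pi>)"
    unfolding tilted_density[OF \<pi> fin] using r by (intro integral_density) auto
  also have "\<dots> = (\<integral>\<tau>. (h \<tau> / \<tau>) / ?r \<partial>\<pi>)" using ae by (intro integral_cong_AE) auto
  finally show ?eq by (simp only: integral_divide_zero)
  have "integrable (tilted \<pi>) h \<longleftrightarrow> integrable \<pi> (\<lambda>\<tau>. (max 0 (1 / \<tau>) / ?r) *\<^sub>R h \<tau>)"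
    unfolding tilted_density[OF \<pi> fin] using r by (intro integrable_density) auto
  also have "\<dots> \<longleftrightarrow> integrable \<pi> (\<lambda>\<tau>. (h \<tau> / \<tau>) / ?r)" using ae by (intro integrable_cong_AE) auto
  also have "\<dots> \<longleftrightarrow> integrable \<pi> (\<lambda>\<tau>. h \<tau> / \<tau>)"
    using r integrable_mult_left_iff[of \<pi> "1 / ?r" "\<lambda>\<tau>. h \<tau> / \<tau>"] by (simp add: mult.commute)
  finally show ?int .
qed

text \<open>\<open>\<pi>\<close> is the size-biased version of \<open>tilted \<pi>\<close>: the
  former is the law of the cycle seen by a uniform time, the latter that of a typical waiting time.
  Hence \<open>mean_recip \<pi>\<close> is the number of renewals per unit of time.\<close>

lemma tilted_mean:
  assumes \<pi>: "\<pi> \<in> pos_probs" and fin: "mean_recip \<pi> < \<infinity>"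
  shows "integrable (tilted \<pi>) (\<lambda>\<tau>. \<tau>)" "(\<integral>\<tau>. \<tau> \<partial>tilted \<pi>) = 1 / enn2real (mean_recip \<pi>)"
proof -
  have \<pi>': "\<pi> \<in> borel_probs" "AE x in \<pi>. 0 < x" using pos_probsD[OF \<pi>] by auto
  interpret prob_space \<pi> using \<pi>' borel_probsD by blast
  have s[measurable_cong]: "sets \<pi> = sets borel" using \<pi>' borel_probsD by blast
  have ae: "AE \<tau> in \<pi>. \<tau> / \<tau> = 1" using \<pi>'(2) by eventually_elim simp
  have "integrable \<pi> (\<lambda>\<tau>. \<tau> / \<tau>) \<longleftrightarrow> integrable \<pi> (\<lambda>\<tau>. 1 :: real)"
    using ae by (intro integrable_cong_AE) auto
  then show "integrable (tilted \<pi>) (\<lambda>\<tau>. \<tau>)" using integral_tilted(2)[OF assms, of "\<lambda>\<tau>. \<tau>"] by simp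
  have "(\<integral>\<tau>. \<tau> / \<tau> \<partial>\<pi>) = (\<integral>\<tau>. 1 \<partial>\<pi>)" using ae by (intro integral_cong_AE) auto
  then show "(\<integral>\<tau>. \<tau> \<partial>tilted \<pi>) = 1 / enn2real (mean_recip \<pi>)"
    using integral_tilted(1)[OF assms, of "\<lambda>\<tau>. \<tau>"] by (simp add: prob_space)
qed

text \<open>The variational inequality for the test function \<open>- x\<close>. As it is not
  bounded below, the inequality is proved directly. It forces the mean waiting time to be bounded
  away from 0 when the entropy is small.\<close>

lemma rel_entropy_Gibbs:
  assumes \<psi>: "\<psi> \<in> pos_probs" and \<nu>: "\<nu> \<in> borel_probs" and int: "integrable \<nu> (\<lambda>x. x)"
  shows "ereal (- (\<integral>x. x \<partial>\<nu>) - ln (\<integral>x. exp (- x) \<partial>\<psi>)) \<le> rel_entropy \<nu> \<psi>"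
proof (cases "absolutely_continuous \<psi> \<nu>")
  case False
  then show ?thesis by (simp add: rel_entropy_def)
next
  case True
  have \<psi>': "\<psi> \<in> borel_probs" using pos_probsD[OF \<psi>] by auto
  interpret \<psi>: prob_space \<psi> using \<psi>' borel_probsD by blast
  interpret \<nu>: prob_space \<nu> using \<nu> borel_probsD by blast
  have s[measurable_cong]: "sets \<psi> = sets borel" "sets \<nu> = sets borel" using \<psi>' \<nu> borel_probsD by blast+
  from rel_entropy_density[OF \<psi>' \<nu> True] obtain D where D[measurable]: "D \<in> borel_measurable borel"
    and D0: "\<And>x. 0 \<le> D x"
    and dens: "\<nu> = density \<psi> (\<lambda>x. ennreal (D x))" and Dpos: "AE x in \<nu>. 0 < D x"
    and ent: "rel_entropy \<nu> \<psi> = (if integrable \<nu> (\<lambda>x. ln (D x)) then ereal (\<integral>x. ln (D x) \<partial>\<nu>) else \<infinity>)"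
    by blast
  show ?thesis
  proof (cases "integrable \<nu> (\<lambda>x. ln (D x))")
    case i: True
    define q where "q = (\<integral>x. exp (- x) \<partial>\<psi>)"
    have q: "0 < q" unfolding q_def using exp_decay_integral[OF \<psi>] by simp
    \<comment> \<open>The density, relative to \<open>\<nu>\<close>, of \<open>\<psi>\<close> tilted
      by \<open>exp (- x)\<close>; its integral is at most 1, and \<open>ln u \<le> u - 1\<close>
      takes the place of Jensen's inequality.\<close>
    define u where "u x = exp (- x) / (q * D x)" for x
    have [measurable]: "u \<in> borel_measurable borel" unfolding u_def by measurable
    have u0: "0 \<le> u x" for x using q D0 by (simp add: u_def)
    have "(\<integral>\<^sup>+x. ennreal (u x) \<partial>\<nu>) = (\<integral>\<^sup>+x. ennreal (D x) * ennreal (u x) \<partial>\<psi>)"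
      unfolding dens by (intro nn_integral_density) auto
    also have "\<dots> \<le> (\<integral>\<^sup>+x. ennreal (exp (- x) / q) \<partial>\<psi>)"
    proof (intro nn_integral_mono)
      fix x
      have "D x * u x \<le> exp (- x) / q" using q D0[of x] by (cases "D x = 0") (auto simp: u_def)
      then show "ennreal (D x) * ennreal (u x) \<le> ennreal (exp (- x) / q)"
        using D0 by (simp add: ennreal_mult'[symmetric] ennreal_leI)
    qed
    also have "\<dots> = ennreal (\<integral>x. exp (- x) / q \<partial>\<psi>)"
      using exp_decay_integral(3)[OF \<psi>] q by (intro nn_integral_eq_integral) auto
    also have "(\<integral>x. exp (- x) / q \<partial>\<psi>) = 1" using q by (simp add: q_def)
    finally have un: "(\<integral>\<^sup>+x. ennreal (u x) \<partial>\<nu>) \<le> 1" by simp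
    then have ui: "integrable \<nu> u"
      using u0 by (intro integrableI_nonneg) (auto intro: le_less_trans)
    have u1: "(\<integral>x. u x \<partial>\<nu>) \<le> 1"
      using un ui u0 by (subst (asm) nn_integral_eq_integral) auto
    have "- (\<integral>x. x \<partial>\<nu>) - ln q - (\<integral>x. ln (D x) \<partial>\<nu>) = (\<integral>x. - x - ln q - ln (D x) \<partial>\<nu>)"
      using int i by (simp add: \<nu>.prob_space)
    also have "\<dots> \<le> (\<integral>x. u x - 1 \<partial>\<nu>)"
    proof (rule integral_mono_AE)
      show "AE x in \<nu>. - x - ln q - ln (D x) \<le> u x - 1"
        using Dpos
      proof eventually_elim
        case (elim x)
        have "- x - ln q - ln (D x) = ln (u x)"
          using q elim by (simp add: u_def ln_div ln_mult)
        also have "\<dots> \<le> u x - 1" using q elim by (intro ln_le_minus_one) (simp add: u_def)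
        finally show ?case .
      qed
    qed (use int i ui in auto)
    also have "\<dots> \<le> 0" using u1 ui by (simp add: \<nu>.prob_space)
    finally show ?thesis using i ent by (simp add: q_def)
  qed (simp add: ent)
qed

lemma exp_abscissa_nonneg:
  assumes \<psi>: "\<psi> \<in> pos_probs"
  shows "0 \<le> exp_abscissa \<psi>"
proof -
  interpret prob_space \<psi> using pos_probsD[OF \<psi>] borel_probsD by blast
  have "(\<integral>\<^sup>+\<tau>. ennreal (exp (0 * \<tau>)) \<partial>\<psi>) < \<infinity>" by (simp add: emeasure_space_1)
  then show ?thesis unfolding exp_abscissa_def zero_ereal_def by (intro Sup_upper) blast
qed

text \<open>An admissible exponent can always be taken nonnegative, because 0 is admissible. The
  sign matters when the elapsed part of a cycle is replaced by its whole length.\<close>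

lemma exp_abscissa_less:
  assumes \<psi>: "\<psi> \<in> pos_probs" and y: "ereal y < exp_abscissa \<psi>"
  shows "\<exists>c\<ge>0. y < c \<and> (\<integral>\<^sup>+\<tau>. ennreal (exp (c * \<tau>)) \<partial>\<psi>) < \<infinity>"
proof -
  interpret prob_space \<psi> using pos_probsD[OF \<psi>] borel_probsD by blast
  obtain c where c: "(\<integral>\<^sup>+\<tau>. ennreal (exp (c * \<tau>)) \<partial>\<psi>) < \<infinity>" "y < c"
    using y unfolding exp_abscissa_def less_Sup_iff by auto
  show ?thesis
  proof (cases "0 \<le> c")
    case False
    then show ?thesis using c by (intro exI[of _ 0]) (auto simp: emeasure_space_1)
  qed (use c in blast)
qed

text \<open>Only the limsup of the exponential decay rate of \<open>\<psi>([L,L+1[)\<close> is controlled, so the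
  lengths \<open>L\<close> have to be chosen.\<close>

lemma heavy_unit_intervals:
  assumes \<psi>: "\<psi> \<in> pos_probs" and x: "exp_abscissa \<psi> < ereal x"
  shows "\<exists>L\<ge>L0. exp (- x * real L) \<le> measure \<psi> {real L..<real L + 1}"
proof (rule ccontr)
  assume neg: "\<not> ?thesis"
  have \<psi>': "\<psi> \<in> borel_probs" "AE x in \<psi>. 0 < x" using pos_probsD[OF \<psi>] by auto
  interpret prob_space \<psi> using \<psi>' borel_probsD by blast
  have s[measurable_cong]: "sets \<psi> = sets borel" using \<psi>' borel_probsD by blast
  \<comment> \<open>If all unit intervals from \<open>L0\<close> on were lighter than
    \<open>exp (- x * L)\<close>, a geometric series of ratio \<open>exp (y - x)\<close> would make
    \<open>exp (y * \<tau>)\<close> integrable for this \<open>y\<close> beyond the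
    abscissa.\<close>
  obtain y where y: "exp_abscissa \<psi> < ereal y" "y < x"
    using ereal_dense2[OF x] exp_abscissa_nonneg[OF \<psi>]
    by (metis ereal_less_eq(3) ereal_less_ereal_Ex less_ereal.simps(1) less_imp_le not_less)
  have y0: "0 < y" using y(1) exp_abscissa_nonneg[OF \<psi>] by (metis ereal_less(2) order_le_less_trans)
  have small: "measure \<psi> {real L..<real L + 1} \<le> exp (- x * real L)" if "L0 \<le> L" for L
    using neg that by (meson linear)
  define w where "w L = exp (y * (real L + 1))" for L :: nat
  have "(\<integral>\<^sup>+\<tau>. ennreal (exp (y * \<tau>)) \<partial>\<psi>) \<le>
     (\<integral>\<^sup>+\<tau>. ennreal (exp (y * L0)) + (\<Sum>L. ennreal (w L) * indicator {real L..<real L + 1} \<tau> * (if L0 \<le> L then 1 else 0)) \<partial>\<psi>)"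
  proof (rule nn_integral_mono_AE)
    show "AE \<tau> in \<psi>. ennreal (exp (y * \<tau>)) \<le> ennreal (exp (y * L0)) +
        (\<Sum>L. ennreal (w L) * indicator {real L..<real L + 1} \<tau> * (if L0 \<le> L then 1 else 0))"
      using \<psi>'(2)
    proof eventually_elim
      case (elim \<tau>)
      show ?case
      proof (cases "\<tau> \<le> L0")
        case True
        then show ?thesis using y0 by (intro add_increasing2 ennreal_leI) auto
      next
        case False
        define L where "L = nat \<lfloor>\<tau>\<rfloor>"
        have L: "real L \<le> \<tau>" "\<tau> < real L + 1" using elim by (auto simp: L_def)
        have "L0 \<le> L" using False L by linarith
        then have "ennreal (exp (y * \<tau>)) \<le> ennreal (w L) * indicator {real L..<real L + 1} \<tau> * (if L0 \<le> L then 1 else 0)"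
          using L y0 by (simp add: w_def ennreal_leI)
        also have "\<dots> = (\<Sum>L'\<in>{L}. ennreal (w L') * indicator {real L'..<real L' + 1} \<tau> * (if L0 \<le> L' then 1 else 0))"
          by simp
        also have "\<dots> \<le> (\<Sum>L'. ennreal (w L') * indicator {real L'..<real L' + 1} \<tau> * (if L0 \<le> L' then 1 else 0))"
          by (rule sum_le_suminf) auto
        finally show ?thesis by (rule add_increasing[rotated]) simp
      qed
    qed
  qed
  also have "\<dots> = ennreal (exp (y * L0)) + (\<Sum>L. (\<integral>\<^sup>+\<tau>. ennreal (w L) * indicator {real L..<real L + 1} \<tau> * (if L0 \<le> L then 1 else 0) \<partial>\<psi>))"
    by (subst nn_integral_add) (auto simp: emeasure_space_1 nn_integral_suminf)
  also have "\<dots> \<le> ennreal (exp (y * L0)) + (\<Sum>L. ennreal (exp y * exp (y - x) ^ L))"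
  proof (intro add_left_mono suminf_le summableI)
    fix L
    show "(\<integral>\<^sup>+\<tau>. ennreal (w L) * indicator {real L..<real L + 1} \<tau> * (if L0 \<le> L then 1 else 0) \<partial>\<psi>) \<le> ennreal (exp y * exp (y - x) ^ L)"
    proof (cases "L0 \<le> L")
      case True
      then have "(\<integral>\<^sup>+\<tau>. ennreal (w L) * indicator {real L..<real L + 1} \<tau> * (if L0 \<le> L then 1 else 0) \<partial>\<psi>)
          = ennreal (w L * measure \<psi> {real L..<real L + 1})"
        by (simp add: nn_integral_cmult_indicator emeasure_eq_measure ennreal_mult w_def)
      also have "\<dots> \<le> ennreal (w L * exp (- x * real L))"
        using small[OF True] by (intro ennreal_leI mult_left_mono) (auto simp: w_def)
      also have "w L * exp (- x * real L) = exp y * exp (y - x) ^ L"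
        by (simp add: w_def exp_of_nat_mult[symmetric] algebra_simps flip: exp_add)
      finally show ?thesis .
    qed simp
  qed
  also have "(\<Sum>L. ennreal (exp y * exp (y - x) ^ L)) = ennreal (\<Sum>L. exp y * exp (y - x) ^ L)"
    using y(2) by (intro suminf_ennreal_eq summable_sums summable_mult summable_geometric) auto
  also have "ennreal (exp (y * L0)) + \<dots> < \<infinity>" by simp
  finally have "ereal y \<le> exp_abscissa \<psi>" unfolding exp_abscissa_def by (intro Sup_upper) blast
  then show False using y(1) by simp
qed


text \<open>Either summand of the rate may be infinite; real thresholds below each of them allow the
  entropy part and the abscissa part to be treated separately.\<close>

lemma ereal_less_add_split:
  fixes A B :: ereal
  assumes "ereal a < A + B" "A \<noteq> - \<infinity>" "B \<noteq> - \<infinity>"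
  shows "\<exists>x y. ereal x < A \<and> ereal y < B \<and> a < x + y"
proof (cases A)
  case A: (real u)
  show ?thesis
  proof (cases B)
    case (real v)
    then have "a < u + v" using A assms by simp
    then show ?thesis using A real
      by (intro exI[of _ "u - (u + v - a) / 3"] exI[of _ "v - (u + v - a) / 3"]) (simp add: field_simps)
  next
    case PInf
    then show ?thesis using A by (intro exI[of _ "u - 1"] exI[of _ "a - u + 2"]) simp
  qed (use assms in simp)
next
  case A: PInf
  show ?thesis
  proof (cases B)
    case (real v)
    then show ?thesis using A by (intro exI[of _ "a - v + 2"] exI[of _ "v - 1"]) simp
  next
    case PInf
    then show ?thesis using A by (intro exI[of _ "a + 1"] exI[of _ 0]) simp
  qed (use assms in simp)
qed (use assms in simp)

lemma rel_entropy_not_MInf: "rel_entropy \<nu> \<mu> \<noteq> - \<infinity>"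
  by (simp add: rel_entropy_def)

text \<open>The function sought is \<open>x * h (1 / x)\<close>, corrected to have value
  \<open>c\<close> at 0. Truncating at \<open>n\<close> and adding a spike of height
  \<open>c\<close> and width \<open>1 / n\<close> makes it bounded and continuous. In terms of
  \<open>\<tau>\<close> the exponent is at most \<open>B + c * \<tau>\<close> for all
  \<open>n\<close>, so the exponential moment of order \<open>c\<close> dominates, and the spike
  disappears pointwise as \<open>n\<close> grows.\<close>

lemma rate_test_function:
  assumes \<psi>: "\<psi> \<in> pos_probs" and \<pi>: "\<pi> \<in> pos_probs" and fin: "mean_recip \<pi> < \<infinity>"
    and \<alpha>: "\<alpha> \<in> {0..1}" and q: "q \<in> borel_probs" and d: "length_decomp q \<alpha> \<pi>"
    and a: "ereal a < ereal \<alpha> * enn2ereal (mean_recip \<pi>) * rel_entropy (tilted \<pi>) \<psi> + ereal (1 - \<alpha>) * exp_abscissa \<psi>"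
  shows "\<exists>g\<in>bcont. \<exists>c\<ge>0. (\<integral>\<^sup>+\<tau>. ennreal (exp (c * \<tau>)) \<partial>\<psi>) < \<infinity> \<and> g 0 = c \<and>
     (\<integral>\<^sup>+\<tau>. ennreal (exp (\<tau> * g (1 / \<tau>))) \<partial>\<psi>) < 1 \<and> a < (\<integral>x. g x \<partial>q)"
proof -
  have \<psi>': "\<psi> \<in> borel_probs" "AE x in \<psi>. 0 < x" using pos_probsD[OF \<psi>] by auto
  have \<pi>': "\<pi> \<in> borel_probs" "AE x in \<pi>. 0 < x" using pos_probsD[OF \<pi>] by auto
  interpret \<psi>: prob_space \<psi> using \<psi>' borel_probsD by blast
  interpret \<pi>: prob_space \<pi> using \<pi>' borel_probsD by blast
  have s[measurable_cong]: "sets \<psi> = sets borel" "sets \<pi> = sets borel" using \<psi>' \<pi>' borel_probsD by blast+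
  have tp: "tilted \<pi> \<in> borel_probs" using tilted_pos_probs[OF \<pi> fin] pos_probsD by blast
  define r where "r = enn2real (mean_recip \<pi>)"
  have r: "0 < r" "mean_recip \<pi> = ennreal r" unfolding r_def using mean_recip_pos[OF \<pi> fin] by auto
  have er: "enn2ereal (mean_recip \<pi>) = ereal r" unfolding r(2) using r(1) by (simp add: enn2ereal_ennreal)
  obtain x y where x: "ereal x < ereal \<alpha> * ereal r * rel_entropy (tilted \<pi>) \<psi>" and y: "ereal y < ereal (1 - \<alpha>) * exp_abscissa \<psi>"
    and xy: "a < x + y"
  proof -
    have "ereal \<alpha> * ereal r * rel_entropy (tilted \<pi>) \<psi> \<noteq> - \<infinity>"
      using \<alpha> r rel_entropy_not_MInf[of "tilted \<pi>" \<psi>] by (cases "rel_entropy (tilted \<pi>) \<psi>") auto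
    moreover have "ereal (1 - \<alpha>) * exp_abscissa \<psi> \<noteq> - \<infinity>"
      using \<alpha> exp_abscissa_nonneg[OF \<psi>] by (cases "exp_abscissa \<psi>") auto
    ultimately show thesis using ereal_less_add_split a that unfolding er by blast
  qed
  have "\<exists>h\<in>bcont. (\<integral>x. exp (h x) \<partial>\<psi>) < 1 \<and> x < \<alpha> * r * (\<integral>x. h x \<partial>tilted \<pi>)"
  proof (cases "\<alpha> = 0")
    case True
    \<comment> \<open>For \<open>\<alpha> = 0\<close> the entropy may be infinite but carries weight
      0, so any admissible function will do.\<close>
    have "(\<lambda>_. -1) \<in> bcont" by (rule bcontI[of _ 1]) auto
    then show ?thesis using x True by (intro bexI[of _ "\<lambda>_. -1"]) (auto simp: \<psi>.prob_space zero_ereal_def[symmetric])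
  next
    case False
    then have ar: "0 < \<alpha> * r" using \<alpha> r by simp
    have "ereal (x / (\<alpha> * r)) < rel_entropy (tilted \<pi>) \<psi>"
    proof (cases "rel_entropy (tilted \<pi>) \<psi>")
      case (real H)
      then show ?thesis using x ar by (simp add: field_simps)
    qed (use rel_entropy_not_MInf in auto)
    from rel_entropy_variational[OF \<psi>'(1) tp this] obtain h where "h \<in> bcont" "(\<integral>x. exp (h x) \<partial>\<psi>) < 1"
      "x / (\<alpha> * r) < (\<integral>x. h x \<partial>tilted \<pi>)" by blast
    then show ?thesis using ar by (intro bexI[of _ h]) (auto simp: field_simps)
  qed
  then obtain h where h: "h \<in> bcont" "(\<integral>x. exp (h x) \<partial>\<psi>) < 1" "x < \<alpha> * r * (\<integral>x. h x \<partial>tilted \<pi>)" by blast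
  have "\<exists>c\<ge>0. (\<integral>\<^sup>+\<tau>. ennreal (exp (c * \<tau>)) \<partial>\<psi>) < \<infinity> \<and> y \<le> (1 - \<alpha>) * c"
  proof (cases "\<alpha> = 1")
    case True
    \<comment> \<open>For \<open>\<alpha> = 1\<close> the abscissa carries weight 0, and
      \<open>c = 0\<close> is always admissible.\<close>
    then show ?thesis using y by (intro exI[of _ 0]) (auto simp: \<psi>.emeasure_space_1 zero_ereal_def[symmetric])
  next
    case False
    then have a1: "0 < 1 - \<alpha>" using \<alpha> by simp
    have "ereal (y / (1 - \<alpha>)) < exp_abscissa \<psi>"
      using y a1 exp_abscissa_nonneg[OF \<psi>] by (cases "exp_abscissa \<psi>") (auto simp: field_simps)
    from exp_abscissa_less[OF \<psi> this] obtain c where c: "c \<ge> 0" "y / (1 - \<alpha>) < c" "(\<integral>\<^sup>+\<tau>. ennreal (exp (c * \<tau>)) \<partial>\<psi>) < \<infinity>" by blast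
    then show ?thesis using a1 by (intro exI[of _ c]) (auto simp: field_simps)
  qed
  then obtain c where c: "0 \<le> c" "(\<integral>\<^sup>+\<tau>. ennreal (exp (c * \<tau>)) \<partial>\<psi>) < \<infinity>" "y \<le> (1 - \<alpha>) * c" by blast
  obtain B where B: "B > 0" "\<And>x. \<bar>h x\<bar> \<le> B" using bcont_boundE[OF h(1)] by blast
  define k where "k n x = max (- real n) (min (real n) (x * h (1 / x)))" for n x
  define g where "g n x = k n x + c * max 0 (1 - real n * \<bar>x\<bar>)" for n x
  note [measurable] = bcont_measurable[OF h(1)]
  have [measurable]: "k n \<in> borel_measurable borel" for n unfolding k_def by measurable
  have contxh: "continuous_on UNIV (\<lambda>x. x * h (1 / x))"
    unfolding continuous_on_eq_continuous_at[OF open_UNIV]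
  proof
    fix z :: real
    show "isCont (\<lambda>x. x * h (1 / x)) z"
    proof (cases "z = 0")
      case True
      have "((\<lambda>x. x * h (1 / x)) \<longlongrightarrow> 0) (at 0)"
      proof (rule Lim_null_comparison[where g="\<lambda>x. \<bar>x\<bar> * B"])
        show "\<forall>\<^sub>F x in at 0. norm (x * h (1 / x)) \<le> \<bar>x\<bar> * B"
          using B by (intro always_eventually allI) (simp add: abs_mult mult_left_mono)
        show "((\<lambda>x. \<bar>x\<bar> * B) \<longlongrightarrow> 0) (at 0)" by (auto intro!: tendsto_eq_intros)
      qed
      then show ?thesis by (simp add: True isCont_def)
    next
      case False
      have "isCont (\<lambda>x. h (1 / x)) z"
      proof (rule isCont_o2[where f="\<lambda>x. 1 / x"])
        show "isCont (\<lambda>x. 1 / x) z" using False by (intro continuous_divide) auto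
        show "isCont h (1 / z)" by (rule bcont_isCont[OF h(1)])
      qed
      then show ?thesis by (intro isCont_mult continuous_ident)
    qed
  qed
  have gb: "g n \<in> bcont" for n
  proof (rule bcontI[of _ "real n + c"])
    have "continuous_on UNIV (k n)"
      unfolding k_def by (intro continuous_on_max continuous_on_min continuous_on_const contxh)
    then show "continuous_on UNIV (g n)" unfolding g_def by (intro continuous_intros)
    fix x
    have "c * max 0 (1 - real n * \<bar>x\<bar>) \<le> c * 1" using c(1) by (intro mult_left_mono) auto
    moreover have "0 \<le> c * max 0 (1 - real n * \<bar>x\<bar>)" using c(1) by simp
    moreover have "\<bar>k n x\<bar> \<le> real n" by (auto simp: k_def)
    ultimately show "\<bar>g n x\<bar> \<le> real n + c" unfolding g_def by linarith
  qed
  note [measurable] = bcont_measurable[OF gb]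
  \<comment> \<open>Seen from a cycle of length \<open>\<tau>\<close>, the spike rewards only the
    part of the length beyond \<open>n\<close>, at rate \<open>c\<close>.\<close>
  have eg: "\<tau> * g n (1 / \<tau>) = max (- real n * \<tau>) (min (real n * \<tau>) (h \<tau>)) + c * max 0 (\<tau> - real n)" if "0 < \<tau>" for n \<tau>
  proof -
    have "\<tau> * k n (1 / \<tau>) = max (- real n * \<tau>) (min (real n * \<tau>) (h \<tau>))"
      unfolding k_def using that by (simp add: max_mult_distrib_left min_mult_distrib_left mult.commute)
    moreover have "\<tau> * max 0 (1 - real n * \<bar>1 / \<tau>\<bar>) = max 0 (\<tau> - real n)"
      using that by (simp add: max_mult_distrib_left right_diff_distrib)
    ultimately show ?thesis unfolding g_def by (simp add: distrib_left mult.left_commute)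
  qed
  have ec: "integrable \<psi> (\<lambda>\<tau>. exp (c * \<tau>))"
    using c(2) by (intro integrableI_nonneg) auto
  have lim\<psi>: "(\<lambda>n. \<integral>\<tau>. exp (\<tau> * g n (1 / \<tau>)) \<partial>\<psi>) \<longlonglongrightarrow> (\<integral>\<tau>. exp (h \<tau>) \<partial>\<psi>)"
    and ig: "integrable \<psi> (\<lambda>\<tau>. exp (\<tau> * g n (1 / \<tau>)))" for n
  proof -
    \<comment> \<open>The upper truncation is harmless and the lower one stays at or below 0, hence
      below \<open>B\<close>; the spike contributes at most \<open>c * \<tau>\<close>.\<close>
    have dom: "AE \<tau> in \<psi>. norm (exp (\<tau> * g n (1 / \<tau>))) \<le> exp B * exp (c * \<tau>)" for n
      using \<psi>'(2)
    proof eventually_elim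
      case (elim \<tau>)
      have "0 \<le> real n * \<tau>" using elim by simp
      then have "max (- real n * \<tau>) (min (real n * \<tau>) (h \<tau>)) \<le> B" using B(1) B(2)[of \<tau>] by (auto simp: abs_le_iff)
      moreover have "c * max 0 (\<tau> - real n) \<le> c * \<tau>" using c(1) elim by (intro mult_left_mono) auto
      ultimately have "\<tau> * g n (1 / \<tau>) \<le> B + c * \<tau>" using eg[OF elim, of n] by linarith
      then show ?case by (simp flip: exp_add)
    qed
    have w: "integrable \<psi> (\<lambda>\<tau>. exp B * exp (c * \<tau>))" using ec by simp
    show "integrable \<psi> (\<lambda>\<tau>. exp (\<tau> * g n (1 / \<tau>)))" for n
    proof (rule Bochner_Integration.integrable_bound[OF w])
      show "AE \<tau> in \<psi>. norm (exp (\<tau> * g n (1 / \<tau>))) \<le> norm (exp B * exp (c * \<tau>))"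
        using dom[of n] by eventually_elim (simp add: abs_mult)
    qed simp
    show "(\<lambda>n. \<integral>\<tau>. exp (\<tau> * g n (1 / \<tau>)) \<partial>\<psi>) \<longlonglongrightarrow> (\<integral>\<tau>. exp (h \<tau>) \<partial>\<psi>)"
    proof (rule integral_dominated_convergence[where w="\<lambda>\<tau>. exp B * exp (c * \<tau>)"])
      show "AE \<tau> in \<psi>. (\<lambda>n. exp (\<tau> * g n (1 / \<tau>))) \<longlonglongrightarrow> exp (h \<tau>)"
        using \<psi>'(2)
      proof eventually_elim
        case (elim \<tau>)
        obtain m :: nat where m: "max \<tau> (B / \<tau>) \<le> m" using real_arch_simple by blast
        have "\<tau> * g n (1 / \<tau>) = h \<tau>" if n: "m \<le> n" for n
        proof -
          have mn: "\<tau> \<le> n" "B / \<tau> \<le> n" using m n by (auto intro: order_trans)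
          then have "B \<le> real n * \<tau>" using elim by (simp add: field_simps)
          then show ?thesis using eg[OF elim, of n] B(2)[of \<tau>] mn by (simp add: abs_le_iff)
        qed
        then show ?case by (intro tendsto_eventually eventually_sequentiallyI[of m]) auto
      qed
    qed (use dom w in auto)
  qed
  \<comment> \<open>Only the truncated part needs a limit, dominated by \<open>B / \<tau>\<close>,
    which is integrable since \<open>mean_recip \<pi>\<close> is finite. Under \<open>\<pi>\<close>
    the spike is nonnegative and is dropped at the end; it counts only through
    \<open>g 0 = c\<close>.\<close>
  have lim\<pi>: "(\<lambda>n. \<integral>\<tau>. k n (1 / \<tau>) \<partial>\<pi>) \<longlonglongrightarrow> (\<integral>\<tau>. h \<tau> / \<tau> \<partial>\<pi>)"
  proof (rule integral_dominated_convergence[where w="\<lambda>\<tau>. B * \<bar>1 / \<tau>\<bar>"])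
    show "integrable \<pi> (\<lambda>\<tau>. B * \<bar>1 / \<tau>\<bar>)"
    proof -
      have "integrable (tilted \<pi>) (\<lambda>_. 1 :: real)"
        by (rule finite_measure.integrable_const[OF prob_space.finite_measure[OF borel_probsD(1)[OF tp]]])
      then have "integrable \<pi> (\<lambda>\<tau>. 1 / \<tau>)"
        by (rule iffD1[OF integral_tilted(2)[OF \<pi> fin], rotated]) simp
      then show ?thesis by (intro integrable_mult_right integrable_abs)
    qed
    show "AE \<tau> in \<pi>. norm (k n (1 / \<tau>)) \<le> B * \<bar>1 / \<tau>\<bar>" for n
      using \<pi>'(2)
    proof eventually_elim
      case (elim \<tau>)
      have "\<bar>1 / \<tau> * h \<tau>\<bar> \<le> B * \<bar>1 / \<tau>\<bar>" using B(2)[of \<tau>] elim by (simp add: abs_mult divide_right_mono)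
      moreover have "\<bar>k n (1 / \<tau>)\<bar> \<le> \<bar>1 / \<tau> * h \<tau>\<bar>"
      proof -
        have "k n (1 / \<tau>) = max (- real n) (min (real n) (1 / \<tau> * h \<tau>))" by (simp add: k_def)
        then show ?thesis by (smt (verit) of_nat_0_le_iff)
      qed
      ultimately show ?case unfolding real_norm_def by linarith
    qed
    show "AE \<tau> in \<pi>. (\<lambda>n. k n (1 / \<tau>)) \<longlonglongrightarrow> h \<tau> / \<tau>"
    proof (rule AE_I2)
      fix \<tau>
      obtain m :: nat where m: "\<bar>h \<tau> / \<tau>\<bar> \<le> m" using real_arch_simple by blast
      have "k n (1 / \<tau>) = h \<tau> / \<tau>" if n: "m \<le> n" for n
      proof -
        have "\<bar>h \<tau> / \<tau>\<bar> \<le> real n" using m n by (smt (verit) of_nat_mono)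
        moreover have "k n (1 / \<tau>) = max (- real n) (min (real n) (h \<tau> / \<tau>))" by (simp add: k_def)
        ultimately show ?thesis by linarith
      qed
      then show "(\<lambda>n. k n (1 / \<tau>)) \<longlonglongrightarrow> h \<tau> / \<tau>" by (intro tendsto_eventually eventually_sequentiallyI[of m]) auto
    qed
  qed auto
  have g0: "g n 0 = c" for n by (simp add: g_def k_def)
  have "(\<lambda>n. \<alpha> * (\<integral>\<tau>. k n (1 / \<tau>) \<partial>\<pi>)) \<longlonglongrightarrow> \<alpha> * (\<integral>\<tau>. h \<tau> / \<tau> \<partial>\<pi>)" by (intro tendsto_intros lim\<pi>)
  moreover have "x < \<alpha> * (\<integral>\<tau>. h \<tau> / \<tau> \<partial>\<pi>)"
  proof -
    have "(\<integral>\<tau>. h \<tau> \<partial>tilted \<pi>) = (\<integral>\<tau>. h \<tau> / \<tau> \<partial>\<pi>) / r"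
      unfolding r_def by (rule integral_tilted(1)[OF \<pi> fin]) simp
    then show ?thesis using h(3) r(1) by simp
  qed
  ultimately have "\<forall>\<^sub>F n in sequentially. x < \<alpha> * (\<integral>\<tau>. k n (1 / \<tau>) \<partial>\<pi>)" by (rule order_tendstoD(1))
  moreover have "\<forall>\<^sub>F n in sequentially. (\<integral>\<tau>. exp (\<tau> * g n (1 / \<tau>)) \<partial>\<psi>) < 1"
    using lim\<psi> h(2) by (rule order_tendstoD(2))
  ultimately have "\<forall>\<^sub>F n in sequentially. x < \<alpha> * (\<integral>\<tau>. k n (1 / \<tau>) \<partial>\<pi>) \<and> (\<integral>\<tau>. exp (\<tau> * g n (1 / \<tau>)) \<partial>\<psi>) < 1"
    by (rule eventually_conj)
  then obtain n where n: "x < \<alpha> * (\<integral>\<tau>. k n (1 / \<tau>) \<partial>\<pi>)" "(\<integral>\<tau>. exp (\<tau> * g n (1 / \<tau>)) \<partial>\<psi>) < 1"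
    by (auto simp: eventually_sequentially)
  show ?thesis
  proof (intro bexI[of _ "g n"] exI[of _ c] conjI)
    have "(\<integral>\<^sup>+\<tau>. ennreal (exp (\<tau> * g n (1 / \<tau>))) \<partial>\<psi>) = ennreal (\<integral>\<tau>. exp (\<tau> * g n (1 / \<tau>)) \<partial>\<psi>)"
      by (intro nn_integral_eq_integral ig) auto
    also have "\<dots> < ennreal 1" using n(2) by (subst ennreal_less_iff) auto
    finally show "(\<integral>\<^sup>+\<tau>. ennreal (exp (\<tau> * g n (1 / \<tau>))) \<partial>\<psi>) < 1" by simp
    obtain C where C: "\<And>x. \<bar>g n x\<bar> \<le> C" using bcont_boundE[OF gb] by blast
    have "(\<integral>x. g n x \<partial>q) = \<alpha> * (\<integral>\<tau>. g n (1 / \<tau>) \<partial>\<pi>) + (1 - \<alpha>) * c"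
      using length_decomp_integral[OF d q \<pi>'(1) \<alpha> bcont_measurable[OF gb] C] g0 by simp
    moreover have "(\<integral>\<tau>. k n (1 / \<tau>) \<partial>\<pi>) \<le> (\<integral>\<tau>. g n (1 / \<tau>) \<partial>\<pi>)"
    proof (rule integral_mono)
      show "integrable \<pi> (\<lambda>\<tau>. k n (1 / \<tau>))" by (rule \<pi>.integrable_const_bound[of _ n]) (auto simp: k_def)
      show "integrable \<pi> (\<lambda>\<tau>. g n (1 / \<tau>))" by (rule \<pi>.integrable_const_bound[of _ C]) (use C in auto)
    qed (use c(1) in \<open>simp add: g_def\<close>)
    then have "\<alpha> * (\<integral>\<tau>. k n (1 / \<tau>) \<partial>\<pi>) \<le> \<alpha> * (\<integral>\<tau>. g n (1 / \<tau>) \<partial>\<pi>)" using \<alpha> by (intro mult_left_mono) auto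
    ultimately show "a < (\<integral>x. g n x \<partial>q)" using n(1) c(3) xy by linarith
  qed (use c g0 gb in auto)
qed

text \<open>With \<open>l\<close> the negative logarithm of the exponential moment and
  \<open>r\<close> the value of \<open>mean_recip \<pi>\<close>, Gibbs' inequality gives entropy at
  least \<open>l - 1 / r\<close>. Multiplied by \<open>\<alpha> * r\<close> this reads
  \<open>\<alpha> * r * l \<le> c + \<alpha>\<close>: a bounded rate bounds the number of renewals
  per unit of time.\<close>

lemma rate_renewal_bound:
  assumes \<psi>: "\<psi> \<in> pos_probs" and \<pi>: "\<pi> \<in> pos_probs" and fin: "mean_recip \<pi> < \<infinity>" and \<alpha>: "\<alpha> \<in> {0..1}"
    and c: "ereal \<alpha> * enn2ereal (mean_recip \<pi>) * rel_entropy (tilted \<pi>) \<psi> + ereal (1 - \<alpha>) * exp_abscissa \<psi> \<le> ereal c"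
  shows "ennreal \<alpha> * mean_recip \<pi> \<le> ennreal ((c + 1) / - ln (\<integral>x. exp (- x) \<partial>\<psi>))"
proof -
  define r where "r = enn2real (mean_recip \<pi>)"
  have r: "0 < r" "mean_recip \<pi> = ennreal r" unfolding r_def using mean_recip_pos[OF \<pi> fin] by auto
  have er: "enn2ereal (mean_recip \<pi>) = ereal r" unfolding r(2) using r(1) by (simp add: enn2ereal_ennreal)
  have tp: "tilted \<pi> \<in> borel_probs" using tilted_pos_probs[OF \<pi> fin] pos_probsD by blast
  define l where "l = - ln (\<integral>x. exp (- x) \<partial>\<psi>)"
  have l: "0 < l" unfolding l_def using exp_decay_integral[OF \<psi>] by (simp add: ln_less_zero)
  have "ereal (l - 1 / r) \<le> rel_entropy (tilted \<pi>) \<psi>"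
  proof -
    have "l - 1 / r = - (\<integral>x. x \<partial>tilted \<pi>) - ln (\<integral>x. exp (- x) \<partial>\<psi>)"
      using tilted_mean(2)[OF \<pi> fin] by (simp add: l_def r_def)
    then show ?thesis using rel_entropy_Gibbs[OF \<psi> tp tilted_mean(1)[OF \<pi> fin]] by simp
  qed
  then have "ereal (\<alpha> * r) * ereal (l - 1 / r) \<le> ereal (\<alpha> * r) * rel_entropy (tilted \<pi>) \<psi>"
    using \<alpha> r by (intro ereal_mult_left_mono) auto
  also have "\<dots> \<le> ereal (\<alpha> * r) * rel_entropy (tilted \<pi>) \<psi> + ereal (1 - \<alpha>) * exp_abscissa \<psi>"
    using \<alpha> exp_abscissa_nonneg[OF \<psi>] by (intro ereal_le_add_self) auto
  also have "\<dots> \<le> ereal c" using c unfolding er by simp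
  finally have "\<alpha> * r * (l - 1 / r) \<le> c" by simp
  then have "\<alpha> * r * l \<le> c + \<alpha>" using r by (simp add: algebra_simps)
  then have "\<alpha> * r * l \<le> c + 1" using \<alpha> by simp
  then have "\<alpha> * r \<le> (c + 1) / l" using l by (simp add: field_simps)
  then show ?thesis unfolding r(2) l_def using \<alpha> r(1) by (simp add: ennreal_mult[symmetric] ennreal_leI)
qed

section \<open>Independent identically distributed variables\<close>

text \<open>The index set is a parameter because the notion is used for the infinite sequence, for
  its initial blocks, and for coordinates of finite product spaces.\<close>

definition iid_law :: "'w measure \<Rightarrow> (nat \<Rightarrow> 'w \<Rightarrow> real) \<Rightarrow> nat set \<Rightarrow> real measure \<Rightarrow> bool" where
  "iid_law M X I \<psi> \<longleftrightarrow> prob_space M \<and> prob_space.indep_vars M (\<lambda>_. borel) X I \<and> (\<forall>i\<in>I. distr M borel (X i) = \<psi>)"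

lemma iid_lawD:
  assumes "iid_law M X I \<psi>"
  shows "prob_space M" "prob_space.indep_vars M (\<lambda>_. borel) X I" "\<And>i. i \<in> I \<Longrightarrow> distr M borel (X i) = \<psi>"
    "\<And>i. i \<in> I \<Longrightarrow> X i \<in> borel_measurable M"
proof -
  show p: "prob_space M" and i: "prob_space.indep_vars M (\<lambda>_. borel) X I"
    and "\<And>i. i \<in> I \<Longrightarrow> distr M borel (X i) = \<psi>"
    using assms by (auto simp: iid_law_def)
  show "\<And>i. i \<in> I \<Longrightarrow> X i \<in> borel_measurable M"
    using i unfolding prob_space.indep_vars_def[OF p] by simp
qed

lemma iid_law_subset: "iid_law M X I \<psi> \<Longrightarrow> J \<subseteq> I \<Longrightarrow> iid_law M X J \<psi>"
  unfolding iid_law_def using prob_space.indep_vars_subset by blast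

lemma iid_law_borel_probs:
  assumes "iid_law M X I \<psi>" "i \<in> I"
  shows "\<psi> \<in> borel_probs"
proof -
  interpret prob_space M using assms iid_lawD by blast
  show ?thesis
    using iid_lawD(3,4)[OF assms(1,2)] by (auto simp: borel_probs_def dest: prob_space_distr)
qed

lemma iid_law_integral:
  fixes g :: "real \<Rightarrow> real"
  assumes iid: "iid_law M X I \<psi>" and i: "i \<in> I" and g: "g \<in> borel_measurable borel"
  shows "(\<integral>\<omega>. g (X i \<omega>) \<partial>M) = (\<integral>x. g x \<partial>\<psi>)" "integrable M (\<lambda>\<omega>. g (X i \<omega>)) \<longleftrightarrow> integrable \<psi> g"
  using iid_lawD(3)[OF iid i] iid_lawD(4)[OF iid i] g
  by (auto simp: integral_distr[of "X i" M borel g, symmetric] integrable_distr_eq[of "X i" M borel g, symmetric])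

lemma iid_law_nn_integral:
  assumes iid: "iid_law M X I \<psi>" and i: "i \<in> I" and g: "g \<in> borel_measurable borel"
  shows "(\<integral>\<^sup>+\<omega>. g (X i \<omega>) \<partial>M) = (\<integral>\<^sup>+x. g x \<partial>\<psi>)"
proof -
  have "(\<integral>\<^sup>+\<omega>. g (X i \<omega>) \<partial>M) = (\<integral>\<^sup>+x. g x \<partial>distr M borel (X i))"
    using iid_lawD(4)[OF iid i] g by (subst nn_integral_distr) auto
  then show ?thesis by (simp only: iid_lawD(3)[OF iid i])
qed

lemma iid_law_nn_integral_prod:
  assumes iid: "iid_law M X I \<psi>" and J: "finite J" "J \<subseteq> I" and g[measurable]: "\<And>i. i \<in> J \<Longrightarrow> g i \<in> borel_measurable borel"
  shows "(\<integral>\<^sup>+\<omega>. (\<Prod>i\<in>J. g i (X i \<omega>)) \<partial>M) = (\<Prod>i\<in>J. \<integral>\<^sup>+x. g i x \<partial>\<psi>)"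
proof -
  interpret prob_space M using iid iid_lawD by blast
  have "indep_vars (\<lambda>_. borel) X J" using iid J iid_lawD(2) indep_vars_subset by blast
  then have "indep_vars (\<lambda>_. borel) (\<lambda>i \<omega>. g i (X i \<omega>)) J"
    by (rule indep_vars_compose2) (use g in auto)
  then have "(\<integral>\<^sup>+\<omega>. (\<Prod>i\<in>J. g i (X i \<omega>)) \<partial>M) = (\<Prod>i\<in>J. \<integral>\<^sup>+\<omega>. g i (X i \<omega>) \<partial>M)"
    using J by (intro indep_vars_nn_integral) auto
  also have "\<dots> = (\<Prod>i\<in>J. \<integral>\<^sup>+x. g i x \<partial>\<psi>)"
    using J g by (intro prod.cong refl iid_law_nn_integral[OF iid]) auto
  finally show ?thesis .
qed

text \<open>The threshold is uniform over all probability spaces carrying such variables, because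
  the law is applied on product spaces whose dimension grows with \<open>n\<close>; and
  \<open>n = 0\<close> is included since the first block of waiting times may be empty. The proof
  truncates \<open>g\<close>, using Hoeffding's inequality for the bounded part and Markov's for the
  remainder.\<close>

lemma weak_law_large_numbers:
  fixes \<nu> :: "real measure" and g :: "real \<Rightarrow> real"
  assumes \<nu>: "\<nu> \<in> borel_probs" and g[measurable]: "g \<in> borel_measurable borel" and int: "integrable \<nu> g" and e: "0 < e"
  shows "\<exists>n0. \<forall>n. n = 0 \<or> n0 \<le> n \<longrightarrow> (\<forall>(N :: 'w measure) X. iid_law N X {1..n} \<nu> \<longrightarrow>
     measure N {x \<in> space N. e * real n < \<bar>(\<Sum>i=1..n. g (X i x)) - real n * (\<integral>x. g x \<partial>\<nu>)\<bar>} \<le> e)"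
proof -
  interpret \<nu>: prob_space \<nu> using \<nu> borel_probsD by blast
  have s[measurable_cong]: "sets \<nu> = sets borel" using \<nu> borel_probsD by blast
  define c where "c R x = max (- real R) (min (real R) (g x))" for R x
  have [measurable]: "c R \<in> borel_measurable borel" for R unfolding c_def by measurable
  have "(\<lambda>R. \<integral>x. \<bar>g x - c R x\<bar> \<partial>\<nu>) \<longlonglongrightarrow> (\<integral>x. 0 \<partial>\<nu>)"
  proof (rule integral_dominated_convergence[where w="\<lambda>x. \<bar>g x\<bar>"])
    show "AE x in \<nu>. (\<lambda>R. \<bar>g x - c R x\<bar>) \<longlonglongrightarrow> 0"
    proof (rule AE_I2)
      fix x
      obtain k :: nat where k: "\<bar>g x\<bar> \<le> k" using real_arch_simple by blast
      have "\<bar>g x - c R x\<bar> = 0" if "k \<le> R" for R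
      proof -
        have "\<bar>g x\<bar> \<le> real R" using k that by (smt (verit) of_nat_mono)
        then show ?thesis by (simp add: c_def abs_le_iff)
      qed
      then show "(\<lambda>R. \<bar>g x - c R x\<bar>) \<longlonglongrightarrow> 0" by (intro tendsto_eventually eventually_sequentiallyI[of k]) auto
    qed
  qed (use int in \<open>auto simp: c_def\<close>)
  then have "\<forall>\<^sub>F R in sequentially. (\<integral>x. \<bar>g x - c R x\<bar> \<partial>\<nu>) < min (e / 4) (e\<^sup>2 / 8) \<and> 1 \<le> R"
    using e by (intro eventually_conj order_tendstoD(2) eventually_ge_at_top) auto
  \<comment> \<open>The bound \<open>e / 4\<close> controls the shift of the mean caused by
    truncation; \<open>e\<^sup>2 / 8\<close> brings Markov's bound \<open>4 * \<delta> / e\<close>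
    below \<open>e / 2\<close>.\<close>
  then obtain R where R: "(\<integral>x. \<bar>g x - c R x\<bar> \<partial>\<nu>) < min (e / 4) (e\<^sup>2 / 8)" "1 \<le> R"
    by (auto simp: eventually_sequentially)
  define \<delta> where "\<delta> = (\<integral>x. \<bar>g x - c R x\<bar> \<partial>\<nu>)"
  have \<delta>: "0 \<le> \<delta>" "\<delta> \<le> e / 4" "\<delta> \<le> e\<^sup>2 / 8" using R unfolding \<delta>_def by auto
  have cR: "\<bar>c R x\<bar> \<le> R" for x by (auto simp: c_def)
  have ci: "integrable \<nu> (c R)" by (rule \<nu>.integrable_const_bound[of _ R]) (use cR in auto)
  define m where "m = (\<integral>x. g x \<partial>\<nu>)"
  define mR where "mR = (\<integral>x. c R x \<partial>\<nu>)"
  have m: "\<bar>m - mR\<bar> \<le> \<delta>"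
  proof -
    have "m - mR = (\<integral>x. g x - c R x \<partial>\<nu>)" using int ci by (simp add: m_def mR_def)
    then show ?thesis using integral_abs_bound[of \<nu> "\<lambda>x. g x - c R x"] by (simp add: \<delta>_def)
  qed
  have "(\<lambda>n::nat. 2 * exp (- (e\<^sup>2 / (8 * (real R)\<^sup>2)) * real n)) \<longlonglongrightarrow> 2 * 0"
  proof (intro tendsto_intros)
    have p: "0 < e\<^sup>2 / (8 * (real R)\<^sup>2)" using e R by simp
    have "filterlim (\<lambda>n::nat. (e\<^sup>2 / (8 * (real R)\<^sup>2)) * real n) at_top sequentially"
      using p by (intro filterlim_tendsto_pos_mult_at_top[OF tendsto_const]) (auto simp: filterlim_real_sequentially)
    then show "(\<lambda>n::nat. exp (- (e\<^sup>2 / (8 * (real R)\<^sup>2)) * real n)) \<longlonglongrightarrow> 0"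
      by (intro filterlim_compose[OF exp_at_bot]) (simp add: filterlim_uminus_at_bot)
  qed
  then have "\<forall>\<^sub>F n in sequentially. 2 * exp (- (e\<^sup>2 / (8 * (real R)\<^sup>2)) * real n) < e / 2"
    by (rule order_tendstoD(2)) (use e in simp)
  then obtain n0 where n0: "\<And>n. n0 \<le> n \<Longrightarrow> 2 * exp (- (e\<^sup>2 / (8 * (real R)\<^sup>2)) * real n) < e / 2"
    by (auto simp: eventually_sequentially)
  show ?thesis
  proof (intro exI[of _ n0] allI impI)
    fix n and N :: "'w measure" and X assume n: "n = 0 \<or> n0 \<le> n" and iid: "iid_law N X {1..n} \<nu>"
    interpret N: prob_space N using iid iid_lawD by blast
    show "measure N {x \<in> space N. e * real n < \<bar>(\<Sum>i=1..n. g (X i x)) - real n * (\<integral>x. g x \<partial>\<nu>)\<bar>} \<le> e"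
    proof (cases "n = 0")
      case False
      then have n1: "0 < n" "n0 \<le> n" using n by auto
      have X[measurable]: "X i \<in> borel_measurable N" if "i \<in> {1..n}" for i using iid_lawD(4)[OF iid that] .
      have sm[measurable]: "(\<lambda>x. \<Sum>i=1..n. f (X i x)) \<in> borel_measurable N" if [measurable]: "f \<in> borel_measurable borel" for f :: "real \<Rightarrow> real"
        by (intro borel_measurable_sum) (use measurable_compose[OF X that] in auto)
      define U where "U x = (\<Sum>i=1..n. \<bar>g (X i x) - c R (X i x)\<bar>)" for x
      define V where "V x = (\<Sum>i=1..n. c R (X i x))" for x
      have [measurable]: "U \<in> borel_measurable N" "V \<in> borel_measurable N"
        unfolding U_def V_def by (auto intro!: sm[of "\<lambda>x. \<bar>g x - c R x\<bar>"] sm[of "c R"])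
      have Ui: "integrable N (\<lambda>x. \<bar>g (X i x) - c R (X i x)\<bar>)" "(\<integral>x. \<bar>g (X i x) - c R (X i x)\<bar> \<partial>N) = \<delta>" if "i \<in> {1..n}" for i
        using iid_law_integral[OF iid that, of "\<lambda>x. \<bar>g x - c R x\<bar>"] int ci by (auto simp: \<delta>_def)
      have EU: "(\<integral>x. U x \<partial>N) = n * \<delta>" "integrable N U" unfolding U_def using Ui by (auto simp: Bochner_Integration.integral_sum)
      have U0: "0 \<le> U x" for x by (simp add: U_def sum_nonneg)
      have "measure N {x \<in> space N. e * n / 4 \<le> U x} \<le> (\<integral>x. U x \<partial>N) / (e * n / 4)"
        using e n1 EU by (intro integral_Markov_inequality_measure[where A="{}"]) (auto simp: U0)
      also have "\<dots> = 4 * \<delta> / e" using n1 e by (simp add: EU field_simps)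
      also have "\<dots> \<le> e / 2" using \<delta>(3) e by (simp add: field_simps power2_eq_square)
      finally have PU: "measure N {x \<in> space N. e * n / 4 \<le> U x} \<le> e / 2" .
      have PV: "measure N {x \<in> space N. e * n / 2 \<le> \<bar>V x - n * mR\<bar>} \<le> e / 2"
      proof -
        \<comment> \<open>A deviation of \<open>e * n / 2\<close> for values in an interval of
          length \<open>2 * R\<close> gives the exponent for which \<open>n0\<close> was chosen. The
          three errors \<open>e * n / 4\<close>, \<open>e * n / 2\<close> and
          \<open>e * n / 4\<close> add up to \<open>e * n\<close>.\<close>
        interpret H: Hoeffding_ineq N "{1..n}" "\<lambda>i x. c R (X i x)" "\<lambda>_. - real R" "\<lambda>_. real R" "\<Sum>i=1..n. N.expectation (\<lambda>x. c R (X i x))"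
        proof unfold_locales
          show "N.indep_vars (\<lambda>_. borel) (\<lambda>i x. c R (X i x)) {1..n}"
            using iid_lawD(2)[OF iid] by (rule N.indep_vars_compose2) auto
          show "AE x in N. c R (X i x) \<in> {- real R..real R}" for i by (auto simp: c_def)
        qed auto
        have mu: "(\<Sum>i=1..n. N.expectation (\<lambda>x. c R (X i x))) = n * mR"
          using iid_law_integral(1)[OF iid, of _ "c R"] by (simp add: mR_def)
        have sq: "(\<Sum>i=1..n. (real R - - real R)\<^sup>2) = n * (2 * real R)\<^sup>2" by simp
        have "measure N {x \<in> space N. e * n / 2 \<le> \<bar>V x - n * mR\<bar>} \<le> 2 * exp (- 2 * (e * n / 2)\<^sup>2 / (\<Sum>i=1..n. (real R - - real R)\<^sup>2))"
          unfolding V_def using H.Hoeffding_ineq_abs_ge[of "e * n / 2"] e n1 R(2) unfolding mu by simp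
        also have "- 2 * (e * n / 2)\<^sup>2 / (\<Sum>i=1..n. (real R - - real R)\<^sup>2) = - (e\<^sup>2 / (8 * (real R)\<^sup>2)) * n"
          unfolding sq using n1 R(2) by (simp add: field_simps power2_eq_square)
        also have "2 * exp \<dots> \<le> e / 2" using n0[OF n1(2)] by simp
        finally show ?thesis .
      qed
      have "measure N {x \<in> space N. e * real n < \<bar>(\<Sum>i=1..n. g (X i x)) - real n * (\<integral>x. g x \<partial>\<nu>)\<bar>} \<le>
         measure N ({x \<in> space N. e * n / 4 \<le> U x} \<union> {x \<in> space N. e * n / 2 \<le> \<bar>V x - n * mR\<bar>})"
      proof (rule N.finite_measure_mono)
        show "{x \<in> space N. e * real n < \<bar>(\<Sum>i=1..n. g (X i x)) - real n * (\<integral>x. g x \<partial>\<nu>)\<bar>} \<subseteq>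
          {x \<in> space N. e * n / 4 \<le> U x} \<union> {x \<in> space N. e * n / 2 \<le> \<bar>V x - n * mR\<bar>}"
        proof (intro subsetI, rule ccontr)
          fix x assume x: "x \<in> {x \<in> space N. e * real n < \<bar>(\<Sum>i=1..n. g (X i x)) - real n * (\<integral>x. g x \<partial>\<nu>)\<bar>}"
            "x \<notin> {x \<in> space N. e * n / 4 \<le> U x} \<union> {x \<in> space N. e * n / 2 \<le> \<bar>V x - n * mR\<bar>}"
          then have x1: "e * n < \<bar>(\<Sum>i=1..n. g (X i x)) - n * m\<bar>" and x2: "U x < e * n / 4" "\<bar>V x - n * mR\<bar> < e * n / 2"
            by (auto simp: m_def not_le)
          have "\<bar>(\<Sum>i=1..n. g (X i x)) - V x\<bar> \<le> U x"
            unfolding U_def V_def by (subst sum_subtractf[symmetric]) (rule sum_abs)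
          moreover have "\<bar>n * mR - n * m\<bar> \<le> e * n / 4"
          proof -
            have "\<bar>n * mR - n * m\<bar> = n * \<bar>m - mR\<bar>" by (simp only: right_diff_distrib[symmetric] abs_mult) (simp add: abs_minus_commute)
            also have "\<dots> \<le> n * (e / 4)" using m \<delta>(2) by (intro mult_left_mono) auto
            finally show ?thesis by (simp add: mult.commute)
          qed
          ultimately have "\<bar>(\<Sum>i=1..n. g (X i x)) - n * m\<bar> \<le> e * n / 4 + e * n / 2 + e * n / 4" using x2 by linarith
          then show False using x1 by simp
        qed
      qed auto
      also have "\<dots> \<le> e / 2 + e / 2" by (rule order_trans[OF measure_Un_le add_mono[OF PU PV]]) auto
      finally show ?thesis by simp
    qed (use e in simp)
  qed
qed

section \<open>Densities and coordinates of finite products\<close>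

lemma PiM_density:
  assumes I: "finite I" and prob: "\<And>i. prob_space (P i)" "\<And>i. prob_space (density (P i) (f i))"
    and f[measurable]: "\<And>i. f i \<in> borel_measurable (P i)"
  shows "PiM I (\<lambda>i. density (P i) (f i)) = density (PiM I P) (\<lambda>x. \<Prod>i\<in>I. f i (x i))"
proof -
  interpret P: product_sigma_finite P
    by (rule product_sigma_finite.intro) (rule prob_space_imp_sigma_finite[OF prob(1)])
  interpret D: product_sigma_finite "\<lambda>i. density (P i) (f i)"
    by (rule product_sigma_finite.intro) (rule prob_space_imp_sigma_finite[OF prob(2)])
  show ?thesis
  proof (rule D.PiM_eqI[OF I, symmetric])
    show "sets (density (PiM I P) (\<lambda>x. \<Prod>i\<in>I. f i (x i))) = sets (PiM I (\<lambda>i. density (P i) (f i)))"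
      by (simp cong: sets_PiM_cong)
    fix A assume "\<And>i. i \<in> I \<Longrightarrow> A i \<in> sets (density (P i) (f i))"
    then have A[measurable]: "\<And>i. i \<in> I \<Longrightarrow> A i \<in> sets (P i)" by simp
    have "emeasure (density (PiM I P) (\<lambda>x. \<Prod>i\<in>I. f i (x i))) (Pi\<^sub>E I A) =
       (\<integral>\<^sup>+x. (\<Prod>i\<in>I. f i (x i)) * indicator (Pi\<^sub>E I A) x \<partial>PiM I P)"
      using A I by (intro emeasure_density sets_PiM_I_finite) auto
    also have "\<dots> = (\<integral>\<^sup>+x. (\<Prod>i\<in>I. f i (x i) * indicator (A i) (x i)) \<partial>PiM I P)"
    proof (rule nn_integral_cong)
      fix x assume "x \<in> space (PiM I P)"
      then have "x \<in> extensional I" by (simp add: space_PiM PiE_def)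
      then have "(\<Prod>i\<in>I. indicator (A i) (x i)) = (indicator (Pi\<^sub>E I A) x :: ennreal)"
        using I by (auto simp: indicator_def PiE_def Pi_def prod_eq_1_iff intro!: prod_zero)
      then show "(\<Prod>i\<in>I. f i (x i)) * indicator (Pi\<^sub>E I A) x = (\<Prod>i\<in>I. f i (x i) * indicator (A i) (x i))"
        by (simp add: prod.distrib)
    qed
    also have "\<dots> = (\<Prod>i\<in>I. \<integral>\<^sup>+x. f i x * indicator (A i) x \<partial>P i)"
      using A by (intro P.product_nn_integral_prod[OF I]) auto
    also have "\<dots> = (\<Prod>i\<in>I. emeasure (density (P i) (f i)) (A i))"
      using A by (intro prod.cong refl emeasure_density[symmetric]) auto
    finally show "emeasure (density (PiM I P) (\<lambda>x. \<Prod>i\<in>I. f i (x i))) (Pi\<^sub>E I A) = (\<Prod>i\<in>I. emeasure (density (P i) (f i)) (A i))" .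
  qed
qed

lemma PiM_coordinates_iid:
  assumes I: "finite I" and prob: "\<And>i. prob_space (P i)" "\<And>i. sets (P i) = sets borel"
    and J: "J \<subseteq> I" "\<And>i. i \<in> J \<Longrightarrow> P i = \<nu>"
  shows "iid_law (PiM I P) (\<lambda>i x. x i) J \<nu>"
proof -
  interpret P: prob_space "PiM I P" by (rule prob_space_PiM) (rule prob(1))
  have comp: "distr (PiM I P) borel (\<lambda>x. x i) = P i" if "i \<in> I" for i
  proof -
    have "distr (PiM I P) borel (\<lambda>x. x i) = distr (PiM I P) (P i) (\<lambda>x. x i)"
      by (rule distr_cong) (simp_all add: prob(2))
    then show ?thesis using distr_PiM_component[OF prob(1) that] by simp
  qed
  show ?thesis
  proof (cases "J = {}")
    case True
    then show ?thesis
      by (simp add: iid_law_def P.prob_space_axioms P.indep_vars_def P.indep_sets_def)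
  next
    case False
    then have Ine: "I \<noteq> {}" using J(1) by auto
    have sets: "sets (PiM I (\<lambda>i. borel)) = sets (PiM I P)" by (rule sets_PiM_cong) (simp_all add: prob(2))
    have "distr (PiM I P) (PiM I (\<lambda>i. borel)) (\<lambda>x. \<lambda>i\<in>I. x i) = distr (PiM I P) (PiM I P) (\<lambda>x. x)"
      using sets by (intro distr_cong refl) (auto simp: space_PiM PiE_def extensional_restrict)
    also have "\<dots> = PiM I P" by (rule distr_id2) (rule refl)
    also have "\<dots> = PiM I (\<lambda>i. distr (PiM I P) borel (\<lambda>x. x i))" using comp by (intro PiM_cong) auto
    finally have "distr (PiM I P) (PiM I (\<lambda>i. borel)) (\<lambda>x. \<lambda>i\<in>I. x i) = PiM I (\<lambda>i. distr (PiM I P) borel (\<lambda>x. x i))" .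
    moreover have "(\<lambda>x. x i) \<in> borel_measurable (PiM I P)" if "i \<in> I" for i
      using measurable_component_singleton[OF that, of P] measurable_cong_sets[OF refl prob(2)[of i]] by blast
    ultimately have "P.indep_vars (\<lambda>_. borel) (\<lambda>i x. x i) I"
      using P.indep_vars_iff_distr_eq_PiM'[OF Ine, where M'="\<lambda>_. borel" and X="\<lambda>i x. x i"] by blast
    then show ?thesis
      unfolding iid_law_def using P.indep_vars_subset[OF _ J(1)] P.prob_space_axioms comp J(2) subsetD[OF J(1)] by simp
  qed
qed

section \<open>Exponential bounds for renewal paths\<close>

text \<open>On \<open>A\<close> the likelihood ratio is at most \<open>C\<close>, so a lower bound
  under the changed law becomes one under \<open>\<psi>\<close>. The densities may vary with the
  coordinate because the two blocks of the lower bound are changed differently.\<close>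

lemma iid_change_of_measure:
  fixes M :: "'w measure" and X :: "nat \<Rightarrow> 'w \<Rightarrow> real"
  assumes iid: "iid_law M X I \<psi>" and I: "finite I" "I \<noteq> {}"
    and f[measurable]: "\<And>i. f i \<in> borel_measurable borel" and f0: "\<And>i x. 0 \<le> (f i x :: real)"
    and prob: "\<And>i. prob_space (density \<psi> (\<lambda>x. ennreal (f i x)))"
    and A[measurable]: "A \<in> sets (PiM I (\<lambda>_. borel))" and C: "0 \<le> C" "\<And>x. x \<in> A \<Longrightarrow> (\<Prod>i\<in>I. f i (x i)) \<le> C"
  shows "measure (PiM I (\<lambda>i. density \<psi> (\<lambda>x. ennreal (f i x)))) A \<le>
    C * measure M {\<omega> \<in> space M. (\<lambda>i\<in>I. X i \<omega>) \<in> A}"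
proof -
  interpret M: prob_space M using iid by (rule iid_lawD)
  obtain i0 where i0: "i0 \<in> I" using I(2) by blast
  have \<psi>: "\<psi> \<in> borel_probs" using iid_law_borel_probs[OF iid i0] .
  have p\<psi>: "prob_space \<psi>" using \<psi> by (rule borel_probsD)
  have s[measurable_cong]: "sets \<psi> = sets borel" using \<psi> by (rule borel_probsD)
  let ?Q = "PiM I (\<lambda>i. density \<psi> (\<lambda>x. ennreal (f i x)))" and ?P = "PiM I (\<lambda>_. \<psi>)"
  have sP: "sets ?P = sets (PiM I (\<lambda>_. borel))" by (rule sets_PiM_cong) (simp_all add: s)
  have [measurable]: "A \<in> sets ?P" using A sP by simp
  interpret Q: prob_space ?Q by (rule prob_space_PiM) (rule prob)
  interpret P: prob_space ?P by (rule prob_space_PiM) (rule p\<psi>)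
  have Q: "?Q = density ?P (\<lambda>x. \<Prod>i\<in>I. ennreal (f i (x i)))"
    by (rule PiM_density[OF I(1) p\<psi> prob]) measurable
  have "emeasure ?Q A = (\<integral>\<^sup>+x. (\<Prod>i\<in>I. ennreal (f i (x i))) * indicator A x \<partial>?P)"
    unfolding Q by (rule emeasure_density) measurable
  also have "\<dots> \<le> (\<integral>\<^sup>+x. ennreal C * indicator A x \<partial>?P)"
    using C f0 by (intro nn_integral_mono) (auto split: split_indicator simp: prod_ennreal intro!: ennreal_leI)
  also have "\<dots> = ennreal C * emeasure ?P A" by (rule nn_integral_cmult_indicator) measurable
  finally have "ennreal (measure ?Q A) \<le> ennreal (C * measure ?P A)"
    using C(1) by (simp add: Q.emeasure_eq_measure P.emeasure_eq_measure ennreal_mult)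
  then have "measure ?Q A \<le> C * measure ?P A" using C(1) by (simp add: ennreal_le_iff)
  moreover have "?P = distr M (PiM I (\<lambda>_. borel)) (\<lambda>\<omega>. \<lambda>i\<in>I. X i \<omega>)"
  proof -
    have "distr M (PiM I (\<lambda>_. borel)) (\<lambda>\<omega>. \<lambda>i\<in>I. X i \<omega>) = PiM I (\<lambda>i. distr M borel (X i))"
      using M.indep_vars_iff_distr_eq_PiM'[OF I(2), where M'="\<lambda>_. borel" and X=X] iid_lawD(2,4)[OF iid] by blast
    also have "\<dots> = ?P" using iid_lawD(3)[OF iid] by (intro PiM_cong) auto
    finally show ?thesis by simp
  qed
  moreover have "measure (distr M (PiM I (\<lambda>_. borel)) (\<lambda>\<omega>. \<lambda>i\<in>I. X i \<omega>)) A = measure M {\<omega> \<in> space M. (\<lambda>i\<in>I. X i \<omega>) \<in> A}"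
    using iid_lawD(4)[OF iid] A by (subst measure_distr) (auto intro!: measurable_restrict arg_cong[where f="measure M"])
  ultimately show ?thesis by simp
qed

text \<open>The first \<open>n1\<close> coordinates get the law \<open>\<nu>\<close>, the next
  \<open>n2\<close> are conditioned to lie in \<open>B\<close>. Under this law the event has
  probability at least one half by the law of large numbers. Each conditioned coordinate costs a
  factor \<open>measure \<psi> B\<close>, and the likelihood ratio of the first block is controlled
  by treating \<open>ln D\<close> as one more observable.\<close>

lemma lower_block:
  fixes \<psi> \<nu> :: "real measure" and D :: "real \<Rightarrow> real"
  assumes \<psi>: "\<psi> \<in> borel_probs" and \<nu>: "\<nu> \<in> borel_probs" and D[measurable]: "D \<in> borel_measurable borel"
    and D0: "\<And>x. 0 \<le> D x" and dens: "\<nu> = density \<psi> (\<lambda>x. ennreal (D x))"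
    and lnD: "integrable \<nu> (\<lambda>x. ln (D x))" and G: "finite G" "\<And>g. g \<in> G \<Longrightarrow> g \<in> borel_measurable borel \<and> integrable \<nu> g"
    and e: "0 < e" and B[measurable]: "B \<in> sets borel"
  shows "\<exists>n0. \<forall>n1 n2. n1 = 0 \<or> n0 \<le> n1 \<longrightarrow> n2 = 0 \<or> 0 < measure \<psi> B \<longrightarrow>
    (\<forall>(M :: 'w measure) X. iid_law M X {1..} \<psi> \<longrightarrow>
      1 / 2 * exp (- (real n1 * ((\<integral>x. ln (D x) \<partial>\<nu>) + e))) * measure \<psi> B ^ n2 \<le>
      measure M {\<omega> \<in> space M. (\<forall>g\<in>G. \<bar>(\<Sum>i=1..n1. g (X i \<omega>)) - real n1 * (\<integral>x. g x \<partial>\<nu>)\<bar> \<le> e * real n1) \<and>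
        (\<forall>i\<in>{n1<..n1 + n2}. X i \<omega> \<in> B)})"
proof -
  interpret \<psi>: prob_space \<psi> using \<psi> borel_probsD by blast
  interpret \<nu>: prob_space \<nu> using \<nu> borel_probsD by blast
  have s[measurable_cong]: "sets \<psi> = sets borel" "sets \<nu> = sets borel" using \<psi> \<nu> borel_probsD by blast+
  define L where "L x = ln (D x)" for x
  have [measurable]: "L \<in> borel_measurable borel" unfolding L_def by measurable
  define H where "H = (\<integral>x. L x \<partial>\<nu>)"
  define G' where "G' = insert L G"
  have G': "finite G'" "\<And>g. g \<in> G' \<Longrightarrow> g \<in> borel_measurable borel" "\<And>g. g \<in> G' \<Longrightarrow> integrable \<nu> g"
    using G lnD unfolding G'_def by (auto simp: L_def[abs_def])
  \<comment> \<open>Each observable fails with probability at most \<open>e'\<close>; this choice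
    keeps the sum of all failures at most one half.\<close>
  define e' where "e' = min e (1 / (2 * (card G' + 1)))"
  have e': "0 < e'" "e' \<le> e" "card G' * e' \<le> 1 / 2"
  proof -
    have "card G' * e' \<le> card G' * (1 / (2 * (card G' + 1)))" unfolding e'_def by (intro mult_left_mono) auto
    also have "\<dots> \<le> 1 / 2" by (simp add: field_simps)
    finally show "card G' * e' \<le> 1 / 2" .
  qed (use e in \<open>auto simp: e'_def\<close>)
  have "\<forall>g\<in>G'. \<exists>n0. \<forall>n. n = 0 \<or> n0 \<le> n \<longrightarrow> (\<forall>(N :: (nat \<Rightarrow> real) measure) X. iid_law N X {1..n} \<nu> \<longrightarrow>
     measure N {x \<in> space N. e' * real n < \<bar>(\<Sum>i=1..n. g (X i x)) - real n * (\<integral>x. g x \<partial>\<nu>)\<bar>} \<le> e')"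
    using weak_law_large_numbers[OF \<nu> G'(2,3) e'(1)] by blast
  from bchoice[OF this] obtain n0 where "\<forall>g\<in>G'. \<forall>n. n = 0 \<or> n0 g \<le> n \<longrightarrow> (\<forall>(N :: (nat \<Rightarrow> real) measure) X. iid_law N X {1..n} \<nu> \<longrightarrow>
     measure N {x \<in> space N. e' * real n < \<bar>(\<Sum>i=1..n. g (X i x)) - real n * (\<integral>x. g x \<partial>\<nu>)\<bar>} \<le> e')"
    by blast
  then have n0: "measure N {x \<in> space N. e' * real n < \<bar>(\<Sum>i=1..n. g (X i x)) - real n * (\<integral>x. g x \<partial>\<nu>)\<bar>} \<le> e'"
    if "g \<in> G'" "n = 0 \<or> n0 g \<le> n" "iid_law N X {1..n} \<nu>" for g n and N :: "(nat \<Rightarrow> real) measure" and X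
    using that by blast
  define p where "p = measure \<psi> B"
  show ?thesis
  proof (intro exI[of _ "Max (n0 ` G')"] allI impI)
    fix n1 n2 :: nat and M :: "'w measure" and X
    assume n1: "n1 = 0 \<or> Max (n0 ` G') \<le> n1" and n2: "n2 = 0 \<or> 0 < measure \<psi> B" and iid: "iid_law M X {1..} \<psi>"
    have n1': "n1 = 0 \<or> n0 g \<le> n1" if "g \<in> G'" for g using n1 Max_ge[of "n0 ` G'" "n0 g"] that G'(1) by fastforce
    interpret M: prob_space M using iid by (rule iid_lawD)
    have X[measurable]: "X i \<in> borel_measurable M" if "1 \<le> i" for i using iid_lawD(4)[OF iid] that by simp
    let ?I = "{1..n1 + n2}"
    let ?E = "{\<omega> \<in> space M. (\<forall>g\<in>G. \<bar>(\<Sum>i=1..n1. g (X i \<omega>)) - real n1 * (\<integral>x. g x \<partial>\<nu>)\<bar> \<le> e * real n1) \<and>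
        (\<forall>i\<in>{n1<..n1 + n2}. X i \<omega> \<in> B)}"
    show "1 / 2 * exp (- (real n1 * ((\<integral>x. ln (D x) \<partial>\<nu>) + e))) * measure \<psi> B ^ n2 \<le> measure M ?E"
    proof (cases "n1 + n2 = 0")
      case True
      then show ?thesis by (simp add: M.prob_space)
    next
      case False
      \<comment> \<open>If \<open>p = 0\<close> then \<open>n2 = 0\<close>, and no coordinate of the
        second block occurs; using \<open>D\<close> there keeps \<open>f i\<close> a probability
        density for every index, as the product construction requires.\<close>
      define f where "f i x = (if i \<le> n1 \<or> p = 0 then D x else indicator B x / p)" for i x
      have [measurable]: "f i \<in> borel_measurable borel" for i
        unfolding f_def by (cases "i \<le> n1 \<or> p = 0") auto
      have fm: "(\<lambda>x. ennreal (f i x)) \<in> borel_measurable \<psi>" for i by measurable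
      have f0: "0 \<le> f i x" for i x using D0 by (auto simp: f_def p_def)
      have prob: "prob_space (density \<psi> (\<lambda>x. ennreal (f i x)))" for i
      proof (cases "i \<le> n1 \<or> p = 0")
        case True
        then have "(\<lambda>x. ennreal (f i x)) = (\<lambda>x. ennreal (D x))" by (auto simp: f_def)
        then show ?thesis using \<nu>.prob_space_axioms dens by simp
      next
        case False
        then have p: "0 < p" by (simp add: p_def zero_less_measure_iff less_le)
        have "emeasure (density \<psi> (\<lambda>x. ennreal (f i x))) (space \<psi>) = (\<integral>\<^sup>+x. ennreal (1 / p) * indicator B x \<partial>\<psi>)"
          using False p by (subst emeasure_density) (auto simp: f_def intro!: nn_integral_cong split: split_indicator)
        also have "\<dots> = ennreal (1 / p) * ennreal p"
          by (subst nn_integral_cmult_indicator) (auto simp: p_def \<psi>.emeasure_eq_measure)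
        also have "\<dots> = 1" using p by (simp flip: ennreal_mult)
        finally show ?thesis by (intro prob_spaceI) simp
      qed
      let ?Q = "PiM ?I (\<lambda>i. density \<psi> (\<lambda>x. ennreal (f i x)))" and ?b = "PiM ?I (\<lambda>_. borel :: real measure)"
      interpret Q: prob_space ?Q by (rule prob_space_PiM) (rule prob)
      have sQ: "sets ?Q = sets ?b" by (rule sets_PiM_cong) (simp_all add: s)
      have spQ: "space ?Q = space ?b" by (rule sets_eq_imp_space_eq[OF sQ])
      have Qnu: "density \<psi> (\<lambda>x. ennreal (f i x)) = \<nu>" if "i \<le> n1" for i
        using that by (simp add: f_def dens)
      have iidQ: "iid_law ?Q (\<lambda>i x. x i) {1..n1} \<nu>"
        by (rule PiM_coordinates_iid) (use prob Qnu in \<open>auto simp: s\<close>)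
      define bad where "bad g = {x \<in> space ?b. e' * real n1 < \<bar>(\<Sum>i=1..n1. g (x i)) - real n1 * (\<integral>x. g x \<partial>\<nu>)\<bar>}" for g
      have mg[measurable]: "(\<lambda>x. \<Sum>i=1..n1. g (x i)) \<in> borel_measurable ?b" if "g \<in> G'" for g
      proof (intro borel_measurable_sum)
        fix i assume "i \<in> {1..n1}"
        then have "i \<in> ?I" by auto
        then show "(\<lambda>x. g (x i)) \<in> borel_measurable ?b"
          using G'(2)[OF that] by (intro measurable_compose[OF measurable_component_singleton]) auto
      qed
      have bad_sets: "bad g \<in> sets ?b" if "g \<in> G'" for g
        unfolding bad_def using mg[OF that] by measurable
      have bad: "Q.prob (bad g) \<le> e'" if "g \<in> G'" for g
        using n0[OF that n1'[OF that] iidQ] by (simp only: bad_def spQ)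
      \<comment> \<open>Positivity of \<open>D\<close> on the first block allows the product of
        densities to be written as the exponential of a sum of logarithms, in spite of
        \<open>ln 0 = 0\<close>.\<close>
      define A where "A = {x \<in> space ?b. (\<forall>g\<in>G'. x \<notin> bad g) \<and> (\<forall>i\<in>{n1<..n1 + n2}. x i \<in> B) \<and> (\<forall>i\<in>{1..n1}. 0 < D (x i))}"
      have A_eq: "A = (space ?b - (\<Union>g\<in>G'. bad g)) \<inter> {x \<in> space ?b. (\<forall>i\<in>{n1<..n1 + n2}. x i \<in> B) \<and> (\<forall>i\<in>{1..n1}. 0 < D (x i))}"
        by (auto simp: A_def)
      have comp[measurable]: "(\<lambda>x. x i) \<in> borel_measurable ?b" if "i \<in> ?I" for i
        using that by (rule measurable_component_singleton)
      have set2: "{x \<in> space ?b. (\<forall>i\<in>{n1<..n1 + n2}. x i \<in> B) \<and> (\<forall>i\<in>{1..n1}. 0 < D (x i))} \<in> sets ?b"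
      proof -
        have "Measurable.pred ?b (\<lambda>x. (\<forall>i\<in>{n1<..n1 + n2}. x i \<in> B) \<and> (\<forall>i\<in>{1..n1}. 0 < D (x i)))"
        proof (intro pred_intros_logic pred_intros_finite)
          fix i assume "i \<in> {n1<..n1 + n2}"
          then have [measurable]: "(\<lambda>x. x i) \<in> borel_measurable ?b" by (intro comp) auto
          show "Measurable.pred ?b (\<lambda>x. x i \<in> B)" by measurable
        next
          fix i assume "i \<in> {1..n1}"
          then have [measurable]: "(\<lambda>x. x i) \<in> borel_measurable ?b" by (intro comp) auto
          show "Measurable.pred ?b (\<lambda>x. 0 < D (x i))" by measurable
        qed auto
        then show ?thesis by (simp add: pred_def)
      qed
      have UB: "(\<Union>g\<in>G'. bad g) \<in> sets ?b" using G'(1) bad_sets by auto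
      have A: "A \<in> sets ?b" unfolding A_eq using set2 UB by auto
      have QA: "1 / 2 \<le> Q.prob A"
      proof -
        have "AE x in ?Q. \<forall>i\<in>{n1<..n1 + n2}. x i \<in> B"
        proof (intro AE_finite_allI)
          fix i assume i: "i \<in> {n1<..n1 + n2}"
          then have p: "0 < p" using n2 by (auto simp: p_def)
          have "AE x in density \<psi> (\<lambda>x. ennreal (f i x)). x \<in> B"
            using i p by (subst AE_density[OF fm]) (auto simp: f_def split: split_indicator)
          then show "AE x in ?Q. x i \<in> B" using i prob by (intro AE_PiM_component) auto
        qed simp
        moreover have "AE x in ?Q. \<forall>i\<in>{1..n1}. 0 < D (x i)"
        proof (intro AE_finite_allI)
          fix i assume i: "i \<in> {1..n1}"
          have "AE x in density \<psi> (\<lambda>x. ennreal (f i x)). 0 < D x"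
            using i by (subst AE_density[OF fm]) (auto simp: f_def)
          then show "AE x in ?Q. 0 < D (x i)" using i prob by (intro AE_PiM_component) auto
        qed simp
        moreover have "AE x in ?Q. x \<in> space ?b" unfolding spQ[symmetric] by (rule AE_space)
        ultimately have "AE x in ?Q. x \<in> A \<union> (\<Union>g\<in>G'. bad g)"
          by eventually_elim (auto simp: A_def)
        then have "Q.prob (A \<union> (\<Union>g\<in>G'. bad g)) = 1"
          using A UB sQ by (subst Q.prob_eq_1) auto
        moreover have "Q.prob (A \<union> (\<Union>g\<in>G'. bad g)) \<le> Q.prob A + Q.prob (\<Union>g\<in>G'. bad g)"
          using A UB sQ by (intro measure_Un_le) auto
        moreover have "Q.prob (\<Union>g\<in>G'. bad g) \<le> (\<Sum>g\<in>G'. Q.prob (bad g))"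
          using G'(1) bad_sets sQ by (intro Q.finite_measure_subadditive_finite) auto
        moreover have "(\<Sum>g\<in>G'. Q.prob (bad g)) \<le> card G' * e'"
          using bad sum_bounded_above[of G' "\<lambda>g. Q.prob (bad g)" e'] by simp
        ultimately show ?thesis using e'(3) by linarith
      qed
      define C where "C = exp (real n1 * (H + e)) * (1 / p) ^ n2"
      have C0: "0 \<le> C" by (simp add: C_def p_def)
      have bound: "(\<Prod>i\<in>?I. f i (x i)) \<le> C" if x: "x \<in> A" for x
      proof -
        have split: "?I = {1..n1} \<union> {n1<..n1 + n2}" by auto
        have "(\<Prod>i\<in>?I. f i (x i)) = (\<Prod>i\<in>{1..n1}. f i (x i)) * (\<Prod>i\<in>{n1<..n1 + n2}. f i (x i))"
          unfolding split by (rule prod.union_disjoint) auto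
        also have "(\<Prod>i\<in>{1..n1}. f i (x i)) = (\<Prod>i\<in>{1..n1}. exp (L (x i)))"
          using x by (intro prod.cong) (auto simp: f_def L_def A_def)
        also have "\<dots> = exp (\<Sum>i=1..n1. L (x i))" by (simp add: exp_sum)
        also have "(\<Prod>i\<in>{n1<..n1 + n2}. f i (x i)) = (\<Prod>i\<in>{n1<..n1 + n2}. 1 / p)"
        proof (rule prod.cong[OF refl])
          fix i assume i: "i \<in> {n1<..n1 + n2}"
          then have "0 < p" using n2 by (auto simp: p_def)
          then show "f i (x i) = 1 / p" using i x by (auto simp: f_def A_def)
        qed
        also have "\<dots> = (1 / p) ^ n2" by simp
        also have "exp (\<Sum>i=1..n1. L (x i)) * (1 / p) ^ n2 \<le> C"
        proof -
          have "x \<notin> bad L" "x \<in> space ?b" using x by (auto simp: A_def G'_def)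
          then have "\<bar>(\<Sum>i=1..n1. L (x i)) - real n1 * H\<bar> \<le> e' * real n1" by (auto simp: bad_def H_def)
          moreover have "e' * real n1 \<le> e * real n1" using e'(2) by (intro mult_right_mono) auto
          ultimately have "(\<Sum>i=1..n1. L (x i)) \<le> real n1 * (H + e)" by (simp add: algebra_simps)
          then show ?thesis unfolding C_def by (intro mult_right_mono) (auto simp: p_def)
        qed
        finally show ?thesis .
      qed
      have "1 / 2 \<le> C * measure M {\<omega> \<in> space M. (\<lambda>i\<in>?I. X i \<omega>) \<in> A}"
        using QA iid_change_of_measure[OF iid_law_subset[OF iid, of ?I] _ _ _ f0 prob A C0 bound] False by auto
      also have "\<dots> \<le> C * measure M ?E"
      proof (intro mult_left_mono M.finite_measure_mono C0)
        show "{\<omega> \<in> space M. (\<lambda>i\<in>?I. X i \<omega>) \<in> A} \<subseteq> ?E"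
        proof (intro subsetI CollectI conjI ballI)
          fix \<omega> assume \<omega>: "\<omega> \<in> {\<omega> \<in> space M. (\<lambda>i\<in>?I. X i \<omega>) \<in> A}"
          then show "\<omega> \<in> space M" by simp
          fix i assume i: "i \<in> {n1<..n1 + n2}"
          then have "(\<lambda>i\<in>?I. X i \<omega>) i \<in> B" using \<omega> unfolding A_def by blast
          then show "X i \<omega> \<in> B" using i by simp
        next
          fix \<omega> g assume \<omega>: "\<omega> \<in> {\<omega> \<in> space M. (\<lambda>i\<in>?I. X i \<omega>) \<in> A}" and g: "g \<in> G"
          have "(\<Sum>i=1..n1. g ((\<lambda>i\<in>?I. X i \<omega>) i)) = (\<Sum>i=1..n1. g (X i \<omega>))" by (intro sum.cong) auto
          moreover have "(\<lambda>i\<in>?I. X i \<omega>) \<notin> bad g" "(\<lambda>i\<in>?I. X i \<omega>) \<in> space ?b" using \<omega> g by (auto simp: A_def G'_def)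
          ultimately have "\<bar>(\<Sum>i=1..n1. g (X i \<omega>)) - real n1 * (\<integral>x. g x \<partial>\<nu>)\<bar> \<le> e' * real n1"
            unfolding bad_def by auto
          also have "\<dots> \<le> e * real n1" using e'(2) by (intro mult_right_mono) auto
          finally show "\<bar>(\<Sum>i=1..n1. g (X i \<omega>)) - real n1 * (\<integral>x. g x \<partial>\<nu>)\<bar> \<le> e * real n1" .
        qed
        have "Measurable.pred M (\<lambda>\<omega>. (\<forall>g\<in>G. \<bar>(\<Sum>i=1..n1. g (X i \<omega>)) - real n1 * (\<integral>x. g x \<partial>\<nu>)\<bar> \<le> e * real n1) \<and>
            (\<forall>i\<in>{n1<..n1 + n2}. X i \<omega> \<in> B))"
        proof (intro pred_intros_logic pred_intros_finite G(1))
          fix g assume g: "g \<in> G"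
          have [measurable]: "(\<lambda>\<omega>. \<Sum>i=1..n1. g (X i \<omega>)) \<in> borel_measurable M"
            using G(2)[OF g] X by (intro borel_measurable_sum) (auto intro: measurable_compose)
          show "Measurable.pred M (\<lambda>\<omega>. \<bar>(\<Sum>i=1..n1. g (X i \<omega>)) - real n1 * (\<integral>x. g x \<partial>\<nu>)\<bar> \<le> e * real n1)"
            by measurable
        next
          fix i assume "i \<in> {n1<..n1 + n2}"
          then have [measurable]: "X i \<in> borel_measurable M" by (intro X) auto
          show "Measurable.pred M (\<lambda>\<omega>. X i \<omega> \<in> B)" by measurable
        qed auto
        then show "?E \<in> M.events" by (simp add: pred_def)
      qed
      finally have fin: "1 / 2 \<le> C * measure M ?E" .
      have "1 / 2 * exp (- (real n1 * (H + e))) * p ^ n2 \<le> exp (- (real n1 * (H + e))) * p ^ n2 * (C * measure M ?E)"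
        using mult_left_mono[OF fin, of "exp (- (real n1 * (H + e))) * p ^ n2"] by (simp add: p_def mult_ac)
      also have "\<dots> = measure M ?E"
      proof (cases "n2 = 0")
        case True
        then show ?thesis by (simp add: C_def flip: exp_add mult.assoc)
      next
        case False
        then have "0 < p" using n2 by (simp add: p_def)
        then have "exp (- (real n1 * (H + e))) * p ^ n2 * C = 1"
          by (simp add: C_def power_one_over field_simps flip: exp_add)
        then show ?thesis by (simp flip: mult.assoc)
      qed
      finally show ?thesis by (simp add: H_def L_def[abs_def] p_def)
    qed
  qed
qed

text \<open>Markov's inequality for \<open>exp (- S)\<close> with \<open>S\<close> the renewal time.
  The base of the power is below 1, so having more than \<open>K * t\<close> renewals by time
  \<open>t\<close> is as unlikely on the exponential scale as desired, once \<open>K\<close> is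
  large.\<close>

lemma renewal_bound:
  assumes iid: "iid_law M X {1..} \<psi>" and \<psi>: "\<psi> \<in> pos_probs"
  shows "measure M {\<omega> \<in> space M. renewal_time X k \<omega> \<le> t} \<le> exp t * (\<integral>x. exp (- x) \<partial>\<psi>) ^ k"
proof -
  interpret M: prob_space M using iid by (rule iid_lawD)
  have X[measurable]: "X i \<in> borel_measurable M" if "i \<in> {1..k}" for i using iid_lawD(4)[OF iid] that by simp
  have [measurable]: "renewal_time X k \<in> borel_measurable M"
    unfolding renewal_time_def[abs_def] by (intro borel_measurable_sum X)
  have "emeasure M {\<omega> \<in> space M. renewal_time X k \<omega> \<le> t} = (\<integral>\<^sup>+\<omega>. indicator {\<omega> \<in> space M. renewal_time X k \<omega> \<le> t} \<omega> \<partial>M)"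
    by simp
  also have "\<dots> \<le> (\<integral>\<^sup>+\<omega>. ennreal (exp t) * (\<Prod>i\<in>{1..k}. ennreal (exp (- X i \<omega>))) \<partial>M)"
  proof (rule nn_integral_mono)
    fix \<omega>
    have "(\<Prod>i\<in>{1..k}. ennreal (exp (- X i \<omega>))) = ennreal (exp (- renewal_time X k \<omega>))"
      by (simp add: prod_ennreal renewal_time_def exp_sum[symmetric] sum_negf)
    then have "ennreal (exp t) * (\<Prod>i\<in>{1..k}. ennreal (exp (- X i \<omega>))) = ennreal (exp (t - renewal_time X k \<omega>))"
      by (simp add: ennreal_mult[symmetric] exp_diff exp_minus field_simps)
    then show "indicator {\<omega> \<in> space M. renewal_time X k \<omega> \<le> t} \<omega> \<le> ennreal (exp t) * (\<Prod>i\<in>{1..k}. ennreal (exp (- X i \<omega>)))"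
      by (auto split: split_indicator simp del: ennreal_1 simp: ennreal_1[symmetric] intro!: ennreal_leI)
  qed
  also have "\<dots> = ennreal (exp t) * (\<integral>\<^sup>+\<omega>. (\<Prod>i\<in>{1..k}. ennreal (exp (- X i \<omega>))) \<partial>M)"
    by (rule nn_integral_cmult) (use X in measurable)
  also have "(\<integral>\<^sup>+\<omega>. (\<Prod>i\<in>{1..k}. ennreal (exp (- X i \<omega>))) \<partial>M) = (\<Prod>i\<in>{1..k}. \<integral>\<^sup>+x. ennreal (exp (- x)) \<partial>\<psi>)"
    by (rule iid_law_nn_integral_prod[OF iid, where g="\<lambda>_ x. ennreal (exp (- x))"]) auto
  also have "(\<integral>\<^sup>+x. ennreal (exp (- x)) \<partial>\<psi>) = ennreal (\<integral>x. exp (- x) \<partial>\<psi>)"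
    using exp_decay_integral(3)[OF \<psi>] by (intro nn_integral_eq_integral) auto
  also have "ennreal (exp t) * (\<Prod>i\<in>{1..k}. ennreal (\<integral>x. exp (- x) \<partial>\<psi>)) = ennreal (exp t * (\<integral>x. exp (- x) \<partial>\<psi>) ^ k)"
    by (simp add: ennreal_power ennreal_mult)
  finally show ?thesis by (simp add: M.emeasure_eq_measure ennreal_le_iff)
qed

text \<open>By \<open>renewal_bound\<close>, infinitely many renewals before a fixed time have
  probability 0. For \<open>t < 0\<close> there is no last renewal before \<open>t\<close>, whence
  the extra disjunct.\<close>

lemma AE_renewal:
  assumes iid: "iid_law M X {1..} \<psi>" and \<psi>: "\<psi> \<in> pos_probs"
  shows "AE \<omega> in M. (\<forall>i\<ge>1. 0 < X i \<omega>) \<and> (\<forall>t. \<exists>n. renewal_time X n \<omega> \<le> t \<and> t < renewal_time X (Suc n) \<omega> \<or> t < 0)"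
proof -
  interpret M: prob_space M using iid by (rule iid_lawD)
  have X[measurable]: "X i \<in> borel_measurable M" if "1 \<le> i" for i using iid_lawD(4)[OF iid] that by simp
  have S[measurable]: "renewal_time X k \<in> borel_measurable M" for k
    unfolding renewal_time_def[abs_def] by (intro borel_measurable_sum X) auto
  have pos: "AE \<omega> in M. \<forall>i. 1 \<le> i \<longrightarrow> 0 < X i \<omega>"
    unfolding AE_all_countable
  proof
    fix i
    show "AE \<omega> in M. 1 \<le> i \<longrightarrow> 0 < X i \<omega>"
    proof (cases "1 \<le> i")
      case True
      have "distr M borel (X i) = \<psi>" using iid_lawD(3)[OF iid, of i] True by simp
      then have "AE x in distr M borel (X i). 0 < x" using pos_probsD(2)[OF \<psi>] by (simp only:)
      then show ?thesis using X[OF True] by (subst (asm) AE_distr_iff) auto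
    qed simp
  qed
  have "AE \<omega> in M. \<forall>m :: nat. \<not> (\<forall>n. renewal_time X n \<omega> \<le> real m)"
    unfolding AE_all_countable
  proof
    fix m :: nat
    let ?N = "{\<omega> \<in> space M. \<forall>n. renewal_time X n \<omega> \<le> real m}"
    have "measure M ?N \<le> exp (real m) * (\<integral>x. exp (- x) \<partial>\<psi>) ^ k" for k
      by (rule order_trans[OF M.finite_measure_mono renewal_bound[OF iid \<psi>]]) auto
    moreover have "(\<lambda>k. exp (real m) * (\<integral>x. exp (- x) \<partial>\<psi>) ^ k) \<longlonglongrightarrow> exp (real m) * 0"
      using exp_decay_integral[OF \<psi>] by (intro tendsto_intros LIMSEQ_realpow_zero) auto
    ultimately have "measure M ?N \<le> exp (real m) * 0" using LIMSEQ_le_const by blast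
    then have "measure M ?N \<le> 0" by simp
    then have "emeasure M ?N = 0" by (simp add: M.emeasure_eq_measure measure_le_0_iff)
    then show "AE \<omega> in M. \<not> (\<forall>n. renewal_time X n \<omega> \<le> real m)"
      by (subst AE_iff_measurable[of ?N]) auto
  qed
  with pos show ?thesis
  proof eventually_elim
    case (elim \<omega>)
    show ?case
    proof (rule conjI; intro allI impI)
      show "0 < X i \<omega>" if "1 \<le> i" for i using elim(1) that by auto
      fix t :: real
      obtain m :: nat where "t \<le> real m" using real_arch_simple by blast
      then obtain k where k: "t < renewal_time X k \<omega>" using elim(2) by (meson le_less_trans not_le)
      define n where "n = (LEAST k. t < renewal_time X k \<omega>)"
      have n: "t < renewal_time X n \<omega>" "\<And>j. j < n \<Longrightarrow> \<not> t < renewal_time X j \<omega>"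
        unfolding n_def using k by (auto intro: LeastI dest: not_less_Least)
      show "\<exists>n. renewal_time X n \<omega> \<le> t \<and> t < renewal_time X (Suc n) \<omega> \<or> t < 0"
      proof (cases n)
        case 0
        then show ?thesis using n(1) by simp
      next
        case (Suc j)
        then show ?thesis using n(1) n(2)[of j] by (intro exI[of _ j]) auto
      qed
    qed
  qed
qed

text \<open>The event is split by the number \<open>n\<close> of completed cycles. As
  \<open>c \<ge> 0\<close>, the elapsed part of the current cycle is bounded by its whole length,
  which removes the condition on \<open>t\<close>; independence then gives \<open>K ^ n * C\<close>,
  and \<open>K < 1\<close> makes the sum finite, uniformly in \<open>t\<close> and
  \<open>b\<close>.\<close>

lemma exp_upper_bound:
  assumes iid: "iid_law M X {1..} \<psi>" and \<psi>: "\<psi> \<in> pos_probs"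
    and h[measurable]: "h \<in> borel_measurable borel" and h1: "(\<integral>\<^sup>+x. ennreal (exp (h x)) \<partial>\<psi>) < 1"
    and c: "0 \<le> c" "(\<integral>\<^sup>+x. ennreal (exp (c * x)) \<partial>\<psi>) < \<infinity>"
  shows "\<exists>Z\<ge>0. \<forall>t b. measure M {\<omega> \<in> space M. \<exists>n. renewal_time X n \<omega> \<le> t \<and> t < renewal_time X (Suc n) \<omega> \<and>
      b \<le> (\<Sum>i=1..n. h (X i \<omega>)) + c * (t - renewal_time X n \<omega>)} \<le> Z * exp (- b)"
proof -
  interpret M: prob_space M using iid by (rule iid_lawD)
  have X[measurable]: "X i \<in> borel_measurable M" if "1 \<le> i" for i using iid_lawD(4)[OF iid] that by simp
  have S[measurable]: "renewal_time X k \<in> borel_measurable M" for k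
    unfolding renewal_time_def[abs_def] by (intro borel_measurable_sum X) auto
  have hs[measurable]: "(\<lambda>\<omega>. \<Sum>i=1..n. h (X i \<omega>)) \<in> borel_measurable M" for n
    using X by (intro borel_measurable_sum) (auto intro: measurable_compose[OF _ h])
  define K where "K = enn2real (\<integral>\<^sup>+x. ennreal (exp (h x)) \<partial>\<psi>)"
  define C where "C = enn2real (\<integral>\<^sup>+x. ennreal (exp (c * x)) \<partial>\<psi>)"
  have "(\<integral>\<^sup>+x. ennreal (exp (h x)) \<partial>\<psi>) < \<infinity>" using h1 by (rule order.strict_trans) simp
  then have K: "(\<integral>\<^sup>+x. ennreal (exp (h x)) \<partial>\<psi>) = ennreal K" "0 \<le> K" by (auto simp: K_def)
  then have K1: "K < 1" using h1 by (simp add: ennreal_less_one_iff)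
  have C: "(\<integral>\<^sup>+x. ennreal (exp (c * x)) \<partial>\<psi>) = ennreal C" "0 \<le> C" using c(2) by (auto simp: C_def)
  show ?thesis
  proof (intro exI[of _ "C / (1 - K)"] conjI allI)
    show "0 \<le> C / (1 - K)" using C K1 by simp
    fix t b :: real
    define E where "E n = {\<omega> \<in> space M. renewal_time X n \<omega> \<le> t \<and> t < renewal_time X (Suc n) \<omega> \<and>
      b \<le> (\<Sum>i=1..n. h (X i \<omega>)) + c * (t - renewal_time X n \<omega>)}" for n
    have E[measurable]: "E n \<in> sets M" for n unfolding E_def by measurable
    have En: "emeasure M (E n) \<le> ennreal (exp (- b) * C * K ^ n)" for n
    proof -
      define g where "g i x = (if i = Suc n then ennreal (exp (c * x)) else ennreal (exp (h x)))" for i x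
      have [measurable]: "g i \<in> borel_measurable borel" for i unfolding g_def by (cases "i = Suc n") auto
      have "emeasure M (E n) = (\<integral>\<^sup>+\<omega>. indicator (E n) \<omega> \<partial>M)" by simp
      also have "\<dots> \<le> (\<integral>\<^sup>+\<omega>. ennreal (exp (- b)) * (\<Prod>i\<in>{1..Suc n}. g i (X i \<omega>)) \<partial>M)"
      proof (rule nn_integral_mono)
        fix \<omega>
        have "(\<Prod>i\<in>{1..n}. g i (X i \<omega>)) = (\<Prod>i\<in>{1..n}. ennreal (exp (h (X i \<omega>))))"
          by (intro prod.cong) (auto simp: g_def)
        also have "\<dots> = ennreal (exp (\<Sum>i=1..n. h (X i \<omega>)))" by (simp add: prod_ennreal exp_sum)
        finally have "(\<Prod>i\<in>{1..Suc n}. g i (X i \<omega>)) = ennreal (exp (\<Sum>i=1..n. h (X i \<omega>))) * ennreal (exp (c * X (Suc n) \<omega>))"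
          by (simp add: prod.atLeastAtMost_shift_bounds prod.nat_ivl_Suc' g_def mult.commute)
        then have eq: "ennreal (exp (- b)) * (\<Prod>i\<in>{1..Suc n}. g i (X i \<omega>)) =
           ennreal (exp (- b + (\<Sum>i=1..n. h (X i \<omega>)) + c * X (Suc n) \<omega>))"
          by (simp add: ennreal_mult[symmetric] exp_add exp_diff exp_minus field_simps)
        show "indicator (E n) \<omega> \<le> ennreal (exp (- b)) * (\<Prod>i\<in>{1..Suc n}. g i (X i \<omega>))"
        proof (cases "\<omega> \<in> E n")
          case True
          then have "t - renewal_time X n \<omega> \<le> X (Suc n) \<omega>" by (simp add: E_def renewal_time_Suc)
          then have "c * (t - renewal_time X n \<omega>) \<le> c * X (Suc n) \<omega>" using c(1) by (rule mult_left_mono)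
          then have "0 \<le> - b + (\<Sum>i=1..n. h (X i \<omega>)) + c * X (Suc n) \<omega>" using True by (simp add: E_def)
          then have "ennreal 1 \<le> ennreal (exp (- b + (\<Sum>i=1..n. h (X i \<omega>)) + c * X (Suc n) \<omega>))"
            by (intro ennreal_leI) simp
          then show ?thesis unfolding eq using True by simp
        qed simp
      qed
      also have "\<dots> = ennreal (exp (- b)) * (\<integral>\<^sup>+\<omega>. (\<Prod>i\<in>{1..Suc n}. g i (X i \<omega>)) \<partial>M)"
        using X by (intro nn_integral_cmult borel_measurable_prod_ennreal) (auto intro: measurable_compose)
      also have "(\<integral>\<^sup>+\<omega>. (\<Prod>i\<in>{1..Suc n}. g i (X i \<omega>)) \<partial>M) = (\<Prod>i\<in>{1..Suc n}. \<integral>\<^sup>+x. g i x \<partial>\<psi>)"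
        by (rule iid_law_nn_integral_prod[OF iid]) auto
      also have "\<dots> = (\<Prod>i\<in>{1..n}. \<integral>\<^sup>+x. g i x \<partial>\<psi>) * (\<integral>\<^sup>+x. g (Suc n) x \<partial>\<psi>)"
        by (simp add: prod.nat_ivl_Suc' mult.commute)
      also have "(\<Prod>i\<in>{1..n}. \<integral>\<^sup>+x. g i x \<partial>\<psi>) = (\<Prod>i\<in>{1..n}. ennreal K)"
        by (intro prod.cong) (auto simp: g_def K)
      also have "(\<integral>\<^sup>+x. g (Suc n) x \<partial>\<psi>) = ennreal C" by (simp add: g_def C)
      also have "ennreal (exp (- b)) * ((\<Prod>i\<in>{1..n}. ennreal K) * ennreal C) = ennreal (exp (- b) * C * K ^ n)"
        using K C by (simp add: ennreal_power ennreal_mult mult_ac)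
      finally show ?thesis .
    qed
    have eq: "{\<omega> \<in> space M. \<exists>n. renewal_time X n \<omega> \<le> t \<and> t < renewal_time X (Suc n) \<omega> \<and>
      b \<le> (\<Sum>i=1..n. h (X i \<omega>)) + c * (t - renewal_time X n \<omega>)} = (\<Union>n. E n)"
      by (auto simp: E_def)
    have "emeasure M (\<Union>n. E n) \<le> (\<Sum>n. emeasure M (E n))" by (rule emeasure_subadditive_countably) auto
    also have "\<dots> \<le> (\<Sum>n. ennreal (exp (- b) * C * K ^ n))" using En by (intro suminf_le summableI)
    also have "\<dots> = ennreal (\<Sum>n. exp (- b) * C * K ^ n)"
      using K K1 C by (intro suminf_ennreal_eq summable_sums summable_mult summable_geometric) auto
    also have "(\<Sum>n. exp (- b) * C * K ^ n) = exp (- b) * C * (1 / (1 - K))"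
      using K K1 by (subst suminf_mult) (auto simp: suminf_geometric summable_geometric)
    finally have "measure M (\<Union>n. E n) \<le> exp (- b) * C * (1 / (1 - K))"
      using C K1 by (simp add: M.emeasure_eq_measure ennreal_le_iff)
    then show "measure M {\<omega> \<in> space M. \<exists>n. renewal_time X n \<omega> \<le> t \<and> t < renewal_time X (Suc n) \<omega> \<and>
      b \<le> (\<Sum>i=1..n. h (X i \<omega>)) + c * (t - renewal_time X n \<omega>)} \<le> C / (1 - K) * exp (- b)"
      unfolding eq by (simp add: mult_ac)
  qed
qed

section \<open>Large deviations bounds\<close>

text \<open>The arithmetic of two consecutive blocks: \<open>S1\<close>, \<open>S2\<close> are their
  lengths, \<open>A1\<close>, \<open>A2\<close> the integrals of the test function over their
  cycles, \<open>I\<close> the integral up to \<open>t\<close>, and \<open>z\<close> the value at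
  infinity. The shares \<open>\<beta>\<close>, \<open>\<gamma>\<close> of time sum to
  \<open>1 + \<delta>\<close>, so that the blocks cover \<open>[0,t]\<close> in spite of
  fluctuations. The error has a part linear in \<open>t\<close>, small with \<open>\<delta>\<close>,
  \<open>1 / L\<close> and \<open>\<epsilon>\<close>, and a part independent of
  \<open>t\<close>.\<close>

lemma block_error:
  fixes t n1 n2 m L :: real
  assumes t: "0 < t" and m: "0 < m" and L: "1 \<le> L" and \<delta>: "0 < \<delta>" "\<delta> \<le> 1" and \<epsilon>: "0 \<le> \<epsilon>"
    and \<beta>: "0 \<le> \<beta>" "\<beta> \<le> 2" and \<gamma>: "0 \<le> \<gamma>" "\<gamma> \<le> 2" and \<beta>\<gamma>: "\<beta> + \<gamma> = 1 + \<delta>"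
    and ab: "\<bar>\<beta> - \<alpha>\<bar> \<le> \<delta>" "\<bar>\<gamma> - (1 - \<alpha>)\<bar> \<le> \<delta>"
    and n1: "\<beta> * t / m \<le> n1" "n1 \<le> \<beta> * t / m + 1" and n2: "\<gamma> * t / L \<le> n2" "n2 \<le> \<gamma> * t / L + 1"
    and h1: "\<bar>S1 - n1 * m\<bar> \<le> \<delta> * m / 2 * n1" and h2: "\<bar>A1 - n1 * V\<bar> \<le> \<delta> * m / 2 * n1"
    and h3: "n2 * L \<le> S2" "S2 \<le> n2 * (L + 1)" and h4: "\<bar>A2 - S2 * z\<bar> \<le> \<epsilon> * S2"
    and V: "\<bar>V\<bar> \<le> B * m" and z: "\<bar>z\<bar> \<le> B"
  shows "t \<le> S1 + S2"
    and "\<bar>I - (A1 + A2)\<bar> \<le> B * (S1 + S2 - t) \<Longrightarrow>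
      \<bar>I - t * (\<alpha> / m * V + (1 - \<alpha>) * z)\<bar> \<le>
        t * (4 * B * \<delta> + \<delta> + 4 * B / L + 4 * \<epsilon>) + (B * (2 * m + L + 1) + m + B * m + \<epsilon> * (L + 1) + B * (L + 1))"
proof -
  have B: "0 \<le> B" using z by linarith
  have n1m: "\<beta> * t \<le> n1 * m" "n1 * m \<le> \<beta> * t + m"
    using n1 m by (simp_all add: field_simps)
  have n2L: "\<gamma> * t \<le> n2 * L" "n2 * L \<le> \<gamma> * t + L"
    using n2 L by (simp_all add: field_simps)
  have \<beta>t: "\<beta> * t \<le> 2 * t" "\<gamma> * t \<le> 2 * t" using \<beta> \<gamma> t by (auto intro: mult_right_mono)
  have e1: "\<delta> * m / 2 * n1 \<le> \<delta> * t + \<delta> * m / 2"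
  proof -
    have "\<delta> / 2 * (n1 * m) \<le> \<delta> / 2 * (2 * t + m)" using n1m(2) \<beta>t \<delta> by (intro mult_left_mono) auto
    then show ?thesis by (simp add: field_simps)
  qed
  have \<delta>m: "\<delta> * m \<le> m" using \<delta> m by simp
  \<comment> \<open>A relative error of \<open>\<delta> / 2\<close> on a share of at most
    \<open>2 * t\<close> loses at most \<open>\<delta> * t\<close>, exactly the surplus; the second
    block loses nothing, since its cycles have length at least \<open>L\<close>.\<close>
  have S1_low: "\<beta> * t - \<delta> * t \<le> S1"
  proof -
    have "n1 * m - \<delta> * m / 2 * n1 \<le> S1" using h1 by linarith
    moreover have "n1 * m * (1 - \<delta> / 2) = n1 * m - \<delta> * m / 2 * n1" by (simp add: field_simps)
    ultimately have "n1 * m * (1 - \<delta> / 2) \<le> S1" by simp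
    moreover have "\<beta> * t * (1 - \<delta> / 2) \<le> n1 * m * (1 - \<delta> / 2)" using n1m(1) \<delta> by (intro mult_right_mono) auto
    moreover have "\<beta> * t * (\<delta> / 2) \<le> 2 * t * (\<delta> / 2)"
      by (rule mult_right_mono[OF \<beta>t(1)]) (use \<delta> in simp)
    ultimately show ?thesis by (simp add: field_simps)
  qed
  have S1_up: "S1 \<le> \<beta> * t + \<delta> * t + 2 * m"
    using h1 e1 n1m(2) \<delta>m m by linarith
  have S2_low: "\<gamma> * t \<le> S2" using h3(1) n2L(1) by linarith
  have n2t: "n2 \<le> 2 * t / L + 1"
  proof -
    have "\<gamma> * t / L \<le> 2 * t / L" using \<beta>t L by (intro divide_right_mono) auto
    then show ?thesis using n2(2) by linarith
  qed
  have S2_up: "S2 \<le> \<gamma> * t + 2 * t / L + L + 1"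
    using h3(2) n2L(2) n2t by (simp add: distrib_left)
  have tS: "\<beta> * t + \<gamma> * t = t + \<delta> * t" using \<beta>\<gamma> by (metis distrib_right mult_1)
  show "t \<le> S1 + S2" using S1_low S2_low tS by linarith
  assume I: "\<bar>I - (A1 + A2)\<bar> \<le> B * (S1 + S2 - t)"
  have 1: "\<bar>I - (A1 + A2)\<bar> \<le> B * (2 * \<delta> * t + 2 * t / L + 2 * m + L + 1)"
  proof -
    have "S1 + S2 - t \<le> 2 * \<delta> * t + 2 * t / L + 2 * m + L + 1" using S1_up S2_up tS by linarith
    then show ?thesis using I mult_left_mono[OF _ B] by (meson order_trans)
  qed
  have 2: "\<bar>A1 - n1 * V\<bar> \<le> \<delta> * t + m" using h2 e1 \<delta>m m by linarith
  have 3: "\<bar>n1 * V - t * (\<alpha> / m * V)\<bar> \<le> B * (\<delta> * t + m)"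
  proof -
    have "n1 * V - t * (\<alpha> / m * V) = (n1 * m - \<alpha> * t) * (V / m)" using m by (simp add: field_simps)
    then have "\<bar>n1 * V - t * (\<alpha> / m * V)\<bar> = \<bar>n1 * m - \<alpha> * t\<bar> * \<bar>V / m\<bar>" by (simp only: abs_mult)
    also have "\<dots> \<le> (\<delta> * t + m) * B"
    proof (rule mult_mono)
      have "\<bar>(\<beta> - \<alpha>) * t\<bar> \<le> \<delta> * t" using ab(1) t by (simp add: abs_mult)
      then show "\<bar>n1 * m - \<alpha> * t\<bar> \<le> \<delta> * t + m" using n1m m by (simp add: left_diff_distrib abs_le_iff)
      show "\<bar>V / m\<bar> \<le> B" using V m by (simp add: field_simps)
    qed (use \<delta> t m in auto)
    finally show ?thesis by (simp add: mult.commute)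
  qed
  have tL: "2 * t / L \<le> 2 * t" using t L by (simp add: field_simps)
  have 4: "\<bar>A2 - S2 * z\<bar> \<le> \<epsilon> * (4 * t + L + 1)"
  proof -
    have "S2 \<le> 4 * t + L + 1" using S2_up \<beta>t tL by linarith
    then show ?thesis using h4 mult_left_mono[OF _ \<epsilon>] by (meson order_trans)
  qed
  have 5: "\<bar>S2 * z - t * ((1 - \<alpha>) * z)\<bar> \<le> B * (\<delta> * t + 2 * t / L + L + 1)"
  proof -
    have "S2 * z - t * ((1 - \<alpha>) * z) = (S2 - (1 - \<alpha>) * t) * z" by (simp add: algebra_simps)
    then have "\<bar>S2 * z - t * ((1 - \<alpha>) * z)\<bar> = \<bar>S2 - (1 - \<alpha>) * t\<bar> * \<bar>z\<bar>" by (simp only: abs_mult)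
    also have "\<dots> \<le> (\<delta> * t + 2 * t / L + L + 1) * B"
    proof (rule mult_mono)
      have "\<bar>(\<gamma> - (1 - \<alpha>)) * t\<bar> \<le> \<delta> * t" using ab(2) t by (simp add: abs_mult)
      then have "\<bar>\<gamma> * t - (1 - \<alpha>) * t\<bar> \<le> \<delta> * t" by (simp only: left_diff_distrib)
      moreover have "0 \<le> 2 * t / L" using t L by simp
      ultimately show "\<bar>S2 - (1 - \<alpha>) * t\<bar> \<le> \<delta> * t + 2 * t / L + L + 1" using S2_low S2_up L by linarith
    qed (use \<delta> t L z in auto)
    finally show ?thesis by (simp add: mult.commute)
  qed
  have "\<bar>I - t * (\<alpha> / m * V + (1 - \<alpha>) * z)\<bar> \<le> B * (2 * \<delta> * t + 2 * t / L + 2 * m + L + 1) + (\<delta> * t + m) + B * (\<delta> * t + m)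
     + \<epsilon> * (4 * t + L + 1) + B * (\<delta> * t + 2 * t / L + L + 1)"
    unfolding distrib_left[of t] using 1 2 3 4 5 by linarith
  also have "\<dots> = t * (4 * B * \<delta> + \<delta> + 4 * B / L + 4 * \<epsilon>) + (B * (2 * m + L + 1) + m + B * m + \<epsilon> * (L + 1) + B * (L + 1))"
    by (simp add: algebra_simps)
  finally show "\<bar>I - t * (\<alpha> / m * V + (1 - \<alpha>) * z)\<bar> \<le>
        t * (4 * B * \<delta> + \<delta> + 4 * B / L + 4 * \<epsilon>) + (B * (2 * m + L + 1) + m + B * m + \<epsilon> * (L + 1) + B * (L + 1))" .
qed

lemma cycle_avg_near_infinity:
  assumes f: "f \<in> bcont" and e: "0 < e"
  shows "\<forall>\<^sub>F L in sequentially. \<forall>\<tau>\<ge>real L. \<bar>cycle_avg f (1 / \<tau>) - f (\<infinity>, \<infinity>)\<bar> \<le> e"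
proof -
  have "isCont (cycle_avg f) 0" by (rule bcont_isCont[OF cycle_avg_bcont[OF f]])
  then obtain d where d: "0 < d" "\<And>x. dist x 0 < d \<Longrightarrow> dist (cycle_avg f x) (cycle_avg f 0) < e"
    using e unfolding continuous_at_eps_delta by blast
  obtain L0 :: nat where L0: "1 / d < L0" using reals_Archimedean2 by blast
  have "\<forall>\<tau>\<ge>real L. \<bar>cycle_avg f (1 / \<tau>) - f (\<infinity>, \<infinity>)\<bar> \<le> e" if L: "L0 \<le> L" for L
  proof (intro allI impI)
    fix \<tau> assume "real L \<le> \<tau>"
    then have \<tau>: "1 / d < \<tau>" using L0 L by (meson le_less_trans less_le_trans of_nat_le_iff)
    then have "0 < \<tau>" using d(1) by (meson less_trans zero_less_divide_1_iff)
    then have "dist (1 / \<tau>) 0 < d" using \<tau> d(1) by (simp add: field_simps)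
    then have "dist (cycle_avg f (1 / \<tau>)) (cycle_avg f 0) < e" by (rule d(2))
    then show "\<bar>cycle_avg f (1 / \<tau>) - f (\<infinity>, \<infinity>)\<bar> \<le> e" by (simp add: dist_real_def)
  qed
  then show ?thesis by (auto simp: eventually_sequentially)
qed

text \<open>About \<open>\<beta> * t / m\<close> waiting times follow \<open>\<nu>\<close>, of mean
  \<open>m\<close>, at cost \<open>H\<close> each; about \<open>\<gamma> * t / L\<close> further
  ones lie in \<open>[L,L+1[\<close>, at cost \<open>x * L\<close> each, that is \<open>x\<close>
  per unit of time. The length \<open>L\<close> is fixed before \<open>t\<close> grows. The shares
  and the rate \<open>x\<close> are left open because their choice depends on
  \<open>\<alpha>\<close>.\<close>

lemma lower_bound_integrals:
  fixes M :: "'w measure" and \<tau> :: "nat \<Rightarrow> 'w \<Rightarrow> real" and \<nu> \<psi> :: "real measure" and D :: "real \<Rightarrow> real"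
  assumes iid: "iid_law M \<tau> {1..} \<psi>" and \<psi>: "\<psi> \<in> pos_probs" and \<nu>: "\<nu> \<in> pos_probs"
    and D: "D \<in> borel_measurable borel" "\<And>x. 0 \<le> D x" "\<nu> = density \<psi> (\<lambda>x. ennreal (D x))" "integrable \<nu> (\<lambda>x. ln (D x))"
    and m: "integrable \<nu> (\<lambda>x. x)" "m = (\<integral>x. x \<partial>\<nu>)" "0 < m" and H: "H = (\<integral>x. ln (D x) \<partial>\<nu>)"
    and F: "finite F" "F \<subseteq> bcont" and e: "0 < e" and B: "0 < B" "\<And>f z. f \<in> F \<Longrightarrow> \<bar>f z\<bar> \<le> B"
    and \<delta>: "0 < \<delta>" "\<delta> \<le> 1" "4 * B * \<delta> + \<delta> \<le> e / 4"
    and \<beta>: "0 \<le> \<beta>" "\<beta> \<le> 2" and \<gamma>: "0 \<le> \<gamma>" "\<gamma> \<le> 2" and \<beta>\<gamma>: "\<beta> + \<gamma> = 1 + \<delta>"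
    and ab: "\<bar>\<beta> - \<alpha>\<bar> \<le> \<delta>" "\<bar>\<gamma> - (1 - \<alpha>)\<bar> \<le> \<delta>"
    and x: "0 < x" "\<gamma> = 0 \<or> exp_abscissa \<psi> < ereal x" and w: "\<beta> / m * (H + \<delta> * m / 2) + \<gamma> * x < w"
  shows "\<forall>\<^sub>F t in at_top. exp (- w * t) \<le> measure M {\<omega> \<in> space M. \<forall>f\<in>F.
    \<bar>(\<integral>z. f z \<partial>empirical_measure \<tau> t \<omega>) - (\<alpha> / m * (\<integral>x. x * cycle_avg f (1 / x) \<partial>\<nu>) + (1 - \<alpha>) * f (\<infinity>, \<infinity>))\<bar> < e}"
proof -
  interpret M: prob_space M using iid by (rule iid_lawD)
  have meas: "\<And>i. 1 \<le> i \<Longrightarrow> \<tau> i \<in> borel_measurable M" using iid_lawD(4)[OF iid] by simp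
  have \<psi>': "\<psi> \<in> borel_probs" and \<nu>': "\<nu> \<in> borel_probs" using \<psi> \<nu> pos_probsD by auto
  have s[measurable_cong]: "sets \<nu> = sets borel" using \<nu>' borel_probsD by blast
  \<comment> \<open>Makes \<open>4 * \<epsilon>\<close> equal to \<open>e / 8\<close>; the choice of
    \<open>L2\<close> makes \<open>4 * B / L\<close> at most \<open>e / 8\<close>, and
    \<open>e / 4\<close> is reserved for the terms in \<open>\<delta>\<close>.\<close>
  define \<epsilon> where "\<epsilon> = e / 32"
  have \<epsilon>: "0 < \<epsilon>" using e by (simp add: \<epsilon>_def)
  have "\<forall>\<^sub>F L in sequentially. \<forall>f\<in>F. \<forall>\<tau>\<ge>real L. \<bar>cycle_avg f (1 / \<tau>) - f (\<infinity>, \<infinity>)\<bar> \<le> \<epsilon>"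
    using F \<epsilon> by (intro eventually_ball_finite ballI cycle_avg_near_infinity) auto
  then obtain L1 where L1: "\<And>L f y. L1 \<le> L \<Longrightarrow> f \<in> F \<Longrightarrow> real L \<le> y \<Longrightarrow> \<bar>cycle_avg f (1 / y) - f (\<infinity>, \<infinity>)\<bar> \<le> \<epsilon>"
    by (auto simp: eventually_sequentially)
  obtain L2 :: nat where L2: "32 * B / e < real L2" using reals_Archimedean2 by blast
  \<comment> \<open>Heavy intervals occur beyond every bound, so \<open>L\<close> can meet the
    accuracy requirements. If \<open>\<gamma> = 0\<close> the second block is empty and the abscissa
    may be infinite, so nothing is asked of \<open>\<psi>\<close>.\<close>
  have "\<exists>L\<ge>L1 + L2 + 1. \<gamma> = 0 \<or> exp (- x * real L) \<le> measure \<psi> {real L..<real L + 1}"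
    using x(2) heavy_unit_intervals[OF \<psi>, of x "L1 + L2 + 1"] by blast
  then obtain L where L: "L1 + L2 + 1 \<le> L" "\<gamma> = 0 \<or> exp (- x * real L) \<le> measure \<psi> {real L..<real L + 1}" by blast
  have L1': "1 \<le> real L" using L(1) by linarith
  have BL: "4 * B / L \<le> e / 8"
  proof -
    have "32 * B / e \<le> L" using L2 L(1) by linarith
    then show ?thesis using e L1' by (simp add: field_simps)
  qed
  \<comment> \<open>The identity controls the length of the first block, the other functions the
    integrals over its cycles.\<close>
  define G where "G = insert (\<lambda>x. x) ((\<lambda>f x. x * cycle_avg f (1 / x)) ` F)"
  have avgB: "\<bar>cycle_avg f x\<bar> \<le> B" if f: "f \<in> F" for f x
  proof -
    have [measurable]: "f \<in> borel_measurable borel" using bcont_measurable f F(2) by blast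
    show ?thesis
      unfolding cycle_avg_def
      by (rule prob_space.abs_expectation_le[OF prob_space_unif01]) (measurable, rule B(2)[OF f])
  qed
  have G: "g \<in> borel_measurable borel \<and> integrable \<nu> g" if "g \<in> G" for g
    proof (cases "g = (\<lambda>x. x)")
      case True
      have "(\<lambda>x :: real. x) \<in> borel_measurable borel" by measurable
      then show ?thesis using m(1) unfolding True by blast
    next
      case False
      then obtain f where f: "f \<in> F" "g = (\<lambda>x. x * cycle_avg f (1 / x))" using \<open>g \<in> G\<close> by (auto simp: G_def)
      have [measurable]: "cycle_avg f \<in> borel_measurable borel" using f F(2) cycle_avg_bcont bcont_measurable by blast
      have g: "g \<in> borel_measurable borel" unfolding f(2) by measurable
      moreover have "integrable \<nu> g"
      proof (rule Bochner_Integration.integrable_bound)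
        show "integrable \<nu> (\<lambda>x. B * x)" using m(1) by simp
        show "g \<in> borel_measurable \<nu>" using g by measurable
        have "\<bar>x\<bar> * \<bar>cycle_avg f (1 / x)\<bar> \<le> B * \<bar>x\<bar>" for x
          using mult_right_mono[OF avgB[OF f(1), of "1 / x"] abs_ge_zero[of x]] by (simp add: mult.commute)
        then show "AE x in \<nu>. norm (g x) \<le> norm (B * x)" using B(1) by (intro AE_I2) (simp add: f(2) abs_mult)
      qed
      ultimately show ?thesis by simp
    qed
  have G1: "finite G" using F(1) by (simp add: G_def)
  define V where "V f = (\<integral>x. x * cycle_avg f (1 / x) \<partial>\<nu>)" for f
  have VB: "\<bar>V f\<bar> \<le> B * m" if f: "f \<in> F" for f
  proof -
    have gi: "integrable \<nu> (\<lambda>x. x * cycle_avg f (1 / x))" using G f by (auto simp: G_def)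
    have "\<bar>V f\<bar> \<le> (\<integral>x. \<bar>x * cycle_avg f (1 / x)\<bar> \<partial>\<nu>)" unfolding V_def by (rule integral_abs_bound)
    also have "\<dots> \<le> (\<integral>x. B * x \<partial>\<nu>)"
    proof (rule integral_mono_AE)
      show "AE x in \<nu>. \<bar>x * cycle_avg f (1 / x)\<bar> \<le> B * x"
        using pos_probsD(2)[OF \<nu>]
      proof eventually_elim
        case (elim x)
        then show ?case using mult_left_mono[OF avgB[OF f, of "1 / x"], of x] by (simp add: abs_mult mult.commute)
      qed
    qed (use gi m(1) in auto)
    finally show ?thesis using m(2) by simp
  qed
  define e1 where "e1 = \<delta> * m / 2"
  have e1: "0 < e1" using \<delta> m by (simp add: e1_def)
  define Bs where "Bs = {real L..<real L + 1}"
  have Bs[measurable]: "Bs \<in> sets borel" by (simp add: Bs_def)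
  define E where "E n1 n2 = {\<omega> \<in> space M. (\<forall>g\<in>G. \<bar>(\<Sum>i=1..n1. g (\<tau> i \<omega>)) - real n1 * (\<integral>x. g x \<partial>\<nu>)\<bar> \<le> e1 * real n1) \<and>
        (\<forall>i\<in>{n1<..n1 + n2}. \<tau> i \<omega> \<in> Bs)}" for n1 n2 :: nat
  obtain n0 where n0': "\<forall>n1 n2. n1 = 0 \<or> n0 \<le> n1 \<longrightarrow> n2 = 0 \<or> 0 < measure \<psi> Bs \<longrightarrow>
    (\<forall>(M :: 'w measure) X. iid_law M X {1..} \<psi> \<longrightarrow>
      1 / 2 * exp (- (real n1 * ((\<integral>x. ln (D x) \<partial>\<nu>) + e1))) * measure \<psi> Bs ^ n2 \<le>
      measure M {\<omega> \<in> space M. (\<forall>g\<in>G. \<bar>(\<Sum>i=1..n1. g (X i \<omega>)) - real n1 * (\<integral>x. g x \<partial>\<nu>)\<bar> \<le> e1 * real n1) \<and>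
        (\<forall>i\<in>{n1<..n1 + n2}. X i \<omega> \<in> Bs)})"
    by (rule exE[OF lower_block[OF \<psi>' \<nu>' D G1 _ e1 Bs, where 'w='w]]) (rule G, assumption, rule that)
  have n0: "1 / 2 * exp (- (real n1 * (H + e1))) * measure \<psi> Bs ^ n2 \<le> measure M (E n1 n2)"
    if "n1 = 0 \<or> n0 \<le> n1" "n2 = 0 \<or> 0 < measure \<psi> Bs" for n1 n2
    unfolding H E_def by (rule n0'[rule_format, OF that iid])
  define w' where "w' = \<beta> / m * (H + e1) + \<gamma> * x"
  have w': "w' < w" using w by (simp add: w'_def e1_def)
  \<comment> \<open>Collects what rounding up the two numbers of cycles and the factor one half
    cost; a constant, absorbed by \<open>(w - w') * t\<close> for large \<open>t\<close>.\<close>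
  define c1 where "c1 = \<bar>H + e1\<bar> + x * real L + ln 2"
  \<comment> \<open>The part of the error in \<open>block_error\<close> that does not grow with
    \<open>t\<close>.\<close>
  define c2 where "c2 = B * (2 * m + real L + 1) + m + B * m + \<epsilon> * (real L + 1) + B * (real L + 1)"
  define N1 where "N1 t = nat \<lceil>\<beta> * t / m\<rceil>" for t :: real
  define N2 where "N2 t = nat \<lceil>\<gamma> * t / L\<rceil>" for t :: real
  have N1: "\<beta> * t / m \<le> N1 t" "N1 t \<le> \<beta> * t / m + 1" if "0 < t" for t
  proof -
    have "0 \<le> \<beta> * t / m" using \<beta>(1) that m(3) by simp
    then show "\<beta> * t / m \<le> N1 t" "N1 t \<le> \<beta> * t / m + 1" unfolding N1_def by linarith+
  qed
  have N2: "\<gamma> * t / L \<le> N2 t" "N2 t \<le> \<gamma> * t / L + 1" if "0 < t" for t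
  proof -
    have "0 \<le> \<gamma> * t / L" using \<gamma>(1) that by simp
    then show "\<gamma> * t / L \<le> N2 t" "N2 t \<le> \<gamma> * t / L + 1" unfolding N2_def by linarith+
  qed
  have ev1: "\<forall>\<^sub>F t in at_top. N1 t = 0 \<or> n0 \<le> N1 t"
  proof (cases "\<beta> = 0")
    case True
    then show ?thesis by (simp add: N1_def)
  next
    case False
    have "\<forall>\<^sub>F t in at_top. max 1 (real n0 * m / \<beta>) \<le> t" by (rule eventually_ge_at_top)
    then show ?thesis
    proof eventually_elim
      case (elim t)
      then have "real n0 \<le> \<beta> * t / m" using False \<beta>(1) m(3) by (simp add: field_simps)
      also have "\<dots> \<le> N1 t" using N1(1)[of t] elim by simp
      finally show ?case by simp
    qed
  qed
  have "\<forall>\<^sub>F t in at_top. max 1 (c1 / (w - w')) \<le> t \<and> 4 * c2 / e + 1 \<le> t"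
    by (intro eventually_conj eventually_ge_at_top)
  with ev1 show ?thesis
  proof eventually_elim
    case (elim t)
    have t: "0 < t" "c1 \<le> (w - w') * t" "c2 < e / 4 * t"
      using elim(2) w' e by (auto simp: field_simps)
    have n2pos: "N2 t = 0 \<or> 0 < measure \<psi> Bs"
    proof (cases "\<gamma> = 0")
      case False
      then have "exp (- x * real L) \<le> measure \<psi> Bs" using L(2) by (simp add: Bs_def)
      then show ?thesis by (meson exp_gt_zero less_le_trans)
    qed (simp add: N2_def)
    have p: "exp (- x * real L) ^ N2 t \<le> measure \<psi> Bs ^ N2 t"
    proof (cases "\<gamma> = 0")
      case False
      then show ?thesis using L(2) by (intro power_mono) (auto simp: Bs_def)
    qed (simp add: N2_def)
    have "exp (- w * t) \<le> 1 / 2 * exp (- (real (N1 t) * (H + e1))) * exp (- x * real L) ^ N2 t"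
    proof -
      have "real (N1 t) * (H + e1) \<le> \<beta> * t / m * (H + e1) + \<bar>H + e1\<bar>"
      proof -
        have "(real (N1 t) - \<beta> * t / m) * (H + e1) \<le> 1 * \<bar>H + e1\<bar>"
          using N1[OF t(1)] by (intro order_trans[OF mult_left_mono[OF abs_ge_self] mult_right_mono]) auto
        then show ?thesis by (simp add: left_diff_distrib)
      qed
      moreover have "real (N2 t) * (x * real L) \<le> (\<gamma> * t / L + 1) * (x * real L)"
        using N2[OF t(1)] x(1) by (intro mult_right_mono) auto
      moreover have "(\<gamma> * t / L + 1) * (x * real L) = \<gamma> * x * t + x * real L" using L1' by (simp add: field_simps)
      moreover have "\<beta> * t / m * (H + e1) + \<gamma> * x * t = w' * t" by (simp add: w'_def algebra_simps)
      ultimately have "real (N1 t) * (H + e1) + real (N2 t) * (x * real L) + ln 2 \<le> w * t"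
        using t(2) by (simp add: c1_def algebra_simps)
      then have "exp (- w * t) \<le> exp (- ln 2 - real (N1 t) * (H + e1) - real (N2 t) * (x * real L))" by simp
      also have "\<dots> = 1 / 2 * exp (- (real (N1 t) * (H + e1))) * exp (- x * real L) ^ N2 t"
        by (simp add: exp_diff exp_minus exp_add exp_of_nat_mult[symmetric] field_simps)
      finally show ?thesis .
    qed
    also have "\<dots> \<le> 1 / 2 * exp (- (real (N1 t) * (H + e1))) * measure \<psi> Bs ^ N2 t"
      using p by (intro mult_left_mono) auto
    also have "\<dots> \<le> measure M (E (N1 t) (N2 t))"
      by (rule n0[OF elim(1) n2pos])
    also have "\<dots> \<le> measure M {\<omega> \<in> space M. \<forall>f\<in>F.
      \<bar>(\<integral>z. f z \<partial>empirical_measure \<tau> t \<omega>) - (\<alpha> / m * V f + (1 - \<alpha>) * f (\<infinity>, \<infinity>))\<bar> < e}"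
    proof (rule M.finite_measure_mono_AE)
      show "AE \<omega> in M. \<omega> \<in> E (N1 t) (N2 t) \<longrightarrow> \<omega> \<in> {\<omega> \<in> space M. \<forall>f\<in>F.
      \<bar>(\<integral>z. f z \<partial>empirical_measure \<tau> t \<omega>) - (\<alpha> / m * V f + (1 - \<alpha>) * f (\<infinity>, \<infinity>))\<bar> < e}"
        using AE_renewal[OF iid \<psi>]
      proof eventually_elim
        case (elim \<omega>)
        then have pos: "\<And>i. 1 \<le> i \<Longrightarrow> 0 < \<tau> i \<omega>" by blast
        show ?case
        proof (intro impI CollectI conjI ballI)
          assume \<omega>: "\<omega> \<in> E (N1 t) (N2 t)"
          then show sp: "\<omega> \<in> space M" by (simp add: E_def)
          fix f assume f: "f \<in> F"
          define S1 where "S1 = (\<Sum>i=1..N1 t. \<tau> i \<omega>)"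
          define S2 where "S2 = (\<Sum>i\<in>{N1 t<..N1 t + N2 t}. \<tau> i \<omega>)"
          define A1 where "A1 = (\<Sum>i=1..N1 t. \<tau> i \<omega> * cycle_avg f (1 / \<tau> i \<omega>))"
          define A2 where "A2 = (\<Sum>i\<in>{N1 t<..N1 t + N2 t}. \<tau> i \<omega> * cycle_avg f (1 / \<tau> i \<omega>))"
          define I where "I = t * (\<integral>z. f z \<partial>empirical_measure \<tau> t \<omega>)"
          have split: "{1..N1 t + N2 t} = {1..N1 t} \<union> {N1 t<..N1 t + N2 t}" by auto
          have S: "renewal_time \<tau> (N1 t + N2 t) \<omega> = S1 + S2"
            unfolding renewal_time_def S1_def S2_def split by (rule sum.union_disjoint) auto
          have A: "(\<Sum>i=1..N1 t + N2 t. \<tau> i \<omega> * cycle_avg f (1 / \<tau> i \<omega>)) = A1 + A2"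
            unfolding A1_def A2_def split by (rule sum.union_disjoint) auto
          have inB: "real L \<le> \<tau> i \<omega>" "\<tau> i \<omega> \<le> real L + 1" if "i \<in> {N1 t<..N1 t + N2 t}" for i
          proof -
            have "\<tau> i \<omega> \<in> Bs" using \<omega> that unfolding E_def by blast
            then show "real L \<le> \<tau> i \<omega>" "\<tau> i \<omega> \<le> real L + 1" by (simp_all add: Bs_def)
          qed
          have h1: "\<bar>S1 - N1 t * m\<bar> \<le> \<delta> * m / 2 * N1 t"
            using \<omega> by (auto simp: E_def G_def S1_def m(2) e1_def)
          have h2: "\<bar>A1 - N1 t * V f\<bar> \<le> \<delta> * m / 2 * N1 t"
            using \<omega> f by (auto simp: E_def G_def A1_def V_def e1_def)
          have h3: "N2 t * real L \<le> S2" "S2 \<le> N2 t * (real L + 1)"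
          proof -
            show "N2 t * real L \<le> S2" unfolding S2_def
              using sum_bounded_below[of "{N1 t<..N1 t + N2 t}" "real L" "\<lambda>i. \<tau> i \<omega>"] inB by simp
            show "S2 \<le> N2 t * (real L + 1)" unfolding S2_def
              using sum_bounded_above[of "{N1 t<..N1 t + N2 t}" "\<lambda>i. \<tau> i \<omega>" "real L + 1"] inB by simp
          qed
          have h4: "\<bar>A2 - S2 * f (\<infinity>, \<infinity>)\<bar> \<le> \<epsilon> * S2"
          proof -
            have "A2 - S2 * f (\<infinity>, \<infinity>) = (\<Sum>i\<in>{N1 t<..N1 t + N2 t}. \<tau> i \<omega> * (cycle_avg f (1 / \<tau> i \<omega>) - f (\<infinity>, \<infinity>)))"
              unfolding A2_def S2_def by (simp add: right_diff_distrib sum_subtractf sum_distrib_right)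
            also have "\<bar>\<dots>\<bar> \<le> (\<Sum>i\<in>{N1 t<..N1 t + N2 t}. \<epsilon> * \<tau> i \<omega>)"
            proof (rule order_trans[OF sum_abs sum_mono])
              fix i assume i: "i \<in> {N1 t<..N1 t + N2 t}"
              have "\<bar>cycle_avg f (1 / \<tau> i \<omega>) - f (\<infinity>, \<infinity>)\<bar> \<le> \<epsilon>"
                using L(1) f inB(1)[OF i] by (intro L1[of L]) auto
              moreover have "0 < \<tau> i \<omega>" using i by (intro pos) auto
              ultimately show "\<bar>\<tau> i \<omega> * (cycle_avg f (1 / \<tau> i \<omega>) - f (\<infinity>, \<infinity>))\<bar> \<le> \<epsilon> * \<tau> i \<omega>"
                by (simp add: abs_mult mult.commute)
            qed
            finally show ?thesis by (simp add: S2_def sum_distrib_left)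
          qed
          note err = block_error[OF t(1) m(3) L1' \<delta>(1,2) less_imp_le[OF \<epsilon>] \<beta> \<gamma> \<beta>\<gamma> ab N1[OF t(1)] N2[OF t(1)]
              h1 h2 h3 h4 VB[OF f] B(2)[OF f]]
          have "\<bar>I - (A1 + A2)\<bar> \<le> B * (S1 + S2 - t)"
          proof -
            have fm: "f \<in> borel_measurable borel" using f F(2) bcont_measurable by blast
            have le: "t \<le> renewal_time \<tau> (N1 t + N2 t) \<omega>" unfolding S by (rule err(1))
            show ?thesis
              unfolding S[symmetric] A[symmetric] I_def
              by (rule empirical_measure_cycles_Lipschitz[OF meas sp pos fm B(2)[OF f] t(1) le])
          qed
          from err(2)[OF this]
          have "\<bar>I - t * (\<alpha> / m * V f + (1 - \<alpha>) * f (\<infinity>, \<infinity>))\<bar> \<le> t * (4 * B * \<delta> + \<delta> + 4 * B / L + 4 * \<epsilon>) + c2"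
            unfolding c2_def .
          also have "\<dots> < t * (e / 4 + e / 8 + e / 8) + e / 4 * t"
          proof (rule add_le_less_mono)
            show "t * (4 * B * \<delta> + \<delta> + 4 * B / L + 4 * \<epsilon>) \<le> t * (e / 4 + e / 8 + e / 8)"
              using \<delta>(3) BL t(1) by (intro mult_left_mono add_mono) (auto simp: \<epsilon>_def)
          qed (rule t(3))
          also have "\<dots> < t * e" using e t(1) by (simp add: field_simps)
          finally have "\<bar>t * ((\<integral>z. f z \<partial>empirical_measure \<tau> t \<omega>) - (\<alpha> / m * V f + (1 - \<alpha>) * f (\<infinity>, \<infinity>)))\<bar> < t * e"
            unfolding I_def right_diff_distrib .
          then show "\<bar>(\<integral>z. f z \<partial>empirical_measure \<tau> t \<omega>) - (\<alpha> / m * V f + (1 - \<alpha>) * f (\<infinity>, \<infinity>))\<bar> < e"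
            using t(1) by (simp add: abs_mult)
        qed
      qed
      have "Measurable.pred M (\<lambda>\<omega>. \<forall>f\<in>F. \<bar>(\<integral>z. f z \<partial>empirical_measure \<tau> t \<omega>) - (\<alpha> / m * V f + (1 - \<alpha>) * f (\<infinity>, \<infinity>))\<bar> < e)"
      proof (intro pred_intros_finite F(1))
        fix f assume "f \<in> F"
        then have [measurable]: "(\<lambda>\<omega>. \<integral>z. f z \<partial>empirical_measure \<tau> t \<omega>) \<in> borel_measurable M"
          using F(2) by (intro measurable_integral_empirical_measure meas t(1) bcont_measurable) auto
        show "Measurable.pred M (\<lambda>\<omega>. \<bar>(\<integral>z. f z \<partial>empirical_measure \<tau> t \<omega>) - (\<alpha> / m * V f + (1 - \<alpha>) * f (\<infinity>, \<infinity>))\<bar> < e)"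
          by measurable
      qed
      then show "{\<omega> \<in> space M. \<forall>f\<in>F. \<bar>(\<integral>z. f z \<partial>empirical_measure \<tau> t \<omega>) - (\<alpha> / m * V f + (1 - \<alpha>) * f (\<infinity>, \<infinity>))\<bar> < e} \<in> M.events"
        by (simp add: pred_def)
    qed
    finally show ?case by (simp add: V_def)
  qed
qed

lemma bcont_common_bound:
  assumes "finite F" "F \<subseteq> bcont"
  shows "\<exists>B>0. \<forall>f\<in>F. \<forall>z. \<bar>f z :: real\<bar> \<le> B"
  using assms
proof (induction F)
  case empty
  show ?case by (intro exI[of _ 1]) auto
next
  case (insert f F)
  then obtain B where B: "B > 0" "\<forall>f\<in>F. \<forall>z. \<bar>f z\<bar> \<le> B" by auto
  obtain C where C: "C > 0" "\<And>z. \<bar>f z\<bar> \<le> C" using bcont_boundE[of f] insert by auto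
  show ?case
  proof (intro exI[of _ "max B C"] conjI ballI allI)
    fix g z assume "g \<in> insert f F"
    then show "\<bar>g z\<bar> \<le> max B C" using B(2) C(2) by (auto simp: le_max_iff_disj)
  qed (use B in simp)
qed

text \<open>A substitute for \<open>tilted \<pi>\<close> when \<open>\<alpha> = 0\<close>, where
  nothing is known about the entropy of the latter. Conditioning \<open>\<psi>\<close> on a bounded
  interval of positive mass gives a bounded density and a finite mean.\<close>

lemma finite_entropy_law_exists:
  assumes \<psi>: "\<psi> \<in> pos_probs"
  shows "\<exists>\<nu>\<in>pos_probs. \<exists>D. D \<in> borel_measurable borel \<and> (\<forall>x. 0 \<le> D x) \<and> \<nu> = density \<psi> (\<lambda>x. ennreal (D x)) \<and>
    integrable \<nu> (\<lambda>x. ln (D x)) \<and> integrable \<nu> (\<lambda>x. x) \<and> 0 < (\<integral>x. x \<partial>\<nu>)"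
proof -
  have \<psi>': "\<psi> \<in> borel_probs" "AE x in \<psi>. 0 < x" using pos_probsD[OF \<psi>] by auto
  interpret prob_space \<psi> using \<psi>' borel_probsD by blast
  have s[measurable_cong]: "sets \<psi> = sets borel" using \<psi>' borel_probsD by blast
  have sp: "space \<psi> = UNIV" using \<psi>' borel_probsD by blast
  have "\<exists>n::nat. emeasure \<psi> {..real n} \<noteq> 0"
  proof (rule ccontr)
    assume "\<not> ?thesis"
    then have "emeasure \<psi> (\<Union>n::nat. {..real n}) = 0" by (intro emeasure_UN_eq_0) auto
    moreover have "(\<Union>n::nat. {..real n}) = UNIV" by (auto simp: real_arch_simple)
    ultimately show False using emeasure_space_1 by (simp add: sp)
  qed
  then obtain n :: nat where n: "emeasure \<psi> {..real n} \<noteq> 0" by blast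
  define p where "p = measure \<psi> {..real n}"
  have p: "0 < p" using n by (simp add: p_def emeasure_eq_measure zero_less_measure_iff)
  define D where "D x = indicator {..real n} x / p" for x
  have Dm[measurable]: "D \<in> borel_measurable borel" unfolding D_def by measurable
  define \<nu> where "\<nu> = density \<psi> (\<lambda>x. ennreal (D x))"
  have s\<nu>[measurable_cong]: "sets \<nu> = sets borel" by (simp add: \<nu>_def s)
  have "emeasure \<nu> (space \<nu>) = (\<integral>\<^sup>+x. ennreal (1 / p) * indicator {..real n} x \<partial>\<psi>)"
    unfolding \<nu>_def using p by (subst emeasure_density) (auto simp: D_def sp intro!: nn_integral_cong split: split_indicator)
  also have "\<dots> = ennreal (1 / p) * ennreal p"
    by (subst nn_integral_cmult_indicator) (auto simp: p_def emeasure_eq_measure)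
  also have "\<dots> = 1" using p by (simp flip: ennreal_mult)
  finally have p\<nu>: "prob_space \<nu>" by (rule prob_spaceI)
  interpret \<nu>: prob_space \<nu> by (rule p\<nu>)
  have ae: "AE x in \<nu>. 0 < x \<and> x \<le> real n"
    unfolding \<nu>_def using \<psi>'(2)
    by (subst AE_density) (auto elim!: eventually_mono simp: D_def split: split_indicator)
  have \<nu>: "\<nu> \<in> pos_probs" using ae p\<nu> s\<nu> by (auto simp: pos_probs_def borel_probs_def elim: eventually_mono)
  have i1: "integrable \<nu> (\<lambda>x. x)"
  proof (rule \<nu>.integrable_const_bound[of _ n])
    show "AE x in \<nu>. norm x \<le> real n" using ae by eventually_elim simp
  qed measurable
  have i2: "integrable \<nu> (\<lambda>x. ln (D x))"
  proof (rule \<nu>.integrable_const_bound[of _ "\<bar>ln (1 / p)\<bar>"])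
    show "AE x in \<nu>. norm (ln (D x)) \<le> \<bar>ln (1 / p)\<bar>"
      using ae by eventually_elim (simp add: D_def)
  qed measurable
  have "(\<integral>x. 0 \<partial>\<nu>) < (\<integral>x. x \<partial>\<nu>)"
  proof (rule \<nu>.integral_less_AE_space)
    show "AE x in \<nu>. 0 < x" using ae by eventually_elim simp
  qed (use i1 \<nu>.emeasure_space_1 in auto)
  then have "0 < (\<integral>x. x \<partial>\<nu>)" by simp
  moreover have "0 \<le> D x" for x using p by (simp add: D_def)
  ultimately have "D \<in> borel_measurable borel \<and> (\<forall>x. 0 \<le> D x) \<and> \<nu> = density \<psi> (\<lambda>x. ennreal (D x)) \<and>
    integrable \<nu> (\<lambda>x. ln (D x)) \<and> integrable \<nu> (\<lambda>x. x) \<and> 0 < (\<integral>x. x \<partial>\<nu>)"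
    using i1 i2 Dm \<nu>_def by (intro conjI allI)
  then show ?thesis using \<nu> by (rule_tac bexI[of _ \<nu>], rule_tac exI[of _ D])
qed

text \<open>Multiplying and dividing by \<open>\<tau>\<close> passes from the cycle seen by a
  uniform time to a typical waiting time, weighted by its length; in this form the value is the
  limit of sums over waiting times.\<close>

lemma integral_convex_comb_cycle:
  assumes \<pi>: "\<pi> \<in> pos_probs" "mean_recip \<pi> < \<infinity>" and \<alpha>: "\<alpha> \<in> {0..1}" and f: "f \<in> bcont"
  shows "(\<integral>z. f z \<partial>convex_comb \<alpha> (cycle_measure \<pi>) (return borel (\<infinity>, \<infinity>))) =
    \<alpha> * (enn2real (mean_recip \<pi>) * (\<integral>x. x * cycle_avg f (1 / x) \<partial>tilted \<pi>)) + (1 - \<alpha>) * f (\<infinity>, \<infinity>)"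
proof -
  obtain q where q: "q \<in> borel_probs" "length_decomp q \<alpha> \<pi>"
    using length_decomp_exists_law[OF \<pi>(1) \<alpha>] by blast
  have avg: "cycle_avg f \<in> bcont" using f by (rule cycle_avg_bcont)
  note [measurable] = bcont_measurable[OF avg]
  obtain B where B: "\<And>x. \<bar>cycle_avg f x\<bar> \<le> B" using bcont_boundE[OF avg] by blast
  have \<pi>': "\<pi> \<in> borel_probs" "AE x in \<pi>. 0 < x" using pos_probsD[OF \<pi>(1)] by auto
  have [measurable_cong]: "sets \<pi> = sets borel" using \<pi>' borel_probsD by blast
  have "(\<integral>z. f z \<partial>convex_comb \<alpha> (cycle_measure \<pi>) (return borel (\<infinity>, \<infinity>))) = (\<integral>x. cycle_avg f x \<partial>q)"
    using cycle_law_eq_convex_comb[OF q(1) \<pi>(1) q(2)] integral_cycle_law[OF q(1) f] by simp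
  also have "\<dots> = \<alpha> * (\<integral>\<tau>. cycle_avg f (1 / \<tau>) \<partial>\<pi>) + (1 - \<alpha>) * cycle_avg f 0"
    by (rule length_decomp_integral[OF q(2,1) \<pi>'(1) \<alpha> _ B]) measurable
  also have "(\<integral>\<tau>. cycle_avg f (1 / \<tau>) \<partial>\<pi>) = (\<integral>\<tau>. (\<tau> * cycle_avg f (1 / \<tau>)) / \<tau> \<partial>\<pi>)"
  proof (rule integral_cong_AE)
    show "AE \<tau> in \<pi>. cycle_avg f (1 / \<tau>) = \<tau> * cycle_avg f (1 / \<tau>) / \<tau>"
      using \<pi>'(2) by eventually_elim simp
  qed measurable
  also have "\<dots> = enn2real (mean_recip \<pi>) * (\<integral>x. x * cycle_avg f (1 / x) \<partial>tilted \<pi>)"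
    using integral_tilted(1)[OF \<pi>, of "\<lambda>x. x * cycle_avg f (1 / x)"] mean_recip_pos(2)[OF \<pi>] by simp
  finally show ?thesis by simp
qed

lemma lower_bound_open:
  fixes M :: "'w measure" and \<tau> :: "nat \<Rightarrow> 'w \<Rightarrow> real"
  assumes iid: "iid_law M \<tau> {1..} \<psi>" and \<psi>: "\<psi> \<in> pos_probs" and U: "openin narrow_topology U" "\<mu> \<in> U"
    and w: "rate \<psi> \<mu> < ereal w"
  shows "\<forall>\<^sub>F t in at_top. exp (- w * t) \<le> measure M {\<omega> \<in> space M. empirical_measure \<tau> t \<omega> \<in> U}"
proof -
  interpret M: prob_space M using iid by (rule iid_lawD)
  have meas: "\<And>i. 1 \<le> i \<Longrightarrow> \<tau> i \<in> borel_measurable M" using iid_lawD(4)[OF iid] by simp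
  have \<psi>': "\<psi> \<in> borel_probs" using pos_probsD[OF \<psi>] by auto
  have "\<mu> \<in> Delta" using w by (auto simp: rate_def split: if_splits)
  then obtain \<alpha> \<pi> where \<mu>: "\<mu> = convex_comb \<alpha> (cycle_measure \<pi>) (return borel (\<infinity>, \<infinity>))"
    and \<alpha>: "\<alpha> \<in> {0..1}" and \<pi>: "\<pi> \<in> pos_probs" "mean_recip \<pi> < \<infinity>"
    unfolding Delta_def Delta0_def by blast
  obtain F e where F: "finite F" "F \<subseteq> bcont" and e: "0 < e" and nU: "nbhd F e \<mu> \<subseteq> U"
    using narrow_nbhd_base[OF U] by blast
  obtain B where B: "0 < B" "\<And>f z. f \<in> F \<Longrightarrow> \<bar>f z\<bar> \<le> B" using bcont_common_bound[OF F] by blast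
  define r where "r = enn2real (mean_recip \<pi>)"
  have r: "0 < r" "mean_recip \<pi> = ennreal r" unfolding r_def using mean_recip_pos[OF \<pi>] by auto
  have er: "enn2ereal (mean_recip \<pi>) = ereal r" unfolding r(2) using r(1) by (simp add: enn2ereal_ennreal)
  have w1: "ereal (\<alpha> * r) * rel_entropy (tilted \<pi>) \<psi> + ereal (1 - \<alpha>) * exp_abscissa \<psi> < ereal w"
    using w unfolding \<mu> rate_convex_comb[OF \<pi> \<alpha>] er by simp
  \<comment> \<open>For \<open>\<alpha> \<noteq> 0\<close> the finite rate provides a density of
    \<open>tilted \<pi>\<close> with integrable logarithm. For \<open>\<alpha> = 0\<close> the first
    block has weight 0, and any law of finite entropy and finite positive mean may be used.\<close>
  have "\<exists>\<nu>\<in>pos_probs. \<exists>D. D \<in> borel_measurable borel \<and> (\<forall>x. 0 \<le> D x) \<and> \<nu> = density \<psi> (\<lambda>x. ennreal (D x)) \<and>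
    integrable \<nu> (\<lambda>x. ln (D x)) \<and> integrable \<nu> (\<lambda>x. x) \<and> 0 < (\<integral>x. x \<partial>\<nu>) \<and>
    ereal (\<alpha> / (\<integral>x. x \<partial>\<nu>) * (\<integral>x. ln (D x) \<partial>\<nu>)) = ereal (\<alpha> * r) * rel_entropy (tilted \<pi>) \<psi> \<and>
    (\<alpha> = 0 \<or> \<nu> = tilted \<pi>)"
  proof (cases "\<alpha> = 0")
    case True
    have "ereal (\<alpha> / (\<integral>x. x \<partial>\<nu>) * (\<integral>x. ln (D x) \<partial>\<nu>)) = ereal (\<alpha> * r) * rel_entropy (tilted \<pi>) \<psi>"
      for \<nu> and D :: "real \<Rightarrow> real" using True by (simp add: zero_ereal_def[symmetric])
    then show ?thesis using finite_entropy_law_exists[OF \<psi>] True by (simp only: simp_thms)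
  next
    case False
    then have ar: "0 < \<alpha> * r" using \<alpha> r by simp
    have "rel_entropy (tilted \<pi>) \<psi> \<noteq> \<infinity>"
    proof
      assume "rel_entropy (tilted \<pi>) \<psi> = \<infinity>"
      then have inf: "ereal (\<alpha> * r) * rel_entropy (tilted \<pi>) \<psi> + ereal (1 - \<alpha>) * exp_abscissa \<psi> = \<infinity>"
        using ar by (auto simp: zero_less_mult_iff)
      show False using w1 unfolding inf by simp
    qed
    then have ac: "absolutely_continuous \<psi> (tilted \<pi>)" by (auto simp: rel_entropy_def split: if_splits)
    have tp: "tilted \<pi> \<in> pos_probs" by (rule tilted_pos_probs[OF \<pi>])
    from rel_entropy_density[OF \<psi>' pos_probsD(1)[OF tp] ac] obtain D where D: "D \<in> borel_measurable borel" "\<And>x. 0 \<le> D x"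
      "tilted \<pi> = density \<psi> (\<lambda>x. ennreal (D x))"
      "rel_entropy (tilted \<pi>) \<psi> = (if integrable (tilted \<pi>) (\<lambda>x. ln (D x)) then ereal (\<integral>x. ln (D x) \<partial>tilted \<pi>) else \<infinity>)"
      by blast
    have i: "integrable (tilted \<pi>) (\<lambda>x. ln (D x))" using D(4) \<open>rel_entropy (tilted \<pi>) \<psi> \<noteq> \<infinity>\<close> by (auto split: if_splits)
    have "ereal (\<alpha> / (\<integral>x. x \<partial>tilted \<pi>) * (\<integral>x. ln (D x) \<partial>tilted \<pi>)) = ereal (\<alpha> * r) * rel_entropy (tilted \<pi>) \<psi>"
      using D(4) i tilted_mean(2)[OF \<pi>] by (simp add: r_def)
    moreover have "0 < (\<integral>x. x \<partial>tilted \<pi>)" using tilted_mean(2)[OF \<pi>] r(1) by (simp add: r_def)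
    ultimately have "D \<in> borel_measurable borel \<and> (\<forall>x. 0 \<le> D x) \<and> tilted \<pi> = density \<psi> (\<lambda>x. ennreal (D x)) \<and>
      integrable (tilted \<pi>) (\<lambda>x. ln (D x)) \<and> integrable (tilted \<pi>) (\<lambda>x. x) \<and> 0 < (\<integral>x. x \<partial>tilted \<pi>) \<and>
      ereal (\<alpha> / (\<integral>x. x \<partial>tilted \<pi>) * (\<integral>x. ln (D x) \<partial>tilted \<pi>)) = ereal (\<alpha> * r) * rel_entropy (tilted \<pi>) \<psi> \<and>
      (\<alpha> = 0 \<or> tilted \<pi> = tilted \<pi>)"
      using D(1-3) i tilted_mean(1)[OF \<pi>] by (intro conjI allI disjI2 refl)
    then show ?thesis using tp by (rule_tac bexI[of _ "tilted \<pi>"], rule_tac exI[of _ D])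
  qed
  then obtain \<nu> D where \<nu>: "\<nu> \<in> pos_probs" and D: "D \<in> borel_measurable borel" "\<And>x. 0 \<le> D x" "\<nu> = density \<psi> (\<lambda>x. ennreal (D x))"
    "integrable \<nu> (\<lambda>x. ln (D x))" and m: "integrable \<nu> (\<lambda>x. x)" "0 < (\<integral>x. x \<partial>\<nu>)"
    and H: "ereal (\<alpha> / (\<integral>x. x \<partial>\<nu>) * (\<integral>x. ln (D x) \<partial>\<nu>)) = ereal (\<alpha> * r) * rel_entropy (tilted \<pi>) \<psi>"
    and \<nu>\<pi>: "\<alpha> = 0 \<or> \<nu> = tilted \<pi>" by blast
  define m where "m = (\<integral>x. x \<partial>\<nu>)"
  define H where "H = (\<integral>x. ln (D x) \<partial>\<nu>)"
  have m0: "0 < m" using m(2) by (simp add: m_def)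
  have w2: "ereal (\<alpha> / m * H) + ereal (1 - \<alpha>) * exp_abscissa \<psi> < ereal w"
    using w1 H by (simp add: m_def H_def)
  have "\<exists>\<delta> \<beta> \<gamma> x. 0 < \<delta> \<and> \<delta> \<le> 1 \<and> 4 * B * \<delta> + \<delta> \<le> e / 4 \<and> 0 \<le> \<beta> \<and> \<beta> \<le> 2 \<and> 0 \<le> \<gamma> \<and> \<gamma> \<le> 2 \<and> \<beta> + \<gamma> = 1 + \<delta> \<and>
    \<bar>\<beta> - \<alpha>\<bar> \<le> \<delta> \<and> \<bar>\<gamma> - (1 - \<alpha>)\<bar> \<le> \<delta> \<and> 0 < x \<and> (\<gamma> = 0 \<or> exp_abscissa \<psi> < ereal x) \<and>
    \<beta> / m * (H + \<delta> * m / 2) + \<gamma> * x < w"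
  proof -
    have small: "\<forall>\<^sub>F \<delta> in at_right (0::real). 0 < \<delta> \<and> \<delta> < 1 \<and> 4 * B * \<delta> + \<delta> < e / 4"
    proof (intro eventually_conj)
      show "\<forall>\<^sub>F \<delta> in at_right (0::real). 0 < \<delta>" by (rule eventually_at_right_less)
      have "((\<lambda>\<delta>::real. \<delta>) \<longlongrightarrow> 0) (at_right 0)" by (rule tendsto_ident_at)
      then show "\<forall>\<^sub>F \<delta> in at_right (0::real). \<delta> < 1" by (rule order_tendstoD(2)) simp
      have "((\<lambda>\<delta>. 4 * B * \<delta> + \<delta>) \<longlongrightarrow> 4 * B * 0 + 0) (at_right (0::real))" by (intro tendsto_intros)
      then show "\<forall>\<^sub>F \<delta> in at_right (0::real). 4 * B * \<delta> + \<delta> < e / 4" by (rule order_tendstoD(2)) (use e in simp)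
    qed
    show ?thesis
    proof (cases "\<alpha> = 1")
      \<comment> \<open>Here the abscissa has weight 0 and may be infinite, so no long waiting time
        can be afforded: \<open>\<gamma> = 0\<close>, and the first block also takes the surplus,
        \<open>\<beta> = 1 + \<delta>\<close>.\<close>
      case True
      have "((\<lambda>\<delta>. (1 + \<delta>) / m * (H + \<delta> * m / 2)) \<longlongrightarrow> (1 + 0) / m * (H + 0 * m / 2)) (at_right 0)"
        using m0 by (intro tendsto_intros) auto
      moreover have "(1 + 0) / m * (H + 0 * m / 2) < w" using w2 True by (simp add: zero_ereal_def[symmetric])
      ultimately have "\<forall>\<^sub>F \<delta> in at_right 0. (1 + \<delta>) / m * (H + \<delta> * m / 2) < w" by (rule order_tendstoD(2))
      with small have "\<forall>\<^sub>F \<delta> in at_right 0. (0 < \<delta> \<and> \<delta> < 1 \<and> 4 * B * \<delta> + \<delta> < e / 4) \<and> (1 + \<delta>) / m * (H + \<delta> * m / 2) < w"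
        by (rule eventually_conj)
      then obtain \<delta> where "0 < \<delta>" "\<delta> < 1" "4 * B * \<delta> + \<delta> < e / 4" "(1 + \<delta>) / m * (H + \<delta> * m / 2) < w"
        using eventually_happens'[OF trivial_limit_at_right_real] by blast
      then show ?thesis using True by (intro exI[of _ \<delta>] exI[of _ "1 + \<delta>"] exI[of _ 0] exI[of _ 1]) auto
    next
      case False
      \<comment> \<open>Now the abscissa \<open>x0\<close> is finite, and the second block takes the
        surplus: \<open>\<beta> = \<alpha>\<close>,
        \<open>\<gamma> = 1 - \<alpha> + \<delta>\<close>, at rate \<open>x0 + \<delta>\<close>,
        slightly above the abscissa as heavy intervals require.\<close>
      then have a1: "0 < 1 - \<alpha>" using \<alpha> by simp
      have "exp_abscissa \<psi> \<noteq> \<infinity>" using w2 a1 by auto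
      then obtain x0 where x0: "exp_abscissa \<psi> = ereal x0" "0 \<le> x0"
        using exp_abscissa_nonneg[OF \<psi>] by (cases "exp_abscissa \<psi>") auto
      have "((\<lambda>\<delta>. \<alpha> / m * (H + \<delta> * m / 2) + (1 - \<alpha> + \<delta>) * (x0 + \<delta>)) \<longlongrightarrow> \<alpha> / m * (H + 0 * m / 2) + (1 - \<alpha> + 0) * (x0 + 0)) (at_right 0)"
        using m0 by (intro tendsto_intros) auto
      moreover have "\<alpha> / m * (H + 0 * m / 2) + (1 - \<alpha> + 0) * (x0 + 0) < w" using w2 x0 by simp
      ultimately have "\<forall>\<^sub>F \<delta> in at_right 0. \<alpha> / m * (H + \<delta> * m / 2) + (1 - \<alpha> + \<delta>) * (x0 + \<delta>) < w" by (rule order_tendstoD(2))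
      with small have "\<forall>\<^sub>F \<delta> in at_right 0. (0 < \<delta> \<and> \<delta> < 1 \<and> 4 * B * \<delta> + \<delta> < e / 4) \<and> \<alpha> / m * (H + \<delta> * m / 2) + (1 - \<alpha> + \<delta>) * (x0 + \<delta>) < w"
        by (rule eventually_conj)
      then obtain \<delta> where "0 < \<delta>" "\<delta> < 1" "4 * B * \<delta> + \<delta> < e / 4" "\<alpha> / m * (H + \<delta> * m / 2) + (1 - \<alpha> + \<delta>) * (x0 + \<delta>) < w"
        using eventually_happens'[OF trivial_limit_at_right_real] by blast
      then show ?thesis using \<alpha> x0
        by (intro exI[of _ \<delta>] exI[of _ \<alpha>] exI[of _ "1 - \<alpha> + \<delta>"] exI[of _ "x0 + \<delta>"]) auto
    qed
  qed
  then obtain \<delta> \<beta> \<gamma> x where par: "0 < \<delta>" "\<delta> \<le> 1" "4 * B * \<delta> + \<delta> \<le> e / 4" "0 \<le> \<beta>" "\<beta> \<le> 2" "0 \<le> \<gamma>" "\<gamma> \<le> 2" "\<beta> + \<gamma> = 1 + \<delta>"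
    "\<bar>\<beta> - \<alpha>\<bar> \<le> \<delta>" "\<bar>\<gamma> - (1 - \<alpha>)\<bar> \<le> \<delta>" "0 < x" "\<gamma> = 0 \<or> exp_abscissa \<psi> < ereal x"
    "\<beta> / m * (H + \<delta> * m / 2) + \<gamma> * x < w" by blast
  have "\<forall>\<^sub>F t in at_top. exp (- w * t) \<le> measure M {\<omega> \<in> space M. \<forall>f\<in>F.
    \<bar>(\<integral>z. f z \<partial>empirical_measure \<tau> t \<omega>) - (\<alpha> / m * (\<integral>x. x * cycle_avg f (1 / x) \<partial>\<nu>) + (1 - \<alpha>) * f (\<infinity>, \<infinity>))\<bar> < e}"
    by (rule lower_bound_integrals[OF iid \<psi> \<nu> D m(1) m_def m0 H_def F e B(1) _ par]) (rule B(2))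
  moreover have "\<forall>\<^sub>F t in at_top. (0::real) < t" by (rule eventually_gt_at_top)
  ultimately show ?thesis
  proof eventually_elim
    case (elim t)
    have int: "(\<integral>z. f z \<partial>\<mu>) = \<alpha> / m * (\<integral>x. x * cycle_avg f (1 / x) \<partial>\<nu>) + (1 - \<alpha>) * f (\<infinity>, \<infinity>)" if "f \<in> F" for f
    proof -
      have "f \<in> bcont" using F(2) that by blast
      then have "(\<integral>z. f z \<partial>\<mu>) = \<alpha> * (r * (\<integral>x. x * cycle_avg f (1 / x) \<partial>tilted \<pi>)) + (1 - \<alpha>) * f (\<infinity>, \<infinity>)"
        unfolding \<mu> r_def by (rule integral_convex_comb_cycle[OF \<pi> \<alpha>])
      moreover have "m = 1 / r" if "\<nu> = tilted \<pi>" using that tilted_mean(2)[OF \<pi>] by (simp add: m_def r_def)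
      ultimately show ?thesis using \<nu>\<pi> by auto
    qed
    note elim(1)
    also have "measure M {\<omega> \<in> space M. \<forall>f\<in>F.
      \<bar>(\<integral>z. f z \<partial>empirical_measure \<tau> t \<omega>) - (\<alpha> / m * (\<integral>x. x * cycle_avg f (1 / x) \<partial>\<nu>) + (1 - \<alpha>) * f (\<infinity>, \<infinity>))\<bar> < e}
      \<le> measure M {\<omega> \<in> space M. empirical_measure \<tau> t \<omega> \<in> U}"
    proof (rule M.finite_measure_mono)
      show "{\<omega> \<in> space M. \<forall>f\<in>F.
        \<bar>(\<integral>z. f z \<partial>empirical_measure \<tau> t \<omega>) - (\<alpha> / m * (\<integral>x. x * cycle_avg f (1 / x) \<partial>\<nu>) + (1 - \<alpha>) * f (\<infinity>, \<infinity>))\<bar> < e}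
        \<subseteq> {\<omega> \<in> space M. empirical_measure \<tau> t \<omega> \<in> U}"
        using nU int empirical_measure_borel_probs[OF meas _ elim(2)] by (auto simp: nbhd_def)
      show "{\<omega> \<in> space M. empirical_measure \<tau> t \<omega> \<in> U} \<in> M.events"
        using measurable_sets[OF measurable_empirical_measure[OF meas elim(2)] sets_borel_of_openin[OF U(1)]]
        by (simp add: vimage_def Int_def conj_commute)
    qed
    finally show ?case .
  qed
qed

text \<open>An exponential Chebyshev bound: the test function depends on the inverse length only, so
  over a complete cycle it integrates to \<open>h\<close> of the waiting time, and over the current
  one to \<open>c\<close> per unit of time up to a small error.\<close>

lemma upper_bound_half_space:
  fixes M :: "'w measure" and \<tau> :: "nat \<Rightarrow> 'w \<Rightarrow> real"
  assumes iid: "iid_law M \<tau> {1..} \<psi>" and \<psi>: "\<psi> \<in> pos_probs" and l: "l \<in> short_recip_set K"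
    and a: "ereal a < rate \<psi> l"
  shows "\<exists>f\<in>bcont. \<exists>b Z. b < (\<integral>z. f z \<partial>l) \<and> 0 \<le> Z \<and>
    (\<forall>\<^sub>F t in at_top. measure M {\<omega> \<in> space M. b < (\<integral>z. f z \<partial>empirical_measure \<tau> t \<omega>)} \<le> Z * exp (- a * t))"
proof -
  interpret M: prob_space M using iid by (rule iid_lawD)
  have meas: "\<And>i. 1 \<le> i \<Longrightarrow> \<tau> i \<in> borel_measurable M" using iid_lawD(4)[OF iid] by simp
  obtain q where q: "l = cycle_law q" "q \<in> borel_probs" "AE x in q. 0 \<le> x" "(\<integral>\<^sup>+x. ennreal x \<partial>q) \<le> ennreal K"
    using l by (auto simp: short_recip_set_def)
  have "(\<integral>\<^sup>+x. ennreal x \<partial>q) < \<infinity>" using q(4) by (rule order.strict_trans1) simp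
  from length_decomp_exists[OF q(2,3) this] obtain \<alpha> \<pi> where \<alpha>: "\<alpha> \<in> {0..1}" and \<pi>: "\<pi> \<in> pos_probs" "mean_recip \<pi> < \<infinity>"
    and d: "length_decomp q \<alpha> \<pi>" by blast
  have "ereal a < ereal \<alpha> * enn2ereal (mean_recip \<pi>) * rel_entropy (tilted \<pi>) \<psi> + ereal (1 - \<alpha>) * exp_abscissa \<psi>"
    using a unfolding q(1) cycle_law_eq_convex_comb[OF q(2) \<pi>(1) d] rate_convex_comb[OF \<pi> \<alpha>] .
  from rate_test_function[OF \<psi> \<pi> \<alpha> q(2) d this] obtain g c where g: "g \<in> bcont" and c: "0 \<le> c" "(\<integral>\<^sup>+\<tau>. ennreal (exp (c * \<tau>)) \<partial>\<psi>) < \<infinity>"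
    and g0: "g 0 = c" and g1: "(\<integral>\<^sup>+\<tau>. ennreal (exp (\<tau> * g (1 / \<tau>))) \<partial>\<psi>) < 1" and ga: "a < (\<integral>x. g x \<partial>q)" by blast
  define f where "f z = g (inv_length z)" for z
  have f: "f \<in> bcont" unfolding f_def using g by (rule length_function_bcont)
  note [measurable] = bcont_measurable[OF g] bcont_measurable[OF f]
  have avg: "cycle_avg f x = g x" if "0 \<le> x" for x
    unfolding f_def using that by (intro cycle_avg_inv_length) auto
  have intl: "(\<integral>z. f z \<partial>l) = (\<integral>x. g x \<partial>q)"
  proof -
    have "(\<integral>z. f z \<partial>l) = (\<integral>x. cycle_avg f x \<partial>q)" unfolding q(1) by (rule integral_cycle_law[OF q(2) f])
    also have "\<dots> = (\<integral>x. g x \<partial>q)"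
    proof (rule integral_cong_AE)
      show "AE x in q. cycle_avg f x = g x" using q(3) by eventually_elim (rule avg)
      show "cycle_avg f \<in> borel_measurable q" "g \<in> borel_measurable q"
        unfolding borel_probsD(4)[OF q(2)] by (intro bcont_measurable cycle_avg_bcont f g)+
    qed
    finally show ?thesis .
  qed
  \<comment> \<open>Halfway between the target exponent and the value at \<open>l\<close>; the gap
    \<open>b - a\<close> pays for the error of \<open>empirical_measure_approx\<close>.\<close>
  define b where "b = (a + (\<integral>x. g x \<partial>q)) / 2"
  have b: "a < b" "b < (\<integral>z. f z \<partial>l)" using ga intl by (auto simp: b_def)
  define h where "h x = x * g (1 / x)" for x
  have h: "h \<in> borel_measurable borel" unfolding h_def by measurable
  have h1: "(\<integral>\<^sup>+x. ennreal (exp (h x)) \<partial>\<psi>) < 1" using g1 by (simp add: h_def)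
  obtain Z where Z: "0 \<le> Z" "\<And>t b. measure M {\<omega> \<in> space M. \<exists>n. renewal_time \<tau> n \<omega> \<le> t \<and> t < renewal_time \<tau> (Suc n) \<omega> \<and>
      b \<le> (\<Sum>i=1..n. h (\<tau> i \<omega>)) + c * (t - renewal_time \<tau> n \<omega>)} \<le> Z * exp (- b)"
    using exp_upper_bound[OF iid \<psi> h h1 c] by blast
  have "\<exists>T>0. \<forall>t\<ge>T. \<forall>\<omega>\<in>space M. \<forall>n. (\<forall>i\<ge>1. 0 < \<tau> i \<omega>) \<longrightarrow> renewal_time \<tau> n \<omega> \<le> t \<longrightarrow> t \<le> renewal_time \<tau> (Suc n) \<omega> \<longrightarrow>
    \<bar>t * (\<integral>z. f z \<partial>empirical_measure \<tau> t \<omega>) -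
      ((\<Sum>i=1..n. \<tau> i \<omega> * cycle_avg f (1 / \<tau> i \<omega>)) + (t - renewal_time \<tau> n \<omega>) * f (\<infinity>, \<infinity>))\<bar> \<le> (b - a) * t"
    by (rule empirical_measure_approx[OF meas f]) (use b(1) in auto)
  then obtain T where T: "T > 0" "\<And>t \<omega> n. T \<le> t \<Longrightarrow> \<omega> \<in> space M \<Longrightarrow> (\<forall>i\<ge>1. 0 < \<tau> i \<omega>) \<Longrightarrow> renewal_time \<tau> n \<omega> \<le> t \<Longrightarrow> t \<le> renewal_time \<tau> (Suc n) \<omega> \<Longrightarrow>
    \<bar>t * (\<integral>z. f z \<partial>empirical_measure \<tau> t \<omega>) -
      ((\<Sum>i=1..n. \<tau> i \<omega> * cycle_avg f (1 / \<tau> i \<omega>)) + (t - renewal_time \<tau> n \<omega>) * f (\<infinity>, \<infinity>))\<bar> \<le> (b - a) * t"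
    by blast
  have f0: "f (\<infinity>, \<infinity>) = c" using avg[of 0] g0 by simp
  have "\<forall>\<^sub>F t in at_top. measure M {\<omega> \<in> space M. b < (\<integral>z. f z \<partial>empirical_measure \<tau> t \<omega>)} \<le> Z * exp (- a * t)"
    using eventually_ge_at_top[of T]
  proof eventually_elim
    case (elim t)
    have t: "0 < t" using T(1) elim by simp
    let ?E = "{\<omega> \<in> space M. \<exists>n. renewal_time \<tau> n \<omega> \<le> t \<and> t < renewal_time \<tau> (Suc n) \<omega> \<and>
      a * t \<le> (\<Sum>i=1..n. h (\<tau> i \<omega>)) + c * (t - renewal_time \<tau> n \<omega>)}"
    have "measure M {\<omega> \<in> space M. b < (\<integral>z. f z \<partial>empirical_measure \<tau> t \<omega>)} \<le> measure M ?E"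
    proof (rule M.finite_measure_mono_AE)
      show "AE \<omega> in M. \<omega> \<in> {\<omega> \<in> space M. b < (\<integral>z. f z \<partial>empirical_measure \<tau> t \<omega>)} \<longrightarrow> \<omega> \<in> ?E"
        using AE_renewal[OF iid \<psi>]
      proof eventually_elim
        case (elim \<omega>)
        then have pos: "\<forall>i\<ge>1. 0 < \<tau> i \<omega>" by blast
        obtain n where n: "renewal_time \<tau> n \<omega> \<le> t" "t < renewal_time \<tau> (Suc n) \<omega>" using elim t by (meson less_asym)
        show ?case
        proof (intro impI)
          assume \<omega>: "\<omega> \<in> {\<omega> \<in> space M. b < (\<integral>z. f z \<partial>empirical_measure \<tau> t \<omega>)}"
          have "(\<Sum>i=1..n. \<tau> i \<omega> * cycle_avg f (1 / \<tau> i \<omega>)) = (\<Sum>i=1..n. h (\<tau> i \<omega>))"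
            using pos by (intro sum.cong) (auto simp: h_def avg less_imp_le)
          then have "t * (\<integral>z. f z \<partial>empirical_measure \<tau> t \<omega>) \<le> (\<Sum>i=1..n. h (\<tau> i \<omega>)) + c * (t - renewal_time \<tau> n \<omega>) + (b - a) * t"
            using T(2)[OF \<open>T \<le> t\<close> _ pos n(1) less_imp_le[OF n(2)]] \<omega> by (simp add: f0 abs_le_iff mult.commute)
          moreover have "t * b \<le> t * (\<integral>z. f z \<partial>empirical_measure \<tau> t \<omega>)" using \<omega> t by (intro mult_left_mono) auto
          ultimately have "a * t \<le> (\<Sum>i=1..n. h (\<tau> i \<omega>)) + c * (t - renewal_time \<tau> n \<omega>)" by (simp add: algebra_simps)
          then show "\<omega> \<in> ?E" using \<omega> n by blast
        qed
      qed
      have S[measurable]: "renewal_time \<tau> k \<in> borel_measurable M" for k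
        unfolding renewal_time_def[abs_def] by (intro borel_measurable_sum meas) auto
      have [measurable]: "(\<lambda>\<omega>. \<Sum>i=1..n. h (\<tau> i \<omega>)) \<in> borel_measurable M" for n
        using meas by (intro borel_measurable_sum) (auto intro: measurable_compose[OF _ h])
      show "?E \<in> M.events" by measurable
    qed
    also have "\<dots> \<le> Z * exp (- (a * t))" by (rule Z(2))
    finally show ?case by simp
  qed
  then show ?thesis using f b(2) Z(1) by blast
qed

lemma measure_empirical_law:
  assumes iid: "iid_law M \<tau> {1..} \<psi>" and t: "0 < t" and W: "W \<in> sets (borel_of narrow_topology)"
  shows "measure (empirical_law M \<tau> t) W = measure M {\<omega> \<in> space M. empirical_measure \<tau> t \<omega> \<in> W}"
    and "{\<omega> \<in> space M. empirical_measure \<tau> t \<omega> \<in> W} \<in> sets M"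
proof -
  have "\<And>i. 1 \<le> i \<Longrightarrow> \<tau> i \<in> borel_measurable M" using iid_lawD(4)[OF iid] by simp
  from measurable_empirical_measure[OF this t]
  have m: "empirical_measure \<tau> t \<in> measurable M (borel_of narrow_topology)" by simp
  have eq: "empirical_measure \<tau> t -` W \<inter> space M = {\<omega> \<in> space M. empirical_measure \<tau> t \<omega> \<in> W}" by auto
  show "measure (empirical_law M \<tau> t) W = measure M {\<omega> \<in> space M. empirical_measure \<tau> t \<omega> \<in> W}"
    unfolding empirical_law_def measure_distr[OF m W] eq ..
  show "{\<omega> \<in> space M. empirical_measure \<tau> t \<omega> \<in> W} \<in> sets M"
    using measurable_sets[OF m W] unfolding eq .
qed

lemma rate_sublevel_subset_short_recip:
  assumes \<psi>: "\<psi> \<in> pos_probs"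
  shows "{\<mu>. rate \<psi> \<mu> \<le> ereal c} \<subseteq> short_recip_set ((c + 1) / - ln (\<integral>x. exp (- x) \<partial>\<psi>))"
proof
  fix \<mu> assume "\<mu> \<in> {\<mu>. rate \<psi> \<mu> \<le> ereal c}"
  then have c: "rate \<psi> \<mu> \<le> ereal c" by simp
  then have "\<mu> \<in> Delta" by (auto simp: rate_def split: if_splits)
  then obtain \<alpha> \<pi> where \<mu>: "\<mu> = convex_comb \<alpha> (cycle_measure \<pi>) (return borel (\<infinity>, \<infinity>))"
    and \<alpha>: "\<alpha> \<in> {0..1}" and \<pi>: "\<pi> \<in> pos_probs" "mean_recip \<pi> < \<infinity>"
    unfolding Delta_def Delta0_def by blast
  obtain q where q: "q \<in> borel_probs" "AE x in q. 0 \<le> x" "length_decomp q \<alpha> \<pi>"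
    using length_decomp_exists_law[OF \<pi>(1) \<alpha>] by blast
  have "(\<integral>\<^sup>+x. ennreal x \<partial>q) \<le> ennreal ((c + 1) / - ln (\<integral>x. exp (- x) \<partial>\<psi>))"
    unfolding length_decomp_mean[OF q(3)]
    by (rule rate_renewal_bound[OF \<psi> \<pi> \<alpha>]) (use c in \<open>simp only: \<mu> rate_convex_comb[OF \<pi> \<alpha>]\<close>)
  moreover have "\<mu> = cycle_law q" unfolding \<mu> cycle_law_eq_convex_comb[OF q(1) \<pi>(1) q(3)] ..
  ultimately show "\<mu> \<in> short_recip_set ((c + 1) / - ln (\<integral>x. exp (- x) \<partial>\<psi>))"
    unfolding short_recip_set_def using q(1,2) by blast
qed

lemma short_recip_set_mono: "K \<le> K' \<Longrightarrow> short_recip_set K \<subseteq> short_recip_set K'"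
  unfolding short_recip_set_def using ennreal_leI[of K K'] order_trans by blast

lemma compactin_short_recip_set: "0 \<le> K \<Longrightarrow> compactin narrow_topology (short_recip_set K)"
  by (rule compactin_short_recip_subset) auto

text \<open>The radius is written as \<open>2 * e\<close> so that a cover by neighbourhoods of
  radius \<open>e\<close> still leaves \<open>e\<close> for the distance between the empirical
  measure and its cycle law.\<close>

lemma upper_bound_nbhd:
  assumes iid: "iid_law M \<tau> {1..} \<psi>" and \<psi>: "\<psi> \<in> pos_probs" and l: "l \<in> short_recip_set K"
    and a: "ereal a < rate \<psi> l"
  shows "\<exists>f\<in>bcont. \<exists>e>0. \<exists>Z\<ge>0. \<forall>\<^sub>F t in at_top.
    measure M {\<omega> \<in> space M. empirical_measure \<tau> t \<omega> \<in> nbhd {f} (2 * e) l} \<le> Z * exp (- a * t)"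
proof -
  interpret M: prob_space M using iid by (rule iid_lawD)
  have meas: "\<And>i. 1 \<le> i \<Longrightarrow> \<tau> i \<in> borel_measurable M" using iid_lawD(4)[OF iid] by simp
  obtain f b Z where f: "f \<in> bcont" and b: "b < (\<integral>z. f z \<partial>l)" and Z: "0 \<le> Z"
    "\<forall>\<^sub>F t in at_top. measure M {\<omega> \<in> space M. b < (\<integral>z. f z \<partial>empirical_measure \<tau> t \<omega>)} \<le> Z * exp (- a * t)"
    using upper_bound_half_space[OF iid \<psi> l a] by blast
  define e where "e = ((\<integral>z. f z \<partial>l) - b) / 2"
  have e: "0 < e" "2 * e = (\<integral>z. f z \<partial>l) - b" using b by (auto simp: e_def)
  have "\<forall>\<^sub>F t in at_top. measure M {\<omega> \<in> space M. empirical_measure \<tau> t \<omega> \<in> nbhd {f} (2 * e) l} \<le> Z * exp (- a * t)"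
    using Z(2) eventually_gt_at_top[of 0]
  proof eventually_elim
    case (elim t)
    have [measurable]: "(\<lambda>\<omega>. \<integral>z. f z \<partial>empirical_measure \<tau> t \<omega>) \<in> borel_measurable M"
      by (rule measurable_integral_empirical_measure[OF meas elim(2) bcont_measurable[OF f]])
    have "measure M {\<omega> \<in> space M. empirical_measure \<tau> t \<omega> \<in> nbhd {f} (2 * e) l} \<le>
      measure M {\<omega> \<in> space M. b < (\<integral>z. f z \<partial>empirical_measure \<tau> t \<omega>)}"
      by (intro M.finite_measure_mono) (auto simp: nbhd_def e(2))
    then show ?case using elim(1) by linarith
  qed
  then show ?thesis using f e(1) Z(1) by blast
qed

text \<open>Closedness of the sublevel sets is read off the large deviations bounds: near a limit \<open>l\<close> of
  measures of rate at most \<open>c\<close> the empirical measure has probability at least \<open>exp (- w * t)\<close> for all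
  \<open>w > c\<close>, against an upper bound by \<open>exp (- a * t)\<close> for all \<open>a < rate \<psi> l\<close>.\<close>

lemma compactin_rate_sublevel:
  assumes iid: "iid_law M \<tau> {1..} \<psi>" and \<psi>: "\<psi> \<in> pos_probs"
  shows "compactin narrow_topology {\<mu> \<in> topspace narrow_topology. rate \<psi> \<mu> \<le> ereal c}"
proof (rule compactin_short_recip_subset)
  let ?S = "{\<mu> \<in> topspace narrow_topology. rate \<psi> \<mu> \<le> ereal c}"
  let ?K = "max 0 ((c + 1) / - ln (\<integral>x. exp (- x) \<partial>\<psi>))"
  have "?S \<subseteq> {\<mu>. rate \<psi> \<mu> \<le> ereal c}" by blast
  also note rate_sublevel_subset_short_recip[OF \<psi>]
  also have "short_recip_set ((c + 1) / - ln (\<integral>x. exp (- x) \<partial>\<psi>)) \<subseteq> short_recip_set ?K"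
    by (rule short_recip_set_mono) simp
  finally show "?S \<subseteq> short_recip_set ?K" .
  show "0 \<le> ?K" by simp
  fix \<mu> l assume \<mu>: "range \<mu> \<subseteq> ?S" and l: "l \<in> short_recip_set ?K"
    and lim: "\<And>U. openin narrow_topology U \<Longrightarrow> l \<in> U \<Longrightarrow> \<forall>\<^sub>F n::nat in sequentially. \<mu> n \<in> U"
  have lb: "l \<in> borel_probs" using l short_recip_set_subset by blast
  have "rate \<psi> l \<le> ereal c"
  proof (rule ccontr)
    assume "\<not> ?thesis"
    then have "ereal c < rate \<psi> l" by simp
    from ereal_dense2[OF this] obtain a where a: "ereal c < ereal a" "ereal a < rate \<psi> l" by blast
    define w where "w = (c + a) / 2"
    have w: "c < w" "w < a" using a(1) by (auto simp: w_def)
    obtain f e Z where f: "f \<in> bcont" and e: "0 < e" and Z: "0 \<le> Z" "\<forall>\<^sub>F t in at_top.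
        measure M {\<omega> \<in> space M. empirical_measure \<tau> t \<omega> \<in> nbhd {f} (2 * e) l} \<le> Z * exp (- a * t)"
      using upper_bound_nbhd[OF iid \<psi> l a(2)] by blast
    have U: "openin narrow_topology (nbhd {f} (2 * e) l)" using f by (intro openin_nbhd) auto
    moreover have "l \<in> nbhd {f} (2 * e) l" using lb e by (intro nbhd_self) auto
    ultimately have "\<forall>\<^sub>F n in sequentially. \<mu> n \<in> nbhd {f} (2 * e) l" by (rule lim)
    then obtain n where n: "\<mu> n \<in> nbhd {f} (2 * e) l" by (meson eventually_happens' sequentially_bot)
    have "rate \<psi> (\<mu> n) \<le> ereal c" using \<mu> by auto
    then have "rate \<psi> (\<mu> n) < ereal w" using w(1) by (meson ereal_less_eq(3) less_ereal.simps(1) order.strict_trans1)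
    note low = lower_bound_open[OF iid \<psi> U n this]
    have "((\<lambda>t. Z * exp (- (a - w) * t)) \<longlongrightarrow> 0) at_top"
      using w(2) by real_asymp
    then have "\<forall>\<^sub>F t in at_top. Z * exp (- (a - w) * t) < 1" by (rule order_tendstoD(2)) simp
    with low Z(2) have "\<forall>\<^sub>F t::real in at_top. False"
    proof eventually_elim
      case (elim t)
      have "exp (- w * t) \<le> Z * exp (- a * t)" using elim(1,2) by linarith
      also have "\<dots> = Z * exp (- (a - w) * t) * exp (- w * t)" by (simp add: algebra_simps flip: exp_add)
      also have "\<dots> < 1 * exp (- w * t)" using elim(3) by (rule mult_strict_right_mono) simp
      finally show False by simp
    qed
    then show False by simp
  qed
  then show "l \<in> ?S" using lb by (simp add: topspace_narrow_topology)
qed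

text \<open>The empirical measure itself need not lie in the compact set, because of its last cycle;
  the nearby \<open>cycle_law\<close> of its inverse lengths does, unless there are too many
  renewals. So the compact set is covered with radius \<open>e\<close>, while the probability bounds
  are taken with radius \<open>2 * e\<close> and intersected with \<open>C\<close>.\<close>

lemma upper_bound_closed:
  assumes iid: "iid_law M \<tau> {1..} \<psi>" and \<psi>: "\<psi> \<in> pos_probs" and C: "closedin narrow_topology C"
    and a: "ereal a < (INF \<mu>\<in>C. rate \<psi> \<mu>)"
  shows "\<exists>Z\<ge>0. \<forall>\<^sub>F t in at_top. measure M {\<omega> \<in> space M. empirical_measure \<tau> t \<omega> \<in> C} \<le> Z * exp (- a * t)"
proof -
  interpret M: prob_space M using iid by (rule iid_lawD)
  have meas: "\<And>i. 1 \<le> i \<Longrightarrow> \<tau> i \<in> borel_measurable M" using iid_lawD(4)[OF iid] by simp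
  define l where "l = - ln (\<integral>x. exp (- x) \<partial>\<psi>)"
  have l: "0 < l" "(\<integral>x. exp (- x) \<partial>\<psi>) = exp (- l)" using exp_decay_integral[OF \<psi>] by (auto simp: l_def)
  \<comment> \<open>Chosen for \<open>l * K \<ge> a + 1\<close>: the bound
    \<open>exp (t - l * k)\<close> on having \<open>k \<ge> K * t\<close> renewals by time
    \<open>t\<close> is then at most \<open>exp (- a * t)\<close>.\<close>
  define K where "K = max 0 ((a + 1) / l)"
  have K: "0 \<le> K" "a + 1 \<le> l * K" using l(1) by (auto simp: K_def max_def field_simps)
  \<comment> \<open>Points outside \<open>C\<close> have a neighbourhood disjoint from
    \<open>C\<close> and get \<open>Z = 0\<close>, so the cover can be taken of the whole compact
    set rather than of its part in \<open>C\<close>.\<close>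
  have "\<forall>\<mu>\<in>short_recip_set (K + 1). \<exists>x. case x of (F, e, Z) \<Rightarrow> finite F \<and> F \<subseteq> bcont \<and> 0 < e \<and> 0 \<le> Z \<and>
    (\<forall>\<^sub>F t in at_top. measure M {\<omega> \<in> space M. empirical_measure \<tau> t \<omega> \<in> nbhd F (2 * e) \<mu> \<inter> C} \<le> Z * exp (- a * t))"
  proof
    fix \<mu> assume \<mu>: "\<mu> \<in> short_recip_set (K + 1)"
    show "\<exists>x. case x of (F, e, Z) \<Rightarrow> finite F \<and> F \<subseteq> bcont \<and> 0 < e \<and> 0 \<le> Z \<and>
      (\<forall>\<^sub>F t in at_top. measure M {\<omega> \<in> space M. empirical_measure \<tau> t \<omega> \<in> nbhd F (2 * e) \<mu> \<inter> C} \<le> Z * exp (- a * t))"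
    proof (cases "\<mu> \<in> C")
      case True
      then have "ereal a < rate \<psi> \<mu>" using a by (meson INF_lower order.strict_trans2)
      then obtain f e Z where f: "f \<in> bcont" and e: "0 < e" and Z: "0 \<le> Z" "\<forall>\<^sub>F t in at_top.
          measure M {\<omega> \<in> space M. empirical_measure \<tau> t \<omega> \<in> nbhd {f} (2 * e) \<mu>} \<le> Z * exp (- a * t)"
        using upper_bound_nbhd[OF iid \<psi> \<mu>] by blast
      have "\<forall>\<^sub>F t in at_top. measure M {\<omega> \<in> space M. empirical_measure \<tau> t \<omega> \<in> nbhd {f} (2 * e) \<mu> \<inter> C} \<le> Z * exp (- a * t)"
        using Z(2) eventually_gt_at_top[of 0]
      proof eventually_elim
        case (elim t)
        have U: "openin narrow_topology (nbhd {f} (2 * e) \<mu>)" using f by (intro openin_nbhd) auto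
        have "measure M {\<omega> \<in> space M. empirical_measure \<tau> t \<omega> \<in> nbhd {f} (2 * e) \<mu> \<inter> C} \<le>
          measure M {\<omega> \<in> space M. empirical_measure \<tau> t \<omega> \<in> nbhd {f} (2 * e) \<mu>}"
          by (rule M.finite_measure_mono[OF _ measure_empirical_law(2)[OF iid elim(2) sets_borel_of_openin[OF U]]]) auto
        then show ?case using elim(1) by linarith
      qed
      then show ?thesis using f e Z(1) by (intro exI[of _ "({f}, e, Z)"]) simp
    next
      case False
      have o: "openin narrow_topology (topspace narrow_topology - C)" using C by (simp add: closedin_def)
      have m: "\<mu> \<in> topspace narrow_topology - C"
        using False \<mu> short_recip_set_subset by (auto simp: topspace_narrow_topology)
      from narrow_nbhd_base[OF o m] obtain F e where F: "finite F" "F \<subseteq> bcont" "0 < e" "nbhd F e \<mu> \<subseteq> topspace narrow_topology - C"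
        by blast
      then have "nbhd F e \<mu> \<inter> C = {}" by blast
      then show ?thesis using F(1-3) by (intro exI[of _ "(F, e / 2, 0)"]) (simp del: Int_iff)
    qed
  qed
  from bchoice[OF this] obtain G where G: "\<forall>\<mu>\<in>short_recip_set (K + 1). case G \<mu> of (F, e, Z) \<Rightarrow>
    finite F \<and> F \<subseteq> bcont \<and> 0 < e \<and> 0 \<le> Z \<and>
    (\<forall>\<^sub>F t in at_top. measure M {\<omega> \<in> space M. empirical_measure \<tau> t \<omega> \<in> nbhd F (2 * e) \<mu> \<inter> C} \<le> Z * exp (- a * t))"
    by (rule exE)
  define F where "F \<mu> = fst (G \<mu>)" for \<mu>
  define e where "e \<mu> = fst (snd (G \<mu>))" for \<mu>
  define Z where "Z \<mu> = snd (snd (G \<mu>))" for \<mu>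
  have F: "finite (F \<mu>)" "F \<mu> \<subseteq> bcont" and e: "0 < e \<mu>" and Z: "0 \<le> Z \<mu>" "\<forall>\<^sub>F t in at_top.
      measure M {\<omega> \<in> space M. empirical_measure \<tau> t \<omega> \<in> nbhd (F \<mu>) (2 * e \<mu>) \<mu> \<inter> C} \<le> Z \<mu> * exp (- a * t)"
    if "\<mu> \<in> short_recip_set (K + 1)" for \<mu>
    using G[rule_format, OF that] unfolding F_def e_def Z_def by (simp_all add: case_prod_beta)
  have "\<exists>\<F>. finite \<F> \<and> \<F> \<subseteq> (\<lambda>\<mu>. nbhd (F \<mu>) (e \<mu>) \<mu>) ` short_recip_set (K + 1) \<and> short_recip_set (K + 1) \<subseteq> \<Union>\<F>"
  proof (rule compactinD)
    show "compactin narrow_topology (short_recip_set (K + 1))" using K(1) by (intro compactin_short_recip_set) simp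
    show "openin narrow_topology U" if "U \<in> (\<lambda>\<mu>. nbhd (F \<mu>) (e \<mu>) \<mu>) ` short_recip_set (K + 1)" for U
      using that F openin_nbhd by blast
    show "short_recip_set (K + 1) \<subseteq> \<Union> ((\<lambda>\<mu>. nbhd (F \<mu>) (e \<mu>) \<mu>) ` short_recip_set (K + 1))"
    proof
      fix \<mu> assume \<mu>: "\<mu> \<in> short_recip_set (K + 1)"
      then have "\<mu> \<in> nbhd (F \<mu>) (e \<mu>) \<mu>" using short_recip_set_subset by (intro nbhd_self e) auto
      then show "\<mu> \<in> \<Union> ((\<lambda>\<mu>. nbhd (F \<mu>) (e \<mu>) \<mu>) ` short_recip_set (K + 1))" using \<mu> by (rule UN_I[rotated])
    qed
  qed
  then obtain \<F> where \<F>: "finite \<F>" "\<F> \<subseteq> (\<lambda>\<mu>. nbhd (F \<mu>) (e \<mu>) \<mu>) ` short_recip_set (K + 1)" "short_recip_set (K + 1) \<subseteq> \<Union>\<F>"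
    by blast
  obtain T where T: "T \<subseteq> short_recip_set (K + 1)" "finite T" "\<F> = (\<lambda>\<mu>. nbhd (F \<mu>) (e \<mu>) \<mu>) ` T"
    using finite_subset_image[OF \<F>(1,2)] by blast
  let ?near = "\<lambda>t f d. \<forall>\<omega>\<in>space M. \<forall>n. (\<forall>i\<ge>1. 0 < \<tau> i \<omega>) \<longrightarrow> renewal_time \<tau> n \<omega> \<le> t \<longrightarrow> t \<le> renewal_time \<tau> (Suc n) \<omega> \<longrightarrow>
    \<bar>(\<integral>z. f z \<partial>empirical_measure \<tau> t \<omega>) - (\<integral>z. cycle_avg f (inv_length z) \<partial>empirical_measure \<tau> t \<omega>)\<bar> \<le> d"
  have near: "\<forall>\<^sub>F t in at_top. ?near t f d" if "f \<in> bcont" "0 < d" for f d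
  proof -
    have "\<exists>T>0. \<forall>t\<ge>T. ?near t f d" by (rule empirical_measure_near_cycle_law[OF meas that])
    then show ?thesis unfolding eventually_at_top_linorder by blast
  qed
  have "\<forall>\<^sub>F t in at_top. \<forall>\<mu>\<in>T. \<forall>f\<in>F \<mu>. ?near t f (e \<mu>)"
    by (intro eventually_ball_finite ballI near T(2) F(1) e subsetD[OF F(2)]) (use T(1) in auto)
  moreover have "\<forall>\<^sub>F t in at_top. \<forall>\<mu>\<in>T.
      measure M {\<omega> \<in> space M. empirical_measure \<tau> t \<omega> \<in> nbhd (F \<mu>) (2 * e \<mu>) \<mu> \<inter> C} \<le> Z \<mu> * exp (- a * t)"
    by (intro eventually_ball_finite ballI T(2) Z(2)) (use T(1) in auto)
  ultimately have "\<forall>\<^sub>F t in at_top. measure M {\<omega> \<in> space M. empirical_measure \<tau> t \<omega> \<in> C} \<le> (1 + (\<Sum>\<mu>\<in>T. Z \<mu>)) * exp (- a * t)"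
    using eventually_ge_at_top[of 1]
  proof eventually_elim
    case (elim t)
    have t: "0 < t" using elim(3) by simp
    \<comment> \<open>Fewer than \<open>k\<close> completed cycles give
      \<open>Suc n \<le> k \<le> K * t + 1\<close>, which is at most \<open>(K + 1) * t\<close> as
      \<open>t \<ge> 1\<close>. This is why the compact set was taken at level
      \<open>K + 1\<close>.\<close>
    define k where "k = nat \<lceil>K * t\<rceil>"
    have k: "K * t \<le> real k" "real k \<le> K * t + 1" using K(1) t by (auto simp: k_def)
    let ?D = "{\<omega> \<in> space M. renewal_time \<tau> k \<omega> \<le> t}"
    let ?W = "\<lambda>\<mu>. {\<omega> \<in> space M. empirical_measure \<tau> t \<omega> \<in> nbhd (F \<mu>) (2 * e \<mu>) \<mu> \<inter> C}"
    have [measurable]: "renewal_time \<tau> k \<in> borel_measurable M"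
      unfolding renewal_time_def[abs_def] by (intro borel_measurable_sum meas) auto
    have D: "?D \<in> M.events" by measurable
    have W: "?W \<mu> \<in> M.events" if "\<mu> \<in> T" for \<mu>
    proof (rule measure_empirical_law(2)[OF iid t])
      have "openin narrow_topology (nbhd (F \<mu>) (2 * e \<mu>) \<mu>)" using that T(1) F by (intro openin_nbhd) auto
      then show "nbhd (F \<mu>) (2 * e \<mu>) \<mu> \<inter> C \<in> sets (borel_of narrow_topology)"
        by (intro sets.Int sets_borel_of_openin sets_borel_of_closedin C)
    qed
    have "measure M {\<omega> \<in> space M. empirical_measure \<tau> t \<omega> \<in> C} \<le> measure M (?D \<union> (\<Union>\<mu>\<in>T. ?W \<mu>))"
    proof (rule M.finite_measure_mono_AE)
      show "?D \<union> (\<Union>\<mu>\<in>T. ?W \<mu>) \<in> M.events" using D W T(2) by (intro sets.Un sets.finite_UN)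
      show "AE \<omega> in M. \<omega> \<in> {\<omega> \<in> space M. empirical_measure \<tau> t \<omega> \<in> C} \<longrightarrow> \<omega> \<in> ?D \<union> (\<Union>\<mu>\<in>T. ?W \<mu>)"
        using AE_renewal[OF iid \<psi>]
      proof eventually_elim
        case AE: (elim \<omega>)
        then have pos: "\<forall>i\<ge>1. 0 < \<tau> i \<omega>" by blast
        obtain n where n: "renewal_time \<tau> n \<omega> \<le> t" "t < renewal_time \<tau> (Suc n) \<omega>" using AE t by (meson less_asym)
        show ?case
        proof (intro impI)
          assume "\<omega> \<in> {\<omega> \<in> space M. empirical_measure \<tau> t \<omega> \<in> C}"
          then have \<omega>: "\<omega> \<in> space M" "empirical_measure \<tau> t \<omega> \<in> C" by auto
          show "\<omega> \<in> ?D \<union> (\<Union>\<mu>\<in>T. ?W \<mu>)"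
          proof (cases "renewal_time \<tau> k \<omega> \<le> t")
            case True
            then show ?thesis using \<omega> by simp
          next
            case False
            have "n < k"
            proof (rule ccontr)
              assume "\<not> n < k"
              then have "renewal_time \<tau> k \<omega> \<le> renewal_time \<tau> n \<omega>"
                unfolding renewal_time_def using pos by (intro sum_mono2) (auto intro: less_imp_le)
              then show False using False n(1) by simp
            qed
            then have "real (Suc n) \<le> K * t + 1" using k(2) by linarith
            also have "\<dots> \<le> (K + 1) * t" using elim(3) by (simp add: algebra_simps)
            finally have nK: "real (Suc n) / t \<le> K + 1" using t by (simp add: field_simps)
            let ?m = "empirical_measure \<tau> t \<omega>"
            have m: "?m \<in> borel_probs" by (rule empirical_measure_borel_probs[OF meas \<omega>(1) t])
            have il: "inv_length \<in> borel_measurable ?m" by (simp add: borel_probsD(4)[OF m])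
            interpret m: prob_space ?m using m by (rule borel_probsD)
            define q where "q = distr ?m borel inv_length"
            have q: "q \<in> borel_probs" unfolding borel_probs_def q_def using m.prob_space_distr[OF il] by simp
            have "(\<integral>\<^sup>+x. ennreal x \<partial>q) = (\<integral>\<^sup>+z. ennreal (inv_length z) \<partial>?m)"
              unfolding q_def by (rule nn_integral_distr[OF il]) simp
            also have "\<dots> \<le> ennreal (real (Suc n) / t)"
              by (rule empirical_measure_inv_length[OF meas \<omega>(1) _ t n(1) less_imp_le[OF n(2)]]) (use pos in auto)
            also have "\<dots> \<le> ennreal (K + 1)" using nK by (rule ennreal_leI)
            finally have "(\<integral>\<^sup>+x. ennreal x \<partial>q) \<le> ennreal (K + 1)" .
            moreover have "AE x in q. 0 \<le> x" unfolding q_def using il by (subst AE_distr_iff) auto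
            ultimately have "cycle_law q \<in> short_recip_set (K + 1)" unfolding short_recip_set_def using q by blast
            then obtain \<mu> where \<mu>: "\<mu> \<in> T" "cycle_law q \<in> nbhd (F \<mu>) (e \<mu>) \<mu>" using \<F>(3) T(3) by blast
            have "\<bar>(\<integral>z. f z \<partial>?m) - (\<integral>z. f z \<partial>\<mu>)\<bar> < 2 * e \<mu>" if f: "f \<in> F \<mu>" for f
            proof -
              have fb: "f \<in> bcont" using f \<mu>(1) T(1) F(2) by blast
              have "(\<integral>z. f z \<partial>cycle_law q) = (\<integral>x. cycle_avg f x \<partial>q)" by (rule integral_cycle_law[OF q fb])
              also have "\<dots> = (\<integral>z. cycle_avg f (inv_length z) \<partial>?m)"
                unfolding q_def by (rule integral_distr[OF il bcont_measurable[OF cycle_avg_bcont[OF fb]]])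
              finally have "\<bar>(\<integral>z. f z \<partial>?m) - (\<integral>z. f z \<partial>cycle_law q)\<bar> \<le> e \<mu>"
                using elim(1) \<mu>(1) f \<omega>(1) pos n(1) less_imp_le[OF n(2)] by simp
              moreover have "\<bar>(\<integral>z. f z \<partial>cycle_law q) - (\<integral>z. f z \<partial>\<mu>)\<bar> < e \<mu>" using \<mu>(2) f by (auto simp: nbhd_def)
              ultimately show ?thesis by linarith
            qed
            then have "?m \<in> nbhd (F \<mu>) (2 * e \<mu>) \<mu>" using m by (simp add: nbhd_def)
            then show ?thesis using \<omega> \<mu>(1) by blast
          qed
        qed
      qed
    qed
    also have "\<dots> \<le> measure M ?D + measure M (\<Union>\<mu>\<in>T. ?W \<mu>)"
      using D W T(2) by (intro measure_Un_le sets.finite_UN)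
    also have "\<dots> \<le> exp (- a * t) + (\<Sum>\<mu>\<in>T. Z \<mu> * exp (- a * t))"
    proof (rule add_mono)
      have "measure M ?D \<le> exp t * exp (- l) ^ k" using renewal_bound[OF iid \<psi>, of k t] unfolding l(2) .
      also have "\<dots> = exp (t - l * real k)" by (simp add: exp_diff exp_minus field_simps flip: exp_of_nat_mult)
      also have "\<dots> \<le> exp (- a * t)"
      proof -
        have "(a + 1) * t \<le> l * K * t" using K(2) t by (intro mult_right_mono) auto
        also have "\<dots> \<le> l * real k" using k(1) l(1) by (simp add: mult.assoc)
        finally show ?thesis by (simp add: algebra_simps)
      qed
      finally show "measure M ?D \<le> exp (- a * t)" .
      have "measure M (\<Union>\<mu>\<in>T. ?W \<mu>) \<le> (\<Sum>\<mu>\<in>T. measure M (?W \<mu>))"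
        using W T(2) by (intro M.finite_measure_subadditive_finite) auto
      also have "\<dots> \<le> (\<Sum>\<mu>\<in>T. Z \<mu> * exp (- a * t))" using elim(2) by (intro sum_mono) auto
      finally show "measure M (\<Union>\<mu>\<in>T. ?W \<mu>) \<le> (\<Sum>\<mu>\<in>T. Z \<mu> * exp (- a * t))" .
    qed
    also have "\<dots> = (1 + (\<Sum>\<mu>\<in>T. Z \<mu>)) * exp (- a * t)" by (simp add: distrib_right sum_distrib_right)
    finally show ?case .
  qed
  moreover have "0 \<le> 1 + (\<Sum>\<mu>\<in>T. Z \<mu>)" using Z(1) T(1) by (intro add_nonneg_nonneg sum_nonneg) auto
  ultimately show ?thesis by blast
qed

section \<open>Passage to logarithmic limits\<close>

lemma elog_ge: "exp x \<le> p \<Longrightarrow> ereal x \<le> elog p"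
  using less_le_trans[OF exp_gt_zero[of x], of p] by (auto simp: elog_def ln_ge_iff)

lemma elog_le: "p \<le> exp x \<Longrightarrow> elog p \<le> ereal x"
  by (auto simp: elog_def) (metis exp_gt_zero ln_exp ln_le_cancel_iff not_le)

text \<open>The strict gap between \<open>a\<close> and \<open>a'\<close> absorbs the constant
  \<open>Z\<close>; vanishing probabilities, with logarithm \<open>-\<infinity>\<close>, need no
  separate treatment.\<close>

lemma Limsup_elog_le:
  assumes Z: "0 \<le> Z" and p: "\<forall>\<^sub>F t in at_top. p t \<le> Z * exp (- a' * t)" and a: "a < a'"
  shows "Limsup at_top (\<lambda>t. ereal (1 / t) * elog (p t)) \<le> - ereal a"
proof (rule Limsup_bounded)
  have "((\<lambda>t. Z * exp (- (a' - a) * t)) \<longlongrightarrow> 0) at_top" using a by real_asymp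
  then have "\<forall>\<^sub>F t in at_top. Z * exp (- (a' - a) * t) < 1" by (rule order_tendstoD(2)) simp
  with p show "\<forall>\<^sub>F t in at_top. ereal (1 / t) * elog (p t) \<le> - ereal a"
    using eventually_gt_at_top[of 0]
  proof eventually_elim
    case (elim t)
    have "Z * exp (- a' * t) = Z * exp (- (a' - a) * t) * exp (- a * t)" by (simp add: algebra_simps flip: exp_add)
    also have "\<dots> \<le> 1 * exp (- a * t)" using elim(2) by (intro mult_right_mono) auto
    finally have "elog (p t) \<le> ereal (- a * t)" using elim(1) by (intro elog_le) simp
    then have "ereal (1 / t) * elog (p t) \<le> ereal (1 / t) * ereal (- a * t)"
      using elim(3) by (intro ereal_mult_left_mono) auto
    then show ?case using elim(3) by simp
  qed
qed

lemma Liminf_elog_ge: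
  assumes p: "\<forall>\<^sub>F t in at_top. exp (- w * t) \<le> p t"
  shows "- ereal w \<le> Liminf at_top (\<lambda>t. ereal (1 / t) * elog (p t))"
proof (rule Liminf_bounded)
  show "\<forall>\<^sub>F t in at_top. - ereal w \<le> ereal (1 / t) * elog (p t)"
    using p eventually_gt_at_top[of 0]
  proof eventually_elim
    case (elim t)
    have "ereal (- w * t) \<le> elog (p t)" using elim(1) by (rule elog_ge)
    then have "ereal (1 / t) * ereal (- w * t) \<le> ereal (1 / t) * elog (p t)"
      using elim(2) by (intro ereal_mult_left_mono) auto
    then show ?case using elim(2) by simp
  qed
qed

theorem theorem1p4:
  fixes M :: "'w measure" and \<tau> :: "nat \<Rightarrow> 'w \<Rightarrow> real" and \<psi> :: "real measure"
  assumes "\<psi> \<in> pos_probs"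
    and "prob_space M"
    and "prob_space.indep_vars M (\<lambda>_. borel) \<tau> {1..}"
    and "\<And>i. i \<ge> 1 \<Longrightarrow> distr M borel (\<tau> i) = \<psi>"
  shows "LDP_good narrow_topology (empirical_law M \<tau>) (rate \<psi>)"
proof -
  have iid: "iid_law M \<tau> {1..} \<psi>" using assms(2-4) by (simp add: iid_law_def)
  \<comment> \<open>For \<open>t \<le> 0\<close> the uniform measure on the empty segment is not a
    probability measure; as only \<open>t\<close> tending to infinity matters, the identity is
    stated eventually.\<close>
  have law: "\<forall>\<^sub>F t in at_top. measure (empirical_law M \<tau> t) W = measure M {\<omega> \<in> space M. empirical_measure \<tau> t \<omega> \<in> W}"
    if "W \<in> sets (borel_of narrow_topology)" for W
    using eventually_gt_at_top[of 0] by eventually_elim (rule measure_empirical_law(1)[OF iid _ that])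
  show ?thesis
    unfolding LDP_good_def
  proof (intro conjI allI impI)
    show "compactin narrow_topology {\<mu> \<in> topspace narrow_topology. rate \<psi> \<mu> \<le> ereal c}" for c
      by (rule compactin_rate_sublevel[OF iid assms(1)])
  next
    fix C :: "(ext_pos \<times> ext_pos) measure set" assume C: "closedin narrow_topology C"
    let ?L = "Limsup at_top (\<lambda>t. ereal (1 / t) * elog (measure (empirical_law M \<tau> t) C))"
    show "?L \<le> - (INF \<mu>\<in>C. rate \<psi> \<mu>)"
    \<comment> \<open>A real number strictly between the two sides turns the claim into a statement
      about finite exponents and also covers an infinite infimum, as for empty
      \<open>C\<close>.\<close>
    proof (rule ccontr)
      assume "\<not> ?thesis"
      then have "- ?L < (INF \<mu>\<in>C. rate \<psi> \<mu>)" by (simp add: not_le ereal_uminus_less_reorder)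
      then obtain a where a: "- ?L < ereal a" "ereal a < (INF \<mu>\<in>C. rate \<psi> \<mu>)" using ereal_dense2 by blast
      \<comment> \<open>A second exponent above \<open>a\<close> leaves the gap that absorbs the
        constant \<open>Z\<close>.\<close>
      from ereal_dense2[OF a(2)] obtain a' where a': "ereal a < ereal a'" "ereal a' < (INF \<mu>\<in>C. rate \<psi> \<mu>)" by blast
      obtain Z where Z: "0 \<le> Z" "\<forall>\<^sub>F t in at_top. measure M {\<omega> \<in> space M. empirical_measure \<tau> t \<omega> \<in> C} \<le> Z * exp (- a' * t)"
        using upper_bound_closed[OF iid assms(1) C a'(2)] by blast
      have "\<forall>\<^sub>F t in at_top. measure (empirical_law M \<tau> t) C \<le> Z * exp (- a' * t)"
        using Z(2) law[OF sets_borel_of_closedin[OF C]] by eventually_elim simp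
      from Limsup_elog_le[OF Z(1) this] have "?L \<le> - ereal a" using a'(1) by simp
      then have "ereal a \<le> - ?L" by (metis ereal_minus_le_minus ereal_uminus_uminus)
      then show False using a(1) by simp
    qed
  next
    fix U :: "(ext_pos \<times> ext_pos) measure set" assume U: "openin narrow_topology U"
    let ?L = "Liminf at_top (\<lambda>t. ereal (1 / t) * elog (measure (empirical_law M \<tau> t) U))"
    show "- (INF \<mu>\<in>U. rate \<psi> \<mu>) \<le> ?L"
    proof (rule ccontr)
      assume "\<not> ?thesis"
      then have "(INF \<mu>\<in>U. rate \<psi> \<mu>) < - ?L" by (simp add: not_le ereal_less_uminus_reorder)
      then obtain \<mu> where \<mu>: "\<mu> \<in> U" "rate \<psi> \<mu> < - ?L" by (auto simp: INF_less_iff)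
      obtain w where w: "rate \<psi> \<mu> < ereal w" "ereal w < - ?L" using ereal_dense2[OF \<mu>(2)] by blast
      have "\<forall>\<^sub>F t in at_top. exp (- w * t) \<le> measure (empirical_law M \<tau> t) U"
        using lower_bound_open[OF iid assms(1) U \<mu>(1) w(1)] law[OF sets_borel_of_openin[OF U]] by eventually_elim simp
      from Liminf_elog_ge[OF this] have "- ?L \<le> ereal w" by (metis ereal_minus_le_minus ereal_uminus_uminus)
      then show False using w(2) by simp
    qed
  qed
qed

end
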